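(* Let $(\overline{\mathcal M},\overline G)$ be a metrically complete smooth strong Riemannian manifold. Let $\mathcal M\subset\overline{\mathcal M}$ be open, and let $G$ be a smooth strong Riemannian metric on $\mathcal M$. Assume that on any $G$-metric ball $B$ in $(\mathcal M,G)$ the following hold: (a) There exists $C>0$ such that for all $x\in B$ and $h\in T_x\mathcal M$ we have $\overline G_x(h,h)\le C\,G_x(h,h)$. (b) The closure of $B$ in $\overline{\mathcal M}$ (with respect to $\overline G$) lies in $\mathcal M$. Then $(\mathcal M,G)$ is metrically and geodesically complete. Let furthermore $(\overline{\mathcal M},\overline G)$ be a Hilbert space, and assume the following condition: (c) The path energy associated with $G$, $$E:H^1((0,1),(\overline{\mathcal M},\overline G))\to[0,\infty],\qquad E(f)=\int_0^1G_{f_t}(\dot f_t,\dot f_t)\,\mathrm dt,$$ is weakly sequentially lower semicontinuous along sequences of paths with fixed end points in $\mathcal M$ (where we set $G_f(h,h)=\infty$ for $f\notin\mathcal M$). Then there exists a $G$-minimizing geodesic between any two points $f_0,f_1\in\mathcal M$ at finite $G$-distance, and being at finite $G$-distance is equivalent to $f_0,f_1$ lying in the same connected component of $\mathcal M\subset\overline{\mathcal M}$.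
   Context: Manifolds are possibly infinite-dimensional (modelled on Hilbert spaces). A Riemannian metric $G$ is strong if for every $x$ the inner product $G_x$ induces the given topology of the tangent space $T_x\mathcal M$. $\mathrm{dist}_G$ is the geodesic distance, i.e. the infimum of $G$-lengths of paths connecting two points ($+\infty$ if there is no such path); a $G$-metric ball is a set $\{y\in\mathcal M:\mathrm{dist}_G(x_0,y)<r\}$ with $x_0\in\mathcal M$, $r>0$. Metrically complete means complete as a metric space for the geodesic distance; geodesically complete means every geodesic can be extended for all times. A $G$-minimizing geodesic between $f_0$ and $f_1$ is a path in $\mathcal M$ from $f_0$ to $f_1$ attaining the minimal path energy $\mathrm{dist}_G(f_0,f_1)^2$. When $(\overline{\mathcal M},\overline G)$ is a Hilbert space, $\overline G$ is its (constant) inner product and $H^1((0,1),(\overline{\mathcal M},\overline G))$ is the Sobolev space of Hilbert-space-valued paths $t\mapsto f_t$, with time derivative $\dot f_t$. *)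

theory Defs
  imports "HOL-Analysis.Analysis"
begin

section \<open>Smooth maps between normed spaces\<close>

definition bounded_multilinear_form ::
    "nat \<Rightarrow> ('a::real_normed_vector list \<Rightarrow> 'b::real_normed_vector) \<Rightarrow> bool" where
  "bounded_multilinear_form k m \<longleftrightarrow>
     (\<forall>us vs. length us + length vs + 1 = k \<longrightarrow> linear (\<lambda>x. m (us @ x # vs))) \<and>
     (\<exists>C. \<forall>hs. length hs = k \<longrightarrow> norm (m hs) \<le> C * prod_list (map norm hs))"

text \<open>
  \<open>f\<close> is of class \<open>C\<^sup>\<infinity>\<close> in the Frechet sense on the open set \<open>S\<close>. Here \<open>D x [h\<^sub>1, \<dots>, h\<^sub>k]\<close> is
  the \<open>k\<close>-th derivative at \<open>x\<close> applied to the \<open>k\<close> vectors \<open>h\<^sub>i\<close>, and the last conjunct says that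
  \<open>x \<mapsto> D\<^sup>k f(x)\<close> is Frechet differentiable for the operator norm of \<open>k\<close>-linear maps, with
  derivative \<open>h \<mapsto> D\<^sup>k\<^sup>+\<^sup>1 f(x)(h, \<dots>)\<close>. Lists are used since the type of \<open>k\<close>-linear maps depends on \<open>k\<close>.
\<close>

definition smooth_map_on ::
    "'a::real_normed_vector set \<Rightarrow> ('a \<Rightarrow> 'b::real_normed_vector) \<Rightarrow> bool" where
  "smooth_map_on S f \<longleftrightarrow>
     (\<exists>D. (\<forall>x\<in>S. D x [] = f x) \<and>
          (\<forall>k. \<forall>x\<in>S. bounded_multilinear_form k (\<lambda>hs. D x hs)) \<and>
          (\<forall>k. \<forall>x\<in>S. \<forall>\<epsilon>>0. \<exists>\<delta>>0. \<forall>y\<in>S. norm (y - x) < \<delta> \<longrightarrow>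
             (\<forall>hs. length hs = k \<longrightarrow>
                norm (D y hs - D x hs - D x ((y - x) # hs))
                  \<le> \<epsilon> * norm (y - x) * prod_list (map norm hs))))"


section \<open>Manifolds modelled on a Hilbert space\<close>

text \<open>
  A manifold is a (Hausdorff) topological type \<open>'m\<close> together with a smooth atlas; a chart is a pair
  of its domain and the coordinate map into the Hilbert space \<open>'e\<close>. The values of the coordinate
  map off its domain are irrelevant.
\<close>

type_synonym ('m, 'e) chart = "'m set \<times> ('m \<Rightarrow> 'e)"

definition chart_inv :: "('m, 'e) chart \<Rightarrow> 'e \<Rightarrow> 'm" where
  "chart_inv c = inv_into (fst c) (snd c)"

definition smooth_atlas ::
    "('m::topological_space, 'e::{real_inner, complete_space}) chart set \<Rightarrow> bool" where
  "smooth_atlas A \<longleftrightarrow>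
     (\<Union>c\<in>A. fst c) = UNIV \<and>
     (\<forall>c\<in>A. open (fst c) \<and> open (snd c ` fst c) \<and>
             homeomorphism (fst c) (snd c ` fst c) (snd c) (chart_inv c)) \<and>
     (\<forall>c\<in>A. \<forall>d\<in>A. smooth_map_on (snd c ` (fst c \<inter> fst d)) (snd d \<circ> chart_inv c))"

text \<open>
  A tangent vector at \<open>x\<close> is an equivalence class of pairs (chart around \<open>x\<close>, coordinate vector),
  where coordinate vectors transform by the derivative of the change of charts.
  \<open>tangent A x c v\<close> is the class of \<open>(c, v)\<close>.
\<close>

type_synonym ('m, 'e) tangent = "(('m, 'e) chart \<times> 'e) set"

definition tangent ::
    "('m, 'e::real_normed_vector) chart set \<Rightarrow> 'm \<Rightarrow> ('m, 'e) chart \<Rightarrow> 'e \<Rightarrow> ('m, 'e) tangent" where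
  "tangent A x c v =
     {(d, w). d \<in> A \<and> x \<in> fst d \<and>
              w = frechet_derivative (snd d \<circ> chart_inv c) (at (snd c x)) v}"

definition tangent_space ::
    "('m, 'e::real_normed_vector) chart set \<Rightarrow> 'm \<Rightarrow> ('m, 'e) tangent set" where
  "tangent_space A x = {tangent A x c v | c v. c \<in> A \<and> x \<in> fst c}"

definition velocity ::
    "('m, 'e::real_normed_vector) chart set \<Rightarrow> real set \<Rightarrow> (real \<Rightarrow> 'm) \<Rightarrow> real \<Rightarrow> ('m, 'e) tangent" where
  "velocity A I \<gamma> t =
     {(c, v). c \<in> A \<and> \<gamma> t \<in> fst c \<and> v = vector_derivative (snd c \<circ> \<gamma>) (at t within I)}"


section \<open>Strong Riemannian metrics\<close>

text \<open>Only the values of a metric on \<open>tangent_space A x\<close> for \<open>x\<close> in the manifold matter.\<close>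

type_synonym ('m, 'e) metric = "'m \<Rightarrow> ('m, 'e) tangent \<Rightarrow> ('m, 'e) tangent \<Rightarrow> real"

text \<open>
  A smooth strong Riemannian metric on the open submanifold \<open>S\<close>, whose tangent spaces are those of
  the ambient manifold. Bilinearity of \<open>G x\<close> is part of the existence of the bilinear-form-valued
  local representative \<open>g\<close>. A chart identifies \<open>T\<^sub>xM\<close>, with its given topology, with \<open>'e\<close>.
\<close>

definition strong_riemannian_metric ::
    "('m::topological_space, 'e::{real_inner, complete_space}) chart set \<Rightarrow> 'm set
       \<Rightarrow> ('m, 'e) metric \<Rightarrow> bool" where
  "strong_riemannian_metric A S G \<longleftrightarrow>
     (\<forall>c\<in>A. \<exists>g :: 'e \<Rightarrow> 'e \<Rightarrow>\<^sub>L 'e \<Rightarrow>\<^sub>L real.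
        smooth_map_on (snd c ` (fst c \<inter> S)) g \<and>
        (\<forall>x\<in>fst c \<inter> S. \<forall>v w.
           G x (tangent A x c v) (tangent A x c w) = blinfun_apply (blinfun_apply (g (snd c x)) v) w)) \<and>
     (\<forall>c\<in>A. \<forall>x\<in>fst c \<inter> S.
        (\<forall>v w. G x (tangent A x c v) (tangent A x c w) = G x (tangent A x c w) (tangent A x c v)) \<and>
        (\<forall>v. v \<noteq> 0 \<longrightarrow> 0 < G x (tangent A x c v) (tangent A x c v)) \<and>
        Metric_space.mtopology UNIV
          (\<lambda>v w. sqrt (G x (tangent A x c (v - w)) (tangent A x c (v - w)))) = euclidean)"


section \<open>Geodesic distance and completeness\<close>

definition C1_path_on ::
    "('m::topological_space, 'e::real_normed_vector) chart set \<Rightarrow> real \<Rightarrow> real \<Rightarrow> (real \<Rightarrow> 'm) \<Rightarrow> bool" where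
  "C1_path_on A a b \<gamma> \<longleftrightarrow>
     continuous_on {a..b} \<gamma> \<and>
     (\<forall>c\<in>A. (\<forall>t\<in>{a..b}. \<gamma> t \<in> fst c \<longrightarrow> (snd c \<circ> \<gamma>) differentiable (at t within {a..b})) \<and>
             continuous_on {t\<in>{a..b}. \<gamma> t \<in> fst c}
               (\<lambda>t. vector_derivative (snd c \<circ> \<gamma>) (at t within {a..b})))"

text \<open>Piecewise \<open>C\<^sup>1\<close> with one-sided derivatives at the finitely many break points in \<open>P\<close>.\<close>

definition piecewise_C1_path ::
    "('m::topological_space, 'e::real_normed_vector) chart set \<Rightarrow> (real \<Rightarrow> 'm) \<Rightarrow> bool" where
  "piecewise_C1_path A \<gamma> \<longleftrightarrow>
     continuous_on {0..1} \<gamma> \<and>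
     (\<exists>P. finite P \<and>
        (\<forall>a b. 0 \<le> a \<and> a < b \<and> b \<le> 1 \<and> {a<..<b} \<inter> P = {} \<longrightarrow> C1_path_on A a b \<gamma>))"

definition path_length ::
    "('m, 'e::real_normed_vector) chart set \<Rightarrow> ('m, 'e) metric \<Rightarrow> (real \<Rightarrow> 'm) \<Rightarrow> ennreal" where
  "path_length A G \<gamma> =
     (\<integral>\<^sup>+t. ennreal (sqrt (G (\<gamma> t) (velocity A {0..1} \<gamma> t) (velocity A {0..1} \<gamma> t)))
        \<partial>lebesgue_on {0..1})"

definition geodesic_dist ::
    "('m::topological_space, 'e::real_normed_vector) chart set \<Rightarrow> 'm set \<Rightarrow> ('m, 'e) metric
       \<Rightarrow> 'm \<Rightarrow> 'm \<Rightarrow> ennreal" where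
  "geodesic_dist A S G x y =
     Inf {path_length A G \<gamma> | \<gamma>.
            piecewise_C1_path A \<gamma> \<and> \<gamma> ` {0..1} \<subseteq> S \<and> \<gamma> 0 = x \<and> \<gamma> 1 = y}"

definition metric_balls ::
    "('m::topological_space, 'e::real_normed_vector) chart set \<Rightarrow> 'm set \<Rightarrow> ('m, 'e) metric
       \<Rightarrow> 'm set set" where
  "metric_balls A S G =
     {{y\<in>S. geodesic_dist A S G x0 y < ennreal r} | x0 r. x0 \<in> S \<and> 0 < r}"

definition metric_closure ::
    "('m::topological_space, 'e::real_normed_vector) chart set \<Rightarrow> 'm set \<Rightarrow> ('m, 'e) metric
       \<Rightarrow> 'm set \<Rightarrow> 'm set" where
  "metric_closure A S G B = {y\<in>S. \<forall>\<epsilon>>0. \<exists>x\<in>B. geodesic_dist A S G x y < ennreal \<epsilon>}"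

definition metrically_complete ::
    "('m::topological_space, 'e::real_normed_vector) chart set \<Rightarrow> 'm set \<Rightarrow> ('m, 'e) metric \<Rightarrow> bool" where
  "metrically_complete A S G \<longleftrightarrow>
     (\<forall>X :: nat \<Rightarrow> 'm.
        (\<forall>n. X n \<in> S) \<and>
        (\<forall>\<epsilon>>0. \<exists>N. \<forall>m\<ge>N. \<forall>n\<ge>N. geodesic_dist A S G (X m) (X n) < ennreal \<epsilon>) \<longrightarrow>
        (\<exists>x\<in>S. (\<lambda>n. geodesic_dist A S G (X n) x) \<longlonglongrightarrow> 0))"

definition local_metric ::
    "('m, 'e::real_normed_vector) chart set \<Rightarrow> ('m, 'e) metric \<Rightarrow> ('m, 'e) chart
       \<Rightarrow> 'e \<Rightarrow> 'e \<Rightarrow> 'e \<Rightarrow> real" where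
  "local_metric A G c p v w =
     G (chart_inv c p) (tangent A (chart_inv c p) c v) (tangent A (chart_inv c p) c w)"

text \<open>
  The Christoffel map of the Levi-Civita connection in a chart, given by the Koszul formula
  \<open>g(\<Gamma>(u,v),w) = (D\<^sub>u g(v,w) + D\<^sub>v g(u,w) - D\<^sub>w g(u,v)) / 2\<close>.
\<close>

definition christoffel ::
    "('m, 'e::real_normed_vector) chart set \<Rightarrow> ('m, 'e) metric \<Rightarrow> ('m, 'e) chart
       \<Rightarrow> 'e \<Rightarrow> 'e \<Rightarrow> 'e \<Rightarrow> 'e" where
  "christoffel A G c p u v =
     (let g = local_metric A G c;
          D = (\<lambda>h v w. frechet_derivative (\<lambda>q. g q v w) (at p) h)
      in THE z. \<forall>w. g p z w = (D u v w + D v u w - D w u v) / 2)"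

definition geodesic_on ::
    "('m::topological_space, 'e::real_normed_vector) chart set \<Rightarrow> 'm set \<Rightarrow> ('m, 'e) metric
       \<Rightarrow> real set \<Rightarrow> (real \<Rightarrow> 'm) \<Rightarrow> bool" where
  "geodesic_on A S G I \<gamma> \<longleftrightarrow>
     continuous_on I \<gamma> \<and> \<gamma> ` I \<subseteq> S \<and>
     (\<forall>c\<in>A. \<forall>t\<in>I. \<gamma> t \<in> fst c \<longrightarrow>
        (let x = snd c \<circ> \<gamma>; x' = (\<lambda>s. vector_derivative x (at s))
         in (x has_vector_derivative x' t) (at t) \<and>
            (x' has_vector_derivative - christoffel A G c (x t) (x' t) (x' t)) (at t)))"

definition geodesically_complete ::
    "('m::topological_space, 'e::real_normed_vector) chart set \<Rightarrow> 'm set \<Rightarrow> ('m, 'e) metric \<Rightarrow> bool" where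
  "geodesically_complete A S G \<longleftrightarrow>
     (\<forall>I \<gamma>. open I \<and> is_interval I \<and> I \<noteq> {} \<and> geodesic_on A S G I \<gamma> \<longrightarrow>
        (\<exists>\<eta>. geodesic_on A S G UNIV \<eta> \<and> (\<forall>t\<in>I. \<eta> t = \<gamma> t)))"


section \<open>A Hilbert space as a Riemannian manifold\<close>

abbreviation id_chart :: "('h, 'h) chart" where
  "id_chart \<equiv> (UNIV, id)"

definition hilbert_atlas :: "('h, 'h) chart set" where
  "hilbert_atlas = {id_chart}"

abbreviation hilbert_tangent :: "'h::real_normed_vector \<Rightarrow> 'h \<Rightarrow> ('h, 'h) tangent" where
  "hilbert_tangent x v \<equiv> tangent hilbert_atlas x id_chart v"

definition hilbert_coord :: "('h, 'h) tangent \<Rightarrow> 'h" where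
  "hilbert_coord \<xi> = (THE v. (id_chart, v) \<in> \<xi>)"

definition hilbert_metric :: "('h::real_inner, 'h) metric" where
  "hilbert_metric x \<xi> \<eta> = hilbert_coord \<xi> \<bullet> hilbert_coord \<eta>"


section \<open>The Sobolev space of Hilbert-space-valued paths and the path energy\<close>

text \<open>
  The space \<open>'h\<close> need not be separable, so the library's Bochner integral (which requires a
  second-countable range) does not apply; square-integrability is Bochner's, with strong
  measurability spelled out.
\<close>

definition strongly_measurable :: "(real \<Rightarrow> 'h::real_normed_vector) \<Rightarrow> bool" where
  "strongly_measurable u \<longleftrightarrow>
     (\<exists>s :: nat \<Rightarrow> real \<Rightarrow> 'h. (\<forall>n. simple_function (lebesgue_on {0..1}) (s n)) \<and>
        (AE t in lebesgue_on {0..1}. (\<lambda>n. s n t) \<longlonglongrightarrow> u t))"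

definition L2_path :: "(real \<Rightarrow> 'h::real_normed_vector) \<Rightarrow> bool" where
  "L2_path u \<longleftrightarrow>
     strongly_measurable u \<and> (\<integral>\<^sup>+t. ennreal ((norm (u t))\<^sup>2) \<partial>lebesgue_on {0..1}) < \<infinity>"

definition test_function :: "(real \<Rightarrow> real) \<Rightarrow> bool" where
  "test_function \<phi> \<longleftrightarrow>
     \<phi> C1_differentiable_on UNIV \<and> (\<exists>a b. 0 < a \<and> b < 1 \<and> (\<forall>t. t \<notin> {a..b} \<longrightarrow> \<phi> t = 0))"

text \<open>
  The identity \<open>\<integral> \<phi>' u = - \<integral> \<phi> v\<close> of Bochner integrals, written out by pairing both sides with
  \<open>w\<close>.
\<close>

definition has_weak_derivative ::
    "(real \<Rightarrow> 'h::real_inner) \<Rightarrow> (real \<Rightarrow> 'h) \<Rightarrow> bool" where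
  "has_weak_derivative u v \<longleftrightarrow>
     (\<forall>\<phi> w. test_function \<phi> \<longrightarrow>
        (\<integral>t. deriv \<phi> t * (u t \<bullet> w) \<partial>lebesgue_on {0..1})
          = - (\<integral>t. \<phi> t * (v t \<bullet> w) \<partial>lebesgue_on {0..1}))"

text \<open>
  Elements of \<open>H\<^sup>1((0,1), 'h)\<close> are represented by their continuous representatives on \<open>[0,1]\<close>, so that
  end points are values at 0 and 1. The weak derivative is unique almost everywhere.
\<close>

definition H1 :: "(real \<Rightarrow> 'h::real_inner) set" where
  "H1 = {u. continuous_on {0..1} u \<and> L2_path u \<and> (\<exists>v. L2_path v \<and> has_weak_derivative u v)}"

definition weak_deriv :: "(real \<Rightarrow> 'h::real_inner) \<Rightarrow> real \<Rightarrow> 'h" where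
  "weak_deriv u = (SOME v. L2_path v \<and> has_weak_derivative u v)"

definition H1_inner :: "(real \<Rightarrow> 'h::real_inner) \<Rightarrow> (real \<Rightarrow> 'h) \<Rightarrow> real" where
  "H1_inner u v =
     (\<integral>t. u t \<bullet> v t \<partial>lebesgue_on {0..1}) +
     (\<integral>t. weak_deriv u t \<bullet> weak_deriv v t \<partial>lebesgue_on {0..1})"

definition H1_weakly_converges ::
    "(nat \<Rightarrow> real \<Rightarrow> 'h::real_inner) \<Rightarrow> (real \<Rightarrow> 'h) \<Rightarrow> bool" where
  "H1_weakly_converges U u \<longleftrightarrow> (\<forall>v\<in>H1. (\<lambda>n. H1_inner (U n) v) \<longlonglongrightarrow> H1_inner u v)"

definition path_energy ::
    "'h::real_inner set \<Rightarrow> ('h, 'h) metric \<Rightarrow> (real \<Rightarrow> 'h) \<Rightarrow> ennreal" where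
  "path_energy M G f =
     (\<integral>\<^sup>+t. (if f t \<in> M
              then ennreal (G (f t) (hilbert_tangent (f t) (weak_deriv f t))
                                    (hilbert_tangent (f t) (weak_deriv f t)))
              else \<infinity>) \<partial>lebesgue_on {0..1})"

definition energy_weakly_lsc :: "'h::real_inner set \<Rightarrow> ('h, 'h) metric \<Rightarrow> bool" where
  "energy_weakly_lsc M G \<longleftrightarrow>
     (\<forall>F f a b. a \<in> M \<and> b \<in> M \<and> (\<forall>n. F n \<in> H1 \<and> F n 0 = a \<and> F n 1 = b) \<and>
        f \<in> H1 \<and> H1_weakly_converges F f \<longrightarrow>
        path_energy M G f \<le> liminf (\<lambda>n. path_energy M G (F n)))"

definition H1_paths_between :: "'h::real_inner set \<Rightarrow> 'h \<Rightarrow> 'h \<Rightarrow> (real \<Rightarrow> 'h) set" where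
  "H1_paths_between M a b = {f \<in> H1. f ` {0..1} \<subseteq> M \<and> f 0 = a \<and> f 1 = b}"

definition minimizing_geodesic ::
    "'h::real_inner set \<Rightarrow> ('h, 'h) metric \<Rightarrow> 'h \<Rightarrow> 'h \<Rightarrow> (real \<Rightarrow> 'h) \<Rightarrow> bool" where
  "minimizing_geodesic M G a b f \<longleftrightarrow>
     f \<in> H1_paths_between M a b \<and>
     (\<forall>g \<in> H1_paths_between M a b. path_energy M G f \<le> path_energy M G g) \<and>
     path_energy M G f = (geodesic_dist hilbert_atlas M G a b)\<^sup>2"


section \<open>Conditions on metric balls\<close>

definition dominates_on_balls ::
    "('m::topological_space, 'e::real_normed_vector) chart set \<Rightarrow> ('m, 'e) metric \<Rightarrow> 'm set
       \<Rightarrow> ('m, 'e) metric \<Rightarrow> bool" where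
  "dominates_on_balls A Gbar M G \<longleftrightarrow>
     (\<forall>B \<in> metric_balls A M G. \<exists>C>0. \<forall>x\<in>B. \<forall>h\<in>tangent_space A x. Gbar x h h \<le> C * G x h h)"

definition ball_closures_inside ::
    "('m::topological_space, 'e::real_normed_vector) chart set \<Rightarrow> ('m, 'e) metric \<Rightarrow> 'm set
       \<Rightarrow> ('m, 'e) metric \<Rightarrow> bool" where
  "ball_closures_inside A Gbar M G \<longleftrightarrow>
     (\<forall>B \<in> metric_balls A M G. metric_closure A UNIV Gbar B \<subseteq> M)"

definition completeness_hypotheses ::
    "('m::topological_space, 'e::{real_inner, complete_space}) chart set \<Rightarrow> ('m, 'e) metric \<Rightarrow> 'm set
       \<Rightarrow> ('m, 'e) metric \<Rightarrow> bool" where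
  "completeness_hypotheses A Gbar M G \<longleftrightarrow>
     smooth_atlas A \<and>
     strong_riemannian_metric A UNIV Gbar \<and> metrically_complete A UNIV Gbar \<and>
     open M \<and> strong_riemannian_metric A M G \<and>
     dominates_on_balls A Gbar M G \<and> ball_closures_inside A Gbar M G"

end

theory Submission
  imports Defs "HOL-Complex_Analysis.Great_Picard"
begin

text \<open>
  Both completeness assertions rest on comparing \<open>G\<close> with the norm of a chart, which works because
  \<open>G\<close> is strong: near each point, \<open>sqrt g\<close> lies between two multiples of the norm. Hence a path of small
  \<open>G\<close>-length cannot leave the chart, straight chart segments are short, and \<open>G\<close>-convergence
  amounts to convergence in the chart (\<open>dist_controls_chart\<close>, \<open>chart_controls_dist\<close>).

  Metric completeness: a \<open>G\<close>-Cauchy sequence and the short paths joining its late members lie in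
  one \<open>G\<close>-ball, so by (a) the sequence is Cauchy for the ambient metric and converges
  there; by (b) the limit is in \<open>M\<close>, and in a chart around it ambient convergence
  and \<open>G\<close>-convergence agree.

  Geodesic completeness follows without the Hopf-Rinow theorem, which fails in infinite dimension: a
  geodesic has constant speed, so it is Cauchy at a finite end point of its domain and has a limit;
  the chart velocity is bounded, hence Lipschitz by the geodesic equation, hence has a limit too;
  Picard's theorem restarts the geodesic from this limit, and Zorn's lemma gives a
  maximal extension, which is then defined for all times.

  Minimizers come from the direct method. By Cauchy-Schwarz the squared distance bounds the energy
  from below (\<open>dist_le_energy\<close>), and polygons of almost minimal length, traversed at constant speed,
  have almost minimal energy (\<open>polygon_le_length\<close>, \<open>H1_path_of_polygon\<close>). A minimizing sequence stays in
  a \<open>G\<close>-ball, so (a) bounds it in \<open>H\<^sup>1\<close>; a subsequence converges weakly (\<open>H1_weak_compactness\<close>),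
  and (c) bounds the energy of the limit by the squared distance. The limit stays in \<open>M\<close>: before
  its first exit time it lies in a \<open>G\<close>-ball, so by (b) the exit point would be in \<open>M\<close>.
  As \<open>'h\<close> may be nonseparable, integrals are always paired with a test vector, and the compactness
  argument works with difference quotients on dyadic partitions, which are simple functions.
\<close>

section \<open>Coercive forms on a Hilbert space\<close>

text \<open>
  Lax-Milgram for a symmetric form, by minimizing \<open>B z z - 2 l z\<close>. A form \<open>B\<close> instead
  of the inner product makes the lemma apply to the metric of a strong Riemannian manifold, and a subspace
  \<open>V\<close> allows orthogonal projections.
\<close>

lemma blinfun_riesz_subspace:
  fixes B :: "'a::{real_inner, complete_space} \<Rightarrow>\<^sub>L 'a \<Rightarrow>\<^sub>L real" and l :: "'a \<Rightarrow> real"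
  assumes V: "subspace V" "closed V"
    and sym: "\<And>u v. B u v = B v u" and c: "0 < c" and coer: "\<And>v. c * (norm v)^2 \<le> B v v"
    and add: "\<And>u w. u \<in> V \<Longrightarrow> w \<in> V \<Longrightarrow> l (u + w) = l u + l w"
    and scale: "\<And>a w. w \<in> V \<Longrightarrow> l (a *\<^sub>R w) = a * l w"
    and bound: "\<And>w. w \<in> V \<Longrightarrow> \<bar>l w\<bar> \<le> K * norm w"
  shows "\<exists>z\<in>V. \<forall>w\<in>V. B z w = l w"
proof -
  define J where "J z = B z z - 2 * l z" for z
  have V0: "0 \<in> V" and Vadd: "\<And>u w. u \<in> V \<Longrightarrow> w \<in> V \<Longrightarrow> u + w \<in> V"
    and Vsc: "\<And>a w. w \<in> V \<Longrightarrow> a *\<^sub>R w \<in> V" using V(1) by (auto simp: subspace_def)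
  have low: "- (K^2 / c) \<le> J z" if "z \<in> V" for z
  proof -
    have "0 \<le> (c * norm z - K)^2 / c" using c by simp
    also have "\<dots> = c * (norm z)^2 - 2 * (K * norm z) + K^2 / c"
      using c by (simp add: field_simps power2_eq_square)
    finally show ?thesis using coer[of z] bound[OF that] unfolding J_def by linarith
  qed
  define m where "m = Inf (J ` V)"
  have bdd: "bdd_below (J ` V)" using low by (auto intro!: bdd_belowI)
  have m_le: "m \<le> J z" if "z \<in> V" for z unfolding m_def using bdd that by (intro cInf_lower) auto
  \<comment> \<open>The parallelogram identity for \<open>B\<close> shows that minimizing sequences are Cauchy.\<close>
  have par: "c / 2 * (norm (z - w))^2 \<le> J z + J w - 2 * m" if "z \<in> V" "w \<in> V" for z w
  proof -
    have "(1/2) *\<^sub>R (z + w) \<in> V" using that Vadd Vsc by blast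
    note m_le[OF this]
    moreover have "l ((1/2) *\<^sub>R (z + w)) = (l z + l w) / 2"
      using scale[OF Vadd[OF that], of "1/2"] add[OF that] by simp
    moreover have "B ((1/2) *\<^sub>R (z + w)) ((1/2) *\<^sub>R (z + w)) = (B z z + 2 * B z w + B w w) / 4"
      using sym[of w z] by (simp add: blinfun.bilinear_simps add_divide_distrib)
    moreover have "B (z - w) (z - w) = B z z - 2 * B z w + B w w"
      using sym[of w z] by (simp add: blinfun.bilinear_simps)
    ultimately show ?thesis using coer[of "z - w"] unfolding J_def by (simp add: field_simps)
  qed
  have "\<exists>z\<in>V. J z < m + 1 / Suc n" for n
  proof -
    have "Inf (J ` V) < m + 1 / Suc n" by (simp add: m_def)
    then show ?thesis using V0 by (subst (asm) cInf_less_iff[OF _ bdd]) auto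
  qed
  then obtain z where z: "\<And>n. z n \<in> V" "\<And>n. J (z n) < m + 1 / Suc n" by metis
  have "Cauchy z"
  proof (rule metric_CauchyI)
    fix e :: real assume e: "0 < e"
    obtain N where N: "1 / Suc N < c * e^2 / 4"
      using e c by (metis nat_approx_posE divide_pos_pos mult_pos_pos zero_less_numeral zero_less_power)
    show "\<exists>N. \<forall>i\<ge>N. \<forall>j\<ge>N. dist (z i) (z j) < e"
    proof (intro exI allI impI)
      fix i j assume ij: "i \<ge> N" "j \<ge> N"
      have "1 / real (Suc i) \<le> 1 / Suc N" "1 / real (Suc j) \<le> 1 / Suc N" using ij by (auto simp: frac_le)
      then have "c / 2 * (norm (z i - z j))^2 < c / 2 * e^2"
        using par[OF z(1) z(1), of i j] z(2)[of i] z(2)[of j] N by linarith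
      then have "(norm (z i - z j))^2 < e^2" using c by simp
      then show "dist (z i) (z j) < e" using e by (simp add: dist_norm power2_less_imp_less)
    qed
  qed
  then obtain y where y: "z \<longlonglongrightarrow> y" using Cauchy_convergent_iff convergent_def by blast
  have yV: "y \<in> V" using V(2) y z(1) by (metis closed_sequential_limits)
  have lz: "(\<lambda>n. l (z n)) \<longlonglongrightarrow> l y"
  proof -
    have "(\<lambda>n. K * norm (z n - y)) \<longlonglongrightarrow> K * norm (y - y)" by (intro tendsto_intros y)
    then have "(\<lambda>n. K * norm (z n - y)) \<longlonglongrightarrow> 0" by simp
    moreover have "\<forall>\<^sub>F n in sequentially. norm (l (z n) - l y) \<le> K * norm (z n - y)"
    proof (intro always_eventually allI)
      fix n
      have "l (z n + (-1) *\<^sub>R y) = l (z n) - l y" by (simp only: add[OF z(1) Vsc[OF yV]] scale[OF yV])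
      then have "l (z n - y) = l (z n) - l y" by simp
      then show "norm (l (z n) - l y) \<le> K * norm (z n - y)"
        using bound[of "z n - y"] Vadd[OF z(1) Vsc[OF yV, of "-1"]] by simp
    qed
    ultimately have "(\<lambda>n. l (z n) - l y) \<longlonglongrightarrow> 0" by (rule Lim_null_comparison[rotated])
    then show ?thesis by (simp add: LIM_zero_iff)
  qed
  have "(\<lambda>n. J (z n)) \<longlonglongrightarrow> J y" unfolding J_def by (intro tendsto_intros y lz)
  moreover have "(\<lambda>n. m + 1 / Suc n) \<longlonglongrightarrow> m + 0" by (intro tendsto_intros LIMSEQ_Suc lim_1_over_n)
  ultimately have "J y \<le> m + 0" using z(2) by (intro LIMSEQ_le) (auto intro!: less_imp_le)
  then have Jy: "J y \<le> m" by simp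
  have "B y w = l w" if w: "w \<in> V" for w
  proof (rule ccontr)
    assume ne: "B y w \<noteq> l w"
    define a where "a = B y w - l w"
    define b where "b = B w w + 1"
    have b: "b > 0" using coer[of w] c unfolding b_def by (smt (verit) mult_nonneg_nonneg zero_le_power2)
    have "m \<le> J (y + (- a / b) *\<^sub>R w)" using m_le Vadd[OF yV Vsc[OF w]] by blast
    also have "\<dots> = J y + 2 * (- a / b) * a + (- a / b)^2 * B w w"
    proof -
      have "J (y + t *\<^sub>R w) = J y + 2 * t * a + t^2 * B w w" for t
        using sym[of w y] add[OF yV Vsc[OF w]] scale[OF w] unfolding J_def a_def
        by (simp add: blinfun.bilinear_simps power2_eq_square algebra_simps)
      then show ?thesis .
    qed
    also have "\<dots> = J y + (a / b)^2 * (B w w - 2 * b)" using b by (simp add: field_simps power2_eq_square)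
    also have "\<dots> < J y"
    proof -
      have "B w w - 2 * b = - b - 1" by (simp add: b_def)
      then have "B w w - 2 * b < 0" using b by simp
      moreover have "(a / b)^2 > 0" using ne b by (simp add: a_def)
      ultimately show ?thesis by (simp add: mult_less_0_iff)
    qed
    finally show False using Jy by simp
  qed
  then show ?thesis using yV by blast
qed

lemma riesz_subspace:
  fixes l :: "'a::{real_inner, complete_space} \<Rightarrow> real"
  assumes V: "subspace V" "closed V"
    and add: "\<And>u w. u \<in> V \<Longrightarrow> w \<in> V \<Longrightarrow> l (u + w) = l u + l w"
    and scale: "\<And>a w. w \<in> V \<Longrightarrow> l (a *\<^sub>R w) = a * l w"
    and bound: "\<And>w. w \<in> V \<Longrightarrow> \<bar>l w\<bar> \<le> K * norm w"
  shows "\<exists>z\<in>V. \<forall>w\<in>V. z \<bullet> w = l w"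
proof -
  define B :: "'a \<Rightarrow>\<^sub>L 'a \<Rightarrow>\<^sub>L real" where "B = Blinfun blinfun_inner_left"
  have B: "B u v = u \<bullet> v" for u v unfolding B_def by (subst bounded_linear_Blinfun_apply)
       (auto simp: bounded_linear_blinfun_inner_left blinfun_inner_left.rep_eq inner_commute)
  show ?thesis using blinfun_riesz_subspace[OF V, of B 1 l K] add scale bound
    by (auto simp: B inner_commute power2_norm_eq_inner)
qed

corollary riesz:
  fixes l :: "'a::{real_inner, complete_space} \<Rightarrow> real"
  assumes "bounded_linear l"
  shows "\<exists>z. \<forall>w. l w = z \<bullet> w"
proof -
  interpret bounded_linear l by fact
  from bounded obtain K where "\<And>x. norm (l x) \<le> norm x * K" by blast
  then show ?thesis using riesz_subspace[of UNIV l K] by (simp add: add scale mult.commute) metis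
qed

text \<open>
  This makes the Christoffel map well defined: the Koszul formula prescribes \<open>B z w\<close>.
\<close>

lemma blinfun_form_inverse:
  fixes B :: "'a::{real_inner, complete_space} \<Rightarrow>\<^sub>L 'a \<Rightarrow>\<^sub>L real"
  assumes sym: "\<And>u v. B u v = B v u" and c: "0 < c" and coer: "\<And>v. c * (norm v)^2 \<le> B v v"
  shows "\<exists>!z. \<forall>w. B z w = blinfun_apply l w"
proof -
  obtain z where z: "\<And>w. B z w = blinfun_apply l w"
    using blinfun_riesz_subspace[of UNIV B c "blinfun_apply l" "norm l"] assms norm_blinfun[of l]
    by (auto simp: blinfun.bilinear_simps)
  show ?thesis
  proof (rule ex1I[of _ z])
    fix y assume "\<forall>w. B y w = blinfun_apply l w"
    then have "B (y - z) (y - z) = 0" using z by (simp add: blinfun.bilinear_simps)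
    then have "(norm (y - z))^2 \<le> 0" using coer[of "y - z"] c by (simp add: mult_le_0_iff)
    then show "y = z" by simp
  qed (use z in simp)
qed

lemma form_Cauchy_Schwarz:
  fixes B :: "'a::real_normed_vector \<Rightarrow>\<^sub>L 'a \<Rightarrow>\<^sub>L real"
  assumes sym: "\<And>u v. B u v = B v u" and psd: "\<And>v. 0 \<le> B v v"
  shows "\<bar>B u v\<bar> \<le> sqrt (B u u) * sqrt (B v v)"
proof -
  have *: "0 \<le> B u u + 2 * t * B u v + t^2 * B v v" for t using psd[of "u + t *\<^sub>R v"] sym[of v u]
    by (simp add: blinfun.bilinear_simps power2_eq_square algebra_simps)
  have "(B u v)^2 \<le> B u u * B v v"
  proof (cases "B v v = 0")
    case True
    have "B u v = 0"
    proof (rule ccontr)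
      assume "B u v \<noteq> 0"
      then show False using *[of "- (B u u + 1) / (2 * B u v)"] True by (simp add: field_simps)
    qed
    then show ?thesis using True by simp
  next
    case False
    then have p: "B v v > 0" using psd[of v] by simp
    have "0 \<le> B v v * (B u u + 2 * (- B u v / B v v) * B u v + (- B u v / B v v)^2 * B v v)"
      using *[of "- B u v / B v v"] p by (intro mult_nonneg_nonneg) auto
    also have "\<dots> = B u u * B v v - (B u v)^2" using p by (simp add: field_simps power2_eq_square)
    finally show ?thesis by simp
  qed
  then have "sqrt ((B u v)^2) \<le> sqrt (B u u * B v v)" by (rule real_sqrt_le_mono)
  then show ?thesis by (simp add: real_sqrt_mult)
qed

lemma form_triangle:
  fixes B :: "'a::real_normed_vector \<Rightarrow>\<^sub>L 'a \<Rightarrow>\<^sub>L real"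
  assumes sym: "\<And>u v. B u v = B v u" and psd: "\<And>v. 0 \<le> B v v"
  shows "sqrt (B (u + v) (u + v)) \<le> sqrt (B u u) + sqrt (B v v)"
proof (rule real_le_lsqrt)
  show "0 \<le> sqrt (B u u) + sqrt (B v v)" using psd by simp
  have "B (u + v) (u + v) = B u u + 2 * B u v + B v v" using sym[of v u] by (simp add: blinfun.bilinear_simps)
  then show "B (u + v) (u + v) \<le> (sqrt (B u u) + sqrt (B v v))^2"
    using form_Cauchy_Schwarz[OF assms, of u v] psd by (simp add: power2_sum)
qed

section \<open>Second-order calculus of smooth maps\<close>

text \<open>
  The operator-norm estimates of the first three levels of the derivative family become Frechet derivatives of maps
  into spaces of bounded operators; continuity of the second derivative comes from the third.
\<close>

lemma smooth_map_on_C2: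
  fixes f :: "'a::real_normed_vector \<Rightarrow> 'b::real_normed_vector"
  assumes f: "smooth_map_on S f" and S: "open S"
  obtains f1 :: "'a \<Rightarrow> 'a \<Rightarrow>\<^sub>L 'b" and f2 :: "'a \<Rightarrow> 'a \<Rightarrow>\<^sub>L 'a \<Rightarrow>\<^sub>L 'b"
  where "\<And>x. x \<in> S \<Longrightarrow> (f has_derivative f1 x) (at x)"
    and "\<And>x. x \<in> S \<Longrightarrow> (f1 has_derivative f2 x) (at x)"
    and "continuous_on S f2"
proof -
  obtain D where D: "(\<forall>x\<in>S. D x [] = f x) \<and>
          (\<forall>k. \<forall>x\<in>S. bounded_multilinear_form k (\<lambda>hs. D x hs)) \<and>
          (\<forall>k. \<forall>x\<in>S. \<forall>e>0. \<exists>d>0. \<forall>y\<in>S. norm (y - x) < d \<longrightarrow>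
             (\<forall>hs. length hs = k \<longrightarrow>
                norm (D y hs - D x hs - D x ((y - x) # hs)) \<le> e * norm (y - x) * prod_list (map norm hs)))"
    using f unfolding smooth_map_on_def by (elim exE) (rule that)
  then have D0: "\<And>x. x \<in> S \<Longrightarrow> D x [] = f x"
    and Dm: "\<And>k x. x \<in> S \<Longrightarrow> bounded_multilinear_form k (\<lambda>hs. D x hs)" by auto
  have Dd: "\<exists>d>0. \<forall>y\<in>S. norm (y - x) < d \<longrightarrow>
             (\<forall>hs. length hs = k \<longrightarrow>
                norm (D y hs - D x hs - D x ((y - x) # hs)) \<le> e * norm (y - x) * prod_list (map norm hs))"
    if "x \<in> S" "0 < e" for k x e using D that by (elim conjE allE[of _ k] ballE[of _ _ x] allE[of _ e]) auto
  have lin1: "linear (\<lambda>h. D x [h])" if "x \<in> S" for x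
  proof -
    have *: "\<And>us vs. length us + length vs + 1 = 1 \<Longrightarrow> linear (\<lambda>h. D x (us @ h # vs))"
      using Dm[OF that, of 1] unfolding bounded_multilinear_form_def by blast
    show ?thesis using *[of "[]" "[]"] by simp
  qed
  have bd1: "\<exists>C. \<forall>h. norm (D x [h]) \<le> C * norm h" if xS: "x \<in> S" for x
  proof -
    obtain C where C: "\<forall>hs. length hs = 1 \<longrightarrow> norm (D x hs) \<le> C * prod_list (map norm hs)"
      using Dm[OF xS, of 1] unfolding bounded_multilinear_form_def by blast
    show ?thesis using C[rule_format, of "[_]"] by auto
  qed
  have lin2: "linear (\<lambda>h. D x [h, v])" "linear (\<lambda>h. D x [v, h])" if xS: "x \<in> S" for x v
  proof -
    have *: "\<And>us vs. length us + length vs + 1 = 2 \<Longrightarrow> linear (\<lambda>h. D x (us @ h # vs))"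
      using Dm[OF xS, of 2] unfolding bounded_multilinear_form_def by blast
    show "linear (\<lambda>h. D x [h, v])" using *[of "[]" "[v]"] by simp
    show "linear (\<lambda>h. D x [v, h])" using *[of "[v]" "[]"] by simp
  qed
  have bd2: "\<exists>C\<ge>0. \<forall>k h. norm (D x [k, h]) \<le> C * norm k * norm h" if xS: "x \<in> S" for x
  proof -
    obtain C where C: "\<forall>hs. length hs = 2 \<longrightarrow> norm (D x hs) \<le> C * prod_list (map norm hs)"
      using Dm[OF xS, of 2] unfolding bounded_multilinear_form_def by blast
    have "norm (D x [k, h]) \<le> max C 0 * norm k * norm h" for k h
    proof -
      have "norm (D x [k, h]) \<le> C * (norm k * norm h)" using C[rule_format, of "[k, h]"] by simp
      also have "\<dots> \<le> max C 0 * (norm k * norm h)" by (intro mult_right_mono) auto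
      finally show ?thesis by (simp add: mult.assoc)
    qed
    then show ?thesis by (intro exI[of _ "max C 0"]) auto
  qed
  define f1 where "f1 x = Blinfun (\<lambda>h. D x [h])" for x
  define f2 where "f2 x = Blinfun (\<lambda>k. Blinfun (\<lambda>h. D x [k, h]))" for x
  have bl1: "bounded_linear (\<lambda>h. D x [h])" if xS: "x \<in> S" for x
  proof -
    obtain C where C: "\<And>h. norm (D x [h]) \<le> C * norm h" using bd1[OF xS] by blast
    show ?thesis using linear_add[OF lin1[OF xS]] linear_scale[OF lin1[OF xS]]
      by (intro bounded_linear_intro[where K=C]) (auto simp: C mult.commute)
  qed
  have bl2: "bounded_linear (\<lambda>h. D x [k, h])" if xS: "x \<in> S" for x k
  proof -
    obtain C where C: "\<And>k h. norm (D x [k, h]) \<le> C * norm k * norm h" using bd2[OF xS] by blast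
    show ?thesis using linear_add[OF lin2(2)[OF xS]] linear_scale[OF lin2(2)[OF xS]]
      by (intro bounded_linear_intro[where K="C * norm k"])
         (auto intro: order_trans[OF C] simp: mult_ac)
  qed
  have f1: "f1 x h = D x [h]" if "x \<in> S" for x h
    unfolding f1_def using bl1[OF that] by (simp add: bounded_linear_Blinfun_apply)
  have in2: "blinfun_apply (Blinfun (\<lambda>h. D x [k, h])) h = D x [k, h]" if "x \<in> S" for x k h
    using bl2[OF that] by (simp add: bounded_linear_Blinfun_apply)
  have bl3: "bounded_linear (\<lambda>k. Blinfun (\<lambda>h. D x [k, h]))" if xS: "x \<in> S" for x
  proof -
    obtain C where C: "0 \<le> C" "\<And>k h. norm (D x [k, h]) \<le> C * norm k * norm h" using bd2[OF xS] by blast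
    show ?thesis
    proof (rule bounded_linear_intro[where K=C])
      show "Blinfun (\<lambda>h. D x [u + v, h]) = Blinfun (\<lambda>h. D x [u, h]) + Blinfun (\<lambda>h. D x [v, h])" for u v
        by (rule blinfun_eqI) (simp only: in2[OF xS] blinfun.add_left, rule linear_add[OF lin2(1)[OF xS]])
      show "Blinfun (\<lambda>h. D x [a *\<^sub>R u, h]) = a *\<^sub>R Blinfun (\<lambda>h. D x [u, h])" for a u
        by (rule blinfun_eqI) (simp only: in2[OF xS] blinfun.scaleR_left, rule linear_scale[OF lin2(1)[OF xS]])
      show "norm (Blinfun (\<lambda>h. D x [u, h])) \<le> norm u * C" for u
        using C by (intro norm_blinfun_bound) (auto simp: in2[OF xS] mult.commute[of _ C])
    qed
  qed
  have f2: "f2 x k h = D x [k, h]" if "x \<in> S" for x k h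
    unfolding f2_def using bl3[OF that] by (simp add: bounded_linear_Blinfun_apply in2[OF that])
  show ?thesis
  proof
    fix x assume x: "x \<in> S"
    have "(f has_derivative f1 x) (at x within S)" unfolding has_derivative_within_alt
    proof (intro conjI blinfun.bounded_linear_right allI impI)
      fix e :: real assume e: "0 < e"
      obtain d where d: "d > 0" "\<forall>y\<in>S. norm (y - x) < d \<longrightarrow>
             (\<forall>hs. length hs = 0 \<longrightarrow>
                norm (D y hs - D x hs - D x ((y - x) # hs)) \<le> e * norm (y - x) * prod_list (map norm hs))"
        using Dd[OF x e, where k=0] by (elim exE conjE) (rule that)
      have g: "norm (D y [] - D x [] - D x [y - x]) \<le> e * norm (y - x)"
        if "y \<in> S" "norm (y - x) < d" for y using d(2) that by simp
      have g': "norm (f y - f x - (f1 x) (y - x)) \<le> e * norm (y - x)"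
        if "y \<in> S" "norm (y - x) < d" for y using g[OF that] by (simp only: f1[OF x] D0[OF x] D0[OF that(1)])
      show "\<exists>d>0. \<forall>y\<in>S. norm (y - x) < d \<longrightarrow> norm (f y - f x - (f1 x) (y - x)) \<le> e * norm (y - x)"
        by (intro exI[of _ d] conjI ballI impI d(1) g')
    qed
    then show "(f has_derivative f1 x) (at x)" by (simp only: at_within_open[OF x S])
    have "(f1 has_derivative f2 x) (at x within S)" unfolding has_derivative_within_alt
    proof (intro conjI blinfun.bounded_linear_right allI impI)
      fix e :: real assume e: "0 < e"
      obtain d where d': "d > 0" "\<forall>y\<in>S. norm (y - x) < d \<longrightarrow>
             (\<forall>hs. length hs = 1 \<longrightarrow>
                norm (D y hs - D x hs - D x ((y - x) # hs)) \<le> e * norm (y - x) * prod_list (map norm hs))"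
        using Dd[OF x e, where k=1] by (elim exE conjE) (rule that)
      then have d: "d > 0" "\<And>y hs. y \<in> S \<Longrightarrow> norm (y - x) < d \<Longrightarrow> length hs = 1 \<Longrightarrow>
             norm (D y hs - D x hs - D x ((y - x) # hs)) \<le> e * norm (y - x) * prod_list (map norm hs)"
        by simp_all
      have g: "norm (f1 y - f1 x - (f2 x) (y - x)) \<le> e * norm (y - x)" if "y \<in> S" "norm (y - x) < d" for y
        using d(2)[OF that, of "[_]"] e
        by (intro norm_blinfun_bound) (auto simp: blinfun.diff_left f1[OF x] f1[OF that(1)] f2[OF x])
      show "\<exists>d>0. \<forall>y\<in>S. norm (y - x) < d \<longrightarrow> norm (f1 y - f1 x - (f2 x) (y - x)) \<le> e * norm (y - x)"
        by (intro exI[of _ d] conjI ballI impI d(1) g)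
    qed
    then show "(f1 has_derivative f2 x) (at x)" by (simp only: at_within_open[OF x S])
  next
    show "continuous_on S f2" unfolding continuous_on_iff
    proof (intro ballI allI impI)
      fix x and e :: real assume x: "x \<in> S" and e: "0 < e"
      obtain d where d': "d > 0" "\<forall>y\<in>S. norm (y - x) < d \<longrightarrow>
             (\<forall>hs. length hs = 2 \<longrightarrow>
                norm (D y hs - D x hs - D x ((y - x) # hs)) \<le> 1 * norm (y - x) * prod_list (map norm hs))"
        using Dd[OF x zero_less_one, where k=2] by (elim exE conjE) (rule that)
      then have d: "d > 0" "\<And>y hs. y \<in> S \<Longrightarrow> norm (y - x) < d \<Longrightarrow> length hs = 2 \<Longrightarrow>
             norm (D y hs - D x hs - D x ((y - x) # hs)) \<le> 1 * norm (y - x) * prod_list (map norm hs)"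
        by simp_all
      obtain C' where C': "\<forall>hs. length hs = 3 \<longrightarrow> norm (D x hs) \<le> C' * prod_list (map norm hs)"
        using Dm[OF x, of 3] unfolding bounded_multilinear_form_def by blast
      define C where "C = max C' 0"
      have C: "norm (D x [u, k, h]) \<le> C * norm u * norm k * norm h" for u k h
      proof -
        have "norm (D x [u, k, h]) \<le> C' * (norm u * norm k * norm h)"
          using C'[rule_format, of "[u, k, h]"] by (simp add: mult_ac)
        also have "\<dots> \<le> C * (norm u * norm k * norm h)" unfolding C_def by (intro mult_right_mono) auto
        finally show ?thesis by (simp add: mult_ac)
      qed
      have C0: "C \<ge> 0" by (simp add: C_def)
      have main: "norm (f2 y - f2 x) \<le> (1 + C) * norm (y - x)" if y: "y \<in> S" "norm (y - x) < d" for y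
      proof (intro norm_blinfun_bound)
        fix k h
        have "norm (D y [k, h] - D x [k, h] - D x [y - x, k, h]) \<le> norm (y - x) * (norm k * norm h)"
          using d(2)[OF y, of "[k, h]"] by simp
        moreover have "norm (D y [k, h] - D x [k, h])
            \<le> norm (D y [k, h] - D x [k, h] - D x [y - x, k, h]) + norm (D x [y - x, k, h])"
          using norm_triangle_ineq[of "D y [k, h] - D x [k, h] - D x [y - x, k, h]" "D x [y - x, k, h]"] by simp
        ultimately have "norm (D y [k, h] - D x [k, h]) \<le> norm (y - x) * (norm k * norm h) + C * norm (y - x) * norm k * norm h"
          using C[of "y - x" k h] by linarith
        then show "norm ((f2 y - f2 x) k h) \<le> (1 + C) * norm (y - x) * norm k * norm h"
          by (simp add: blinfun.diff_left f2[OF x] f2[OF y(1)] distrib_right distrib_left mult_ac)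
      qed (use C0 in auto)
      show "\<exists>d>0. \<forall>x'\<in>S. dist x' x < d \<longrightarrow> dist (f2 x') (f2 x) < e"
      proof (intro exI[of _ "min d (e / (1 + C))"] conjI ballI impI)
        show "0 < min d (e / (1 + C))" using d e C0 by simp
        fix y assume y: "y \<in> S" "dist y x < min d (e / (1 + C))"
        then have "(1 + C) * norm (y - x) < e" using C0 by (simp add: dist_norm pos_less_divide_eq mult.commute)
        then show "dist (f2 y) (f2 x) < e" using main[of y] y by (simp add: dist_norm)
      qed
    qed
  qed
qed

text \<open>
  The second difference of \<open>f\<close> is symmetric in \<open>h\<close> and \<open>k\<close> and is
  \<open>s\<^sup>2 f2 h k + o(s\<^sup>2)\<close> by the mean value inequality.
\<close>

lemma second_derivative_symmetric:
  fixes f :: "'a::real_normed_vector \<Rightarrow> 'b::real_normed_vector"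
    and f1 :: "'a \<Rightarrow> 'a \<Rightarrow>\<^sub>L 'b" and f2 :: "'a \<Rightarrow>\<^sub>L 'a \<Rightarrow>\<^sub>L 'b"
  assumes r: "r > 0" and f: "\<And>y. y \<in> ball x r \<Longrightarrow> (f has_derivative f1 y) (at y)"
    and f1: "(f1 has_derivative f2) (at x)"
  shows "f2 h k = f2 k h"
proof -
  define K where "K = norm h + norm k + 1"
  have K: "K > 0" "norm h \<le> K" "norm k \<le> K" by (auto simp: K_def add_nonneg_pos)
  define \<Delta> where "\<Delta> s h k = f (x + s *\<^sub>R h + s *\<^sub>R k) - f (x + s *\<^sub>R h) - (f (x + s *\<^sub>R k) - f x)" for s h k
  have main: "norm (\<Delta> s h k - s^2 *\<^sub>R f2 h k) \<le> 3 * e * s^2 * K^2"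
    if e: "e > 0" and s: "s > 0" "2 * s * K < r" "2 * s * K < d"
      and hk: "norm h \<le> K" "norm k \<le> K"
      and d: "\<And>y. norm (y - x) < d \<Longrightarrow> norm (f1 y - f1 x - f2 (y - x)) \<le> e * norm (y - x)"
    for e s d h k
  proof -
    define g where "g t = f (x + s *\<^sub>R h + t *\<^sub>R k) - f (x + t *\<^sub>R k) - (t * s) *\<^sub>R f2 h k" for t
    define g' where "g' t = f1 (x + s *\<^sub>R h + t *\<^sub>R k) k - f1 (x + t *\<^sub>R k) k - s *\<^sub>R f2 h k" for t
    have small: "norm (a *\<^sub>R h + t *\<^sub>R k) \<le> 2 * s * K" "norm (t *\<^sub>R k) \<le> s * K"
      if "t \<in> {0..s}" "a = s" for t a
    proof -
      have a: "norm (t *\<^sub>R k) \<le> s * K" using that hk s by (auto intro!: mult_mono)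
      have b: "norm (a *\<^sub>R h) \<le> s * K" using that hk s by (auto intro!: mult_mono)
      show "norm (a *\<^sub>R h + t *\<^sub>R k) \<le> 2 * s * K" using norm_triangle_ineq[of "a *\<^sub>R h" "t *\<^sub>R k"] a b by simp
      show "norm (t *\<^sub>R k) \<le> s * K" by fact
    qed
    have sK: "s * K > 0" using s K by simp
    have gd: "(g has_vector_derivative g' t) (at t within {0..s})" if t: "t \<in> {0..s}" for t
    proof -
      have in1: "x + s *\<^sub>R h + t *\<^sub>R k \<in> ball x r" "x + t *\<^sub>R k \<in> ball x r"
        using small[OF t refl] s sK norm_minus_cancel[of "s *\<^sub>R h + t *\<^sub>R k"]
        by (auto simp: dist_norm add.assoc)
      have "((\<lambda>t. x + s *\<^sub>R h + t *\<^sub>R k) has_vector_derivative k) (at t within {0..s})"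
        by (auto intro!: derivative_eq_intros)
      from vector_derivative_diff_chain_within[OF this has_derivative_at_withinI[OF f[OF in1(1)]]]
      have 1: "((\<lambda>t. f (x + s *\<^sub>R h + t *\<^sub>R k)) has_vector_derivative f1 (x + s *\<^sub>R h + t *\<^sub>R k) k) (at t within {0..s})"
        by (simp add: o_def)
      have "((\<lambda>t. x + t *\<^sub>R k) has_vector_derivative k) (at t within {0..s})"
        by (auto intro!: derivative_eq_intros)
      from vector_derivative_diff_chain_within[OF this has_derivative_at_withinI[OF f[OF in1(2)]]]
      have 2: "((\<lambda>t. f (x + t *\<^sub>R k)) has_vector_derivative f1 (x + t *\<^sub>R k) k) (at t within {0..s})"
        by (simp add: o_def)
      have 3: "((\<lambda>t. (t * s) *\<^sub>R f2 h k) has_vector_derivative s *\<^sub>R f2 h k) (at t within {0..s})"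
        by (auto intro!: derivative_eq_intros)
      show ?thesis unfolding g_def g'_def by (intro has_vector_derivative_diff 1 2 3)
    qed
    have bnd: "norm (g' t) \<le> 3 * e * s * K^2" if t: "t \<in> {0..s}" for t
    proof -
      note sm = small[OF t refl]
      define R where "R y = f1 y - f1 x - f2 (y - x)" for y
      have eq: "g' t = R (x + s *\<^sub>R h + t *\<^sub>R k) k - R (x + t *\<^sub>R k) k"
        unfolding g'_def R_def by (simp add: blinfun.bilinear_simps algebra_simps)
      have r1: "norm (R (x + s *\<^sub>R h + t *\<^sub>R k)) \<le> e * (2 * s * K)"
      proof -
        have "norm (R (x + s *\<^sub>R h + t *\<^sub>R k)) \<le> e * norm (x + s *\<^sub>R h + t *\<^sub>R k - x)"
          unfolding R_def using sm s by (intro d) (auto simp: add.assoc)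
        also have "\<dots> \<le> e * (2 * s * K)" using sm e by (intro mult_left_mono) (auto simp: add.assoc)
        finally show ?thesis .
      qed
      have r2: "norm (R (x + t *\<^sub>R k)) \<le> e * (s * K)"
      proof -
        have "norm (R (x + t *\<^sub>R k)) \<le> e * norm (x + t *\<^sub>R k - x)"
          unfolding R_def using sm s sK by (intro d) (auto)
        also have "\<dots> \<le> e * (s * K)" using sm e by (intro mult_left_mono) auto
        finally show ?thesis .
      qed
      have "norm (g' t) \<le> norm (R (x + s *\<^sub>R h + t *\<^sub>R k)) * norm k + norm (R (x + t *\<^sub>R k)) * norm k"
        unfolding eq by (meson add_mono norm_blinfun norm_triangle_ineq4 order_trans)
      also have "\<dots> \<le> (e * (2 * s * K)) * K + (e * (s * K)) * K"
        using r1 r2 hk K e s by (intro add_mono mult_mono) auto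
      also have "\<dots> = 3 * e * s * K^2" by (simp add: power2_eq_square algebra_simps)
      finally show ?thesis .
    qed
    have "norm (g s - g 0) \<le> (3 * e * s * K^2) * norm (s - 0)"
    proof (rule differentiable_bound[OF convex_real_interval(5)[of 0 s]])
      show "(g has_derivative (\<lambda>a. a *\<^sub>R g' t)) (at t within {0..s})" if "t \<in> {0..s}" for t
        using gd[OF that] by (simp add: has_vector_derivative_def)
      show "onorm (\<lambda>a. a *\<^sub>R g' t) \<le> 3 * e * s * K^2" if "t \<in> {0..s}" for t
        using mult_left_mono[OF bnd[OF that] abs_ge_zero] by (intro onorm_le) (simp add: mult.commute)
    qed (use s in auto)
    moreover have "g s - g 0 = \<Delta> s h k - s^2 *\<^sub>R f2 h k"
      unfolding g_def \<Delta>_def by (simp add: power2_eq_square algebra_simps)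
    ultimately show ?thesis using s by (simp add: power2_eq_square algebra_simps)
  qed
  have "norm (f2 h k - f2 k h) \<le> 0"
  proof (rule field_le_epsilon)
    fix e0 :: real assume e0: "0 < e0"
    \<comment> \<open>Two errors of size \<open>3 e s\<^sup>2 K\<^sup>2\<close> add up to \<open>e0 s\<^sup>2\<close>.\<close>
    define e where "e = e0 / (6 * K^2)"
    have e: "e > 0" using e0 K by (simp add: e_def)
    obtain d where d: "d > 0" "\<And>y. norm (y - x) < d \<Longrightarrow> norm (f1 y - f1 x - f2 (y - x)) \<le> e * norm (y - x)"
      using f1 e unfolding has_derivative_at_alt by blast
    define s where "s = min r d / (4 * K)"
    have s: "s > 0" "2 * s * K < r" "2 * s * K < d" using r d K by (auto simp: s_def field_simps min_def)
    have "norm (\<Delta> s h k - s^2 *\<^sub>R f2 h k) \<le> 3 * e * s^2 * K^2" by (rule main[OF e s K(2,3) d(2)])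
    moreover have "norm (\<Delta> s k h - s^2 *\<^sub>R f2 k h) \<le> 3 * e * s^2 * K^2" by (rule main[OF e s K(3,2) d(2)])
    moreover have "\<Delta> s k h = \<Delta> s h k" by (simp add: \<Delta>_def algebra_simps)
    moreover have "norm (s^2 *\<^sub>R f2 h k - s^2 *\<^sub>R f2 k h)
       \<le> norm (\<Delta> s h k - s^2 *\<^sub>R f2 k h) + norm (\<Delta> s h k - s^2 *\<^sub>R f2 h k)"
      using norm_triangle_ineq4[of "\<Delta> s h k - s^2 *\<^sub>R f2 k h" "\<Delta> s h k - s^2 *\<^sub>R f2 h k"] by simp
    ultimately have "s^2 * norm (f2 h k - f2 k h) \<le> s^2 * (6 * e * K^2)"
      by (simp add: scaleR_diff_right[symmetric] algebra_simps del: scaleR_diff_right)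
    then have "norm (f2 h k - f2 k h) \<le> 6 * e * K^2" using s by simp
    also have "\<dots> = e0" using K by (simp add: e_def)
    finally show "norm (f2 h k - f2 k h) \<le> 0 + e0" by simp
  qed
  then show ?thesis by simp
qed

lemma C1_local_lipschitz:
  fixes f' :: "'a::real_normed_vector \<Rightarrow> 'a \<Rightarrow>\<^sub>L 'b::real_normed_vector"
  assumes S: "open S" "x \<in> S" and f: "\<And>y. y \<in> S \<Longrightarrow> (f has_derivative f' y) (at y)"
    and c: "continuous_on S f'"
  shows "\<exists>d>0. \<exists>L. ball x d \<subseteq> S \<and> L-lipschitz_on (ball x d) f"
proof -
  obtain d1 where d1: "d1 > 0" "ball x d1 \<subseteq> S" using S openE by blast
  obtain d2 where d2: "d2 > 0" "\<And>y. y \<in> S \<Longrightarrow> dist y x < d2 \<Longrightarrow> dist (f' y) (f' x) < 1"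
    using c S unfolding continuous_on_iff by (metis zero_less_one)
  define d where "d = min d1 d2"
  have sub: "ball x d \<subseteq> S" using d1 by (auto simp: d_def)
  have b: "norm (f' y) \<le> norm (f' x) + 1" if "y \<in> ball x d" for y
  proof -
    have "dist (f' y) (f' x) < 1" using that sub by (intro d2) (auto simp: d_def dist_commute)
    then show ?thesis using norm_triangle_sub[of "f' y" "f' x"] by (simp add: dist_norm)
  qed
  have "(norm (f' x) + 1)-lipschitz_on (ball x d) f"
  proof (rule lipschitz_onI)
    fix y z assume yz: "y \<in> ball x d" "z \<in> ball x d"
    have "norm (f y - f z) \<le> (norm (f' x) + 1) * norm (y - z)"
    proof (rule differentiable_bound[OF convex_ball _ _ yz])
      show "(f has_derivative f' w) (at w within ball x d)" if "w \<in> ball x d" for w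
        using f sub that by (blast intro: has_derivative_at_withinI)
      show "onorm (f' w) \<le> norm (f' x) + 1" if "w \<in> ball x d" for w
        using b[OF that] by (simp add: norm_blinfun.rep_eq)
    qed
    then show "dist (f y) (f z) \<le> (norm (f' x) + 1) * dist y z" by (simp add: dist_norm)
  qed simp
  then show ?thesis using sub d1 d2 by (intro exI[of _ d]) (auto simp: d_def)
qed

section \<open>Picard iteration and increments of curves\<close>

text \<open>Contraction principle for the integral equation, on bounded continuous functions.\<close>

lemma picard_banach:
  fixes F :: "'b::banach \<Rightarrow> 'b"
  assumes L: "L-lipschitz_on (cball x0 r) F" and r: "r > 0"
  shows "\<exists>e>0. \<exists>x. x 0 = x0 \<and> (\<forall>t\<in>{0..e}. x t \<in> cball x0 r \<and> (x has_vector_derivative F (x t)) (at t within {0..e}))"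
proof -
  have L0: "L \<ge> 0" using L lipschitz_on_nonneg by blast
  define B where "B = norm (F x0) + L * r + 1"
  have B: "B > 0" unfolding B_def using L0 r by (simp add: add_nonneg_pos)
  have FB: "norm (F y) \<le> B" if "y \<in> cball x0 r" for y
  proof -
    have "dist (F y) (F x0) \<le> L * dist y x0" using L that r by (auto intro: lipschitz_onD)
    also have "\<dots> \<le> L * r" using that L0 by (intro mult_left_mono) (auto simp: dist_commute)
    finally show ?thesis using norm_triangle_sub[of "F y" "F x0"] by (simp add: B_def dist_norm)
  qed
  have cF: "continuous_on (cball x0 r) F" using L by (rule lipschitz_on_continuous_on)
  \<comment> \<open>The first bound keeps iterates in the ball, the second makes the iteration a contraction.\<close>
  define e where "e = min (r / B) (1 / (2 * (L + 1)))"
  have e: "e > 0" "e * B \<le> r" "e * L \<le> 1/2"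
  proof -
    show "e > 0" using r B L0 by (simp add: e_def)
    have "e \<le> r / B" by (simp add: e_def)
    then show "e * B \<le> r" using B by (simp add: pos_le_divide_eq)
    have "e \<le> 1 / (2 * (L + 1))" by (simp add: e_def)
    then have "e * (2 * (L + 1)) \<le> 1" using L0 by (subst (asm) pos_le_divide_eq) auto
    then show "e * L \<le> 1/2" using \<open>e > 0\<close> by (simp add: algebra_simps)
  qed
  \<comment> \<open>Clamping time extends functions on \<open>[0,e]\<close> to the line, the domain of \<open>\<Rightarrow>\<^sub>C\<close>.\<close>
  define cl where "cl t = max 0 (min e t)" for t :: real
  have cl: "cl t \<in> {0..e}" for t using e by (auto simp: cl_def)
  have cl_id: "cl t = t" if "t \<in> {0..e}" for t using that by (auto simp: cl_def)
  have ccl: "continuous_on UNIV cl" unfolding cl_def by (intro continuous_intros)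
  define s :: "(real \<Rightarrow>\<^sub>C 'b) set" where "s = PiC UNIV (\<lambda>_. cball x0 r)"
  have sD: "apply_bcontfun u t \<in> cball x0 r" if "u \<in> s" for u t using that by (auto simp: s_def mem_PiC_iff)
  have cu: "continuous_on T (\<lambda>t. F (apply_bcontfun u t))" if "u \<in> s" for u T
    by (rule continuous_on_compose2[OF cF continuous_on_apply_bcontfun]) (use sD[OF that] in blast)
  define P where "P u t = x0 + integral {0..cl t} (\<lambda>t. F (apply_bcontfun u t))" for u :: "real \<Rightarrow>\<^sub>C 'b" and t
  have Pin: "P u t \<in> cball x0 r" if u: "u \<in> s" for u t
  proof -
    have "norm (integral {0..cl t} (\<lambda>t. F (apply_bcontfun u t))) \<le> B * (cl t - 0)"
      using cl[of t] by (intro integral_bound cu[OF u] FB sD[OF u]) auto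
    also have "\<dots> \<le> B * e" using B cl[of t] by (intro mult_left_mono) auto
    also have "\<dots> \<le> r" using e by (simp add: mult.commute)
    finally show ?thesis by (simp add: P_def dist_norm)
  qed
  have Pc: "continuous_on UNIV (P u)" if u: "u \<in> s" for u
  proof -
    have "continuous_on {0..e} (\<lambda>s. integral {0..s} (\<lambda>t. F (apply_bcontfun u t)))"
      by (intro indefinite_integral_continuous_1 integrable_continuous_real cu[OF u])
    then have "continuous_on UNIV (\<lambda>t. integral {0..cl t} (\<lambda>t. F (apply_bcontfun u t)))"
      by (rule continuous_on_compose2[OF _ ccl]) (use cl in blast)
    then show ?thesis unfolding P_def by (intro continuous_intros)
  qed
  define T where "T u = Bcontfun (P u)" for u
  have Pb: "P u \<in> bcontfun" if u: "u \<in> s" for u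
  proof -
    have "range (P u) \<subseteq> cball x0 r" using Pin[OF u] by blast
    then have "bounded (range (P u))" by (rule bounded_subset[OF bounded_cball])
    then show ?thesis using Pc[OF u] by (simp add: bcontfun_def)
  qed
  have T: "apply_bcontfun (T u) = P u" if "u \<in> s" for u
    unfolding T_def using Pb[OF that] by (simp add: Bcontfun_inverse)
  have "\<exists>!u\<in>s. T u = u"
  proof (rule Banach_fix)
    show "complete s" unfolding s_def complete_eq_closed by (auto intro!: closed_PiC)
    show "s \<noteq> {}"
    proof -
      have "const_bcontfun x0 \<in> s" using r by (auto simp: s_def mem_PiC_iff const_bcontfun.rep_eq)
      then show ?thesis by blast
    qed
    show "T ` s \<subseteq> s" using T Pin by (auto simp: s_def mem_PiC_iff)
    show "dist (T u) (T v) \<le> 1/2 * dist u v" if u: "u \<in> s" and v: "v \<in> s" for u v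
    proof (rule dist_bound)
      fix t
      have "P u t - P v t = integral {0..cl t} (\<lambda>t. F (apply_bcontfun u t) - F (apply_bcontfun v t))"
        unfolding P_def by (subst integral_diff) (auto intro!: integrable_continuous_real cu u v)
      moreover have "norm (integral {0..cl t} (\<lambda>t. F (apply_bcontfun u t) - F (apply_bcontfun v t))) \<le> (L * dist u v) * (cl t - 0)"
      proof (intro integral_bound continuous_on_diff cu u v)
        fix t
        have "dist (F (apply_bcontfun u t)) (F (apply_bcontfun v t)) \<le> L * dist (apply_bcontfun u t) (apply_bcontfun v t)"
          using L sD u v by (intro lipschitz_onD)
        also have "\<dots> \<le> L * dist u v" using L0 by (intro mult_left_mono dist_bounded)
        finally show "norm (F (apply_bcontfun u t) - F (apply_bcontfun v t)) \<le> L * dist u v" by (simp add: dist_norm)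
      qed (use cl[of t] in auto)
      moreover have "(L * dist u v) * (cl t - 0) \<le> (L * dist u v) * e"
        using cl[of t] L0 by (intro mult_left_mono) auto
      moreover have "(L * dist u v) * e \<le> 1/2 * dist u v"
        using mult_right_mono[OF e(3), of "dist u v"] by (simp add: mult_ac)
      ultimately show "dist (apply_bcontfun (T u) t) (apply_bcontfun (T v) t) \<le> 1/2 * dist u v"
        unfolding T[OF u] T[OF v] by (simp add: dist_norm)
    qed
  qed auto
  then obtain u where u: "u \<in> s" "T u = u" by blast
  define x where "x = apply_bcontfun u"
  have x: "x t = x0 + integral {0..t} (\<lambda>t. F (x t))" if "t \<in> {0..e}" for t
    using T[OF u(1)] cl_id[OF that] unfolding x_def P_def u(2) by metis
  have "(x has_vector_derivative F (x t)) (at t within {0..e})" if t: "t \<in> {0..e}" for t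
  proof -
    have "((\<lambda>t. x0 + integral {0..t} (\<lambda>t. F (x t))) has_vector_derivative 0 + F (x t)) (at t within {0..e})"
      unfolding x_def
      by (intro has_vector_derivative_add has_vector_derivative_const integral_has_vector_derivative cu u t)
    then have "((\<lambda>t. x0 + integral {0..t} (\<lambda>t. F (x t))) has_vector_derivative F (x t)) (at t within {0..e})" by simp
    then show ?thesis by (rule has_vector_derivative_transform[OF t, rotated]) (use x in auto)
  qed
  then show ?thesis
    using e(1) x[of 0] sD[OF u(1)] unfolding x_def by (intro exI[of _ e] conjI exI[of _ "apply_bcontfun u"]) auto
qed

text \<open>
  \<open>'b\<close> is complete but not of class \<open>banach\<close>; its dual
  \<open>'b \<Rightarrow>\<^sub>L real\<close> is, and is isometric to it by the Riesz theorem.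
\<close>

lemma picard_hilbert:
  fixes F :: "'b::{real_inner, complete_space} \<Rightarrow> 'b"
  assumes L: "L-lipschitz_on (cball x0 r) F" and r: "r > 0"
  shows "\<exists>e>0. \<exists>x. x 0 = x0 \<and> (\<forall>t\<in>{0..e}. x t \<in> cball x0 r \<and> (x has_vector_derivative F (x t)) (at t within {0..e}))"
proof -
  define J :: "'b \<Rightarrow> 'b \<Rightarrow>\<^sub>L real" where "J = blinfun_inner_left"
  have Ja: "J x w = w \<bullet> x" for x w by (simp add: J_def blinfun_inner_left.rep_eq)
  have J: "bounded_linear J" unfolding J_def by (rule bounded_linear_blinfun_inner_left)
  interpret J: bounded_linear J by fact
  have nJ: "norm (J x) = norm x" for x
  proof (rule antisym)
    show "norm (J x) \<le> norm x" by (rule norm_blinfun_bound) (simp_all add: Ja Cauchy_Schwarz_ineq2 mult.commute)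
    have "norm x * norm x \<le> norm (J x) * norm x"
      using norm_blinfun[of "J x" x] by (simp add: Ja power2_norm_eq_inner[symmetric] power2_eq_square)
    then show "norm x \<le> norm (J x)" by (cases "x = 0") auto
  qed
  have "\<exists>x. J x = l" for l
  proof -
    obtain z where "\<And>w. blinfun_apply l w = z \<bullet> w" using riesz[OF blinfun.bounded_linear_right[of l]] by blast
    then have "J z = l" by (intro blinfun_eqI) (simp add: Ja inner_commute)
    then show ?thesis by blast
  qed
  then obtain K where JK: "\<And>l. J (K l) = l" by metis
  have KJ: "K (J x) = x" for x
  proof -
    have "norm (K (J x) - x) = norm (J (K (J x) - x))" by (simp add: nJ)
    also have "\<dots> = 0" by (simp add: J.diff JK)
    finally show ?thesis by simp
  qed
  have nK: "norm (K l) = norm l" for l using nJ[of "K l"] by (simp add: JK)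
  have Kbl: "bounded_linear K"
  proof (rule bounded_linear_intro[where K=1])
    fix a b show "K (a + b) = K a + K b" by (metis J.add JK KJ)
  next
    fix c a show "K (c *\<^sub>R a) = c *\<^sub>R K a" by (metis J.scaleR JK KJ)
  qed (simp add: nK)
  interpret K: bounded_linear K by fact
  have dJ: "dist (J a) (J b) = dist a b" for a b by (simp add: dist_norm J.diff[symmetric] nJ)
  have dK: "dist (K a) (K b) = dist a b" for a b by (simp add: dist_norm K.diff[symmetric] nK)
  have "L-lipschitz_on (cball (J x0) r) (\<lambda>l. J (F (K l)))"
  proof (rule lipschitz_onI)
    fix l m assume "l \<in> cball (J x0) r" "m \<in> cball (J x0) r"
    then have "K l \<in> cball x0 r" "K m \<in> cball x0 r" using dK[of "J x0"] by (auto simp: KJ)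
    then have "dist (F (K l)) (F (K m)) \<le> L * dist (K l) (K m)" by (rule lipschitz_onD[OF L])
    then show "dist (J (F (K l))) (J (F (K m))) \<le> L * dist l m" by (simp add: dJ dK)
  qed (use L lipschitz_on_nonneg in blast)
  from picard_banach[OF this r] obtain e y where e: "e > 0" and y0: "y 0 = J x0"
    and y: "\<And>t. t \<in> {0..e} \<Longrightarrow> y t \<in> cball (J x0) r"
      "\<And>t. t \<in> {0..e} \<Longrightarrow> (y has_vector_derivative J (F (K (y t)))) (at t within {0..e})" by blast
  show ?thesis
  proof (intro exI[of _ e] conjI exI[of _ "\<lambda>t. K (y t)"] ballI e)
    show "K (y 0) = x0" by (simp add: y0 KJ)
    fix t assume t: "t \<in> {0..e}"
    show "K (y t) \<in> cball x0 r" using y(1)[OF t] dK[of "J x0" "y t"] by (simp add: KJ)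
    show "((\<lambda>t. K (y t)) has_vector_derivative F (K (y t))) (at t within {0..e})"
      using K.has_vector_derivative[OF y(2)[OF t]] by (simp add: KJ)
  qed
qed

text \<open>
  Pairing the increment \<open>z\<close> with itself reduces the claim to a real integral, so that no vector-valued
  integral is needed: \<open>B z z = \<integral> B z x' \<le> sqrt (B z z) \<integral> h\<close>.
\<close>

lemma sqrt_form_increment_le_integral:
  fixes B :: "'a::real_normed_vector \<Rightarrow>\<^sub>L 'a \<Rightarrow>\<^sub>L real"
  assumes sym: "\<And>u v. B u v = B v u" and psd: "\<And>v. 0 \<le> B v v"
    and st: "s \<le> t" and P: "finite P" and cont: "continuous_on {s..t} x"
    and der: "\<And>\<tau>. \<tau> \<in> {s<..<t} - P \<Longrightarrow> (x has_vector_derivative x' \<tau>) (at \<tau>)"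
    and bnd: "\<And>\<tau>. \<tau> \<in> {s<..<t} - P \<Longrightarrow> sqrt (B (x' \<tau>) (x' \<tau>)) \<le> h \<tau>"
    and h: "h integrable_on {s..t}"
  shows "sqrt (B (x t - x s) (x t - x s)) \<le> integral {s..t} h"
proof -
  define z where "z = x t - x s"
  define n where "n = sqrt (B z z)"
  have n0: "n \<ge> 0" using psd by (simp add: n_def)
  define P' where "P' = P \<union> {s, t}"
  define h0 where "h0 \<tau> = (if \<tau> \<in> P' then 0 else h \<tau>)" for \<tau>
  define f0 where "f0 \<tau> = (if \<tau> \<in> P' then 0 else B z (x' \<tau>))" for \<tau>
  have fP': "finite P'" using P by (simp add: P'_def)
  have "(h has_integral integral {s..t} h) {s..t}" using h by (simp add: integrable_integral)
  then have h0: "(h0 has_integral integral {s..t} h) {s..t}"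
    by (rule has_integral_spike_finite[OF fP', rotated]) (auto simp: h0_def)
  have "((\<lambda>\<tau>. B z (x' \<tau>)) has_integral (B z (x t) - B z (x s))) {s..t}"
  proof (rule fundamental_theorem_of_calculus_interior_strong[OF P st])
    show "((\<lambda>\<tau>. B z (x \<tau>)) has_vector_derivative B z (x' \<tau>)) (at \<tau>)" if "\<tau> \<in> {s<..<t} - P" for \<tau>
      by (rule bounded_linear.has_vector_derivative[OF blinfun.bounded_linear_right der[OF that]])
    show "continuous_on {s..t} (\<lambda>\<tau>. B z (x \<tau>))" by (intro continuous_intros cont)
  qed
  then have "(f0 has_integral (B z (x t) - B z (x s))) {s..t}"
    by (rule has_integral_spike_finite[OF fP', rotated]) (auto simp: f0_def)
  moreover have "((\<lambda>\<tau>. n * h0 \<tau>) has_integral n * integral {s..t} h) {s..t}"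
    using has_integral_mult_right[OF h0] .
  moreover have "f0 \<tau> \<le> n * h0 \<tau>" if "\<tau> \<in> {s..t}" for \<tau>
  proof (cases "\<tau> \<in> P'")
    case False
    then have \<tau>: "\<tau> \<in> {s<..<t} - P" using that by (auto simp: P'_def)
    have "B z (x' \<tau>) \<le> n * sqrt (B (x' \<tau>) (x' \<tau>))"
      using form_Cauchy_Schwarz[OF sym psd, of z "x' \<tau>"] by (simp add: n_def)
    also have "\<dots> \<le> n * h \<tau>" using bnd[OF \<tau>] n0 by (rule mult_left_mono)
    finally show ?thesis using False by (simp add: f0_def h0_def)
  qed (simp add: f0_def h0_def)
  ultimately have "B z (x t) - B z (x s) \<le> n * integral {s..t} h" by (rule has_integral_le)
  then have le: "n * n \<le> n * integral {s..t} h"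
    using psd[of z] by (simp add: n_def z_def blinfun.bilinear_simps)
  have "0 \<le> h0 \<tau>" if "\<tau> \<in> {s..t}" for \<tau>
  proof (cases "\<tau> \<in> P'")
    case False
    then have "\<tau> \<in> {s<..<t} - P" using that by (auto simp: P'_def)
    from bnd[OF this] psd[of "x' \<tau>"] show ?thesis by (smt (verit) h0_def real_sqrt_ge_zero)
  qed (simp add: h0_def)
  then have "0 \<le> integral {s..t} h" using h0 by (rule has_integral_nonneg[rotated])
  then have "n \<le> integral {s..t} h" using le n0 by (cases "n = 0") auto
  then show ?thesis by (simp add: n_def z_def)
qed

lemma norm_increment_le_integral:
  fixes x :: "real \<Rightarrow> 'a::real_inner"
  assumes st: "s \<le> t" and P: "finite P" and cont: "continuous_on {s..t} x"
    and der: "\<And>\<tau>. \<tau> \<in> {s<..<t} - P \<Longrightarrow> (x has_vector_derivative x' \<tau>) (at \<tau>)"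
    and bnd: "\<And>\<tau>. \<tau> \<in> {s<..<t} - P \<Longrightarrow> norm (x' \<tau>) \<le> h \<tau>"
    and h: "h integrable_on {s..t}"
  shows "norm (x t - x s) \<le> integral {s..t} h"
proof -
  define B :: "'a \<Rightarrow>\<^sub>L 'a \<Rightarrow>\<^sub>L real" where "B = Blinfun blinfun_inner_left"
  have B: "B u v = u \<bullet> v" for u v unfolding B_def by (subst bounded_linear_Blinfun_apply)
       (auto simp: bounded_linear_blinfun_inner_left blinfun_inner_left.rep_eq inner_commute)
  show ?thesis using sqrt_form_increment_le_integral[OF _ _ st P cont der _ h, of B] bnd
    by (simp add: B inner_commute norm_eq_sqrt_inner)
qed

text \<open>
  Used to glue solutions of an ODE: the equation at the gluing point follows from the equation on both sides and
  continuity.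
\<close>

lemma has_vector_derivative_at_removable:
  fixes Z :: "real \<Rightarrow> 'a::real_normed_vector"
  assumes d: "d > 0" and der: "\<And>t. \<bar>t - b\<bar> < d \<Longrightarrow> t \<noteq> b \<Longrightarrow> (Z has_vector_derivative Z' t) (at t)"
    and Z: "isCont Z b" and Z': "isCont Z' b"
  shows "(Z has_vector_derivative Z' b) (at b)" unfolding has_vector_derivative_def has_derivative_at_alt
proof (intro conjI bounded_linear_scaleR_left allI impI)
  fix e :: real assume e: "0 < e"
  obtain d1 where d1: "d1 > 0" "\<And>t. \<bar>t - b\<bar> < d1 \<Longrightarrow> norm (Z' t - Z' b) < e"
    using Z' e unfolding continuous_at_eps_delta by (auto simp: dist_norm)
  define r where "r = min d d1"
  have r: "r > 0" using d d1 by (simp add: r_def)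
  have contZ: "isCont Z t" if "\<bar>t - b\<bar> < r" for t
    using der[of t] that Z by (cases "t = b") (auto simp: r_def intro: has_vector_derivative_continuous)
  have main: "norm (Z u - Z s - (u - s) *\<^sub>R Z' b) \<le> e * (u - s)"
    if su: "s < u" "\<bar>s - b\<bar> < r" "\<bar>u - b\<bar> < r" "u \<le> b \<or> b \<le> s" for s u
  proof -
    define Y where "Y t = Z t - t *\<^sub>R Z' b" for t
    have in_r: "\<bar>t - b\<bar> < r" if "s \<le> t" "t \<le> u" for t using su that by auto
    have "norm (Y u - Y s) \<le> e * u - e * s"
    proof (rule differentiable_bound_general[OF su(1)])
      show "continuous_on {s..u} Y" unfolding Y_def
        using contZ in_r by (intro continuous_intros continuous_at_imp_continuous_on) auto
      fix t assume t: "s < t" "t < u"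
      have tb: "t \<noteq> b" "\<bar>t - b\<bar> < d" "\<bar>t - b\<bar> < d1" using t su in_r[of t] by (auto simp: r_def)
      show "(Y has_vector_derivative Z' t - Z' b) (at t)"
        unfolding Y_def by (rule has_vector_derivative_diff[OF der]) (auto intro!: derivative_eq_intros tb)
      show "norm (Z' t - Z' b) \<le> e" using d1(2)[OF tb(3)] by simp
      show "((\<lambda>t. e * t) has_vector_derivative e) (at t)" by (auto intro!: derivative_eq_intros)
    qed (intro continuous_intros)
    then show ?thesis by (simp add: Y_def algebra_simps)
  qed
  show "\<exists>d>0. \<forall>y. norm (y - b) < d \<longrightarrow> norm (Z y - Z b - (y - b) *\<^sub>R Z' b) \<le> e * norm (y - b)"
  proof (intro exI[of _ r] conjI r allI impI)
    fix y assume y: "norm (y - b) < r"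
    show "norm (Z y - Z b - (y - b) *\<^sub>R Z' b) \<le> e * norm (y - b)"
    proof (cases y b rule: linorder_cases)
      case less
      have "norm (Z b - Z y - (b - y) *\<^sub>R Z' b) \<le> e * (b - y)" using less y r by (intro main) auto
      moreover have "Z b - Z y - (b - y) *\<^sub>R Z' b = - (Z y - Z b - (y - b) *\<^sub>R Z' b)"
        by (simp add: algebra_simps)
      ultimately show ?thesis using less by (metis norm_minus_cancel abs_minus_commute abs_of_pos diff_gt_0_iff_gt real_norm_def)
    next
      case greater
      then show ?thesis using main[of b y] y r by auto
    qed simp
  qed
qed

section \<open>Charts, tangent vectors and piecewise smooth paths\<close>

lemma vector_derivative_cong_on:
  assumes "\<And>s. s \<in> T \<Longrightarrow> f s = g s" "t \<in> T"
  shows "vector_derivative f (at t within T) = vector_derivative g (at t within T)"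
proof -
  have "(f has_vector_derivative v) (at t within T) \<longleftrightarrow> (g has_vector_derivative v) (at t within T)" for v
    using assms by (metis has_vector_derivative_transform)
  then show ?thesis by (simp add: vector_derivative_def)
qed

lemma vector_derivative_cong_near:
  assumes "open T" "t \<in> T" "\<And>s. s \<in> T \<Longrightarrow> f s = g s"
  shows "vector_derivative f (at t) = vector_derivative g (at t)"
proof -
  have "(f has_vector_derivative v) (at t) \<longleftrightarrow> (g has_vector_derivative v) (at t)" for v
    using assms by (metis has_vector_derivative_transform_within_open)
  then show ?thesis by (simp add: vector_derivative_def)
qed

abbreviation "dtrans c d x \<equiv> frechet_derivative (snd d \<circ> chart_inv c) (at (snd c x))"

abbreviation "chart_velocity c \<gamma> t \<equiv> vector_derivative (snd c \<circ> \<gamma>) (at t)"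

locale atlas =
  fixes A :: "('m::t2_space, 'e::{real_inner, complete_space}) chart set"
  assumes atlas: "smooth_atlas A"
begin

lemma ex_chart: "\<exists>c\<in>A. x \<in> fst c" using atlas unfolding smooth_atlas_def by (metis UNIV_I UN_E)

lemma chart_homeo: "c \<in> A \<Longrightarrow> homeomorphism (fst c) (snd c ` fst c) (snd c) (chart_inv c)"
  and chart_open: "c \<in> A \<Longrightarrow> open (fst c)"
  and chart_image_open: "c \<in> A \<Longrightarrow> open (snd c ` fst c)"
  and transition_smooth: "c \<in> A \<Longrightarrow> d \<in> A \<Longrightarrow> smooth_map_on (snd c ` (fst c \<inter> fst d)) (snd d \<circ> chart_inv c)"
  using atlas unfolding smooth_atlas_def by simp_all

lemma chart_inv_chart: "c \<in> A \<Longrightarrow> x \<in> fst c \<Longrightarrow> chart_inv c (snd c x) = x"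
  using chart_homeo by (simp add: homeomorphism_def)

lemma chart_chart_inv: "c \<in> A \<Longrightarrow> p \<in> snd c ` fst c \<Longrightarrow> snd c (chart_inv c p) = p" by (auto simp: chart_inv_chart)

lemma chart_inv_in: "c \<in> A \<Longrightarrow> p \<in> snd c ` fst c \<Longrightarrow> chart_inv c p \<in> fst c" by (auto simp: chart_inv_chart)

lemma chart_continuous: "c \<in> A \<Longrightarrow> continuous_on (fst c) (snd c)"
  using chart_homeo by (simp add: homeomorphism_def)

lemma chart_inv_continuous: "c \<in> A \<Longrightarrow> continuous_on (snd c ` fst c) (chart_inv c)"
  using chart_homeo by (simp add: homeomorphism_def)

lemma chart_image_of_open:
  assumes c: "c \<in> A" and U: "open U"
  shows "open (snd c ` (fst c \<inter> U))"
proof -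
  have "snd c ` (fst c \<inter> U) = snd c ` fst c \<inter> chart_inv c -` U" using chart_inv_chart[OF c] by force
  then show ?thesis
    using continuous_open_preimage[OF chart_inv_continuous[OF c] chart_image_open[OF c] U] by simp
qed

lemma chart_preimage_open:
  assumes c: "c \<in> A" and V: "open V"
  shows "open (fst c \<inter> snd c -` V)"
  using continuous_open_preimage[OF chart_continuous[OF c] chart_open[OF c] V] .

lemma transition_derivative:
  assumes c: "c \<in> A" and d: "d \<in> A" and x: "x \<in> fst c" "x \<in> fst d"
  shows "((snd d \<circ> chart_inv c) has_derivative dtrans c d x) (at (snd c x))"
proof -
  have o: "open (snd c ` (fst c \<inter> fst d))" by (rule chart_image_of_open[OF c chart_open[OF d]])
  obtain f1 :: "'e \<Rightarrow> 'e \<Rightarrow>\<^sub>L 'e" where "\<And>p. p \<in> snd c ` (fst c \<inter> fst d) \<Longrightarrow> ((snd d \<circ> chart_inv c) has_derivative f1 p) (at p)"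
    using smooth_map_on_C2[OF transition_smooth[OF c d] o] by metis
  then have "(snd d \<circ> chart_inv c) differentiable (at (snd c x))"
    using x by (meson differentiable_def Int_iff image_eqI)
  then show ?thesis by (simp add: frechet_derivative_works)
qed

lemma transition_derivative_self:
  assumes c: "c \<in> A" and x: "x \<in> fst c"
  shows "dtrans c c x = (\<lambda>v. v)"
proof -
  have "((\<lambda>p. p) has_derivative (\<lambda>v. v)) (at (snd c x))" by (rule has_derivative_ident)
  then have "((snd c \<circ> chart_inv c) has_derivative (\<lambda>v. v)) (at (snd c x))"
    by (rule has_derivative_transform_within_open[OF _ chart_image_open[OF c]])
       (use x chart_chart_inv[OF c] in auto)
  then show ?thesis by (rule frechet_derivative_at[symmetric])
qed

text \<open>The cocycle condition, the reason why tangent vectors are independent of the chart.\<close>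

lemma transition_derivative_chain:
  assumes c: "c \<in> A" and d: "d \<in> A" and e: "e \<in> A" and x: "x \<in> fst c" "x \<in> fst d" "x \<in> fst e"
  shows "dtrans c e x v =
    dtrans d e x (dtrans c d x v)"
proof -
  have p: "(snd d \<circ> chart_inv c) (snd c x) = snd d x" by (simp add: chart_inv_chart[OF c x(1)])
  have "((snd e \<circ> chart_inv d) \<circ> (snd d \<circ> chart_inv c) has_derivative
      dtrans d e x \<circ> dtrans c d x) (at (snd c x))"
    by (rule diff_chain_at[OF transition_derivative[OF c d x(1,2)]])
       (simp only: p transition_derivative[OF d e x(2,3)])
  then have "(snd e \<circ> chart_inv c has_derivative
      dtrans d e x \<circ> dtrans c d x) (at (snd c x))"
    by (rule has_derivative_transform_within_open[OF _ chart_image_of_open[OF c chart_open[OF d]]])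
       (use x chart_inv_chart[OF c] chart_inv_chart[OF d] in auto)
  from frechet_derivative_at[OF this] show ?thesis by (metis comp_apply)
qed

text \<open>
  A tangent vector as defined is the full equivalence class, so that changing the chart gives an equality of sets.
\<close>

lemma tangent_change:
  assumes c: "c \<in> A" and d: "d \<in> A" and x: "x \<in> fst c" "x \<in> fst d"
  shows "tangent A x c v = tangent A x d (dtrans c d x v)"
  unfolding tangent_def using transition_derivative_chain[OF c d _ x] by auto

lemma path_in_other_chart:
  assumes c: "c \<in> A" and d: "d \<in> A" and x: "\<gamma> t \<in> fst c" "\<gamma> t \<in> fst d"
    and cont: "isCont \<gamma> t" and der: "((snd c \<circ> \<gamma>) has_vector_derivative v) (at t)"
  shows "((snd d \<circ> \<gamma>) has_vector_derivative dtrans c d (\<gamma> t) v) (at t)"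
proof -
  obtain T where T: "open T" "t \<in> T" "\<And>s. s \<in> T \<Longrightarrow> \<gamma> s \<in> fst c"
    using cont x(1) chart_open[OF c] unfolding continuous_at_open by meson
  have "((snd d \<circ> chart_inv c) has_derivative dtrans c d (\<gamma> t))
      (at ((snd c \<circ> \<gamma>) t))" using transition_derivative[OF c d x] by simp
  from vector_derivative_diff_chain_within[OF der has_derivative_at_withinI[OF this]]
  have "((snd d \<circ> chart_inv c) \<circ> (snd c \<circ> \<gamma>) has_vector_derivative dtrans c d (\<gamma> t) v) (at t)" .
  then show ?thesis by (rule has_vector_derivative_transform_within_open[OF _ T(1,2)])
       (use T(3) chart_inv_chart[OF c] in auto)
qed

lemma velocity_eq_tangent:
  assumes c: "c \<in> A" and x: "\<gamma> t \<in> fst c" and t: "t \<in> interior I"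
    and cont: "isCont \<gamma> t" and der: "((snd c \<circ> \<gamma>) has_vector_derivative v) (at t)"
  shows "velocity A I \<gamma> t = tangent A (\<gamma> t) c v"
proof -
  have at: "at t within I = at t" using t by (rule at_within_interior)
  have "vector_derivative (snd d \<circ> \<gamma>) (at t within I) = dtrans c d (\<gamma> t) v"
    if "d \<in> A" "\<gamma> t \<in> fst d" for d
    unfolding at by (rule vector_derivative_at[OF path_in_other_chart[OF c that(1) x that(2) cont der]])
  then show ?thesis unfolding velocity_def tangent_def by auto
qed

lemma velocity_cong_near:
  assumes "open T" "t \<in> T" "\<And>s. s \<in> T \<Longrightarrow> \<gamma> s = \<eta> s"
  shows "velocity A UNIV \<gamma> t = velocity A UNIV \<eta> t"
proof -
  have "chart_velocity c \<gamma> t = vector_derivative (snd c \<circ> \<eta>) (at t)" for c :: "('m, 'e) chart"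
    using assms(3) by (intro vector_derivative_cong_near[OF assms(1,2)]) simp
  then show ?thesis unfolding velocity_def using assms(2,3) by simp
qed

end

definition pwC1 :: "('m::topological_space, 'e::real_normed_vector) chart set \<Rightarrow> real \<Rightarrow> real \<Rightarrow> (real \<Rightarrow> 'm) \<Rightarrow> bool" where
  "pwC1 A a b \<gamma> \<longleftrightarrow> continuous_on {a..b} \<gamma> \<and>
     (\<exists>P. finite P \<and> (\<forall>s t. a \<le> s \<and> s < t \<and> t \<le> b \<and> {s<..<t} \<inter> P = {} \<longrightarrow> C1_path_on A s t \<gamma>))"

lemma piecewise_C1_path_eq_pwC1: "piecewise_C1_path A \<gamma> = pwC1 A 0 1 \<gamma>"
  unfolding piecewise_C1_path_def pwC1_def ..

lemma C1_path_on_cong: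
  assumes "\<And>s. s \<in> {a..b} \<Longrightarrow> \<gamma> s = \<eta> s" and "C1_path_on A a b \<gamma>"
  shows "C1_path_on A a b \<eta>"
proof -
  have vd: "vector_derivative (snd c \<circ> \<gamma>) (at t within {a..b}) = vector_derivative (snd c \<circ> \<eta>) (at t within {a..b})"
    if "t \<in> {a..b}" for t and c :: "('a, 'b) chart"
    using assms(1) that by (intro vector_derivative_cong_on) auto
  have df: "(snd c \<circ> \<gamma>) differentiable (at t within {a..b}) \<Longrightarrow> (snd c \<circ> \<eta>) differentiable (at t within {a..b})"
    if "t \<in> {a..b}" for t and c :: "('a, 'b) chart" unfolding differentiable_def using assms(1) that
    by (metis (no_types, lifting) comp_apply has_derivative_transform)
  have sets: "{t \<in> {a..b}. \<eta> t \<in> fst c} = {t \<in> {a..b}. \<gamma> t \<in> fst c}" for c :: "('a, 'b) chart"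
    using assms(1) by auto
  show ?thesis unfolding C1_path_on_def
  proof (intro conjI ballI impI)
    show "continuous_on {a..b} \<eta>"
      using assms continuous_on_cong[OF refl, of "{a..b}" \<gamma> \<eta>] unfolding C1_path_on_def by blast
    fix c assume c: "c \<in> A"
    show "(snd c \<circ> \<eta>) differentiable at t within {a..b}" if "t \<in> {a..b}" "\<eta> t \<in> fst c" for t
      using assms c that unfolding C1_path_on_def by (intro df) auto
    have "continuous_on {t \<in> {a..b}. \<gamma> t \<in> fst c} (\<lambda>t. vector_derivative (snd c \<circ> \<gamma>) (at t within {a..b}))"
      using assms(2) c unfolding C1_path_on_def by blast
    then show "continuous_on {t \<in> {a..b}. \<eta> t \<in> fst c} (\<lambda>t. vector_derivative (snd c \<circ> \<eta>) (at t within {a..b}))"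
      unfolding sets by (rule continuous_on_eq) (use vd in auto)
  qed
qed

lemma C1_path_on_affine:
  assumes C: "C1_path_on A a b \<gamma>" and ab: "a < b" and m: "m \<noteq> 0"
    and im: "(\<lambda>t. m * t + q) ` {a'..b'} = {a..b}"
  shows "C1_path_on A a' b' (\<lambda>t. \<gamma> (m * t + q))"
proof -
  have a'b': "a' < b'"
  proof (rule ccontr)
    assume "\<not> a' < b'"
    then have "{a'..b'} = {} \<or> (\<exists>z. {a'..b'} = {z})" by (cases "a' = b'") auto
    then have "{a..b} = {} \<or> (\<exists>z. {a..b} = {z})" unfolding im[symmetric] by auto
    moreover have "a \<in> {a..b}" "b \<in> {a..b}" using ab by auto
    ultimately show False using ab by auto
  qed
  have in_ab: "m * t + q \<in> {a..b}" if "t \<in> {a'..b'}" for t using im that by blast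
  have vd: "((snd c \<circ> (\<lambda>t. \<gamma> (m * t + q))) has_vector_derivative
       m *\<^sub>R vector_derivative (snd c \<circ> \<gamma>) (at (m * t + q) within {a..b})) (at t within {a'..b'})"
    if c: "c \<in> A" and t: "t \<in> {a'..b'}" "\<gamma> (m * t + q) \<in> fst c" for c t
  proof -
    have "((\<lambda>t. m * t + q) has_vector_derivative m) (at t within {a'..b'})"
      by (auto intro!: derivative_eq_intros)
    moreover have "((snd c \<circ> \<gamma>) has_vector_derivative vector_derivative (snd c \<circ> \<gamma>) (at (m * t + q) within {a..b}))
      (at (m * t + q) within (\<lambda>t. m * t + q) ` {a'..b'})"
      using C c in_ab[OF t(1)] t(2) unfolding C1_path_on_def im by (auto simp: vector_derivative_works)
    ultimately show ?thesis using vector_diff_chain_within by (force simp: o_def)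
  qed
  have vd_eq: "vector_derivative (snd c \<circ> (\<lambda>t. \<gamma> (m * t + q))) (at t within {a'..b'})
      = m *\<^sub>R vector_derivative (snd c \<circ> \<gamma>) (at (m * t + q) within {a..b})"
    if c: "c \<in> A" and t: "t \<in> {a'..b'}" "\<gamma> (m * t + q) \<in> fst c" for c t
    using vector_derivative_within_cbox[OF a'b', of t, unfolded cbox_interval, OF t(1) vd[OF c t]] .
  have ca: "continuous_on T (\<lambda>t. m * t + q)" for T by (intro continuous_intros)
  show ?thesis unfolding C1_path_on_def
  proof (intro conjI ballI impI)
    show "continuous_on {a'..b'} (\<lambda>t. \<gamma> (m * t + q))"
      by (rule continuous_on_compose2[OF _ ca]) (use C im in \<open>auto simp: C1_path_on_def\<close>)
    fix c assume c: "c \<in> A"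
    show "(snd c \<circ> (\<lambda>t. \<gamma> (m * t + q))) differentiable at t within {a'..b'}"
      if "t \<in> {a'..b'}" "\<gamma> (m * t + q) \<in> fst c" for t using vd[OF c that] by (rule differentiableI_vector)
    have "continuous_on {t \<in> {a..b}. \<gamma> t \<in> fst c} (\<lambda>t. vector_derivative (snd c \<circ> \<gamma>) (at t within {a..b}))"
      using C c unfolding C1_path_on_def by blast
    then have "continuous_on {t \<in> {a'..b'}. \<gamma> (m * t + q) \<in> fst c}
       (\<lambda>t. vector_derivative (snd c \<circ> \<gamma>) (at (m * t + q) within {a..b}))"
      by (rule continuous_on_compose2[OF _ ca]) (use in_ab in auto)
    then have "continuous_on {t \<in> {a'..b'}. \<gamma> (m * t + q) \<in> fst c}
       (\<lambda>t. m *\<^sub>R vector_derivative (snd c \<circ> \<gamma>) (at (m * t + q) within {a..b}))" by (intro continuous_intros)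
    then show "continuous_on {t \<in> {a'..b'}. \<gamma> (m * t + q) \<in> fst c}
       (\<lambda>t. vector_derivative (snd c \<circ> (\<lambda>t. \<gamma> (m * t + q))) (at t within {a'..b'}))"
      by (rule continuous_on_eq) (use vd_eq[OF c] in auto)
  qed
qed

text \<open>
  Bisection for paths: a transitive relation between parameters that holds for the pieces inside small neighbourhoods
  holds globally. Local pieces may be taken \<open>C\<^sup>1\<close>, since break points can be made interval ends.
\<close>

lemma pwC1_Bolzano:
  assumes pw: "pwC1 A a b \<gamma>" and ab: "a \<le> b"
    and trans: "\<And>s t u. a \<le> s \<Longrightarrow> s \<le> t \<Longrightarrow> t \<le> u \<Longrightarrow> u \<le> b \<Longrightarrow> Q s t \<Longrightarrow> Q t u \<Longrightarrow> Q s u"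
    and loc: "\<And>x. x \<in> {a..b} \<Longrightarrow> \<exists>U. open U \<and> \<gamma> x \<in> U \<and>
       (\<forall>s t. a \<le> s \<and> s \<le> t \<and> t \<le> b \<and> \<gamma> ` {s..t} \<subseteq> U \<and> (s < t \<longrightarrow> C1_path_on A s t \<gamma>) \<longrightarrow> Q s t)"
  shows "Q a b"
proof -
  obtain P where cont: "continuous_on {a..b} \<gamma>" and P: "finite P"
    and C: "\<And>s t. a \<le> s \<Longrightarrow> s < t \<Longrightarrow> t \<le> b \<Longrightarrow> {s<..<t} \<inter> P = {} \<Longrightarrow> C1_path_on A s t \<gamma>"
    using pw unfolding pwC1_def by auto
  have "a \<le> a \<longrightarrow> b \<le> b \<longrightarrow> Q a b" using ab
  proof (induction rule: Bolzano[where P="\<lambda>s t. a \<le> s \<longrightarrow> t \<le> b \<longrightarrow> Q s t"])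
    case (trans s t u) then show ?case using assms(3) by auto
  next
    case (local x)
    then have x: "x \<in> {a..b}" by simp
    obtain U where U: "open U" "\<gamma> x \<in> U"
      and Q: "\<And>s t. a \<le> s \<Longrightarrow> s \<le> t \<Longrightarrow> t \<le> b \<Longrightarrow> \<gamma> ` {s..t} \<subseteq> U \<Longrightarrow> (s < t \<longrightarrow> C1_path_on A s t \<gamma>) \<Longrightarrow> Q s t"
      using loc[OF x] by (elim exE conjE) (rule that, auto)
    obtain V where V: "open V" "x \<in> V" "\<And>t. t \<in> {a..b} \<inter> V \<Longrightarrow> \<gamma> t \<in> U"
      using cont U x unfolding continuous_on_topological by (metis Int_iff)
    obtain d1 where d1: "d1 > 0" "ball x d1 \<subseteq> V" using V openE by blast
    obtain d2 where d2: "d2 > 0" "\<forall>p\<in>P. p \<noteq> x \<longrightarrow> d2 \<le> dist x p" using finite_set_avoid[OF P, of x] by auto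
    define d where "d = min d1 d2"
    have "Q s t" if st: "s \<le> x \<and> x \<le> t \<and> t - s < d" "a \<le> s" "t \<le> b" for s t
    proof -
      have im: "\<gamma> ` {s'..t'} \<subseteq> U" if "s \<le> s'" "t' \<le> t" for s' t'
      proof (rule image_subsetI)
        fix \<tau> assume "\<tau> \<in> {s'..t'}"
        then have "\<tau> \<in> {a..b}" "\<tau> \<in> ball x d1" using that st by (auto simp: d_def dist_real_def)
        then show "\<gamma> \<tau> \<in> U" using V(3) d1(2) by blast
      qed
      have np: "{s<..<x} \<inter> P = {}" "{x<..<t} \<inter> P = {}" using d2 st by (force simp: d_def dist_real_def)+
      have "Q s x" using st np C[of s x] x by (intro Q im) auto
      moreover have "Q x t" using st np C[of x t] x by (intro Q im) auto
      ultimately show ?thesis using st by (intro assms(3)[of s x t]) auto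
    qed
    then show ?case using d1 d2 by (intro exI[of _ d]) (auto simp: d_def)
  qed
  then show ?thesis by simp
qed

section \<open>Strong metrics in charts and the length of paths\<close>

text \<open>
  The two-sided velocity; it differs from that of \<open>path_length\<close> only at finitely many parameters, and is
  invariant under restriction of the parameter interval.
\<close>

definition speed :: "('m, 'e::real_normed_vector) chart set \<Rightarrow> ('m, 'e) metric \<Rightarrow> (real \<Rightarrow> 'm) \<Rightarrow> real \<Rightarrow> real" where
  "speed A G \<gamma> t = sqrt (G (\<gamma> t) (velocity A UNIV \<gamma> t) (velocity A UNIV \<gamma> t))"

text \<open>
  A choice of the local representative, hence meaningful on the chart image of \<open>S\<close> only.
\<close>

definition gcoord :: "('m, 'e::real_normed_vector) chart set \<Rightarrow> 'm set \<Rightarrow> ('m, 'e) metric \<Rightarrow> ('m, 'e) chart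
    \<Rightarrow> 'e \<Rightarrow> 'e \<Rightarrow>\<^sub>L 'e \<Rightarrow>\<^sub>L real" where
  "gcoord A S G c = (SOME g. smooth_map_on (snd c ` (fst c \<inter> S)) g \<and>
        (\<forall>x\<in>fst c \<inter> S. \<forall>v w. G x (tangent A x c v) (tangent A x c w) = blinfun_apply (blinfun_apply (g (snd c x)) v) w))"

locale strong_riem = atlas A
  for A :: "('m::t2_space, 'e::{real_inner, complete_space}) chart set" +
  fixes S :: "'m set" and G :: "('m, 'e) metric"
  assumes openS: "open S" and strong: "strong_riemannian_metric A S G"
begin

abbreviation "g \<equiv> gcoord A S G"
abbreviation "dist\<^sub>G \<equiv> geodesic_dist A S G"
abbreviation "Chr \<equiv> christoffel A G"
abbreviation "cdom c \<equiv> snd c ` (fst c \<inter> S)"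

lemma open_dom: "c \<in> A \<Longrightarrow> open (cdom c)" by (rule chart_image_of_open[OF _ openS])

lemma
  assumes c: "c \<in> A"
  shows g_smooth: "smooth_map_on (cdom c) (g c)"
    and G_eq_g: "x \<in> fst c \<Longrightarrow> x \<in> S \<Longrightarrow> G x (tangent A x c v) (tangent A x c w) = g c (snd c x) v w"
proof -
  have "\<exists>g :: 'e \<Rightarrow> 'e \<Rightarrow>\<^sub>L 'e \<Rightarrow>\<^sub>L real. smooth_map_on (cdom c) g \<and>
        (\<forall>x\<in>fst c \<inter> S. \<forall>v w. G x (tangent A x c v) (tangent A x c w) = blinfun_apply (blinfun_apply (g (snd c x)) v) w)"
    using strong c unfolding strong_riemannian_metric_def by blast
  from someI_ex[OF this]
  have *: "smooth_map_on (cdom c) (g c) \<and>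
        (\<forall>x\<in>fst c \<inter> S. \<forall>v w. G x (tangent A x c v) (tangent A x c w) = g c (snd c x) v w)"
    unfolding gcoord_def .
  show "smooth_map_on (cdom c) (g c)" using * by blast
  show "x \<in> fst c \<Longrightarrow> x \<in> S \<Longrightarrow> G x (tangent A x c v) (tangent A x c w) = g c (snd c x) v w" using * by simp
qed

lemma g_sym: "c \<in> A \<Longrightarrow> p \<in> cdom c \<Longrightarrow> g c p v w = g c p w v"
  and g_pos: "c \<in> A \<Longrightarrow> p \<in> cdom c \<Longrightarrow> v \<noteq> 0 \<Longrightarrow> 0 < g c p v v"
  using strong unfolding strong_riemannian_metric_def by (auto simp: G_eq_g[symmetric])

lemma g_nonneg: "c \<in> A \<Longrightarrow> p \<in> cdom c \<Longrightarrow> 0 \<le> g c p v v" using g_pos[of c p v] by (cases "v = 0") auto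

text \<open>
  This is where strength of the metric enters: the unit ball of \<open>'e\<close> contains a ball of \<open>g\<close>,
  and homogeneity does the rest.
\<close>

lemma g_coercive:
  assumes c: "c \<in> A" and p: "p \<in> cdom c"
  shows "\<exists>k>0. \<forall>v. k * norm v \<le> sqrt (g c p v v)"
proof -
  obtain x where x: "x \<in> fst c" "x \<in> S" "p = snd c x" using p by blast
  define B where "B = g c p"
  define d where "d v w = sqrt (B (v - w) (v - w))" for v w
  note B = g_sym[OF c p, folded B_def] g_nonneg[OF c p, folded B_def]
  have top: "Metric_space.mtopology UNIV d = euclidean"
    using strong c x unfolding strong_riemannian_metric_def d_def B_def by (auto simp: G_eq_g)
  interpret M: Metric_space UNIV d
  proof
    show "d v w = d w v" for v w
      unfolding d_def using blinfun.minus_left[of B] by (metis (no_types) blinfun.minus_left blinfun.minus_right minus_diff_eq verit_minus_simplify(4))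
    show "d v w = 0 \<longleftrightarrow> v = w" for v w
      unfolding d_def using g_pos[OF c p, folded B_def, of "v - w"] by (cases "v = w") auto
    show "d u w \<le> d u v + d v w" for u v w unfolding d_def using form_triangle[of B "u - v" "v - w"] B by simp
  qed (simp add: d_def B)
  have "openin M.mtopology (ball 0 1 :: 'e set)" by (simp add: top)
  then obtain r where r: "r > 0" "M.mball 0 r \<subseteq> ball 0 1"
    by (metis M.openin_mtopology centre_in_ball zero_less_one)
  have "r * norm v \<le> sqrt (B v v)" for v
  proof (rule ccontr)
    assume a: "\<not> r * norm v \<le> sqrt (B v v)"
    then have v: "v \<noteq> 0" by auto
    define u where "u = (1 / norm v) *\<^sub>R v"
    have "sqrt (B u u) = sqrt (B v v) / norm v"
      using v by (simp add: u_def blinfun.bilinear_simps real_sqrt_divide)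
    also have "\<dots> < r" using a v by (simp add: pos_divide_less_eq)
    finally have "u \<in> M.mball 0 r" by (simp add: d_def blinfun.bilinear_simps)
    then have "norm u < 1" using r by auto
    then show False using v by (simp add: u_def)
  qed
  then show ?thesis using r(1) unfolding B_def by blast
qed

lemma g_continuous: "c \<in> A \<Longrightarrow> continuous_on (cdom c) (g c)" using smooth_map_on_C2[OF g_smooth open_dom]
  by (metis continuous_at_imp_continuous_on has_derivative_continuous)

text \<open>Coercivity at \<open>p\<close> persists nearby by norm continuity of \<open>g\<close>.\<close>

lemma local_norm_equivalence:
  assumes c: "c \<in> A" and p: "p \<in> cdom c"
  shows "\<exists>r>0. \<exists>k>0. \<exists>K>0. ball p r \<subseteq> cdom c \<and>
    (\<forall>q\<in>ball p r. \<forall>v. k * norm v \<le> sqrt (g c q v v) \<and> sqrt (g c q v v) \<le> K * norm v)"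
proof -
  obtain k where k: "k > 0" "\<And>v. k * norm v \<le> sqrt (g c p v v)" using g_coercive[OF c p] by blast
  \<comment> \<open>Then \<open>k\<^sup>2 - e = (k / 2)\<^sup>2\<close>.\<close>
  define e where "e = k^2 * 3 / 4"
  have e: "e > 0" using k by (simp add: e_def)
  obtain d1 where d1: "d1 > 0" "\<And>q. q \<in> cdom c \<Longrightarrow> dist q p < d1 \<Longrightarrow> dist (g c q) (g c p) < e"
    using g_continuous[OF c] p e unfolding continuous_on_iff by blast
  obtain d2 where d2: "d2 > 0" "ball p d2 \<subseteq> cdom c" using openE[OF open_dom[OF c] p] .
  define r where "r = min d1 d2"
  define K where "K = sqrt (norm (g c p) + e)"
  have Kp: "K > 0" using e by (simp add: K_def add_nonneg_pos)
  have bnd: "\<bar>g c q v v - g c p v v\<bar> \<le> e * (norm v)^2" if "q \<in> ball p r" for q v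
  proof -
    have "q \<in> cdom c" using d2 that by (auto simp: r_def)
    moreover have "dist q p < d1" using that by (simp add: r_def dist_commute)
    ultimately have "norm (g c q - g c p) \<le> e" using d1(2)[of q] by (simp add: dist_norm)
    then have "norm (g c q - g c p) * norm v * norm v \<le> e * norm v * norm v" by (intro mult_right_mono) auto
    moreover have "\<bar>(g c q - g c p) v v\<bar> \<le> norm (g c q - g c p) * norm v * norm v"
      using norm_blinfun[of "(g c q - g c p) v" v] mult_right_mono[OF norm_blinfun[of "g c q - g c p" v] norm_ge_zero[of v]]
      by simp
    ultimately show ?thesis by (simp add: blinfun.bilinear_simps power2_eq_square)
  qed
  have low: "k / 2 * norm v \<le> sqrt (g c q v v)" if "q \<in> ball p r" for q v
  proof -
    have "(k * norm v)^2 \<le> g c p v v"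
      using k(2)[of v] k(1) by (metis mult_nonneg_nonneg norm_ge_zero order_less_imp_le real_le_rsqrt real_sqrt_le_iff real_sqrt_pow2_iff g_nonneg[OF c p] power_mono)
    then have "k^2 * (norm v)^2 - e * (norm v)^2 \<le> g c q v v"
      using bnd[OF that, of v] by (simp add: power_mult_distrib)
    then have "(k / 2 * norm v)^2 \<le> g c q v v"
      by (simp add: e_def power_mult_distrib power_divide algebra_simps)
    then show ?thesis by (rule real_le_rsqrt)
  qed
  have up: "sqrt (g c q v v) \<le> K * norm v" if "q \<in> ball p r" for q v
  proof (rule real_le_lsqrt)
    have "g c p v v \<le> norm (g c p) * norm v * norm v"
      using norm_blinfun[of "g c p v" v] mult_right_mono[OF norm_blinfun[of "g c p" v] norm_ge_zero[of v]]
      by simp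
    then have "g c q v v \<le> (norm (g c p) + e) * (norm v)^2"
      using bnd[OF that, of v] by (simp add: power2_eq_square algebra_simps)
    also have "\<dots> = (K * norm v)^2" using e by (simp add: K_def power_mult_distrib)
    finally show "g c q v v \<le> (K * norm v)^2" .
  qed (use Kp in simp)
  show ?thesis
    using low up Kp k(1) d1 d2 by (intro exI[of _ r] conjI exI[of _ "k/2"] exI[of _ K]) (auto simp: r_def)
qed

text \<open>All that is used of a \<open>C\<^sup>1\<close> piece within one chart.\<close>

lemma chart_piece:
  assumes C: "C1_path_on A s t \<gamma>" and st: "s < t" and c: "c \<in> A"
    and im: "\<gamma> ` {s..t} \<subseteq> fst c"
  shows "\<exists>x'. continuous_on {s..t} (snd c \<circ> \<gamma>) \<and> continuous_on {s..t} x' \<and>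
    (\<forall>\<tau>\<in>{s..t}. ((snd c \<circ> \<gamma>) has_vector_derivative x' \<tau>) (at \<tau> within {s..t})) \<and>
    (\<forall>\<tau>\<in>{s<..<t}. ((snd c \<circ> \<gamma>) has_vector_derivative x' \<tau>) (at \<tau>) \<and>
       (\<gamma> \<tau> \<in> S \<longrightarrow> speed A G \<gamma> \<tau> = sqrt (g c (snd c (\<gamma> \<tau>)) (x' \<tau>) (x' \<tau>))))"
proof -
  define x' where "x' \<tau> = vector_derivative (snd c \<circ> \<gamma>) (at \<tau> within {s..t})" for \<tau>
  have cont: "continuous_on {s..t} \<gamma>" using C by (simp add: C1_path_on_def)
  have x: "continuous_on {s..t} (snd c \<circ> \<gamma>)"
    using continuous_on_compose[OF cont] continuous_on_subset[OF chart_continuous[OF c] im] by blast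
  have eq: "{\<tau> \<in> {s..t}. \<gamma> \<tau> \<in> fst c} = {s..t}" using im by auto
  have x'c: "continuous_on {s..t} x'"
    using C c unfolding C1_path_on_def x'_def by (metis (mono_tags, lifting) eq)
  have d: "((snd c \<circ> \<gamma>) has_vector_derivative x' \<tau>) (at \<tau> within {s..t})" if "\<tau> \<in> {s..t}" for \<tau>
  proof -
    have "\<gamma> \<tau> \<in> fst c" using im that by blast
    then have "(snd c \<circ> \<gamma>) differentiable (at \<tau> within {s..t})" using C c that unfolding C1_path_on_def by blast
    then show ?thesis by (simp only: vector_derivative_works x'_def)
  qed
  have d2: "((snd c \<circ> \<gamma>) has_vector_derivative x' \<tau>) (at \<tau>)" if "\<tau> \<in> {s<..<t}" for \<tau>
    using d[of \<tau>] that at_within_Icc_at[of s \<tau> t] by auto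
  have ic: "isCont \<gamma> \<tau>" if "\<tau> \<in> {s<..<t}" for \<tau> using continuous_on_interior[OF cont] that by simp
  have v: "velocity A UNIV \<gamma> \<tau> = tangent A (\<gamma> \<tau>) c (x' \<tau>)" if "\<tau> \<in> {s<..<t}" for \<tau>
    using that im by (intro velocity_eq_tangent[OF c _ _ ic[OF that] d2[OF that]]) auto
  have sp: "speed A G \<gamma> \<tau> = sqrt (g c (snd c (\<gamma> \<tau>)) (x' \<tau>) (x' \<tau>))" if "\<tau> \<in> {s<..<t}" "\<gamma> \<tau> \<in> S" for \<tau>
  proof -
    have "\<gamma> \<tau> \<in> fst c" using that im by auto
    then show ?thesis unfolding speed_def v[OF that(1)] by (simp add: G_eq_g[OF c _ that(2)])
  qed
  show ?thesis using x x'c d d2 sp by (intro exI[of _ x'] conjI ballI impI) simp_all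
qed

text \<open>
  The points at which speed behaves as for a differentiable curve; a piecewise \<open>C\<^sup>1\<close> path has only
  finitely many others.
\<close>

definition regular_at :: "(real \<Rightarrow> 'm) \<Rightarrow> real \<Rightarrow> bool" where
  "regular_at \<gamma> t \<longleftrightarrow> isCont \<gamma> t \<and> (\<exists>c\<in>A. \<gamma> t \<in> fst c \<and> (\<exists>v. ((snd c \<circ> \<gamma>) has_vector_derivative v) (at t)))"

lemma regular_atE:
  assumes "regular_at \<gamma> t"
  obtains c v where "isCont \<gamma> t" "c \<in> A" "\<gamma> t \<in> fst c" "((snd c \<circ> \<gamma>) has_vector_derivative v) (at t)"
    "velocity A UNIV \<gamma> t = tangent A (\<gamma> t) c v"
    "\<gamma> t \<in> S \<Longrightarrow> speed A G \<gamma> t = sqrt (g c (snd c (\<gamma> t)) v v)"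
proof -
  obtain c v where *: "isCont \<gamma> t" "c \<in> A" "\<gamma> t \<in> fst c" "((snd c \<circ> \<gamma>) has_vector_derivative v) (at t)"
    using assms unfolding regular_at_def by blast
  have v: "velocity A UNIV \<gamma> t = tangent A (\<gamma> t) c v" by (rule velocity_eq_tangent[OF *(2,3) _ *(1,4)]) simp
  show ?thesis by (rule that[OF * v]) (simp add: speed_def v G_eq_g[OF *(2,3)])
qed

lemma speed_nonneg: "regular_at \<gamma> t \<Longrightarrow> \<gamma> t \<in> S \<Longrightarrow> 0 \<le> speed A G \<gamma> t" by (elim regular_atE) (auto intro!: g_nonneg)

lemma pwC1_regular:
  assumes "pwC1 A a b \<gamma>"
  shows "\<exists>P. finite P \<and> (\<forall>t\<in>{a<..<b} - P. regular_at \<gamma> t)"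
proof -
  obtain P where cont: "continuous_on {a..b} \<gamma>" and P: "finite P"
    and C: "\<And>s t. a \<le> s \<Longrightarrow> s < t \<Longrightarrow> t \<le> b \<Longrightarrow> {s<..<t} \<inter> P = {} \<Longrightarrow> C1_path_on A s t \<gamma>"
    using assms unfolding pwC1_def by auto
  have "regular_at \<gamma> t" if t: "t \<in> {a<..<b} - P" for t
  proof -
    have "open ({a<..<b} - P)" using P by (intro open_Diff) (auto intro: finite_imp_closed)
    then obtain e where e: "e > 0" "cball t e \<subseteq> {a<..<b} - P" using t open_contains_cball by blast
    have sub: "{t - e..t + e} \<subseteq> {a<..<b} - P" using e by (simp add: cball_eq_atLeastAtMost)
    moreover have "t - e \<in> {t - e..t + e}" "t + e \<in> {t - e..t + e}" "{t - e<..<t + e} \<subseteq> {t - e..t + e}" using e(1) by auto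
    ultimately have "t - e \<in> {a<..<b}" "t + e \<in> {a<..<b}" "{t - e<..<t + e} \<inter> P = {}" by blast+
    then have C1: "C1_path_on A (t - e) (t + e) \<gamma>" using e(1) by (intro C) auto
    obtain c where c: "c \<in> A" "\<gamma> t \<in> fst c" using ex_chart by blast
    have "(snd c \<circ> \<gamma>) differentiable (at t within {t - e..t + e})"
      using C1 c e(1) unfolding C1_path_on_def by auto
    then have "(snd c \<circ> \<gamma>) differentiable (at t)" using at_within_Icc_at[of "t - e" t "t + e"] e(1) by simp
    moreover have "isCont \<gamma> t" using continuous_on_interior[OF cont] t by simp
    ultimately show ?thesis using c unfolding regular_at_def by (auto simp: vector_derivative_works)
  qed
  then show ?thesis using P by blast
qed

text \<open>
  By bisection: on a small piece, speed agrees with a continuous function except at the end points.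
\<close>

lemma speed_integrable:
  assumes "pwC1 A a b \<gamma>" "\<gamma> ` {a..b} \<subseteq> S"
  shows "speed A G \<gamma> integrable_on {a..b}"
proof (cases "a \<le> b")
  case True
  show ?thesis
  proof (rule pwC1_Bolzano[OF assms(1) True])
    show "speed A G \<gamma> integrable_on {s..u}"
      if "s \<le> t" "t \<le> u" "speed A G \<gamma> integrable_on {s..t}" "speed A G \<gamma> integrable_on {t..u}" for s t u
      using Henstock_Kurzweil_Integration.integrable_combine[OF that] .
    fix x assume "x \<in> {a..b}"
    obtain c where c: "c \<in> A" "\<gamma> x \<in> fst c" using ex_chart by blast
    show "\<exists>U. open U \<and> \<gamma> x \<in> U \<and>
       (\<forall>s t. a \<le> s \<and> s \<le> t \<and> t \<le> b \<and> \<gamma> ` {s..t} \<subseteq> U \<and> (s < t \<longrightarrow> C1_path_on A s t \<gamma>) \<longrightarrow> speed A G \<gamma> integrable_on {s..t})"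
    proof (intro exI[of _ "fst c"] conjI allI impI chart_open c)
      fix s t assume st: "a \<le> s \<and> s \<le> t \<and> t \<le> b \<and> \<gamma> ` {s..t} \<subseteq> fst c \<and> (s < t \<longrightarrow> C1_path_on A s t \<gamma>)"
      show "speed A G \<gamma> integrable_on {s..t}"
      proof (cases "s < t")
        case False
        then show ?thesis using st by (metis integrable_on_refl cbox_interval order_le_less)
      next
        case True
        then have C: "C1_path_on A s t \<gamma>" and im: "\<gamma> ` {s..t} \<subseteq> fst c" using st by auto
        have imS: "\<gamma> \<tau> \<in> S" if "\<tau> \<in> {s..t}" for \<tau> using assms(2) st that by force
        obtain x' where x': "continuous_on {s..t} (snd c \<circ> \<gamma>)" "continuous_on {s..t} x'"
          and sp: "\<forall>\<tau>\<in>{s<..<t}. \<gamma> \<tau> \<in> S \<longrightarrow> speed A G \<gamma> \<tau> = sqrt (g c (snd c (\<gamma> \<tau>)) (x' \<tau>) (x' \<tau>))"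
          using chart_piece[OF C True c(1) im] by blast
        have gc: "continuous_on {s..t} (\<lambda>\<tau>. g c ((snd c \<circ> \<gamma>) \<tau>))"
          by (rule continuous_on_compose2[OF g_continuous[OF c(1)] x'(1)]) (use im imS in auto)
        have "continuous_on {s..t} (\<lambda>\<tau>. sqrt (g c ((snd c \<circ> \<gamma>) \<tau>) (x' \<tau>) (x' \<tau>)))"
          by (intro continuous_intros gc x')
        then have "(\<lambda>\<tau>. sqrt (g c ((snd c \<circ> \<gamma>) \<tau>) (x' \<tau>) (x' \<tau>))) integrable_on {s..t}"
          by (rule integrable_continuous_real)
        then show ?thesis by (rule integrable_spike_finite[of "{s, t}", rotated 2]) (use sp imS in auto)
      qed
    qed
  qed
qed (simp add: integrable_on_empty)

lemma path_length_eq_integral: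
  assumes pw: "pwC1 A 0 1 \<gamma>" and im: "\<gamma> ` {0..1} \<subseteq> S"
  shows "path_length A G \<gamma> = ennreal (integral {0..1} (speed A G \<gamma>))"
proof -
  obtain P where P: "finite P" "\<And>t. t \<in> {0<..<1} - P \<Longrightarrow> regular_at \<gamma> t" using pwC1_regular[OF pw] by blast
  define h where "h t = (if t \<in> P \<union> {0, 1} then 0 else speed A G \<gamma> t)" for t
  have fin: "finite (P \<union> {0, 1})" using P by simp
  have h: "(h has_integral integral {0..1} (speed A G \<gamma>)) {0..1}"
    by (rule has_integral_spike_finite[OF fin _ integrable_integral[OF speed_integrable[OF assms]]])
       (auto simp: h_def)
  have h0: "0 \<le> h t" if "t \<in> {0..1}" for t using that P(2) im by (auto simp: h_def intro!: speed_nonneg)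
  have "path_length A G \<gamma> = (\<integral>\<^sup>+t. ennreal (h t) \<partial>lebesgue_on {0..1})" unfolding path_length_def
  proof (rule nn_integral_cong_AE)
    have "AE t in lebesgue. t \<notin> P \<union> {0, 1}"
      using fin by (intro AE_not_in) (simp add: null_sets_completionI finite_imp_null_set_lborel)
    then have "AE t in lebesgue_on {0..1}. t \<notin> P \<union> {0, 1}"
      by (subst AE_restrict_space_iff) (auto elim: eventually_mono)
    moreover have "AE t in lebesgue_on {0..1}. t \<in> {0..1::real}" by (metis AE_space space_lebesgue_on)
    ultimately show "AE t in lebesgue_on {0..1}. ennreal (sqrt (G (\<gamma> t) (velocity A {0..1} \<gamma> t) (velocity A {0..1} \<gamma> t))) = ennreal (h t)"
    proof eventually_elim
      case (elim t)
      then have t: "t \<in> {0<..<1} - P" by auto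
      from P(2)[OF this] obtain c v where *: "isCont \<gamma> t" "c \<in> A" "\<gamma> t \<in> fst c" "((snd c \<circ> \<gamma>) has_vector_derivative v) (at t)"
        "velocity A UNIV \<gamma> t = tangent A (\<gamma> t) c v" by (rule regular_atE)
      have "velocity A {0..1} \<gamma> t = velocity A UNIV \<gamma> t"
        unfolding *(5) using t by (intro velocity_eq_tangent[OF *(2,3) _ *(1,4)]) auto
      then show ?case using elim by (simp add: h_def speed_def)
    qed
  qed
  also have "\<dots> = (\<integral>\<^sup>+t. ennreal (h t) * indicator {0..1} t \<partial>lebesgue)"
    by (subst nn_integral_restrict_space) auto
  also have "\<dots> = (\<integral>\<^sup>+t. ennreal (h t) * indicator {0..1} t \<partial>lborel)" by (rule nn_integral_completion)
  also have "\<dots> = ennreal (integral {0..1} (speed A G \<gamma>))" by (rule nn_integral_has_integral_lebesgue'[OF h0 h])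
  finally show ?thesis .
qed

lemma speed_integral_nonneg:
  assumes "pwC1 A a b \<gamma>" "\<gamma> ` {a..b} \<subseteq> S"
  shows "0 \<le> integral {a..b} (speed A G \<gamma>)"
proof -
  obtain P where P: "finite P" "\<And>t. t \<in> {a<..<b} - P \<Longrightarrow> regular_at \<gamma> t" using pwC1_regular[OF assms(1)] by blast
  define h where "h t = (if t \<in> P \<union> {a, b} then 0 else speed A G \<gamma> t)" for t
  have "(h has_integral integral {a..b} (speed A G \<gamma>)) {a..b}"
    by (rule has_integral_spike_finite[OF _ _ integrable_integral[OF speed_integrable[OF assms]], of "P \<union> {a, b}"])
       (use P in \<open>auto simp: h_def\<close>)
  then show ?thesis by (rule has_integral_nonneg) (use P(2) assms(2) in \<open>auto simp: h_def intro!: speed_nonneg\<close>)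
qed

text \<open>
  With \<open>length_affine\<close> and the joining lemmas, this frees path lengths from the parameter interval
  \<open>[0,1]\<close>.
\<close>

lemma pwC1_affine:
  assumes pw: "pwC1 A a b \<gamma>" and m: "m \<noteq> 0"
    and im: "(\<lambda>t. m * t + q) ` {a'..b'} = {a..b}"
  shows "pwC1 A a' b' (\<lambda>t. \<gamma> (m * t + q))"
proof -
  obtain P where cont: "continuous_on {a..b} \<gamma>" and P: "finite P"
    and C: "\<And>s t. a \<le> s \<Longrightarrow> s < t \<Longrightarrow> t \<le> b \<Longrightarrow> {s<..<t} \<inter> P = {} \<Longrightarrow> C1_path_on A s t \<gamma>"
    using pw unfolding pwC1_def by auto
  have ca: "continuous_on T (\<lambda>t. m * t + q)" for T by (intro continuous_intros)
  show ?thesis unfolding pwC1_def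
  proof (intro conjI exI[of _ "(\<lambda>t. m * t + q) -` P"] allI impI)
    show "continuous_on {a'..b'} (\<lambda>t. \<gamma> (m * t + q))"
      by (rule continuous_on_compose2[OF cont ca]) (use im in auto)
    show "finite ((\<lambda>t. m * t + q) -` P)" using P m by (intro finite_vimageI) (auto simp: inj_def)
    fix s t assume st: "a' \<le> s \<and> s < t \<and> t \<le> b' \<and> {s<..<t} \<inter> (\<lambda>t. m * t + q) -` P = {}"
    have "(\<lambda>t. m * t + q) s \<in> {a..b}" "(\<lambda>t. m * t + q) t \<in> {a..b}"
      unfolding im[symmetric] by (rule imageI; use st in auto)+
    then have in_ab: "m * s + q \<in> {a..b}" "m * t + q \<in> {a..b}" by simp_all
    define lo hi where "lo = min (m * s + q) (m * t + q)" and "hi = max (m * s + q) (m * t + q)"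
    have lohi: "lo < hi" "a \<le> lo" "hi \<le> b" using in_ab st m by (auto simp: lo_def hi_def min_def max_def)
    have img: "(\<lambda>t. m * t + q) ` {s..t} = {lo..hi}"
    proof (cases "m > 0")
      case True
      then have "m * s \<le> m * t" using st by (intro mult_left_mono) auto
      then show ?thesis using st True image_affinity_atLeastAtMost[of m q s t] by (auto simp: lo_def hi_def)
    next
      case False
      then have "m * t \<le> m * s" using st m by (intro mult_left_mono_neg) auto
      then show ?thesis using st False image_affinity_atLeastAtMost[of m q s t] by (auto simp: lo_def hi_def)
    qed
    have "{lo<..<hi} \<inter> P = {}"
    proof (rule ccontr)
      assume "{lo<..<hi} \<inter> P \<noteq> {}"
      then obtain y where y: "y \<in> {lo<..<hi}" "y \<in> P" by blast
      then have "y \<in> (\<lambda>t. m * t + q) ` {s..t}" using img by auto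
      then obtain \<tau> where \<tau>: "\<tau> \<in> {s..t}" "y = m * \<tau> + q" by auto
      then have "\<tau> \<noteq> s" "\<tau> \<noteq> t" using y by (auto simp: lo_def hi_def)
      then have "\<tau> \<in> {s<..<t}" "\<tau> \<in> (\<lambda>t. m * t + q) -` P" using \<tau> y by auto
      then show False using st by blast
    qed
    from C1_path_on_affine[OF C[OF lohi(2,1,3) this] lohi(1) m img]
    show "C1_path_on A s t (\<lambda>t. \<gamma> (m * t + q))" .
  qed
qed

lemma speed_affine:
  assumes reg: "regular_at \<gamma> (m * t + q)" and S: "\<gamma> (m * t + q) \<in> S"
  shows "speed A G (\<lambda>t. \<gamma> (m * t + q)) t = \<bar>m\<bar> * speed A G \<gamma> (m * t + q)"
proof -
  obtain c v where *: "isCont \<gamma> (m * t + q)" "c \<in> A" "\<gamma> (m * t + q) \<in> fst c" "((snd c \<circ> \<gamma>) has_vector_derivative v) (at (m * t + q))"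
    and sp: "speed A G \<gamma> (m * t + q) = sqrt (g c (snd c (\<gamma> (m * t + q))) v v)"
    using reg S by (auto elim!: regular_atE)
  have "((\<lambda>t. m * t + q) has_vector_derivative m) (at t)" by (auto intro!: derivative_eq_intros)
  from vector_diff_chain_at[OF this *(4)]
  have d: "((snd c \<circ> (\<lambda>t. \<gamma> (m * t + q))) has_vector_derivative m *\<^sub>R v) (at t)" by (simp add: o_def)
  have "isCont (\<lambda>t. m * t + q) t" by (intro continuous_intros)
  then have ic: "isCont (\<lambda>t. \<gamma> (m * t + q)) t" using *(1) by (rule isCont_o2)
  have "velocity A UNIV (\<lambda>t. \<gamma> (m * t + q)) t = tangent A (\<gamma> (m * t + q)) c (m *\<^sub>R v)"
    using velocity_eq_tangent[where \<gamma>="\<lambda>t. \<gamma> (m * t + q)", OF *(2) *(3) _ ic d, of UNIV] by simp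
  then have "speed A G (\<lambda>t. \<gamma> (m * t + q)) t = sqrt (g c (snd c (\<gamma> (m * t + q))) (m *\<^sub>R v) (m *\<^sub>R v))"
    by (simp add: speed_def G_eq_g[OF *(2,3) S])
  also have "\<dots> = \<bar>m\<bar> * sqrt (g c (snd c (\<gamma> (m * t + q))) v v)"
    by (simp add: blinfun.bilinear_simps real_sqrt_mult mult.assoc[symmetric])
  finally show ?thesis using sp by simp
qed

lemma length_affine:
  assumes pw: "pwC1 A a b \<gamma>" and imS: "\<gamma> ` {a..b} \<subseteq> S" and m: "m \<noteq> 0"
    and im: "(\<lambda>t. m * t + q) ` {a'..b'} = {a..b}"
  shows "integral {a'..b'} (speed A G (\<lambda>t. \<gamma> (m * t + q))) = integral {a..b} (speed A G \<gamma>)"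
proof -
  obtain P where P: "finite P" "\<And>t. t \<in> {a<..<b} - P \<Longrightarrow> regular_at \<gamma> t" using pwC1_regular[OF pw] by blast
  define I where "I = integral {a..b} (speed A G \<gamma>)"
  have "(speed A G \<gamma> has_integral I) (cbox a b)"
    unfolding I_def using speed_integrable[OF pw imS] by (simp add: integrable_integral)
  from has_integral_affinity[OF this m, of q]
  have 1: "((\<lambda>t. speed A G \<gamma> (m * t + q)) has_integral I / \<bar>m\<bar>) ((\<lambda>x. 1 / m * x + - (1 / m * q)) ` {a..b})"
    by simp
  have "(\<lambda>x. 1 / m * x + - (1 / m * q)) ` {a..b} = {a'..b'}"
    unfolding im[symmetric] image_image using m by (simp add: field_simps)
  with 1 have "((\<lambda>t. speed A G \<gamma> (m * t + q)) has_integral I / \<bar>m\<bar>) {a'..b'}" by simp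
  from has_integral_mult_right[OF this, of "\<bar>m\<bar>"] m
  have 2: "((\<lambda>t. \<bar>m\<bar> * speed A G \<gamma> (m * t + q)) has_integral I) {a'..b'}" by simp
  have "(speed A G (\<lambda>t. \<gamma> (m * t + q)) has_integral I) {a'..b'}"
  proof (rule has_integral_spike_finite[OF _ _ 2, of "(\<lambda>t. m * t + q) -` (P \<union> {a, b})"])
    show "finite ((\<lambda>t. m * t + q) -` (P \<union> {a, b}))" using P m by (intro finite_vimageI) (auto simp: inj_def)
    fix t assume t: "t \<in> {a'..b'} - (\<lambda>t. m * t + q) -` (P \<union> {a, b})"
    have "(\<lambda>t. m * t + q) t \<in> {a..b}" unfolding im[symmetric] by (rule imageI) (use t in auto)
    then have "m * t + q \<in> {a..b}" by simp
    moreover from this have "m * t + q \<in> {a<..<b} - P" using t by auto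
    ultimately show "speed A G (\<lambda>t. \<gamma> (m * t + q)) t = \<bar>m\<bar> * speed A G \<gamma> (m * t + q)"
      using P(2) imS by (intro speed_affine) auto
  qed
  then show ?thesis unfolding I_def by (rule integral_unique)
qed

lemma pwC1_join:
  assumes 1: "pwC1 A a b \<gamma>" and 2: "pwC1 A b c \<eta>" and eq: "\<gamma> b = \<eta> b" and abc: "a \<le> b" "b \<le> c"
  shows "pwC1 A a c (\<lambda>t. if t \<le> b then \<gamma> t else \<eta> t)"
proof -
  let ?z = "\<lambda>t. if t \<le> b then \<gamma> t else \<eta> t"
  obtain P where c1: "continuous_on {a..b} \<gamma>" and P: "finite P"
    and C1: "\<And>s t. a \<le> s \<Longrightarrow> s < t \<Longrightarrow> t \<le> b \<Longrightarrow> {s<..<t} \<inter> P = {} \<Longrightarrow> C1_path_on A s t \<gamma>"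
    using 1 unfolding pwC1_def by auto
  obtain Q where c2: "continuous_on {b..c} \<eta>" and Q: "finite Q"
    and C2: "\<And>s t. b \<le> s \<Longrightarrow> s < t \<Longrightarrow> t \<le> c \<Longrightarrow> {s<..<t} \<inter> Q = {} \<Longrightarrow> C1_path_on A s t \<eta>"
    using 2 unfolding pwC1_def by auto
  have "continuous_on ({a..b} \<union> {b..c}) ?z" by (rule continuous_on_If) (use c1 c2 eq in \<open>auto\<close>)
  then have cz: "continuous_on {a..c} ?z" using abc by (simp add: ivl_disj_un_two_touch)
  show ?thesis unfolding pwC1_def
  proof (intro conjI exI[of _ "P \<union> Q \<union> {b}"] allI impI cz)
    fix s t assume st: "a \<le> s \<and> s < t \<and> t \<le> c \<and> {s<..<t} \<inter> (P \<union> Q \<union> {b}) = {}"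
    then have "b \<notin> {s<..<t}" by blast
    then consider "t \<le> b" | "b \<le> s" using st by fastforce
    then show "C1_path_on A s t ?z"
    proof cases
      case 1
      then show ?thesis by (intro C1_path_on_cong[OF _ C1]) (use st in auto)
    next
      case 2
      have "\<eta> u = ?z u" if "u \<in> {s..t}" for u using 2 eq that by (cases "u = b") auto
      then show ?thesis by (rule C1_path_on_cong[OF _ C2]) (use 2 st in auto)
    qed
  qed (use P Q in auto)
qed

lemma length_join:
  assumes 1: "pwC1 A a b \<gamma>" "\<gamma> ` {a..b} \<subseteq> S" and 2: "pwC1 A b c \<eta>" "\<eta> ` {b..c} \<subseteq> S"
    and abc: "a \<le> b" "b \<le> c"
  shows "integral {a..c} (speed A G (\<lambda>t. if t \<le> b then \<gamma> t else \<eta> t)) =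
    integral {a..b} (speed A G \<gamma>) + integral {b..c} (speed A G \<eta>)"
proof -
  let ?z = "\<lambda>t. if t \<le> b then \<gamma> t else \<eta> t"
  have s1: "speed A G ?z t = speed A G \<gamma> t" if "t < b" for t
    unfolding speed_def using that velocity_cong_near[of "{..<b}" t ?z \<gamma>] by simp
  have s2: "speed A G ?z t = speed A G \<eta> t" if "b < t" for t
    unfolding speed_def using that velocity_cong_near[of "{b<..}" t ?z \<eta>] by simp
  have "(speed A G ?z has_integral integral {a..b} (speed A G \<gamma>)) {a..b}"
    by (rule has_integral_spike_finite[OF _ _ integrable_integral[OF speed_integrable[OF 1]], of "{b}"])
       (use s1 in auto)
  moreover have "(speed A G ?z has_integral integral {b..c} (speed A G \<eta>)) {b..c}"
    by (rule has_integral_spike_finite[OF _ _ integrable_integral[OF speed_integrable[OF 2]], of "{b}"])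
       (use s2 in auto)
  ultimately show ?thesis using has_integral_combine[OF abc] by (metis integral_unique)
qed

lemma pwC1_subset:
  assumes "pwC1 A a b \<gamma>" "a \<le> a'" "b' \<le> b"
  shows "pwC1 A a' b' \<gamma>"
proof -
  obtain P where P: "continuous_on {a..b} \<gamma>" "finite P"
    "\<forall>s t. a \<le> s \<and> s < t \<and> t \<le> b \<and> {s<..<t} \<inter> P = {} \<longrightarrow> C1_path_on A s t \<gamma>"
    using assms(1) unfolding pwC1_def by blast
  show ?thesis unfolding pwC1_def
    using continuous_on_subset[OF P(1), of "{a'..b'}"] P(2,3) assms(2,3) by (intro conjI exI[of _ P]) auto
qed

lemma dist_le_length:
  assumes pw: "pwC1 A a b \<gamma>" and im: "\<gamma> ` {a..b} \<subseteq> S" and ab: "a < b"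
  shows "dist\<^sub>G (\<gamma> a) (\<gamma> b) \<le> ennreal (integral {a..b} (speed A G \<gamma>))"
proof -
  have img: "(\<lambda>t. (b - a) * t + a) ` {0..1} = {a..b}"
    using ab image_affinity_atLeastAtMost[of "b - a" a 0 1] by auto
  have m: "b - a \<noteq> 0" using ab by simp
  let ?\<eta> = "\<lambda>t. \<gamma> ((b - a) * t + a)"
  have pw': "pwC1 A 0 1 ?\<eta>" by (rule pwC1_affine[OF pw m img])
  have im': "?\<eta> ` {0..1} \<subseteq> S" using im img by blast
  have "dist\<^sub>G (\<gamma> a) (\<gamma> b) \<le> path_length A G ?\<eta>" unfolding geodesic_dist_def
    by (rule Inf_lower) (use pw' im' in \<open>auto simp: piecewise_C1_path_eq_pwC1 intro!: exI[of _ ?\<eta>]\<close>)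
  also have "\<dots> = ennreal (integral {a..b} (speed A G \<gamma>))"
    unfolding path_length_eq_integral[OF pw' im'] length_affine[OF pw im m img] ..
  finally show ?thesis .
qed

lemma dist_lessE:
  assumes "dist\<^sub>G x y < ennreal r"
  obtains \<gamma> where "pwC1 A 0 1 \<gamma>" "\<gamma> ` {0..1} \<subseteq> S" "\<gamma> 0 = x" "\<gamma> 1 = y" "integral {0..1} (speed A G \<gamma>) < r"
proof -
  obtain \<gamma> where \<gamma>: "pwC1 A 0 1 \<gamma>" "\<gamma> ` {0..1} \<subseteq> S" "\<gamma> 0 = x" "\<gamma> 1 = y" "path_length A G \<gamma> < ennreal r"
    using assms unfolding geodesic_dist_def Inf_less_iff piecewise_C1_path_eq_pwC1 by blast
  show ?thesis using \<gamma> by (intro that[OF \<gamma>(1-4)])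
      (auto simp: path_length_eq_integral[OF \<gamma>(1,2)] ennreal_less_iff speed_integral_nonneg)
qed

lemma dist_sym_le: "dist\<^sub>G x y \<le> dist\<^sub>G y x"
proof (rule ccontr)
  assume "\<not> dist\<^sub>G x y \<le> dist\<^sub>G y x"
  then have "dist\<^sub>G y x < dist\<^sub>G x y" by simp
  then obtain r where r: "dist\<^sub>G y x < ennreal r" "ennreal r < dist\<^sub>G x y"
    by (metis ennreal_cases ennreal_less_top dense leD less_imp_le not_less_iff_gr_or_eq top.not_eq_extremum)
  obtain \<gamma> where \<gamma>: "pwC1 A 0 1 \<gamma>" "\<gamma> ` {0..1} \<subseteq> S" "\<gamma> 0 = y" "\<gamma> 1 = x" "integral {0..1} (speed A G \<gamma>) < r"
    using dist_lessE[OF r(1)] .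
  have img: "(\<lambda>t. - 1 * t + 1) ` {0..1} = {0..1::real}"
    using image_affinity_atLeastAtMost[of "-1" 1 0 "1::real"] by auto
  have m: "-1 \<noteq> (0::real)" by simp
  have "dist\<^sub>G x y \<le> ennreal (integral {0..1} (speed A G (\<lambda>t. \<gamma> (-1 * t + 1))))"
    using dist_le_length[OF pwC1_affine[OF \<gamma>(1) m img] _ zero_less_one] \<gamma>(2,3,4) img by force
  also have "\<dots> = ennreal (integral {0..1} (speed A G \<gamma>))" using length_affine[OF \<gamma>(1,2) m img] by simp
  also have "\<dots> \<le> ennreal r" using \<gamma>(5) by (intro ennreal_leI) simp
  finally show False using r(2) by simp
qed

lemma dist_commute: "dist\<^sub>G x y = dist\<^sub>G y x" by (intro antisym dist_sym_le)

text \<open>Join almost minimal paths.\<close>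

lemma dist_triangle: "dist\<^sub>G x z \<le> dist\<^sub>G x y + dist\<^sub>G y z"
proof (rule ccontr)
  assume "\<not> dist\<^sub>G x z \<le> dist\<^sub>G x y + dist\<^sub>G y z"
  then have lt: "dist\<^sub>G x y + dist\<^sub>G y z < dist\<^sub>G x z" by simp
  then have "dist\<^sub>G x y + dist\<^sub>G y z < top" using top.not_eq_extremum by fastforce
  then obtain r1 r2 where r12: "dist\<^sub>G x y = ennreal r1" "dist\<^sub>G y z = ennreal r2" "0 \<le> r1" "0 \<le> r2"
    by (metis ennreal_add_eq_top ennreal_cases less_irrefl)
  then have lt': "ennreal (r1 + r2) < dist\<^sub>G x z" using lt by simp
  then obtain r where r: "ennreal (r1 + r2) < ennreal r" "ennreal r < dist\<^sub>G x z"
    by (metis ennreal_cases dense less_irrefl top_greatest leD)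
  have r': "r1 + r2 < r" using r(1) r12(3,4) by (simp only: ennreal_less_iff[OF add_nonneg_nonneg])
  define e where "e = (r - (r1 + r2)) / 2"
  have e: "e > 0" using r' by (simp add: e_def)
  have "dist\<^sub>G x y < ennreal (r1 + e)" "dist\<^sub>G y z < ennreal (r2 + e)"
    using r12 e by (auto simp: ennreal_less_iff)
  then obtain \<gamma> \<eta> where \<gamma>: "pwC1 A 0 1 \<gamma>" "\<gamma> ` {0..1} \<subseteq> S" "\<gamma> 0 = x" "\<gamma> 1 = y" "integral {0..1} (speed A G \<gamma>) < r1 + e"
    and \<eta>: "pwC1 A 0 1 \<eta>" "\<eta> ` {0..1} \<subseteq> S" "\<eta> 0 = y" "\<eta> 1 = z" "integral {0..1} (speed A G \<eta>) < r2 + e"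
    by (auto elim!: dist_lessE)
  have img: "(\<lambda>t. 1 * t + - 1) ` {1..2} = {0..1::real}"
    using image_affinity_atLeastAtMost[of 1 "-1" 1 "2::real"] by auto
  have m: "1 \<noteq> (0::real)" by simp
  define \<eta>' where "\<eta>' t = \<eta> (1 * t + - 1)" for t
  have \<eta>': "pwC1 A 1 2 \<eta>'" "\<eta>' ` {1..2} \<subseteq> S" "integral {1..2} (speed A G \<eta>') = integral {0..1} (speed A G \<eta>)" "\<eta>' 1 = y" "\<eta>' 2 = z"
    unfolding \<eta>'_def using pwC1_affine[OF \<eta>(1) m img] \<eta>(2-4) img length_affine[OF \<eta>(1,2) m img] by force+
  let ?z = "\<lambda>t. if t \<le> 1 then \<gamma> t else \<eta>' t"
  have "pwC1 A 0 2 ?z" by (rule pwC1_join[OF \<gamma>(1) \<eta>'(1)]) (use \<gamma> \<eta>' in auto)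
  moreover have "?z ` {0..2} \<subseteq> S" using \<gamma>(2) \<eta>'(2) by fastforce
  ultimately have "dist\<^sub>G (?z 0) (?z 2) \<le> ennreal (integral {0..2} (speed A G ?z))"
    by (rule dist_le_length) simp
  also have "integral {0..2} (speed A G ?z) = integral {0..1} (speed A G \<gamma>) + integral {1..2} (speed A G \<eta>')"
    by (rule length_join[OF \<gamma>(1,2) \<eta>'(1,2)]) auto
  also have "ennreal \<dots> \<le> ennreal r" using \<gamma>(5) \<eta>(5) \<eta>'(3) by (intro ennreal_leI) (simp add: e_def field_simps)
  finally show False using r(2) \<gamma>(3) \<eta>'(5) by simp
qed

end

section \<open>The geodesic distance in charts and metric completeness\<close>

lemma integral_le_finite_exceptions:
  fixes f h :: "real \<Rightarrow> real"
  assumes f: "f integrable_on {a..b}" and h: "h integrable_on {a..b}" and P: "finite P"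
    and le: "\<And>x. x \<in> {a..b} - P \<Longrightarrow> f x \<le> h x"
  shows "integral {a..b} f \<le> integral {a..b} h"
proof -
  define f0 where "f0 x = (if x \<in> P then h x else f x)" for x
  have "(f0 has_integral integral {a..b} f) {a..b}"
    by (rule has_integral_spike_finite[OF P _ integrable_integral[OF f]]) (auto simp: f0_def)
  then show ?thesis by (rule has_integral_le[OF _ integrable_integral[OF h]]) (auto simp: f0_def le)
qed

lemma ennreal_tendsto_0_iff:
  fixes f :: "'a \<Rightarrow> ennreal"
  shows "(f \<longlongrightarrow> 0) F \<longleftrightarrow> (\<forall>e>0. eventually (\<lambda>x. f x < ennreal e) F)"
proof
  assume "(f \<longlongrightarrow> 0) F"
  then show "\<forall>e>0. eventually (\<lambda>x. f x < ennreal e) F" by (auto intro: order_tendstoD)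
next
  assume e: "\<forall>e>0. eventually (\<lambda>x. f x < ennreal e) F"
  show "(f \<longlongrightarrow> 0) F"
  proof (rule order_tendstoI)
    fix a :: ennreal assume "0 < a"
    then obtain b where b: "0 < b" "b < a" using dense by blast
    then obtain r where "b = ennreal r" "r > 0" by (cases b) auto
    then have "eventually (\<lambda>x. f x < b) F" using e by simp
    then show "eventually (\<lambda>x. f x < a) F" by (rule eventually_mono) (use b in auto)
  qed simp
qed

context atlas
begin

text \<open>
  A curve that is \<open>C\<^sup>1\<close> in one chart is \<open>C\<^sup>1\<close> in all charts, because transition
  maps are.
\<close>

lemma C1_path_in_chart:
  assumes c: "c \<in> A" and ab: "a < b" and u: "\<And>t. t \<in> {a..b} \<Longrightarrow> u t \<in> snd c ` fst c"
    and du: "\<And>t. t \<in> {a..b} \<Longrightarrow> (u has_vector_derivative u' t) (at t within {a..b})"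
    and u': "continuous_on {a..b} u'"
  shows "C1_path_on A a b (\<lambda>t. chart_inv c (u t))"
proof -
  have cu: "continuous_on {a..b} u"
    by (auto intro: has_vector_derivative_continuous du simp: continuous_on_eq_continuous_within)
  show ?thesis unfolding C1_path_on_def
  proof (intro conjI ballI)
    show "continuous_on {a..b} (\<lambda>t. chart_inv c (u t))"
      by (rule continuous_on_compose2[OF chart_inv_continuous[OF c] cu]) (use u in auto)
    fix d assume d: "d \<in> A"
    have o: "open (snd c ` (fst c \<inter> fst d))" by (rule chart_image_of_open[OF c chart_open[OF d]])
    obtain f1 :: "'e \<Rightarrow> 'e \<Rightarrow>\<^sub>L 'e" and f2 :: "'e \<Rightarrow> 'e \<Rightarrow>\<^sub>L 'e \<Rightarrow>\<^sub>L 'e"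
      where f1: "\<And>p. p \<in> snd c ` (fst c \<inter> fst d) \<Longrightarrow> ((snd d \<circ> chart_inv c) has_derivative f1 p) (at p)"
        and f2: "\<And>p. p \<in> snd c ` (fst c \<inter> fst d) \<Longrightarrow> (f1 has_derivative f2 p) (at p)"
      using smooth_map_on_C2[OF transition_smooth[OF c d] o] by metis
    have cf1: "continuous_on (snd c ` (fst c \<inter> fst d)) f1"
      using f2 by (metis continuous_at_imp_continuous_on has_derivative_continuous)
    have ind: "u t \<in> snd c ` (fst c \<inter> fst d)" if "t \<in> {a..b}" "chart_inv c (u t) \<in> fst d" for t
      using u[OF that(1)] that(2) chart_inv_in[OF c] chart_chart_inv[OF c] by (metis IntI image_eqI)
    have vd: "((snd d \<circ> (\<lambda>t. chart_inv c (u t))) has_vector_derivative f1 (u t) (u' t)) (at t within {a..b})"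
      if "t \<in> {a..b}" "chart_inv c (u t) \<in> fst d" for t
      using vector_derivative_diff_chain_within[OF du[OF that(1)] has_derivative_at_withinI[OF f1[OF ind[OF that]]]]
      by (simp add: o_def)
    show "chart_inv c (u t) \<in> fst d \<longrightarrow> (snd d \<circ> (\<lambda>t. chart_inv c (u t))) differentiable at t within {a..b}"
      if "t \<in> {a..b}" for t using differentiableI_vector[OF vd[OF that]] by blast
    have "continuous_on {t \<in> {a..b}. chart_inv c (u t) \<in> fst d} (\<lambda>t. f1 (u t) (u' t))"
      by (intro continuous_intros continuous_on_compose2[OF cf1] continuous_on_subset[OF cu] continuous_on_subset[OF u'])
         (use ind in auto)
    then show "continuous_on {t \<in> {a..b}. chart_inv c (u t) \<in> fst d}
       (\<lambda>t. vector_derivative (snd d \<circ> (\<lambda>t. chart_inv c (u t))) (at t within {a..b}))"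
    proof (rule continuous_on_eq)
      fix t assume "t \<in> {t \<in> {a..b}. chart_inv c (u t) \<in> fst d}"
      then have t: "t \<in> {a..b}" "chart_inv c (u t) \<in> fst d" by auto
      show "f1 (u t) (u' t) = vector_derivative (snd d \<circ> (\<lambda>t. chart_inv c (u t))) (at t within {a..b})"
        using vector_derivative_within_cbox[OF ab, of t, unfolded cbox_interval, OF t(1) vd[OF t]] by simp
    qed
  qed
qed

end

context strong_riem
begin

lemma regular_in_chart:
  assumes reg: "regular_at \<gamma> t" and c: "c \<in> A" "\<gamma> t \<in> fst c"
  shows "\<exists>v. ((snd c \<circ> \<gamma>) has_vector_derivative v) (at t) \<and> velocity A UNIV \<gamma> t = tangent A (\<gamma> t) c v \<and>
    (\<gamma> t \<in> S \<longrightarrow> speed A G \<gamma> t = sqrt (g c (snd c (\<gamma> t)) v v))"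
proof -
  obtain d w where *: "isCont \<gamma> t" "d \<in> A" "\<gamma> t \<in> fst d" "((snd d \<circ> \<gamma>) has_vector_derivative w) (at t)"
    using reg unfolding regular_at_def by blast
  obtain v where v: "((snd c \<circ> \<gamma>) has_vector_derivative v) (at t)"
    using path_in_other_chart[OF *(2) c(1) *(3) c(2) *(1,4)] by blast
  have "velocity A UNIV \<gamma> t = tangent A (\<gamma> t) c v" by (rule velocity_eq_tangent[OF c _ *(1) v]) simp
  then show ?thesis using v by (auto simp: speed_def G_eq_g[OF c])
qed

lemma length_combine:
  assumes "pwC1 A a b \<gamma>" "\<gamma> ` {a..b} \<subseteq> S" "t \<in> {a..b}"
  shows "integral {a..b} (speed A G \<gamma>) = integral {a..t} (speed A G \<gamma>) + integral {t..b} (speed A G \<gamma>)"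
  using Henstock_Kurzweil_Integration.integral_combine[of a t b "speed A G \<gamma>"] speed_integrable[OF assms(1,2)] assms(3) by simp

lemma length_mono:
  assumes "pwC1 A a b \<gamma>" "\<gamma> ` {a..b} \<subseteq> S" "t \<in> {a..b}"
  shows "integral {a..t} (speed A G \<gamma>) \<le> integral {a..b} (speed A G \<gamma>)"
proof -
  have "0 \<le> integral {t..b} (speed A G \<gamma>)"
    by (rule speed_integral_nonneg[OF pwC1_subset[OF assms(1)]]) (use assms in auto)
  then show ?thesis using length_combine[OF assms] by simp
qed

lemma chart_length_bound:
  assumes c: "c \<in> A" and k: "k > 0"
    and low: "\<And>q v. q \<in> V \<Longrightarrow> k * norm v \<le> sqrt (g c q v v)"
    and pw: "pwC1 A a b \<gamma>" and ab: "a \<le> b" and im: "\<gamma> ` {a..b} \<subseteq> S"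
    and V: "\<And>t. t \<in> {a..b} \<Longrightarrow> \<gamma> t \<in> fst c \<and> snd c (\<gamma> t) \<in> V"
  shows "k * norm (snd c (\<gamma> b) - snd c (\<gamma> a)) \<le> integral {a..b} (speed A G \<gamma>)"
proof -
  obtain P where P: "finite P" "\<And>t. t \<in> {a<..<b} - P \<Longrightarrow> regular_at \<gamma> t" using pwC1_regular[OF pw] by blast
  have "\<exists>v. t \<in> {a<..<b} - P \<longrightarrow> ((snd c \<circ> \<gamma>) has_vector_derivative v) (at t) \<and> speed A G \<gamma> t = sqrt (g c (snd c (\<gamma> t)) v v)" for t
    using regular_in_chart[OF P(2) c] V im by (metis DiffD1 atLeastAtMost_iff greaterThanLessThan_iff image_subset_iff order_less_imp_le)
  then obtain x' where x': "\<And>t. t \<in> {a<..<b} - P \<Longrightarrow> ((snd c \<circ> \<gamma>) has_vector_derivative x' t) (at t)"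
    "\<And>t. t \<in> {a<..<b} - P \<Longrightarrow> speed A G \<gamma> t = sqrt (g c (snd c (\<gamma> t)) (x' t) (x' t))" by metis
  have cg: "continuous_on {a..b} \<gamma>" using pw by (simp add: pwC1_def)
  have cx: "continuous_on {a..b} (snd c \<circ> \<gamma>)"
    by (rule continuous_on_compose[OF cg continuous_on_subset[OF chart_continuous[OF c]]]) (use V in auto)
  have "norm ((snd c \<circ> \<gamma>) b - (snd c \<circ> \<gamma>) a) \<le> integral {a..b} (\<lambda>t. speed A G \<gamma> t * (1 / k))"
  proof (rule norm_increment_le_integral[OF ab P(1) cx x'(1)])
    fix t assume t: "t \<in> {a<..<b} - P"
    then have "k * norm (x' t) \<le> speed A G \<gamma> t" unfolding x'(2)[OF t] using V by (intro low) auto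
    then show "norm (x' t) \<le> speed A G \<gamma> t * (1 / k)" using k by (simp add: field_simps)
  next
    show "(\<lambda>t. speed A G \<gamma> t * (1 / k)) integrable_on {a..b}"
      by (rule integrable_on_mult_left[OF speed_integrable[OF pw im]])
  qed
  then show ?thesis using k by (simp add: field_simps)
qed

text \<open>
  A path of length less than \<open>k r\<close> cannot reach the boundary of the ball of radius \<open>r\<close>. At
  the supremum of the times up to which the path is known to stay inside, its chart coordinates have a limit in the
  open ball; as \<open>'m\<close> is Hausdorff, the path has its value there, so it also stays inside for a while
  after.
\<close>

lemma stay_in_chart:
  assumes c: "c \<in> A" and x: "x \<in> fst c" and k: "k > 0" and r: "ball (snd c x) r \<subseteq> cdom c"
    and low: "\<And>q v. q \<in> ball (snd c x) r \<Longrightarrow> k * norm v \<le> sqrt (g c q v v)"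
    and pw: "pwC1 A a b \<gamma>" and ab: "a \<le> b" and im: "\<gamma> ` {a..b} \<subseteq> S" and \<gamma>a: "\<gamma> a = x"
    and len: "integral {a..b} (speed A G \<gamma>) < k * r"
  shows "\<gamma> b \<in> fst c \<and> snd c (\<gamma> b) \<in> ball (snd c x) r \<and>
    k * norm (snd c (\<gamma> b) - snd c x) \<le> integral {a..b} (speed A G \<gamma>)"
proof -
  define W where "W = fst c \<inter> snd c -` ball (snd c x) r"
  have oW: "open W" unfolding W_def by (rule chart_preimage_open[OF c open_ball])
  define \<Lambda> where "\<Lambda> t = integral {a..t} (speed A G \<gamma>)" for t
  have \<Lambda>le: "\<Lambda> t \<le> \<Lambda> b" if "t \<in> {a..b}" for t unfolding \<Lambda>_def by (rule length_mono[OF pw im that])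
  have \<Lambda>c: "continuous_on {a..b} \<Lambda>" unfolding \<Lambda>_def
    by (rule indefinite_integral_continuous_1[OF speed_integrable[OF pw im]])
  have cont: "continuous_on {a..b} \<gamma>" using pw by (simp add: pwC1_def)
  have "0 \<le> \<Lambda> b" unfolding \<Lambda>_def by (rule speed_integral_nonneg[OF pw im])
  then have r0: "r > 0" using len k unfolding \<Lambda>_def by (smt (verit) zero_less_mult_pos)
  have bound: "k * norm (snd c (\<gamma> v) - snd c (\<gamma> u)) \<le> \<Lambda> v - \<Lambda> u"
    if uv: "a \<le> u" "u \<le> v" "v \<le> b" and Wuv: "\<gamma> ` {u..v} \<subseteq> W" for u v
  proof -
    have "k * norm (snd c (\<gamma> v) - snd c (\<gamma> u)) \<le> integral {u..v} (speed A G \<gamma>)"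
    proof (rule chart_length_bound[OF c k low pwC1_subset[OF pw]])
      show "\<gamma> ` {u..v} \<subseteq> S" using im uv by (auto simp: image_subset_iff)
      show "\<gamma> t \<in> fst c \<and> snd c (\<gamma> t) \<in> ball (snd c x) r" if "t \<in> {u..v}" for t
        using Wuv that unfolding W_def by blast
    qed (use uv in auto)
    moreover have "\<Lambda> v = \<Lambda> u + integral {u..v} (speed A G \<gamma>)"
      unfolding \<Lambda>_def by (rule length_combine[OF pwC1_subset[OF pw]]) (use uv im in \<open>auto simp: image_subset_iff\<close>)
    ultimately show ?thesis by simp
  qed
  define T where "T = {t \<in> {a..b}. \<gamma> ` {a..t} \<subseteq> W}"
  have aT: "a \<in> T" using ab x \<gamma>a r0 by (auto simp: T_def W_def)
  have bdd: "bdd_above T" by (auto simp: T_def intro: bdd_aboveI)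
  define s where "s = Sup T"
  have s: "a \<le> s" "s \<le> b"
  proof -
    show "a \<le> s" unfolding s_def by (rule cSup_upper[OF aT bdd])
    show "s \<le> b" unfolding s_def by (rule cSup_least) (use aT in \<open>auto simp: T_def\<close>)
  qed
  have inW: "\<gamma> u \<in> W" if u: "a \<le> u" "u < s" for u
  proof -
    have "\<exists>t\<in>T. u < t" using u aT bdd unfolding s_def by (subst (asm) less_cSup_iff) auto
    then show ?thesis using u by (auto simp: T_def)
  qed
  have sW: "\<gamma> s \<in> W"
  proof (cases "s = a")
    case True then show ?thesis using x \<gamma>a r0 by (auto simp: W_def)
  next
    case False
    then have as: "a < s" using s by simp
    define u where "u n = s - (s - a) / (real n + 2)" for n
    have u: "a \<le> u n" "u n < s" for n
    proof -
      have "(s - a) / (real n + 2) \<le> (s - a) / 1" using as by (intro divide_left_mono) auto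
      then show "a \<le> u n" by (simp add: u_def)
      show "u n < s" using as by (simp add: u_def)
    qed
    have uab: "u n \<in> {a..b}" for n using u[of n] s by auto
    have ul: "u \<longlonglongrightarrow> s"
    proof -
      have "(\<lambda>n. s - (s - a) * inverse (real (n + 2))) \<longlonglongrightarrow> s - (s - a) * 0"
        by (intro tendsto_intros LIMSEQ_ignore_initial_segment[OF lim_inverse_n])
      then show ?thesis by (simp add: u_def[abs_def] divide_inverse add.commute)
    qed
    define q where "q n = snd c (\<gamma> (u n))" for n
    have qb: "k * norm (q m - q n) \<le> \<bar>\<Lambda> (u m) - \<Lambda> (u n)\<bar>" for m n
    proof -
      have *: "k * norm (q m - q n) \<le> \<bar>\<Lambda> (u m) - \<Lambda> (u n)\<bar>" if "u n \<le> u m" for m n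
      proof -
        have "\<gamma> ` {u n..u m} \<subseteq> W" using u[of n] u[of m] by (auto intro!: inW)
        from bound[OF u(1) that _ this] show ?thesis using uab[of m] by (simp add: q_def)
      qed
      show ?thesis using *[of n m] *[of m n] by (cases "u n \<le> u m") (auto simp: norm_minus_commute abs_minus_commute)
    qed
    have \<Lambda>l: "(\<lambda>n. \<Lambda> (u n)) \<longlonglongrightarrow> \<Lambda> s" using continuous_on_tendsto_compose[OF \<Lambda>c ul] s uab by auto
    have "Cauchy q"
    proof (rule metric_CauchyI)
      fix e :: real assume "0 < e"
      then obtain N where N: "\<And>m n. m \<ge> N \<Longrightarrow> n \<ge> N \<Longrightarrow> dist (\<Lambda> (u m)) (\<Lambda> (u n)) < k * e"
        using LIMSEQ_imp_Cauchy[OF \<Lambda>l] k unfolding Cauchy_def by (meson mult_pos_pos)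
      have "dist (q m) (q n) < e" if "m \<ge> N" "n \<ge> N" for m n
      proof -
        have "k * norm (q m - q n) < k * e" using qb[of m n] N[OF that] by (simp add: dist_real_def)
        then show ?thesis using k by (simp add: dist_norm)
      qed
      then show "\<exists>N. \<forall>m\<ge>N. \<forall>n\<ge>N. dist (q m) (q n) < e" by blast
    qed
    then obtain y where y: "q \<longlonglongrightarrow> y" by (auto simp: Cauchy_convergent_iff convergent_def)
    have "(\<lambda>n. k * norm (q n - snd c x)) \<longlonglongrightarrow> k * norm (y - snd c x)" by (intro tendsto_intros y)
    moreover have "k * norm (q n - snd c x) \<le> \<Lambda> b" for n
    proof -
      have "\<gamma> ` {a..u n} \<subseteq> W" using u[of n] by (auto intro!: inW)
      from bound[OF order_refl u(1) _ this] uab[of n] have "k * norm (q n - snd c x) \<le> \<Lambda> (u n) - \<Lambda> a"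
        by (simp add: q_def \<gamma>a)
      also have "\<dots> \<le> \<Lambda> b" using \<Lambda>le[OF uab[of n]] by (simp add: \<Lambda>_def)
      finally show ?thesis .
    qed
    ultimately have "k * norm (y - snd c x) \<le> \<Lambda> b" by (intro LIMSEQ_le_const2) auto
    then have "k * norm (y - snd c x) < k * r" using len by (simp add: \<Lambda>_def)
    then have yb: "y \<in> ball (snd c x) r" using k by (simp add: dist_norm norm_minus_commute)
    then have yd: "y \<in> snd c ` fst c" using r by blast
    have "isCont (chart_inv c) y"
      using chart_inv_continuous[OF c] continuous_on_eq_continuous_at[OF chart_image_open[OF c]] yd by blast
    then have "(\<lambda>n. chart_inv c (q n)) \<longlonglongrightarrow> chart_inv c y" using y by (rule isCont_tendsto_compose)
    moreover have "chart_inv c (q n) = \<gamma> (u n)" for n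
      unfolding q_def by (rule chart_inv_chart[OF c]) (use inW[OF u] in \<open>simp add: W_def\<close>)
    moreover have "(\<lambda>n. \<gamma> (u n)) \<longlonglongrightarrow> \<gamma> s" using continuous_on_tendsto_compose[OF cont ul] s uab by auto
    ultimately have "\<gamma> s = chart_inv c y" using LIMSEQ_unique by auto
    then show ?thesis using yb yd chart_inv_in[OF c] chart_chart_inv[OF c] by (simp add: W_def)
  qed
  have sT: "\<gamma> ` {a..s} \<subseteq> W"
  proof (rule image_subsetI)
    fix u assume "u \<in> {a..s}"
    then show "\<gamma> u \<in> W" using inW[of u] sW by (cases "u = s") auto
  qed
  have "s = b"
  proof (rule ccontr)
    assume "s \<noteq> b"
    then have sb: "s < b" using s by simp
    obtain V where V: "open V" "s \<in> V" "\<And>t. t \<in> {a..b} \<inter> V \<Longrightarrow> \<gamma> t \<in> W"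
      using cont oW sW s unfolding continuous_on_topological by (metis Int_iff atLeastAtMost_iff)
    obtain d where d: "d > 0" "ball s d \<subseteq> V" using V openE by blast
    define t where "t = min b (s + d / 2)"
    have t: "s < t" "t \<le> b" using sb d by (auto simp: t_def)
    have "\<gamma> ` {a..t} \<subseteq> W"
    proof (rule image_subsetI)
      fix u assume u: "u \<in> {a..t}"
      show "\<gamma> u \<in> W"
      proof (cases "u \<le> s")
        case True then show ?thesis using sT u by auto
      next
        case False
        then have "u \<in> ball s d" using u d by (auto simp: t_def dist_real_def)
        then show ?thesis using V(3) d(2) u t by auto
      qed
    qed
    then have "t \<in> T" using t s by (auto simp: T_def)
    then have "t \<le> s" unfolding s_def using bdd by (rule cSup_upper)
    then show False using t by simp
  qed
  then have Wab: "\<gamma> ` {a..b} \<subseteq> W" using sT by simp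
  have "\<gamma> b \<in> W" using sW \<open>s = b\<close> by simp
  moreover have "k * norm (snd c (\<gamma> b) - snd c x) \<le> \<Lambda> b"
    using bound[OF order_refl ab order_refl Wab] by (simp add: \<gamma>a \<Lambda>_def)
  ultimately show ?thesis by (simp add: W_def \<Lambda>_def)
qed

lemma in_S_if_in_cdom:
  assumes c: "c \<in> A" and y: "y \<in> fst c" and d: "snd c y \<in> cdom c"
  shows "y \<in> S"
proof -
  obtain z where z: "z \<in> fst c" "z \<in> S" "snd c y = snd c z" using d by (elim imageE) auto
  have "y = chart_inv c (snd c z)" using chart_inv_chart[OF c y] z(3) by simp
  then show ?thesis using chart_inv_chart[OF c z(1)] z(2) by simp
qed

text \<open>
  The \<open>G\<close>-topology is finer than the manifold topology. In particular points at small distance lie in the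
  same chart.
\<close>

lemma dist_controls_chart:
  assumes c: "c \<in> A" and x: "x \<in> fst c" "x \<in> S" and e: "e > 0"
  shows "\<exists>\<rho>>0. \<forall>y. dist\<^sub>G x y < ennreal \<rho> \<longrightarrow> y \<in> S \<and> y \<in> fst c \<and> norm (snd c y - snd c x) < e"
proof -
  have p: "snd c x \<in> cdom c" using x by blast
  obtain r k where r: "r > 0" and k: "k > 0" and sub: "ball (snd c x) r \<subseteq> cdom c"
    and low: "\<And>q v. q \<in> ball (snd c x) r \<Longrightarrow> k * norm v \<le> sqrt (g c q v v)"
    using local_norm_equivalence[OF c p] by blast
  define \<rho> where "\<rho> = k * min r e"
  have \<rho>: "\<rho> > 0" "\<rho> \<le> k * r" "\<rho> \<le> k * e" using r e k by (auto simp: \<rho>_def)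
  have "y \<in> S \<and> y \<in> fst c \<and> norm (snd c y - snd c x) < e" if "dist\<^sub>G x y < ennreal \<rho>" for y
  proof -
    obtain \<gamma> where \<gamma>: "pwC1 A 0 1 \<gamma>" "\<gamma> ` {0..1} \<subseteq> S" "\<gamma> 0 = x" "\<gamma> 1 = y" "integral {0..1} (speed A G \<gamma>) < \<rho>"
      using dist_lessE[OF \<open>dist\<^sub>G x y < ennreal \<rho>\<close>] .
    have len: "integral {0..1} (speed A G \<gamma>) < k * r" using \<gamma>(5) \<rho> by simp
    have *: "y \<in> fst c" "k * norm (snd c y - snd c x) \<le> integral {0..1} (speed A G \<gamma>)"
      using stay_in_chart[OF c x(1) k sub low \<gamma>(1) zero_le_one \<gamma>(2,3) len] \<gamma>(4) by auto
    then have "k * norm (snd c y - snd c x) < k * e" using \<gamma>(5) \<rho> by simp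
    then show ?thesis using * k \<gamma>(2,4) by auto
  qed
  then show ?thesis using \<rho>(1) by blast
qed

text \<open>The straight segment in a chart is a competitor.\<close>

lemma dist_le_segment:
  assumes c: "c \<in> A" and y: "y \<in> fst c" and z: "z \<in> fst c"
    and seg: "closed_segment (snd c y) (snd c z) \<subseteq> cdom c"
    and up: "\<And>q. q \<in> closed_segment (snd c y) (snd c z) \<Longrightarrow> sqrt (g c q (snd c z - snd c y) (snd c z - snd c y)) \<le> M"
  shows "dist\<^sub>G y z \<le> ennreal M"
proof -
  define u where "u t = snd c y + t *\<^sub>R (snd c z - snd c y)" for t :: real
  define \<gamma> where "\<gamma> t = chart_inv c (u t)" for t
  have useg: "u t \<in> closed_segment (snd c y) (snd c z)" if "t \<in> {0..1}" for t
    using that unfolding u_def closed_segment_def by (auto intro!: exI[of _ t] simp: algebra_simps)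
  have ud: "u t \<in> cdom c" if "t \<in> {0..1}" for t using useg[OF that] seg by blast
  have uc: "u t \<in> snd c ` fst c" if "t \<in> {0..1}" for t using ud[OF that] by blast
  have du: "(u has_vector_derivative (snd c z - snd c y)) (at t within T)" for t T
    unfolding u_def by (auto intro!: derivative_eq_intros)
  have C1: "C1_path_on A s t \<gamma>" if "0 \<le> s" "s < t" "t \<le> 1" for s t
    unfolding \<gamma>_def by (rule C1_path_in_chart[OF c that(2) uc du]) (use that in auto)
  have cu: "continuous_on {0..1} u" unfolding u_def by (intro continuous_intros)
  have pw: "pwC1 A 0 1 \<gamma>" unfolding pwC1_def
  proof (intro conjI exI[of _ "{}"] allI impI)
    show "continuous_on {0..1} \<gamma>" using C1[of 0 1] by (simp add: C1_path_on_def)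
  qed (use C1 in auto)
  have \<gamma>S: "\<gamma> t \<in> fst c \<and> \<gamma> t \<in> S \<and> snd c (\<gamma> t) = u t" if "t \<in> {0..1}" for t
    using ud[OF that] unfolding \<gamma>_def by (auto simp: chart_inv_chart[OF c])
  then have im: "\<gamma> ` {0..1} \<subseteq> S" by blast
  obtain P where P: "finite P" "\<And>t. t \<in> {0<..<1} - P \<Longrightarrow> regular_at \<gamma> t" using pwC1_regular[OF pw] by blast
  have "integral {0..1} (speed A G \<gamma>) \<le> integral {0..1} (\<lambda>t::real. M)"
  proof (rule integral_le_finite_exceptions[OF speed_integrable[OF pw im] _ finite.insertI[OF finite.insertI[OF P(1), of 1], of 0]])
    fix t assume "t \<in> {0..1} - insert 0 (insert 1 P)"
    then have t: "t \<in> {0<..<1} - P" "t \<in> {0..1}" by auto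
    obtain v where v: "((snd c \<circ> \<gamma>) has_vector_derivative v) (at t)" "speed A G \<gamma> t = sqrt (g c (snd c (\<gamma> t)) v v)"
      using regular_in_chart[OF P(2)[OF t(1)] c] \<gamma>S[OF t(2)] by blast
    have "((snd c \<circ> \<gamma>) has_vector_derivative (snd c z - snd c y)) (at t)"
      by (rule has_vector_derivative_transform_within_open[OF du, of "{0<..<1}"]) (use t \<gamma>S in auto)
    then have "v = snd c z - snd c y" using v(1) vector_derivative_unique_at by blast
    then show "speed A G \<gamma> t \<le> M" using v(2) \<gamma>S[OF t(2)] up[OF useg[OF t(2)]] by simp
  qed auto
  then have "integral {0..1} (speed A G \<gamma>) \<le> M" by simp
  moreover have "dist\<^sub>G (\<gamma> 0) (\<gamma> 1) \<le> ennreal (integral {0..1} (speed A G \<gamma>))"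
    by (rule dist_le_length[OF pw im]) simp
  moreover have "\<gamma> 0 = y" "\<gamma> 1 = z" by (auto simp: \<gamma>_def u_def chart_inv_chart[OF c] y z)
  ultimately show ?thesis by (metis ennreal_leI order_trans)
qed

text \<open>Conversely, the manifold topology is finer than the \<open>G\<close>-topology.\<close>

lemma chart_controls_dist:
  assumes c: "c \<in> A" and x: "x \<in> fst c" "x \<in> S" and e: "e > 0"
  shows "\<exists>d>0. \<forall>y\<in>fst c. norm (snd c y - snd c x) < d \<longrightarrow> y \<in> S \<and> dist\<^sub>G x y < ennreal e"
proof -
  have p: "snd c x \<in> cdom c" using x by blast
  obtain r K where r: "r > 0" and K: "K > 0" and sub: "ball (snd c x) r \<subseteq> cdom c"
    and up: "\<And>q v. q \<in> ball (snd c x) r \<Longrightarrow> sqrt (g c q v v) \<le> K * norm v"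
    using local_norm_equivalence[OF c p] by blast
  define d where "d = min r (e / K)"
  have d: "d > 0" using r e K by (simp add: d_def)
  have "y \<in> S \<and> dist\<^sub>G x y < ennreal e" if y: "y \<in> fst c" "norm (snd c y - snd c x) < d" for y
  proof -
    have yb: "snd c y \<in> ball (snd c x) r" using y by (simp add: d_def dist_norm norm_minus_commute)
    have seg: "closed_segment (snd c x) (snd c y) \<subseteq> ball (snd c x) r"
      by (rule closed_segment_subset) (use yb r in auto)
    have "dist\<^sub>G x y \<le> ennreal (K * norm (snd c y - snd c x))"
      by (rule dist_le_segment[OF c x(1) y(1)]) (use seg sub up in blast)+
    also have "\<dots> < ennreal e"
      using y(2) K e by (intro ennreal_lessI) (auto simp: d_def pos_less_divide_eq mult.commute)
    finally have "dist\<^sub>G x y < ennreal e" .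
    moreover have "y \<in> S" using yb sub by (intro in_S_if_in_cdom[OF c y(1)]) blast
    ultimately show ?thesis by simp
  qed
  then show ?thesis using d by blast
qed

lemma dist_self: "x \<in> S \<Longrightarrow> dist\<^sub>G x x = 0"
proof -
  assume x: "x \<in> S"
  obtain c where c: "c \<in> A" "x \<in> fst c" using ex_chart by blast
  have "dist\<^sub>G x x \<le> ennreal 0" by (rule dist_le_segment[OF c(1) c(2) c(2)]) (use x c in auto)
  then show ?thesis by simp
qed

end

text \<open>
  On a \<open>G\<close>-ball, (a) bounds ambient length by a multiple of \<open>G\<close>-length, and (b) keeps limits
  inside.
\<close>

theorem metric_completeness:
  assumes H: "completeness_hypotheses (A :: ('m::t2_space, 'e::{real_inner, complete_space}) chart set) Gbar M G"
  shows "metrically_complete A M G"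
proof -
  have hyps: "smooth_atlas A" "strong_riemannian_metric A UNIV Gbar" "metrically_complete A UNIV Gbar"
    "open M" "strong_riemannian_metric A M G" "dominates_on_balls A Gbar M G" "ball_closures_inside A Gbar M G"
    using H unfolding completeness_hypotheses_def by auto
  interpret m: strong_riem A M G using hyps by unfold_locales
  interpret bar: strong_riem A UNIV Gbar using hyps by unfold_locales auto
  show ?thesis unfolding metrically_complete_def
  proof (intro allI impI)
    fix X :: "nat \<Rightarrow> 'm"
    assume "(\<forall>n. X n \<in> M) \<and> (\<forall>\<epsilon>>0. \<exists>N. \<forall>m\<ge>N. \<forall>n\<ge>N. geodesic_dist A M G (X m) (X n) < ennreal \<epsilon>)"
    then have XM: "\<And>n. X n \<in> M"
      and Cau: "\<And>\<epsilon>. \<epsilon> > 0 \<Longrightarrow> \<exists>N. \<forall>m\<ge>N. \<forall>n\<ge>N. geodesic_dist A M G (X m) (X n) < ennreal \<epsilon>" by auto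
    obtain N where N: "\<And>m n. m \<ge> N \<Longrightarrow> n \<ge> N \<Longrightarrow> geodesic_dist A M G (X m) (X n) < ennreal 1"
      using Cau[OF zero_less_one] by blast
    \<comment> \<open>Radius 2, since paths of length at most 1 start at points at distance less than 1.\<close>
    define B where "B = {y\<in>M. geodesic_dist A M G (X N) y < ennreal 2}"
    have B: "B \<in> metric_balls A M G"
      unfolding metric_balls_def B_def using XM[of N] by (intro CollectI exI[of _ "X N"] exI[of _ 2]) simp
    have "\<exists>C>0. \<forall>x\<in>B. \<forall>h\<in>tangent_space A x. Gbar x h h \<le> C * G x h h"
      using hyps(6) B unfolding dominates_on_balls_def by (rule bspec)
    then obtain C where C1: "C > 0" and C2: "\<forall>x\<in>B. \<forall>h\<in>tangent_space A x. Gbar x h h \<le> C * G x h h"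
      by (elim exE conjE) (rule that)
    note C = C1 bspec[OF bspec[OF C2]]
    have cmp: "geodesic_dist A UNIV Gbar (X i) (X j) < ennreal (sqrt C * e)"
      if ij: "i \<ge> N" and e: "e \<le> 1" "e > 0" and d: "geodesic_dist A M G (X i) (X j) < ennreal e" for i j e
    proof -
      obtain \<gamma> where \<gamma>: "pwC1 A 0 1 \<gamma>" "\<gamma> ` {0..1} \<subseteq> M" "\<gamma> 0 = X i" "\<gamma> 1 = X j" "integral {0..1} (speed A G \<gamma>) < e"
        using m.dist_lessE[OF d] .
      have inB: "\<gamma> t \<in> B" if t: "t \<in> {0<..<1}" for t
      proof -
        have im: "\<gamma> ` {0..t} \<subseteq> M" using \<gamma>(2) t by (auto simp: image_subset_iff)
        have "geodesic_dist A M G (\<gamma> 0) (\<gamma> t) \<le> ennreal (integral {0..t} (speed A G \<gamma>))"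
          by (rule m.dist_le_length[OF m.pwC1_subset[OF \<gamma>(1)] im]) (use t in auto)
        also have "\<dots> \<le> ennreal (integral {0..1} (speed A G \<gamma>))"
          using m.length_mono[OF \<gamma>(1,2), of t] t by (intro ennreal_leI) auto
        also have "\<dots> < ennreal 1" using \<gamma>(5) e by (intro ennreal_lessI) auto
        finally have "geodesic_dist A M G (X N) (X i) + geodesic_dist A M G (X i) (\<gamma> t) < ennreal 1 + ennreal 1"
          using N[OF order_refl ij] \<gamma>(3) by (intro add_strict_mono) auto
        then have "geodesic_dist A M G (X N) (\<gamma> t) < ennreal 2"
          using m.dist_triangle[of "X N" "\<gamma> t" "X i"] by (simp add: order_le_less_trans flip: ennreal_plus)
        then show ?thesis using im t by (auto simp: B_def)
      qed
      obtain P where P: "finite P" "\<And>t. t \<in> {0<..<1} - P \<Longrightarrow> m.regular_at \<gamma> t"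
        using m.pwC1_regular[OF \<gamma>(1)] by blast
      have "integral {0..1} (speed A Gbar \<gamma>) \<le> integral {0..1} (\<lambda>t. sqrt C * speed A G \<gamma> t)"
      proof (rule integral_le_finite_exceptions[OF bar.speed_integrable[OF \<gamma>(1)] _ finite.insertI[OF finite.insertI[OF P(1), of 1], of 0]])
        show "(\<lambda>t. sqrt C * speed A G \<gamma> t) integrable_on {0..1}"
          by (intro integrable_on_mult_right m.speed_integrable \<gamma>)
        fix t assume "t \<in> {0..1} - insert 0 (insert 1 P)"
        then have t: "t \<in> {0<..<1} - P" by auto
        obtain c v where "c \<in> A" "\<gamma> t \<in> fst c" "velocity A UNIV \<gamma> t = tangent A (\<gamma> t) c v"
          using P(2)[OF t] by (rule m.regular_atE)
        then have "velocity A UNIV \<gamma> t \<in> tangent_space A (\<gamma> t)" unfolding tangent_space_def by blast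
        from C(2)[OF inB this] t show "speed A Gbar \<gamma> t \<le> sqrt C * speed A G \<gamma> t"
          unfolding speed_def real_sqrt_mult[symmetric] by (intro real_sqrt_le_mono) auto
      qed auto
      also have "\<dots> < sqrt C * e" using \<gamma>(5) C(1) by simp
      finally have lt: "integral {0..1} (speed A Gbar \<gamma>) < sqrt C * e" .
      have "geodesic_dist A UNIV Gbar (\<gamma> 0) (\<gamma> 1) \<le> ennreal (integral {0..1} (speed A Gbar \<gamma>))"
        by (rule bar.dist_le_length[OF \<gamma>(1)]) auto
      also have "\<dots> < ennreal (sqrt C * e)" using lt C e by (intro ennreal_lessI) auto
      finally show ?thesis using \<gamma>(3,4) by simp
    qed
    have "\<exists>K. \<forall>i\<ge>K. \<forall>j\<ge>K. geodesic_dist A UNIV Gbar (X i) (X j) < ennreal e" if e: "e > 0" for e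
    proof -
      define e' where "e' = min 1 (e / sqrt C)"
      have e': "e' > 0" "e' \<le> 1" using e C by (auto simp: e'_def)
      have "e' \<le> e / sqrt C" by (simp add: e'_def)
      then have le: "sqrt C * e' \<le> e" using C by (simp add: pos_le_divide_eq mult.commute)
      obtain K where K: "\<And>i j. i \<ge> K \<Longrightarrow> j \<ge> K \<Longrightarrow> geodesic_dist A M G (X i) (X j) < ennreal e'"
        using Cau[OF e'(1)] by blast
      have "geodesic_dist A UNIV Gbar (X i) (X j) < ennreal e" if "i \<ge> max K N" "j \<ge> max K N" for i j
      proof -
        have "geodesic_dist A UNIV Gbar (X i) (X j) < ennreal (sqrt C * e')"
          using that K[of i j] e' by (intro cmp) auto
        also have "\<dots> \<le> ennreal e" by (rule ennreal_leI[OF le])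
        finally show ?thesis .
      qed
      then show ?thesis by blast
    qed
    then obtain x where x: "(\<lambda>n. geodesic_dist A UNIV Gbar (X n) x) \<longlonglongrightarrow> 0"
      using hyps(3) unfolding metrically_complete_def by blast
    have XB: "X n \<in> B" if "n \<ge> N" for n
    proof -
      have "ennreal 1 \<le> ennreal 2" by (rule ennreal_leI) simp
      with N[OF order_refl that] have "geodesic_dist A M G (X N) (X n) < ennreal 2"
        by (rule order.strict_trans2)
      then show ?thesis using XM by (simp add: B_def)
    qed
    have "x \<in> metric_closure A UNIV Gbar B" unfolding metric_closure_def
    proof (intro CollectI conjI UNIV_I allI impI)
      fix e :: real assume "e > 0"
      then have "\<forall>\<^sub>F n in sequentially. geodesic_dist A UNIV Gbar (X n) x < ennreal e \<and> n \<ge> N"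
        using x unfolding ennreal_tendsto_0_iff by (intro eventually_conj eventually_ge_at_top) auto
      then obtain n where "geodesic_dist A UNIV Gbar (X n) x < ennreal e" "n \<ge> N"
        by (auto dest: eventually_happens)
      then show "\<exists>y\<in>B. geodesic_dist A UNIV Gbar y x < ennreal e" using XB by blast
    qed
    then have xM: "x \<in> M" using hyps(7) B unfolding ball_closures_inside_def by blast
    obtain c where c: "c \<in> A" "x \<in> fst c" using m.ex_chart by blast
    show "\<exists>x\<in>M. (\<lambda>n. geodesic_dist A M G (X n) x) \<longlonglongrightarrow> 0" unfolding ennreal_tendsto_0_iff
    proof (intro bexI[of _ x] xM allI impI)
      fix e :: real assume "e > 0"
      then obtain d where d: "d > 0" "\<And>y. y \<in> fst c \<Longrightarrow> norm (snd c y - snd c x) < d \<Longrightarrow> geodesic_dist A M G x y < ennreal e"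
        using m.chart_controls_dist[OF c xM] by blast
      obtain \<rho> where \<rho>: "\<rho> > 0" "\<And>y. geodesic_dist A UNIV Gbar x y < ennreal \<rho> \<Longrightarrow> y \<in> fst c \<and> norm (snd c y - snd c x) < d"
        using bar.dist_controls_chart[OF c UNIV_I d(1)] by blast
      have "\<forall>\<^sub>F n in sequentially. geodesic_dist A UNIV Gbar (X n) x < ennreal \<rho>"
        using x \<rho>(1) unfolding ennreal_tendsto_0_iff by blast
      then show "\<forall>\<^sub>F n in sequentially. geodesic_dist A M G (X n) x < ennreal e"
        by (rule eventually_mono) (use d(2) \<rho>(2) in \<open>auto simp: m.dist_commute[of _ x] bar.dist_commute[of _ x]\<close>)
    qed
  qed
qed

section \<open>The geodesic equation in charts\<close>

lemma norm_blinfun3: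
  fixes D :: "'a::real_normed_vector \<Rightarrow>\<^sub>L 'a \<Rightarrow>\<^sub>L 'a \<Rightarrow>\<^sub>L real"
  shows "\<bar>D u v w\<bar> \<le> norm D * norm u * norm v * norm w"
proof -
  have "\<bar>D u v w\<bar> \<le> norm (D u v) * norm w" using norm_blinfun[of "D u v" w] by simp
  also have "\<dots> \<le> (norm (D u) * norm v) * norm w" by (intro mult_right_mono norm_blinfun) auto
  also have "\<dots> \<le> ((norm D * norm u) * norm v) * norm w" by (intro mult_right_mono norm_blinfun) auto
  finally show ?thesis .
qed

lemma norm_blinfun2:
  fixes B :: "'a::real_normed_vector \<Rightarrow>\<^sub>L 'a \<Rightarrow>\<^sub>L real"
  shows "\<bar>B u v\<bar> \<le> norm B * norm u * norm v"
proof -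
  have "\<bar>B u v\<bar> \<le> norm (B u) * norm v" using norm_blinfun[of "B u" v] by simp
  also have "\<dots> \<le> (norm B * norm u) * norm v" by (intro mult_right_mono norm_blinfun) auto
  finally show ?thesis .
qed

context strong_riem
begin

text \<open>The derivative of the local representative, as a bounded trilinear form.\<close>

definition dg :: "('m, 'e) chart \<Rightarrow> 'e \<Rightarrow> 'e \<Rightarrow>\<^sub>L 'e \<Rightarrow>\<^sub>L 'e \<Rightarrow>\<^sub>L real" where
  "dg c p = Blinfun (frechet_derivative (g c) (at p))"

lemma
  assumes c: "c \<in> A"
  shows dg: "p \<in> cdom c \<Longrightarrow> (g c has_derivative dg c p) (at p)"
    and dg_lipschitz: "p \<in> cdom c \<Longrightarrow> \<exists>d>0. \<exists>L. ball p d \<subseteq> cdom c \<and> L-lipschitz_on (ball p d) (dg c)"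
    and g_lipschitz: "p \<in> cdom c \<Longrightarrow> \<exists>d>0. \<exists>L. ball p d \<subseteq> cdom c \<and> L-lipschitz_on (ball p d) (g c)"
proof -
  obtain g1 :: "'e \<Rightarrow> 'e \<Rightarrow>\<^sub>L 'e \<Rightarrow>\<^sub>L 'e \<Rightarrow>\<^sub>L real" and g2
    where g1: "\<And>q. q \<in> cdom c \<Longrightarrow> (g c has_derivative g1 q) (at q)"
      and g2: "\<And>q. q \<in> cdom c \<Longrightarrow> (g1 has_derivative blinfun_apply (g2 q)) (at q)"
      and c2: "continuous_on (cdom c) g2" using smooth_map_on_C2[OF g_smooth[OF c] open_dom[OF c]] by metis
  have eq: "dg c q = g1 q" if "q \<in> cdom c" for q
    unfolding dg_def frechet_derivative_at[OF g1[OF that], symmetric] by (rule blinfun_apply_inverse)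
  have c1: "continuous_on (cdom c) g1"
    using g2 by (metis continuous_at_imp_continuous_on has_derivative_continuous)
  show "(g c has_derivative dg c p) (at p)" if "p \<in> cdom c" using g1[OF that] eq[OF that] by simp
  show "\<exists>d>0. \<exists>L. ball p d \<subseteq> cdom c \<and> L-lipschitz_on (ball p d) (g c)" if "p \<in> cdom c"
    by (rule C1_local_lipschitz[OF open_dom[OF c] that g1 c1])
  assume p: "p \<in> cdom c"
  obtain d L where d: "d > 0" "ball p d \<subseteq> cdom c" "L-lipschitz_on (ball p d) g1"
    using C1_local_lipschitz[OF open_dom[OF c] p g2 c2] by blast
  have "L-lipschitz_on (ball p d) (dg c)" by (rule lipschitz_on_transform[OF d(3)]) (use eq d(2) in blast)
  then show "\<exists>d>0. \<exists>L. ball p d \<subseteq> cdom c \<and> L-lipschitz_on (ball p d) (dg c)" using d by blast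
qed

lemma local_metric_eq:
  assumes "c \<in> A" "q \<in> cdom c"
  shows "local_metric A G c q v w = g c q v w"
  using assms by (auto simp: local_metric_def chart_inv_chart G_eq_g)

lemma local_metric_derivative:
  assumes c: "c \<in> A" and p: "p \<in> cdom c"
  shows "frechet_derivative (\<lambda>q. local_metric A G c q v w) (at p) h = dg c p h v w"
proof -
  have "((\<lambda>q. g c q v w) has_derivative (\<lambda>h. dg c p h v w)) (at p)"
    by (intro bounded_linear.has_derivative[OF blinfun.bounded_linear_left] dg[OF c p])
  then have "((\<lambda>q. local_metric A G c q v w) has_derivative (\<lambda>h. dg c p h v w)) (at p)"
    by (rule has_derivative_transform_within_open[OF _ open_dom[OF c] p]) (simp add: local_metric_eq[OF c])
  then show ?thesis using frechet_derivative_at by metis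
qed

lemma g_coercive_square:
  assumes c: "c \<in> A" and p: "p \<in> cdom c"
  shows "\<exists>k>0. \<forall>v. k * (norm v)^2 \<le> g c p v v"
proof -
  obtain k where k: "k > 0" "\<And>v. k * norm v \<le> sqrt (g c p v v)" using g_coercive[OF c p] by blast
  have "k^2 * (norm v)^2 \<le> g c p v v" for v
    using power_mono[OF k(2)[of v], of 2] k(1) g_nonneg[OF c p, of v] by (simp add: power_mult_distrib)
  then show ?thesis using k(1) by (intro exI[of _ "k^2"]) auto
qed

text \<open>The Koszul formula has a unique solution because \<open>g\<close> is coercive.\<close>

lemma christoffel_char:
  assumes c: "c \<in> A" and p: "p \<in> cdom c"
  shows "g c p (Chr c p u v) w = (dg c p u v w + dg c p v u w - dg c p w u v) / 2"
    and "(\<And>w. g c p z w = (dg c p u v w + dg c p v u w - dg c p w u v) / 2) \<Longrightarrow> z = Chr c p u v"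
proof -
  obtain k where k: "k > 0" "\<And>v. k * (norm v)^2 \<le> g c p v v" using g_coercive_square[OF c p] by blast
  let ?l = "\<lambda>w. (dg c p u v w + dg c p v u w - dg c p w u v) / 2"
  have "bounded_linear ?l"
    by (intro bounded_linear_divide[THEN bounded_linear_compose] bounded_linear_sub bounded_linear_add
        bounded_linear_compose[OF blinfun.bounded_linear_left] blinfun.bounded_linear_right bounded_linear_ident)
  then have l: "blinfun_apply (Blinfun ?l) = ?l" by (rule bounded_linear_Blinfun_apply)
  have ex: "\<exists>!z. \<forall>w. g c p z w = ?l w"
    using blinfun_form_inverse[OF g_sym[OF c p] k, of "Blinfun ?l"] unfolding l .
  have ch: "Chr c p u v = (THE z. \<forall>w. g c p z w = ?l w)"
    unfolding christoffel_def Let_def by (simp add: local_metric_eq[OF c p] local_metric_derivative[OF c p])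
  show "g c p (Chr c p u v) w = ?l w" using theI'[OF ex] unfolding ch by blast
  show "(\<And>w. g c p z w = ?l w) \<Longrightarrow> z = Chr c p u v" unfolding ch using the1_equality[OF ex, of z] by simp
qed

text \<open>
  Coercivity turns bounds on the Koszul form into bounds on the Christoffel map. The Lipschitz estimate is what Picard
  iteration uses; the quadratic one bounds the acceleration of a geodesic by its squared speed.
\<close>

lemma geodesic_field_estimates:
  assumes c: "c \<in> A" and p0: "p0 \<in> cdom c"
  shows "\<exists>r>0. \<exists>C\<ge>0. ball p0 r \<subseteq> cdom c \<and>
    (\<forall>p\<in>ball p0 r. \<forall>v. norm (Chr c p v v) \<le> C * (norm v)^2) \<and>
    (\<forall>R\<ge>0. \<exists>L\<ge>0. \<forall>p\<in>ball p0 r. \<forall>q\<in>ball p0 r. \<forall>v w. norm v \<le> R \<longrightarrow> norm w \<le> R \<longrightarrow>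
       norm (Chr c p v v - Chr c q w w) \<le> L * (norm (p - q) + norm (v - w)))"
proof -
  obtain d1 L1 where d1: "d1 > 0" "ball p0 d1 \<subseteq> cdom c" "L1-lipschitz_on (ball p0 d1) (dg c)"
    using dg_lipschitz[OF c p0] by blast
  obtain d2 L2 where d2: "d2 > 0" "ball p0 d2 \<subseteq> cdom c" "L2-lipschitz_on (ball p0 d2) (g c)"
    using g_lipschitz[OF c p0] by blast
  obtain d3 k where d3: "d3 > 0" "k > 0" and low: "\<And>q v. q \<in> ball p0 d3 \<Longrightarrow> k * norm v \<le> sqrt (g c q v v)"
    using local_norm_equivalence[OF c p0] by blast
  define r where "r = min d1 (min d2 d3)"
  have r: "r > 0" using d1 d2 d3 by (simp add: r_def)
  have sub: "ball p0 r \<subseteq> cdom c" using d1(2) by (auto simp: r_def)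
  define K where "K = k^2"
  have K: "K > 0" using d3 by (simp add: K_def)
  have coer: "K * (norm v)^2 \<le> g c q v v" if "q \<in> ball p0 r" for q v
    using power_mono[OF low[of q v], of 2] that d3 g_nonneg[OF c, of q v] sub
    by (auto simp: K_def r_def power_mult_distrib)
  have L: "L1 \<ge> 0" "L2 \<ge> 0" using d1(3) d2(3) lipschitz_on_nonneg by auto
  have l1: "norm (dg c p - dg c q) \<le> L1 * norm (p - q)" if "p \<in> ball p0 r" "q \<in> ball p0 r" for p q
    using lipschitz_onD[OF d1(3), of p q] that by (auto simp: r_def dist_norm)
  have l2: "norm (g c p - g c q) \<le> L2 * norm (p - q)" if "p \<in> ball p0 r" "q \<in> ball p0 r" for p q
    using lipschitz_onD[OF d2(3), of p q] that by (auto simp: r_def dist_norm)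
  define N where "N = norm (dg c p0) + L1 * r"
  have N: "norm (dg c p) \<le> N" if "p \<in> ball p0 r" for p
  proof -
    have "L1 * norm (p - p0) \<le> L1 * r" using that L by (intro mult_left_mono) (auto simp: dist_norm norm_minus_commute)
    then show ?thesis using l1[OF that, of p0] norm_triangle_sub[of "dg c p" "dg c p0"] r by (simp add: N_def)
  qed
  have N0: "N \<ge> 0" using L r by (simp add: N_def)
  define b where "b D v w = D v v w - D w v v / 2" for D :: "'e \<Rightarrow>\<^sub>L 'e \<Rightarrow>\<^sub>L 'e \<Rightarrow>\<^sub>L real" and v w
  define \<Gamma> where "\<Gamma> p v = Chr c p v v" for p v
  have \<Gamma>: "g c p (\<Gamma> p v) w = b (dg c p) v w" if "p \<in> ball p0 r" for p v w
    unfolding \<Gamma>_def b_def using christoffel_char(1)[OF c, of p v v w] sub that by auto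
  have bb: "\<bar>b D v w\<bar> \<le> 2 * norm D * (norm v)^2 * norm w" for D v w
    using norm_blinfun3[of D v v w] norm_blinfun3[of D w v v]
    unfolding b_def by (simp add: power2_eq_square mult_ac)
  define C where "C = 2 * N / K"
  have C0: "C \<ge> 0" using N0 K by (simp add: C_def)
  have \<Gamma>b: "norm (\<Gamma> p v) \<le> C * (norm v)^2" if p: "p \<in> ball p0 r" for p v
  proof (cases "\<Gamma> p v = 0")
    case False
    have "K * (norm (\<Gamma> p v))^2 \<le> 2 * norm (dg c p) * (norm v)^2 * norm (\<Gamma> p v)"
      using coer[OF p, of "\<Gamma> p v"] \<Gamma>[OF p, of v "\<Gamma> p v"] bb[of "dg c p" v "\<Gamma> p v"] by linarith
    also have "\<dots> \<le> 2 * N * (norm v)^2 * norm (\<Gamma> p v)" using N[OF p] by (intro mult_right_mono) auto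
    finally have "(K * norm (\<Gamma> p v)) * norm (\<Gamma> p v) \<le> (2 * N * (norm v)^2) * norm (\<Gamma> p v)"
      by (simp add: power2_eq_square mult_ac)
    then have "K * norm (\<Gamma> p v) \<le> 2 * N * (norm v)^2" using False by simp
    then show ?thesis using K by (simp add: C_def field_simps)
  qed (use C0 in simp)
  have \<Gamma>L: "norm (\<Gamma> p v - \<Gamma> q w) \<le> (2 * L1 * R^2 + 4 * N * R + L2 * C * R^2) / K * (norm (p - q) + norm (v - w))"
    if p: "p \<in> ball p0 r" and q: "q \<in> ball p0 r" and vw: "norm v \<le> R" "norm w \<le> R" "R \<ge> 0" for p q v w R
  proof (cases "\<Gamma> p v = \<Gamma> q w")
    case False
    define z where "z = \<Gamma> p v - \<Gamma> q w"
    have z0: "norm z > 0" using False by (simp add: z_def)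
    have "g c p z z = b (dg c p) v z - b (dg c q) w z - (g c p - g c q) (\<Gamma> q w) z"
    proof -
      have "g c p z z = g c p (\<Gamma> p v) z - g c p (\<Gamma> q w) z"
        unfolding z_def by (subst blinfun.diff_right) (rule blinfun.diff_left)
      moreover have "g c p (\<Gamma> q w) z = g c q (\<Gamma> q w) z + (g c p - g c q) (\<Gamma> q w) z"
        by (simp add: blinfun.diff_left)
      ultimately show ?thesis using \<Gamma>[OF p, of v z] \<Gamma>[OF q, of w z] by simp
    qed
    also have "b (dg c p) v z - b (dg c q) w z = b (dg c p - dg c q) v z +
       (dg c q (v - w) v z + dg c q w (v - w) z - (dg c q z (v - w) v + dg c q z w (v - w)) / 2)"
      unfolding b_def by (simp add: blinfun.bilinear_simps diff_divide_distrib add_divide_distrib)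
    finally have eq: "g c p z z = b (dg c p - dg c q) v z +
       (dg c q (v - w) v z + dg c q w (v - w) z - (dg c q z (v - w) v + dg c q z w (v - w)) / 2) - (g c p - g c q) (\<Gamma> q w) z" .
    have RR: "(norm v)^2 \<le> R^2" "(norm w)^2 \<le> R^2" using vw by (auto intro: power_mono)
    have t1: "\<bar>b (dg c p - dg c q) v z\<bar> \<le> (2 * L1 * R^2 * norm (p - q)) * norm z"
    proof -
      have "2 * norm (dg c p - dg c q) * (norm v)^2 * norm z \<le> 2 * (L1 * norm (p - q)) * R^2 * norm z"
        using l1[OF p q] RR L vw by (intro mult_mono mult_nonneg_nonneg) auto
      then show ?thesis using bb[of "dg c p - dg c q" v z] by (simp add: mult_ac)
    qed
    have q1: "\<bar>dg c q x y y'\<bar> \<le> N * norm x * norm y * norm y'" for x y y'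
    proof -
      have "norm (dg c q) * norm x * norm y * norm y' \<le> N * norm x * norm y * norm y'"
        using N[OF q] by (intro mult_right_mono) auto
      then show ?thesis using norm_blinfun3[of "dg c q" x y y'] by simp
    qed
    have q2: "N * norm (v - w) * norm v * norm z \<le> N * R * norm (v - w) * norm z"
        "N * norm (v - w) * norm w * norm z \<le> N * R * norm (v - w) * norm z"
      using mult_left_mono[OF vw(1), of "N * norm (v - w) * norm z"] mult_left_mono[OF vw(2), of "N * norm (v - w) * norm z"] N0
      by (simp_all add: mult_ac)
    have t2: "\<bar>dg c q (v - w) v z + dg c q w (v - w) z - (dg c q z (v - w) v + dg c q z w (v - w)) / 2\<bar>
      \<le> (4 * N * R * norm (v - w)) * norm z"
    proof -
      have "\<bar>dg c q (v - w) v z\<bar> \<le> N * R * norm (v - w) * norm z" using q1[of "v - w" v z] q2 by simp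
      moreover have "\<bar>dg c q w (v - w) z\<bar> \<le> N * R * norm (v - w) * norm z"
        using q1[of w "v - w" z] q2 by (simp add: mult_ac)
      moreover have "\<bar>dg c q z (v - w) v\<bar> \<le> N * R * norm (v - w) * norm z"
        using q1[of z "v - w" v] q2 by (simp add: mult_ac)
      moreover have "\<bar>dg c q z w (v - w)\<bar> \<le> N * R * norm (v - w) * norm z"
        using q1[of z w "v - w"] q2 by (simp add: mult_ac)
      ultimately have "\<bar>dg c q (v - w) v z + dg c q w (v - w) z - (dg c q z (v - w) v + dg c q z w (v - w)) / 2\<bar>
        \<le> 4 * (N * R * norm (v - w) * norm z)" unfolding abs_le_iff by (simp add: field_simps)
      then show ?thesis by (simp add: mult_ac)
    qed
    have t3: "\<bar>(g c p - g c q) (\<Gamma> q w) z\<bar> \<le> (L2 * C * R^2 * norm (p - q)) * norm z"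
    proof -
      have "norm (\<Gamma> q w) \<le> C * R^2" using \<Gamma>b[OF q, of w] mult_left_mono[OF RR(2) C0] by simp
      then have "norm (g c p - g c q) * norm (\<Gamma> q w) * norm z \<le> (L2 * norm (p - q)) * (C * R^2) * norm z"
        using l2[OF p q] L C0 by (intro mult_mono mult_nonneg_nonneg) auto
      then show ?thesis using norm_blinfun2[of "g c p - g c q" "\<Gamma> q w" z] by (simp add: mult_ac)
    qed
    have "K * (norm z)^2 \<le> (2 * L1 * R^2 * norm (p - q)) * norm z + (4 * N * R * norm (v - w)) * norm z + (L2 * C * R^2 * norm (p - q)) * norm z"
      using coer[OF p, of z] eq t1 t2 t3 by linarith
    also have "\<dots> \<le> ((2 * L1 * R^2 + 4 * N * R + L2 * C * R^2) * (norm (p - q) + norm (v - w))) * norm z"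
    proof -
      have "2 * L1 * R^2 * norm (p - q) + 4 * N * R * norm (v - w) + L2 * C * R^2 * norm (p - q)
        \<le> (2 * L1 * R^2 + 4 * N * R + L2 * C * R^2) * (norm (p - q) + norm (v - w))"
        using L N0 C0 vw(3) by (simp add: algebra_simps)
      from mult_right_mono[OF this norm_ge_zero[of z]] show ?thesis by (simp only: distrib_right)
    qed
    finally have "(K * norm z) * norm z \<le> ((2 * L1 * R^2 + 4 * N * R + L2 * C * R^2) * (norm (p - q) + norm (v - w))) * norm z"
      by (simp add: power2_eq_square mult_ac)
    then have "K * norm z \<le> (2 * L1 * R^2 + 4 * N * R + L2 * C * R^2) * (norm (p - q) + norm (v - w))"
      using z0 by simp
    then show ?thesis using K unfolding z_def[symmetric] by (simp add: pos_le_divide_eq mult.commute)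
  qed (use L N0 C0 K vw in simp)
  have ex: "\<exists>L\<ge>0. \<forall>p\<in>ball p0 r. \<forall>q\<in>ball p0 r. \<forall>v w. norm v \<le> R \<longrightarrow> norm w \<le> R \<longrightarrow>
       norm (\<Gamma> p v - \<Gamma> q w) \<le> L * (norm (p - q) + norm (v - w))" if "R \<ge> 0" for R
  proof (intro exI conjI ballI allI impI)
    show "0 \<le> (2 * L1 * R^2 + 4 * N * R + L2 * C * R^2) / K" using L N0 C0 K that by simp
  qed (use \<Gamma>L that in auto)
  show ?thesis using r C0 sub \<Gamma>b ex unfolding \<Gamma>_def by (intro exI[of _ r] exI[of _ C] conjI) auto
qed

text \<open>The geodesic equation at one parameter, in all charts.\<close>

definition geo_at :: "(real \<Rightarrow> 'm) \<Rightarrow> real \<Rightarrow> bool" where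
  "geo_at \<gamma> t \<longleftrightarrow> (\<forall>c\<in>A. \<gamma> t \<in> fst c \<longrightarrow>
     ((snd c \<circ> \<gamma>) has_vector_derivative chart_velocity c \<gamma> t) (at t) \<and>
     ((\<lambda>s. chart_velocity c \<gamma> s) has_vector_derivative
        - Chr c (snd c (\<gamma> t)) (chart_velocity c \<gamma> t) (chart_velocity c \<gamma> t)) (at t))"

lemma geodesic_on_iff:
  "geodesic_on A S G I \<gamma> \<longleftrightarrow> continuous_on I \<gamma> \<and> \<gamma> ` I \<subseteq> S \<and> (\<forall>t\<in>I. geo_at \<gamma> t)"
  unfolding geodesic_on_def geo_at_def Let_def by (auto simp: comp_def)

text \<open>The transition map is an isometry between the two local representatives.\<close>

lemma g_transition:
  assumes c: "c \<in> A" and d: "d \<in> A" and x: "x \<in> fst c" "x \<in> fst d" "x \<in> S"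
  shows "g c (snd c x) u v = g d (snd d x) (dtrans c d x u)
     (dtrans c d x v)" unfolding G_eq_g[OF c x(1,3), symmetric] G_eq_g[OF d x(2,3), symmetric]
  by (simp add: tangent_change[OF c d x(1,2)])

text \<open>
  Chart independence of the geodesic equation. Differentiating the isometry property of the transition map
  \<open>\<phi>\<close> and combining the three cyclic permutations, with \<open>D\<^sup>2 \<phi>\<close> symmetric,
  gives the transformation law of the Christoffel map; its \<open>D\<^sup>2 \<phi>\<close> term matches that of the
  second derivative of \<open>\<phi> (x t)\<close>.
\<close>

lemma geo_at_if_geodesic_in_chart:
  assumes c: "c \<in> A" and T: "open T" "t \<in> T" and in_c: "\<And>s. s \<in> T \<Longrightarrow> \<gamma> s \<in> fst c \<and> \<gamma> s \<in> S"
    and V: "\<And>s. s \<in> T \<Longrightarrow> ((snd c \<circ> \<gamma>) has_vector_derivative V s) (at s)"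
    and V': "(V has_vector_derivative - Chr c (snd c (\<gamma> t)) (V t) (V t)) (at t)"
  shows "geo_at \<gamma> t" unfolding geo_at_def
proof (intro ballI impI)
  fix d assume d: "d \<in> A" and td: "\<gamma> t \<in> fst d"
  define x where "x s = snd c (\<gamma> s)" for s
  define \<phi> where "\<phi> = snd d \<circ> chart_inv c"
  define U where "U = snd c ` (fst c \<inter> (fst d \<inter> S))"
  have oU: "open U" unfolding U_def by (rule chart_image_of_open[OF c open_Int[OF chart_open[OF d] openS]])
  have oU': "open (snd c ` (fst c \<inter> fst d))" by (rule chart_image_of_open[OF c chart_open[OF d]])
  have UU': "U \<subseteq> snd c ` (fst c \<inter> fst d)" and Uc: "U \<subseteq> cdom c" by (auto simp: U_def)
  obtain f1 :: "'e \<Rightarrow> 'e \<Rightarrow>\<^sub>L 'e" and f2 :: "'e \<Rightarrow> 'e \<Rightarrow>\<^sub>L 'e \<Rightarrow>\<^sub>L 'e"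
    where f1': "\<And>p. p \<in> snd c ` (fst c \<inter> fst d) \<Longrightarrow> (\<phi> has_derivative f1 p) (at p)"
      and f2': "\<And>p. p \<in> snd c ` (fst c \<inter> fst d) \<Longrightarrow> (f1 has_derivative f2 p) (at p)"
    using smooth_map_on_C2[OF transition_smooth[OF c d] oU'] unfolding \<phi>_def by metis
  have f1: "(\<phi> has_derivative f1 p) (at p)" and f2: "(f1 has_derivative f2 p) (at p)" if "p \<in> U" for p
    using f1' f2' UU' that by blast+
  have gd: "g c p u v = g d (\<phi> p) (f1 p u) (f1 p v)" and \<phi>d: "\<phi> p \<in> cdom d" if pU: "p \<in> U" for p u v
  proof -
    obtain y where y: "y \<in> fst c" "y \<in> fst d" "y \<in> S" "p = snd c y" using pU by (auto simp: U_def)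
    have "\<phi> p = snd d y" by (simp add: \<phi>_def y chart_inv_chart[OF c])
    moreover have "frechet_derivative \<phi> (at p) = f1 p" by (rule frechet_derivative_at[OF f1[OF pU], symmetric])
    ultimately show "g c p u v = g d (\<phi> p) (f1 p u) (f1 p v)" "\<phi> p \<in> cdom d"
      using g_transition[OF c d y(1-3), of u v] y by (auto simp: \<phi>_def)
  qed
  have xc: "isCont x s" if "s \<in> T" for s
    using has_vector_derivative_continuous[OF V[OF that]] by (simp add: x_def[abs_def] comp_def)
  have cx: "continuous_on T x" using xc by (simp add: continuous_at_imp_continuous_on)
  define T' where "T' = T \<inter> x -` U"
  have oT': "open T'" unfolding T'_def by (rule continuous_open_preimage[OF cx T(1) oU])
  have tT': "t \<in> T'" using T(2) in_c[OF T(2)] td by (auto simp: T'_def x_def U_def)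
  have xU: "x s \<in> U" if "s \<in> T'" for s using that by (simp add: T'_def)
  have y: "snd d (\<gamma> s) = \<phi> (x s)" if "s \<in> T'" for s
    using that in_c[of s] by (simp add: T'_def \<phi>_def x_def chart_inv_chart[OF c])
  have dx: "(x has_vector_derivative V s) (at s)" if "s \<in> T'" for s
    using V[of s] that by (simp add: T'_def x_def[abs_def] comp_def)
  have dy: "((snd d \<circ> \<gamma>) has_vector_derivative f1 (x s) (V s)) (at s)" if s: "s \<in> T'" for s
  proof -
    have "(\<phi> \<circ> x has_vector_derivative f1 (x s) (V s)) (at s)"
      using vector_derivative_diff_chain_within[OF dx[OF s] has_derivative_at_withinI[OF f1[OF xU[OF s]]]] .
    then show ?thesis by (rule has_vector_derivative_transform_within_open[OF _ oT' s]) (simp add: y)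
  qed
  have vd: "chart_velocity d \<gamma> s = f1 (x s) (V s)" if "s \<in> T'" for s
    by (rule vector_derivative_at[OF dy[OF that]])
  define p where "p = x t"
  define v where "v = V t"
  define a where "a = - Chr c p v v"
  define W where "W = f1 p v"
  have pU: "p \<in> U" using xU[OF tT'] by (simp add: p_def)
  have pc: "p \<in> cdom c" using pU Uc by blast
  note qd = \<phi>d[OF pU]
  have "((\<lambda>s. f1 (x s) (V s)) has_vector_derivative f1 p a + f2 p v v) (at t)"
  proof -
    have 1: "((\<lambda>s. f1 (x s)) has_vector_derivative f2 p v) (at t)"
      using vector_derivative_diff_chain_within[OF dx[OF tT'] has_derivative_at_withinI[OF f2[OF xU[OF tT']]]]
      by (simp add: comp_def p_def v_def)
    have 2: "(V has_vector_derivative a) (at t)" using V' by (simp add: a_def p_def v_def x_def)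
    show ?thesis using blinfun.has_vector_derivative[OF 1 2] by (simp add: p_def v_def)
  qed
  then have dy2: "((\<lambda>s. chart_velocity d \<gamma> s) has_vector_derivative f1 p a + f2 p v v) (at t)"
    by (rule has_vector_derivative_transform_within_open[OF _ oT' tT']) (simp add: vd)
  have sym2: "f2 p h k = f2 p k h" for h k
  proof -
    obtain r where "r > 0" "ball p r \<subseteq> U" using oU pU openE by blast
    then show ?thesis using second_derivative_symmetric[of r p \<phi> f1 "f2 p" h k] f1 f2[OF pU] by blast
  qed
  have dg_trans: "dg c p e u w = dg d (\<phi> p) (f1 p e) (f1 p u) (f1 p w) + g d (\<phi> p) (f2 p e u) (f1 p w) + g d (\<phi> p) (f1 p u) (f2 p e w)" for e u w
  proof -
    have 1: "((\<lambda>q. g d (\<phi> q)) has_derivative (\<lambda>e. dg d (\<phi> p) (f1 p e))) (at p)"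
      using diff_chain_at[OF f1[OF pU] dg[OF d qd]] by (simp add: comp_def)
    have 2: "((\<lambda>q. f1 q u) has_derivative (\<lambda>e. f2 p e u)) (at p)" for u
      by (rule bounded_linear.has_derivative[OF blinfun.bounded_linear_left f2[OF pU]])
    have "((\<lambda>q. g d (\<phi> q) (f1 q u) (f1 q w)) has_derivative
       (\<lambda>e. g d (\<phi> p) (f1 p u) (f2 p e w) + (g d (\<phi> p) (f2 p e u) + dg d (\<phi> p) (f1 p e) (f1 p u)) (f1 p w))) (at p)"
      by (rule blinfun.FDERIV[OF blinfun.FDERIV[OF 1 2] 2])
    then have *: "((\<lambda>q. g c q u w) has_derivative
       (\<lambda>e. g d (\<phi> p) (f1 p u) (f2 p e w) + (g d (\<phi> p) (f2 p e u) + dg d (\<phi> p) (f1 p e) (f1 p u)) (f1 p w))) (at p)"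
      by (rule has_derivative_transform_within_open[OF _ oU pU]) (simp add: gd)
    have "((\<lambda>q. g c q u w) has_derivative (\<lambda>e. dg c p e u w)) (at p)"
      by (intro bounded_linear.has_derivative[OF blinfun.bounded_linear_left] dg[OF c pc])
    from has_derivative_unique[OF this *] show ?thesis by (simp add: fun_eq_iff blinfun.bilinear_simps)
  qed
  have surj: "\<exists>w. f1 p w = w'" for w'
  proof -
    have \<gamma>t: "\<gamma> t \<in> fst c" using in_c T(2) by blast
    have pt: "p = snd c (\<gamma> t)" by (simp add: p_def x_def)
    have "dtrans c d (\<gamma> t)
       (dtrans d c (\<gamma> t) w') = w'"
      using transition_derivative_chain[OF d c d td \<gamma>t td, of w'] transition_derivative_self[OF d td] by simp
    moreover have "dtrans c d (\<gamma> t) = f1 p" using frechet_derivative_at[OF f1[OF pU]] by (simp add: \<phi>_def pt)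
    ultimately show ?thesis by metis
  qed
  have "- (f1 p a + f2 p v v) = Chr d (\<phi> p) W W"
  proof (rule christoffel_char(2)[OF d qd])
    fix w'
    obtain w where w: "w' = f1 p w" using surj by metis
    have "g c p (- a) w = (dg c p v v w + dg c p v v w - dg c p w v v) / 2"
      unfolding a_def using christoffel_char(1)[OF c pc] by simp
    moreover have "g c p (- a) w = - g d (\<phi> p) (f1 p a) w'" by (simp add: gd[OF pU] w blinfun.bilinear_simps)
    ultimately have "- g d (\<phi> p) (f1 p a) w' = dg c p v v w - dg c p w v v / 2"
      by (simp add: diff_divide_distrib)
    also have "\<dots> = dg d (\<phi> p) W W w' + g d (\<phi> p) (f2 p v v) w' + g d (\<phi> p) W (f2 p v w)
       - (dg d (\<phi> p) w' W W + g d (\<phi> p) (f2 p w v) W + g d (\<phi> p) W (f2 p w v)) / 2"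
      unfolding dg_trans W_def w by (rule refl)
    also have "g d (\<phi> p) (f2 p w v) W = g d (\<phi> p) W (f2 p v w)" using g_sym[OF d qd] sym2 by metis
    also have "g d (\<phi> p) W (f2 p w v) = g d (\<phi> p) W (f2 p v w)" using sym2 by metis
    finally have fin: "- g d (\<phi> p) (f1 p a) w' = dg d (\<phi> p) W W w' + g d (\<phi> p) (f2 p v v) w' + g d (\<phi> p) W (f2 p v w)
       - (dg d (\<phi> p) w' W W + g d (\<phi> p) W (f2 p v w) + g d (\<phi> p) W (f2 p v w)) / 2" .
    have arith: "- (X + Q) = (P + P - D) / 2" if "- X = P + Q + R - (D + R + R) / 2" for X P Q R D :: real
      using that by (simp add: field_simps)
    show "g d (\<phi> p) (- (f1 p a + f2 p v v)) w' = (dg d (\<phi> p) W W w' + dg d (\<phi> p) W W w' - dg d (\<phi> p) w' W W) / 2"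
      using arith[OF fin] by (simp add: blinfun.bilinear_simps)
  qed
  then have acc: "f1 p a + f2 p v v = - Chr d (\<phi> p) W W" by (metis minus_minus)
  have vt: "chart_velocity d \<gamma> t = W" using vd[OF tT'] by (simp add: W_def p_def v_def)
  have yt: "snd d (\<gamma> t) = \<phi> p" using y[OF tT'] by (simp add: p_def)
  show "((snd d \<circ> \<gamma>) has_vector_derivative chart_velocity d \<gamma> t) (at t) \<and>
     ((\<lambda>s. chart_velocity d \<gamma> s) has_vector_derivative
        - Chr d (snd d (\<gamma> t)) (chart_velocity d \<gamma> t) (chart_velocity d \<gamma> t)) (at t)"
    unfolding vt yt using dy[OF tT'] dy2 acc by (simp add: W_def p_def v_def)
qed

lemma geo_at_cong:
  assumes T: "open T" "t \<in> T" and eq: "\<And>s. s \<in> T \<Longrightarrow> \<gamma> s = \<eta> s" and g: "geo_at \<gamma> t"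
  shows "geo_at \<eta> t"
proof -
  have vd: "chart_velocity c \<gamma> s = vector_derivative (snd c \<circ> \<eta>) (at s)" if "s \<in> T" for s and c :: "('m, 'e) chart"
    using eq by (intro vector_derivative_cong_near[OF T(1) that]) simp
  show ?thesis unfolding geo_at_def
  proof (intro ballI impI)
    fix c assume c: "c \<in> A" "\<eta> t \<in> fst c"
    then have *: "((snd c \<circ> \<gamma>) has_vector_derivative chart_velocity c \<gamma> t) (at t)"
     "((\<lambda>s. chart_velocity c \<gamma> s) has_vector_derivative
        - Chr c (snd c (\<gamma> t)) (chart_velocity c \<gamma> t) (chart_velocity c \<gamma> t)) (at t)"
      using g eq[OF T(2)] unfolding geo_at_def by auto
    have "((snd c \<circ> \<eta>) has_vector_derivative vector_derivative (snd c \<circ> \<eta>) (at t)) (at t)"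
      using has_vector_derivative_transform_within_open[OF *(1) T, of "snd c \<circ> \<eta>"] vd[OF T(2), of c] eq by simp
    moreover have "((\<lambda>s. vector_derivative (snd c \<circ> \<eta>) (at s)) has_vector_derivative
        - Chr c (snd c (\<eta> t)) (vector_derivative (snd c \<circ> \<eta>) (at t)) (vector_derivative (snd c \<circ> \<eta>) (at t))) (at t)"
      using has_vector_derivative_transform_within_open[OF *(2) T, of "\<lambda>s. vector_derivative (snd c \<circ> \<eta>) (at s)"]
        vd[OF T(2), of c] eq[OF T(2)] vd[of _ c] by simp
    ultimately show "((snd c \<circ> \<eta>) has_vector_derivative vector_derivative (snd c \<circ> \<eta>) (at t)) (at t) \<and>
       ((\<lambda>s. vector_derivative (snd c \<circ> \<eta>) (at s)) has_vector_derivative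
        - Chr c (snd c (\<eta> t)) (vector_derivative (snd c \<circ> \<eta>) (at t)) (vector_derivative (snd c \<circ> \<eta>) (at t))) (at t)"
      by blast
  qed
qed

end

section \<open>Speed and limit points of geodesics\<close>

lemma isCont_glue:
  fixes f1 f2 :: "real \<Rightarrow> 'a::real_normed_vector"
  assumes l: "\<And>e. e > 0 \<Longrightarrow> \<exists>a<b. \<forall>t\<in>{a<..<b}. norm (f1 t - f2 b) < e"
    and e: "e > 0" and r: "continuous_on {b..b + e} f2"
  shows "isCont (\<lambda>t. if t < b then f1 t else f2 t) b" unfolding continuous_at_eps_delta
proof (intro allI impI)
  fix d :: real assume d: "d > 0"
  obtain a where a: "a < b" "\<And>t. t \<in> {a<..<b} \<Longrightarrow> norm (f1 t - f2 b) < d" using l[OF d] by blast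
  obtain d2 where d2: "d2 > 0" "\<And>t. t \<in> {b..b + e} \<Longrightarrow> dist t b < d2 \<Longrightarrow> dist (f2 t) (f2 b) < d"
    using r d e unfolding continuous_on_iff by (metis atLeastAtMost_iff add_increasing2 less_imp_le order_refl)
  show "\<exists>da>0. \<forall>x'. dist x' b < da \<longrightarrow> dist (if x' < b then f1 x' else f2 x') (if b < b then f1 b else f2 b) < d"
  proof (intro exI[of _ "min (b - a) (min d2 e)"] conjI allI impI)
    fix t assume t: "dist t b < min (b - a) (min d2 e)"
    show "dist (if t < b then f1 t else f2 t) (if b < b then f1 b else f2 b) < d"
      using a(2)[of t] d2(2)[of t] t by (auto simp: dist_norm)
  qed (use a d2 e in auto)
qed

context strong_riem
begin

lemma dist_triangle_less:
  assumes "dist\<^sub>G x y < ennreal r" "dist\<^sub>G y z \<le> ennreal s" "0 \<le> s"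
  shows "dist\<^sub>G x z < ennreal (r + s)"
proof -
  obtain q where q: "dist\<^sub>G x y = ennreal q" "0 \<le> q" using assms(1) by (cases "dist\<^sub>G x y") auto
  have "dist\<^sub>G x z \<le> ennreal q + ennreal s"
    using dist_triangle[of x z y] assms(2) unfolding q(1) by (meson add_left_mono order_trans)
  also have "\<dots> = ennreal (q + s)" using q assms(3) by simp
  also have "\<dots> < ennreal (r + s)" using assms q by (intro ennreal_lessI) (auto simp: ennreal_less_iff)
  finally show ?thesis .
qed

lemma geo_at_regular: "geo_at \<gamma> t \<Longrightarrow> isCont \<gamma> t \<Longrightarrow> regular_at \<gamma> t"
  unfolding geo_at_def regular_at_def using ex_chart[of "\<gamma> t"] by blast

text \<open>
  The derivative of \<open>g (V, V)\<close> is
  \<open>D\<^sub>V g (V, V) - 2 g (\<Gamma> (V, V), V)\<close>, which vanishes by the Koszul formula.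
\<close>

lemma geodesic_energy_derivative:
  assumes g: "geodesic_on A S G I \<gamma>" and I: "open I" and t: "t \<in> I"
  shows "((\<lambda>s. G (\<gamma> s) (velocity A UNIV \<gamma> s) (velocity A UNIV \<gamma> s)) has_vector_derivative 0) (at t)"
proof -
  have geo: "\<And>s. s \<in> I \<Longrightarrow> geo_at \<gamma> s" and S: "\<And>s. s \<in> I \<Longrightarrow> \<gamma> s \<in> S" and cont: "continuous_on I \<gamma>"
    using g unfolding geodesic_on_iff by auto
  have ic: "isCont \<gamma> s" if "s \<in> I" for s using cont I that by (simp add: continuous_on_eq_continuous_at)
  obtain c where c: "c \<in> A" "\<gamma> t \<in> fst c" using ex_chart by blast
  define T where "T = I \<inter> \<gamma> -` fst c"
  have T: "open T" "t \<in> T"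
    unfolding T_def using continuous_open_preimage[OF cont I chart_open[OF c(1)]] t c by auto
  define x where "x s = snd c (\<gamma> s)" for s
  define V where "V s = chart_velocity c \<gamma> s" for s
  have xV: "((snd c \<circ> \<gamma>) has_vector_derivative V s) (at s)" if "s \<in> T" for s
    using geo[of s] c(1) that unfolding geo_at_def T_def V_def by blast
  have x: "(x has_vector_derivative V t) (at t)" using xV[OF T(2)] by (simp add: x_def[abs_def] comp_def)
  define a where "a = - Chr c (x t) (V t) (V t)"
  have V: "(V has_vector_derivative a) (at t)"
    using geo[OF t] c unfolding geo_at_def V_def[abs_def] a_def x_def by blast
  have xt: "x t \<in> cdom c" using c S[OF t] by (auto simp: x_def)
  have eq: "G (\<gamma> s) (velocity A UNIV \<gamma> s) (velocity A UNIV \<gamma> s) = g c (x s) (V s) (V s)" if s: "s \<in> T" for s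
  proof -
    have sc: "\<gamma> s \<in> fst c" "s \<in> I" using s by (auto simp: T_def)
    have "velocity A UNIV \<gamma> s = tangent A (\<gamma> s) c (V s)"
      by (rule velocity_eq_tangent[OF c(1) sc(1) _ ic[OF sc(2)] xV[OF s]]) simp
    then show ?thesis by (simp add: G_eq_g[OF c(1) sc(1) S[OF sc(2)]] x_def)
  qed
  have "((\<lambda>s. g c (x s)) has_vector_derivative dg c (x t) (V t)) (at t)"
    using vector_derivative_diff_chain_within[OF x has_derivative_at_withinI[OF dg[OF c(1) xt]]] by (simp add: comp_def)
  from blinfun.has_vector_derivative[OF blinfun.has_vector_derivative[OF this V] V]
  have d: "((\<lambda>s. g c (x s) (V s) (V s)) has_vector_derivative
     g c (x t) (V t) a + (g c (x t) a + dg c (x t) (V t) (V t)) (V t)) (at t)" .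
  have "g c (x t) (- a) (V t) = dg c (x t) (V t) (V t) (V t) / 2"
    unfolding a_def using christoffel_char(1)[OF c(1) xt, of "V t" "V t" "V t"] by simp
  then have "g c (x t) (V t) a + (g c (x t) a + dg c (x t) (V t) (V t)) (V t) = 0"
    using g_sym[OF c(1) xt, of "V t" a] by (simp add: blinfun.bilinear_simps field_simps)
  with d have "((\<lambda>s. g c (x s) (V s) (V s)) has_vector_derivative 0) (at t)" by simp
  then show ?thesis by (rule has_vector_derivative_transform_within_open[OF _ T]) (simp add: eq)
qed

lemma geodesic_speed_constant:
  assumes g: "geodesic_on A S G I \<gamma>" and I: "open I" "is_interval I"
  shows "\<exists>\<sigma>\<ge>0. \<forall>t\<in>I. speed A G \<gamma> t = \<sigma>"
proof (cases "I = {}")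
  case False
  then obtain t0 where t0: "t0 \<in> I" by blast
  have "((\<lambda>s. G (\<gamma> s) (velocity A UNIV \<gamma> s) (velocity A UNIV \<gamma> s)) has_derivative (\<lambda>h. 0)) (at t within I)" if "t \<in> I" for t
    using geodesic_energy_derivative[OF g I(1) that] by (auto simp: has_vector_derivative_def intro: has_derivative_at_withinI)
  from has_derivative_zero_constant[OF is_interval_convex[OF I(2)] this]
  obtain E where E: "\<And>t. t \<in> I \<Longrightarrow> G (\<gamma> t) (velocity A UNIV \<gamma> t) (velocity A UNIV \<gamma> t) = E" by blast
  have "isCont \<gamma> t0" "geo_at \<gamma> t0" "\<gamma> t0 \<in> S"
    using g I(1) t0 unfolding geodesic_on_iff by (auto simp: continuous_on_eq_continuous_at)
  then have "0 \<le> speed A G \<gamma> t0" by (intro speed_nonneg geo_at_regular)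
  then have "0 \<le> sqrt E" using E[OF t0] by (simp add: speed_def)
  then show ?thesis using E by (intro exI[of _ "sqrt E"]) (simp add: speed_def)
qed auto

lemma geodesic_C1_path:
  assumes g: "geodesic_on A S G I \<gamma>" and st: "s < t" "{s..t} \<subseteq> I"
  shows "C1_path_on A s t \<gamma>" unfolding C1_path_on_def
proof (intro conjI ballI impI)
  show "continuous_on {s..t} \<gamma>" using g st continuous_on_subset unfolding geodesic_on_iff by blast
  fix c assume c: "c \<in> A"
  have geo: "((snd c \<circ> \<gamma>) has_vector_derivative chart_velocity c \<gamma> u) (at u)"
    "isCont (\<lambda>s. chart_velocity c \<gamma> s) u" if "u \<in> {s..t}" "\<gamma> u \<in> fst c" for u
  proof -
    have "geo_at \<gamma> u" using g st that unfolding geodesic_on_iff by blast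
    then have *: "((snd c \<circ> \<gamma>) has_vector_derivative chart_velocity c \<gamma> u) (at u)"
     "((\<lambda>s. chart_velocity c \<gamma> s) has_vector_derivative
        - Chr c (snd c (\<gamma> u)) (chart_velocity c \<gamma> u) (chart_velocity c \<gamma> u)) (at u)"
      using c that(2) unfolding geo_at_def by blast+
    show "((snd c \<circ> \<gamma>) has_vector_derivative chart_velocity c \<gamma> u) (at u)" by fact
    show "isCont (\<lambda>s. chart_velocity c \<gamma> s) u" using *(2) by (rule has_vector_derivative_continuous)
  qed
  show "(snd c \<circ> \<gamma>) differentiable at u within {s..t}" if "u \<in> {s..t}" "\<gamma> u \<in> fst c" for u
    using geo(1)[OF that] by (meson differentiableI_vector has_vector_derivative_at_within)
  have "continuous_on {u \<in> {s..t}. \<gamma> u \<in> fst c} (\<lambda>s. chart_velocity c \<gamma> s)"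
    using geo(2) by (intro continuous_at_imp_continuous_on) auto
  then show "continuous_on {u \<in> {s..t}. \<gamma> u \<in> fst c} (\<lambda>u. vector_derivative (snd c \<circ> \<gamma>) (at u within {s..t}))"
  proof (rule continuous_on_eq)
    fix u assume "u \<in> {u \<in> {s..t}. \<gamma> u \<in> fst c}"
    then have u: "u \<in> {s..t}" "\<gamma> u \<in> fst c" by auto
    show "chart_velocity c \<gamma> u = vector_derivative (snd c \<circ> \<gamma>) (at u within {s..t})"
      using vector_derivative_at_within_ivl[OF geo(1)[OF u], of s t] u st by simp
  qed
qed

text \<open>Constant speed makes a geodesic Lipschitz for the distance.\<close>

lemma geodesic_dist_le:
  assumes g: "geodesic_on A S G I \<gamma>" and sp: "\<And>t. t \<in> I \<Longrightarrow> speed A G \<gamma> t = \<sigma>" and st: "s < t" "{s..t} \<subseteq> I"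
  shows "dist\<^sub>G (\<gamma> s) (\<gamma> t) \<le> ennreal (\<sigma> * (t - s))"
proof -
  have "pwC1 A s t \<gamma>" unfolding pwC1_def
  proof (intro conjI exI[of _ "{}"] allI impI)
    show "continuous_on {s..t} \<gamma>" using g st continuous_on_subset unfolding geodesic_on_iff by blast
    show "C1_path_on A s' t' \<gamma>" if "s \<le> s' \<and> s' < t' \<and> t' \<le> t \<and> {s'<..<t'} \<inter> {} = {}" for s' t'
      by (rule geodesic_C1_path[OF g]) (use that st in auto)
  qed auto
  moreover have "\<gamma> ` {s..t} \<subseteq> S" using g st unfolding geodesic_on_iff by blast
  ultimately have "dist\<^sub>G (\<gamma> s) (\<gamma> t) \<le> ennreal (integral {s..t} (speed A G \<gamma>))"
    using st(1) by (rule dist_le_length)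
  also have "integral {s..t} (speed A G \<gamma>) = integral {s..t} (\<lambda>_. \<sigma>)"
    by (rule integral_cong) (use sp st in blast)
  also have "\<dots> = \<sigma> * (t - s)" using st by simp
  finally show ?thesis .
qed

text \<open>The geodesic equation as a first-order system for position and velocity in a chart.\<close>

lemma geodesic_field_lipschitz:
  assumes c: "c \<in> A" and p: "p \<in> cdom c"
  shows "\<exists>r>0. \<exists>L. cball p r \<subseteq> cdom c \<and>
    L-lipschitz_on (cball (p, v) r) (\<lambda>z. (snd z, - Chr c (fst z) (snd z) (snd z)))"
proof -
  obtain r0 where r0: "r0 > 0" "ball p r0 \<subseteq> cdom c"
    and ex: "\<And>R. R \<ge> 0 \<Longrightarrow> \<exists>L\<ge>0. \<forall>q\<in>ball p r0. \<forall>q'\<in>ball p r0. \<forall>v w. norm v \<le> R \<longrightarrow> norm w \<le> R \<longrightarrow>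
       norm (Chr c q v v - Chr c q' w w) \<le> L * (norm (q - q') + norm (v - w))"
    using geodesic_field_estimates[OF c p] by blast
  define r where "r = r0 / 2"
  define R where "R = norm v + r"
  have r: "r > 0" "R \<ge> 0" using r0 by (auto simp: r_def R_def)
  obtain L where L: "L \<ge> 0" and \<Gamma>: "\<And>q q' v w. q \<in> ball p r0 \<Longrightarrow> q' \<in> ball p r0 \<Longrightarrow> norm v \<le> R \<Longrightarrow> norm w \<le> R \<Longrightarrow>
       norm (Chr c q v v - Chr c q' w w) \<le> L * (norm (q - q') + norm (v - w))" using ex[OF r(2)] by blast
  have inb: "fst z \<in> ball p r0" "norm (snd z) \<le> R" if "z \<in> cball (p, v) r" for z
  proof -
    have "dist p (fst z) \<le> r" using that dist_fst_le[of "(p, v)" z] by simp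
    then show "fst z \<in> ball p r0" using r0 by (simp add: r_def)
    have "dist v (snd z) \<le> r" using that dist_snd_le[of "(p, v)" z] by simp
    then show "norm (snd z) \<le> R" using norm_triangle_sub[of "snd z" v] by (simp add: R_def dist_norm norm_minus_commute)
  qed
  have "(1 + 2 * L)-lipschitz_on (cball (p, v) r) (\<lambda>z. (snd z, - Chr c (fst z) (snd z) (snd z)))"
  proof (rule lipschitz_onI)
    fix y z assume yz: "y \<in> cball (p, v) r" "z \<in> cball (p, v) r"
    define D where "D = - Chr c (fst y) (snd y) (snd y) - - Chr c (fst z) (snd z) (snd z)"
    have f: "norm (fst y - fst z) \<le> dist y z" "norm (snd y - snd z) \<le> dist y z"
      using dist_fst_le[of y z] dist_snd_le[of y z] by (simp_all add: dist_norm)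
    have "norm D \<le> L * (norm (fst y - fst z) + norm (snd y - snd z))"
      using \<Gamma>[OF inb(1)[OF yz(1)] inb(1)[OF yz(2)] inb(2)[OF yz(1)] inb(2)[OF yz(2)]]
      by (simp add: D_def norm_minus_commute)
    also have "\<dots> \<le> L * (dist y z + dist y z)" using f L by (intro mult_left_mono add_mono) auto
    finally have D: "norm D \<le> 2 * L * dist y z" by simp
    have "dist (snd y, - Chr c (fst y) (snd y) (snd y)) (snd z, - Chr c (fst z) (snd z) (snd z))
       \<le> norm (snd y - snd z) + norm D" using norm_Pair_le[of "snd y - snd z" D] by (simp add: dist_norm D_def)
    also have "\<dots> \<le> (1 + 2 * L) * dist y z" using D f by (simp add: algebra_simps)
    finally show "dist (snd y, - Chr c (fst y) (snd y) (snd y)) (snd z, - Chr c (fst z) (snd z) (snd z))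
       \<le> (1 + 2 * L) * dist y z" .
  qed (use L in simp)
  moreover have "cball p r \<subseteq> cdom c" using r0 by (auto simp: r_def subset_iff)
  ultimately show ?thesis using r(1) by blast
qed

text \<open>The Lipschitz bound makes the geodesic Cauchy at the end of its domain.\<close>

lemma geodesic_limit_point:
  assumes mc: "metrically_complete A S G" and g: "geodesic_on A S G I \<gamma>" and sp: "\<And>t. t \<in> I \<Longrightarrow> speed A G \<gamma> t = \<sigma>"
    and ab: "a < b" "{a..<b} \<subseteq> I" and \<sigma>: "\<sigma> \<ge> 0"
  shows "\<exists>x\<in>S. \<forall>e>0. \<exists>a1\<ge>a. a1 < b \<and> (\<forall>t\<in>{a1<..<b}. dist\<^sub>G x (\<gamma> t) < ennreal e)"
proof -
  define u where "u n = b - (b - a) / (real n + 2)" for n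
  have u: "a \<le> u n" "u n < b" for n
  proof -
    have "(b - a) / (real n + 2) \<le> (b - a) / 1" using ab by (intro divide_left_mono) auto
    then show "a \<le> u n" by (simp add: u_def)
    show "u n < b" using ab by (simp add: u_def)
  qed
  have ul: "u \<longlonglongrightarrow> b"
  proof -
    have "(\<lambda>n. b - (b - a) * inverse (real (n + 2))) \<longlonglongrightarrow> b - (b - a) * 0"
      by (intro tendsto_intros LIMSEQ_ignore_initial_segment[OF lim_inverse_n])
    then show ?thesis by (simp add: u_def[abs_def] divide_inverse add.commute)
  qed
  have d: "dist\<^sub>G (\<gamma> s) (\<gamma> t) \<le> ennreal (\<sigma> * \<bar>t - s\<bar>)" if "s \<in> {a..<b}" "t \<in> {a..<b}" for s t
  proof -
    have *: "dist\<^sub>G (\<gamma> s) (\<gamma> t) \<le> ennreal (\<sigma> * (t - s))" if "s \<in> {a..<b}" "t \<in> {a..<b}" "s < t" for s t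
      by (rule geodesic_dist_le[OF g sp that(3)]) (use that ab in auto)
    have "\<gamma> s \<in> S" using g that ab unfolding geodesic_on_iff by blast
    then show ?thesis using *[OF that] *[OF that(2,1)] dist_commute[of "\<gamma> s" "\<gamma> t"] dist_self
      by (cases s t rule: linorder_cases) simp_all
  qed
  have "\<exists>N. \<forall>m\<ge>N. \<forall>n\<ge>N. dist\<^sub>G (\<gamma> (u m)) (\<gamma> (u n)) < ennreal e" if e: "e > 0" for e
  proof -
    have "e / (\<sigma> + 1) > 0" using e \<sigma> by simp
    then obtain N where N: "\<And>m n. m \<ge> N \<Longrightarrow> n \<ge> N \<Longrightarrow> dist (u m) (u n) < e / (\<sigma> + 1)"
      using LIMSEQ_imp_Cauchy[OF ul] unfolding Cauchy_def by meson
    have "dist\<^sub>G (\<gamma> (u m)) (\<gamma> (u n)) < ennreal e" if mn: "m \<ge> N" "n \<ge> N" for m n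
    proof -
      have "dist\<^sub>G (\<gamma> (u m)) (\<gamma> (u n)) \<le> ennreal (\<sigma> * \<bar>u n - u m\<bar>)" using u by (intro d) auto
      also have "\<dots> < ennreal e"
      proof (rule ennreal_lessI[OF e])
        have "\<bar>u n - u m\<bar> * (\<sigma> + 1) < e" using N[OF mn] \<sigma> by (simp add: dist_real_def pos_less_divide_eq abs_minus_commute)
        moreover have "\<sigma> * \<bar>u n - u m\<bar> \<le> \<bar>u n - u m\<bar> * (\<sigma> + 1)" by (simp add: algebra_simps)
        ultimately show "\<sigma> * \<bar>u n - u m\<bar> < e" by simp
      qed
      finally show ?thesis .
    qed
    then show ?thesis by blast
  qed
  moreover have "\<gamma> (u n) \<in> S" for n
  proof -
    have "u n \<in> I" using u[of n] ab by auto
    then show ?thesis using g unfolding geodesic_on_iff by blast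
  qed
  ultimately obtain x where x: "x \<in> S" "(\<lambda>n. dist\<^sub>G (\<gamma> (u n)) x) \<longlonglongrightarrow> 0"
    using mc[unfolded metrically_complete_def, rule_format, of "\<lambda>n. \<gamma> (u n)"] by blast
  have "\<exists>a1\<ge>a. a1 < b \<and> (\<forall>t\<in>{a1<..<b}. dist\<^sub>G x (\<gamma> t) < ennreal e)" if e: "e > 0" for e
  proof -
    have "e / 2 > 0" using e by simp
    then have ev1: "\<forall>\<^sub>F n in sequentially. dist\<^sub>G (\<gamma> (u n)) x < ennreal (e / 2)" using x(2) unfolding ennreal_tendsto_0_iff by blast
    have ev2: "\<forall>\<^sub>F n in sequentially. dist (u n) b < e / (2 * (\<sigma> + 1))"
      using e \<sigma> by (intro tendstoD[OF ul]) simp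
    obtain n where n: "dist\<^sub>G (\<gamma> (u n)) x < ennreal (e / 2)" "dist (u n) b < e / (2 * (\<sigma> + 1))"
      using eventually_happens[OF eventually_conj[OF ev1 ev2]] by auto
    have "dist\<^sub>G x (\<gamma> t) < ennreal e" if t: "t \<in> {u n<..<b}" for t
    proof -
      have "\<bar>t - u n\<bar> \<le> \<bar>u n - b\<bar>" using t by auto
      then have "\<bar>t - u n\<bar> * (2 * (\<sigma> + 1)) < e"
        using n(2) \<sigma> by (simp add: dist_real_def pos_less_divide_eq) (smt (verit) mult_right_mono)
      moreover define w where "w = \<bar>t - u n\<bar>"
      ultimately have "2 * (\<sigma> * w) + 2 * w < e" by (simp add: algebra_simps)
      moreover have "w \<ge> 0" by (simp add: w_def)
      ultimately have "\<sigma> * w \<le> e / 2" by linarith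
      then have lt: "\<sigma> * \<bar>t - u n\<bar> \<le> e / 2" by (simp only: w_def)
      have "dist\<^sub>G (\<gamma> (u n)) (\<gamma> t) \<le> ennreal (\<sigma> * \<bar>t - u n\<bar>)" using u[of n] t by (intro d) auto
      also have "\<dots> \<le> ennreal (e / 2)" by (rule ennreal_leI[OF lt])
      finally show ?thesis
        using dist_triangle_less[of x "\<gamma> (u n)" "e / 2" "\<gamma> t" "e / 2"] n(1) dist_commute[of x "\<gamma> (u n)"] e by simp
    qed
    then show ?thesis using u[of n] by blast
  qed
  then show ?thesis using x(1) by blast
qed

end

section \<open>Geodesic completeness\<close>

context strong_riem
begin

text \<open>
  Near the limit point \<open>x\<close> the geodesic is in one chart around \<open>x\<close>, where its velocity is
  bounded and its acceleration too, so that position and velocity converge to some \<open>(p, v)\<close>. The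
  solution of the first-order system starting at \<open>(p, v)\<close> continues it.
\<close>

lemma geodesic_extends_right:
  assumes mc: "metrically_complete A S G" and g: "geodesic_on A S G I \<gamma>"
    and I: "open I" "is_interval I" "I \<noteq> {}" "bdd_above I"
  shows "\<exists>J \<eta>. open J \<and> is_interval J \<and> I \<subset> J \<and> geodesic_on A S G J \<eta> \<and> (\<forall>t\<in>I. \<eta> t = \<gamma> t)"
proof -
  define b where "b = Sup I"
  obtain a0 where a0: "a0 \<in> I" using I by blast
  have lt_b: "t < b" if t: "t \<in> I" for t
  proof -
    obtain e where e: "e > 0" "ball t e \<subseteq> I" using I(1) t openE by blast
    then have "t + e / 2 \<in> I" by (auto simp: subset_iff dist_real_def)
    then have "t + e / 2 \<le> b" unfolding b_def using I(4) by (rule cSup_upper)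
    then show ?thesis using e by simp
  qed
  have in_I: "t \<in> I" if t: "a0 \<le> t" "t < b" for t
  proof -
    obtain s where s: "s \<in> I" "t < s" using t(2) I unfolding b_def by (subst (asm) less_cSup_iff) auto
    show ?thesis using I(2) a0 s t unfolding is_interval_1 by (meson less_imp_le)
  qed
  obtain \<sigma> where \<sigma>: "\<sigma> \<ge> 0" "\<And>t. t \<in> I \<Longrightarrow> speed A G \<gamma> t = \<sigma>" using geodesic_speed_constant[OF g I(1,2)] by blast
  obtain x where x: "x \<in> S" and lim: "\<And>e. e > 0 \<Longrightarrow> \<exists>a1\<ge>a0. a1 < b \<and> (\<forall>t\<in>{a1<..<b}. dist\<^sub>G x (\<gamma> t) < ennreal e)"
    using geodesic_limit_point[OF mc g \<sigma>(2) lt_b[OF a0] _ \<sigma>(1)] in_I by force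
  obtain c where c: "c \<in> A" "x \<in> fst c" using ex_chart by blast
  define p where "p = snd c x"
  have p: "p \<in> cdom c" using c x by (auto simp: p_def)
  have near: "\<exists>a1\<ge>a0. a1 < b \<and> (\<forall>t\<in>{a1<..<b}. \<gamma> t \<in> fst c \<and> norm (snd c (\<gamma> t) - p) < e)" if e: "e > 0" for e
  proof -
    obtain \<rho> where \<rho>: "\<rho> > 0" "\<And>y. dist\<^sub>G x y < ennreal \<rho> \<Longrightarrow> y \<in> fst c \<and> norm (snd c y - snd c x) < e"
      using dist_controls_chart[OF c x e] by blast
    obtain a1 where "a1 \<ge> a0" "a1 < b" "\<forall>t\<in>{a1<..<b}. dist\<^sub>G x (\<gamma> t) < ennreal \<rho>" using lim[OF \<rho>(1)] by blast
    then show ?thesis using \<rho>(2) unfolding p_def by (intro exI[of _ a1]) blast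
  qed
  obtain r C where r: "r > 0" and C: "C \<ge> 0" and rsub: "ball p r \<subseteq> cdom c"
    and \<Gamma>: "\<And>q v. q \<in> ball p r \<Longrightarrow> norm (Chr c q v v) \<le> C * (norm v)^2"
    using geodesic_field_estimates[OF c(1) p] by blast
  obtain r3 k where r3: "r3 > 0" and k: "k > 0" and low: "\<And>q v. q \<in> ball p r3 \<Longrightarrow> k * norm v \<le> sqrt (g c q v v)"
    using local_norm_equivalence[OF c(1) p] by blast
  have "min r r3 > 0" using r r3 by simp
  then obtain a where a: "a \<ge> a0" "a < b" and na: "\<And>t. t \<in> {a<..<b} \<Longrightarrow> \<gamma> t \<in> fst c \<and> norm (snd c (\<gamma> t) - p) < min r r3"
    using near by blast
  define X where "X t = snd c (\<gamma> t)" for t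
  define V where "V t = chart_velocity c \<gamma> t" for t
  have tI: "t \<in> I" if "t \<in> {a<..<b}" for t using in_I[of t] that a by auto
  have tS: "\<gamma> t \<in> S" and geo: "geo_at \<gamma> t" and ic: "isCont \<gamma> t" if "t \<in> {a<..<b}" for t
    using g tI[OF that] I(1) unfolding geodesic_on_iff by (auto simp: continuous_on_eq_continuous_at)
  have Xb: "X t \<in> ball p r" "X t \<in> ball p r3" if "t \<in> {a<..<b}" for t
    using na[OF that] by (auto simp: X_def dist_norm norm_minus_commute)
  have dX0: "((snd c \<circ> \<gamma>) has_vector_derivative V t) (at t)" if "t \<in> {a<..<b}" for t
    using geo[OF that] na[OF that] c(1) unfolding geo_at_def V_def by blast
  have dX: "(X has_vector_derivative V t) (at t)" if "t \<in> {a<..<b}" for t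
    using dX0[OF that] by (simp add: X_def[abs_def] comp_def)
  have dV: "(V has_vector_derivative - Chr c (X t) (V t) (V t)) (at t)" if "t \<in> {a<..<b}" for t
    using geo[OF that] na[OF that] c(1) unfolding geo_at_def V_def[abs_def] X_def by blast
  \<comment> \<open>Speed \<open>\<sigma>\<close> and coercivity bound the chart velocity.\<close>
  define R where "R = \<sigma> / k"
  have VR: "norm (V t) \<le> R" if t: "t \<in> {a<..<b}" for t
  proof -
    have "velocity A UNIV \<gamma> t = tangent A (\<gamma> t) c (V t)"
      using na[OF t] by (intro velocity_eq_tangent[OF c(1) _ _ ic[OF t] dX0[OF t]]) auto
    then have "\<sigma> = sqrt (g c (X t) (V t) (V t))"
      using \<sigma>(2)[OF tI[OF t]] na[OF t] by (simp add: speed_def G_eq_g[OF c(1) _ tS[OF t]] X_def)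
    then have "k * norm (V t) \<le> \<sigma>" using low[OF Xb(2)[OF t]] by simp
    then show ?thesis using k by (simp add: R_def pos_le_divide_eq mult.commute)
  qed
  have R0: "R \<ge> 0" using \<sigma> k by (simp add: R_def)
  have lipV: "(C * R^2)-lipschitz_on {a<..<b} V"
  proof (rule lipschitz_onI)
    fix s t assume st: "s \<in> {a<..<b}" "t \<in> {a<..<b}"
    have "norm (V s - V t) \<le> (C * R^2) * norm (s - t)"
    proof (rule differentiable_bound[OF convex_real_interval(8) _ _ st])
      fix u assume u: "u \<in> {a<..<b}"
      show "(V has_derivative (\<lambda>h. h *\<^sub>R - Chr c (X u) (V u) (V u))) (at u within {a<..<b})"
        using dV[OF u] by (auto simp: has_vector_derivative_def intro: has_derivative_at_withinI)
      have "norm (Chr c (X u) (V u) (V u)) \<le> C * (norm (V u))^2" by (rule \<Gamma>[OF Xb(1)[OF u]])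
      also have "\<dots> \<le> C * R^2" using C VR[OF u] by (intro mult_left_mono power_mono) auto
      finally have "norm (Chr c (X u) (V u) (V u)) \<le> C * R^2" .
      from mult_left_mono[OF this abs_ge_zero]
      show "onorm (\<lambda>h. h *\<^sub>R - Chr c (X u) (V u) (V u)) \<le> C * R^2" by (intro onorm_le) (simp add: mult.commute)
    qed
    then show "dist (V s) (V t) \<le> (C * R^2) * dist s t" by (simp add: dist_norm)
  qed (use C in simp)
  obtain Vb where Vb: "uniformly_continuous_on (closure {a<..<b}) Vb" "\<And>t. t \<in> {a<..<b} \<Longrightarrow> V t = Vb t"
    using uniformly_continuous_on_extension_on_closure[OF lipschitz_on_uniformly_continuous[OF lipV]] by metis
  define v where "v = Vb b"
  have nearV: "\<exists>a1<b. a1 \<ge> a \<and> (\<forall>t\<in>{a1<..<b}. norm (V t - v) < e)" if e: "e > 0" for e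
  proof -
    have cl: "closure {a<..<b} = {a..b}" using a(2) by simp
    obtain d where d: "d > 0" "\<And>s t. s \<in> {a..b} \<Longrightarrow> t \<in> {a..b} \<Longrightarrow> dist t s < d \<Longrightarrow> dist (Vb t) (Vb s) < e"
      using Vb(1) e unfolding uniformly_continuous_on_def cl by meson
    show ?thesis
    proof (intro exI[of _ "max a (b - d)"] conjI ballI)
      fix t assume t: "t \<in> {max a (b - d)<..<b}"
      then have t': "t \<in> {a<..<b}" by auto
      show "norm (V t - v) < e" using d(2)[of b t] t a(2) unfolding Vb(2)[OF t'] v_def by (auto simp: dist_norm)
    qed (use a d in auto)
  qed
  define F where "F z = (snd z, - Chr c (fst z) (snd z) (snd z))" for z :: "'e \<times> 'e"
  obtain r1 L where r1: "r1 > 0" "cball p r1 \<subseteq> cdom c" and L: "L-lipschitz_on (cball (p, v) r1) F"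
    using geodesic_field_lipschitz[OF c(1) p, of v] unfolding F_def[abs_def] by blast
  obtain e Z where e: "e > 0" and Z0: "Z 0 = (p, v)"
    and Z: "\<And>t. t \<in> {0..e} \<Longrightarrow> Z t \<in> cball (p, v) r1" "\<And>t. t \<in> {0..e} \<Longrightarrow> (Z has_vector_derivative F (Z t)) (at t within {0..e})"
    using picard_hilbert[OF L r1(1)] by blast
  have Zc: "fst (Z t) \<in> cdom c" if "t \<in> {0..e}" for t
  proof -
    have "dist p (fst (Z t)) \<le> r1" using Z(1)[OF that] dist_fst_le[of "(p, v)" "Z t"] by simp
    then show ?thesis using r1(2) by auto
  qed
  define J where "J = {a<..<b + e}"
  define Y where "Y t = (if t < b then (X t, V t) else Z (t - b))" for t
  have Yb: "Y b = (p, v)" by (simp add: Y_def Z0)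
  have dYl: "(Y has_vector_derivative F (Y t)) (at t)" if t: "t \<in> {a<..<b}" for t
  proof -
    have "((\<lambda>t. (X t, V t)) has_vector_derivative F (Y t)) (at t)"
      using has_vector_derivative_Pair[OF dX[OF t] dV[OF t]] t by (simp add: Y_def F_def)
    then show ?thesis
      by (rule has_vector_derivative_transform_within_open[OF _ open_greaterThanLessThan t]) (simp add: Y_def)
  qed
  have dYr: "(Y has_vector_derivative F (Y t)) (at t)" if t: "t \<in> {b<..<b + e}" for t
  proof -
    have "(Z has_vector_derivative F (Z (t - b))) (at (t - b))"
      using Z(2)[of "t - b"] t at_within_Icc_at[of 0 "t - b" e] by auto
    moreover have "((\<lambda>t. t - b) has_vector_derivative 1) (at t)" by (auto intro!: derivative_eq_intros)
    ultimately have "(Z \<circ> (\<lambda>t. t - b) has_vector_derivative 1 *\<^sub>R F (Z (t - b))) (at t)"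
      by (intro vector_diff_chain_at)
    then have "((\<lambda>t. Z (t - b)) has_vector_derivative F (Y t)) (at t)" using t by (simp add: comp_def Y_def)
    then show ?thesis
      by (rule has_vector_derivative_transform_within_open[OF _ open_greaterThanLessThan t]) (simp add: Y_def)
  qed
  have contY: "isCont Y b" unfolding Y_def[abs_def]
  proof (rule isCont_glue[OF _ e])
    show "continuous_on {b..b + e} (\<lambda>t. Z (t - b))"
    proof (rule continuous_on_compose2[of "{0..e}" Z])
      show "continuous_on {0..e} Z"
        unfolding continuous_on_eq_continuous_within by (intro ballI has_vector_derivative_continuous[OF Z(2)])
    qed (auto intro!: continuous_intros)
    fix d :: real assume d: "d > 0"
    obtain a1 where a1: "a1 < b" "\<And>t. t \<in> {a1<..<b} \<Longrightarrow> norm (X t - p) < d / 2"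
      using near[of "d / 2"] d unfolding X_def by auto
    obtain a2 where a2: "a2 < b" "\<And>t. t \<in> {a2<..<b} \<Longrightarrow> norm (V t - v) < d / 2" using nearV[of "d / 2"] d by auto
    show "\<exists>a<b. \<forall>t\<in>{a<..<b}. norm ((X t, V t) - Z (b - b)) < d"
    proof (intro exI[of _ "max a1 a2"] conjI ballI)
      fix t assume t: "t \<in> {max a1 a2<..<b}"
      have "norm (X t - p, V t - v) \<le> norm (X t - p) + norm (V t - v)" by (rule norm_Pair_le)
      also have "\<dots> < d" using a1(2)[of t] a2(2)[of t] t by auto
      finally show "norm ((X t, V t) - Z (b - b)) < d" by (simp add: Z0)
    qed (use a1 a2 in auto)
  qed
  have "(p, v) \<in> interior (cball (p, v) r1)"
    using interior_maximal[OF ball_subset_cball open_ball, of "(p, v)" r1] r1(1) by auto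
  then have "isCont F (p, v)" by (rule continuous_on_interior[OF lipschitz_on_continuous_on[OF L]])
  then have contFY: "isCont (\<lambda>t. F (Y t)) b" using contY by (intro isCont_o2[of b Y F]) (simp_all add: Yb)
  have dYb: "(Y has_vector_derivative F (Y b)) (at b)"
  proof (rule has_vector_derivative_at_removable[OF _ _ contY contFY])
    show "0 < min (b - a) e" using a e by simp
    show "(Y has_vector_derivative F (Y t)) (at t)" if "\<bar>t - b\<bar> < min (b - a) e" "t \<noteq> b" for t
      using that dYl[of t] dYr[of t] by (cases "t < b") auto
  qed
  have dY: "(Y has_vector_derivative F (Y t)) (at t)" if "t \<in> J" for t
    using that dYl[of t] dYr[of t] dYb unfolding J_def by (cases t b rule: linorder_cases) auto
  define \<eta> where "\<eta> t = (if t < b then \<gamma> t else chart_inv c (fst (Z (t - b))))" for t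
  have \<eta>J: "\<eta> t \<in> fst c \<and> \<eta> t \<in> S \<and> snd c (\<eta> t) = fst (Y t)" if t: "t \<in> J" for t
  proof (cases "t < b")
    case True
    then have "t \<in> {a<..<b}" using t by (simp add: J_def)
    then show ?thesis using True na tS by (auto simp: \<eta>_def Y_def X_def)
  next
    case False
    then have "t - b \<in> {0..e}" using t by (simp add: J_def)
    from Zc[OF this] show ?thesis using False by (auto simp: \<eta>_def Y_def chart_inv_chart[OF c(1)])
  qed
  have \<eta>I: "\<eta> t = \<gamma> t" if "t \<in> I" for t using lt_b[OF that] by (simp add: \<eta>_def)
  have oJ: "open J" by (simp add: J_def)
  have geoJ: "geo_at \<eta> t" if t: "t \<in> J" for t
  proof (rule geo_at_if_geodesic_in_chart[OF c(1) oJ t])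
    show "\<eta> s \<in> fst c \<and> \<eta> s \<in> S" if "s \<in> J" for s using \<eta>J[OF that] by blast
    show "((snd c \<circ> \<eta>) has_vector_derivative snd (Y s)) (at s)" if s: "s \<in> J" for s
    proof -
      have "((\<lambda>t. fst (Y t)) has_vector_derivative snd (Y s)) (at s)"
        using bounded_linear.has_vector_derivative[OF bounded_linear_fst dY[OF s]] by (simp add: F_def)
      then show ?thesis by (rule has_vector_derivative_transform_within_open[OF _ oJ s]) (simp add: \<eta>J)
    qed
    show "((\<lambda>s. snd (Y s)) has_vector_derivative - Chr c (snd c (\<eta> t)) (snd (Y t)) (snd (Y t))) (at t)"
      using bounded_linear.has_vector_derivative[OF bounded_linear_snd dY[OF t]] \<eta>J[OF t] by (simp add: F_def)
  qed
  have geoI: "geo_at \<eta> t" if t: "t \<in> I" for t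
  proof (rule geo_at_cong[OF I(1) t])
    show "geo_at \<gamma> t" using g t unfolding geodesic_on_iff by blast
  qed (simp add: \<eta>I)
  have "continuous_on I \<gamma>" using g unfolding geodesic_on_iff by blast
  then have "continuous_on I \<eta>" by (rule continuous_on_eq) (simp add: \<eta>I)
  moreover have "continuous_on J \<eta>"
  proof -
    have "continuous_on J Y"
      using dY by (intro continuous_at_imp_continuous_on) (auto intro: has_vector_derivative_continuous)
    then have "continuous_on J (\<lambda>t. chart_inv c (fst (Y t)))"
    proof (intro continuous_on_compose2[OF chart_inv_continuous[OF c(1)]] continuous_intros image_subsetI)
      fix t assume "t \<in> J"
      from \<eta>J[OF this] show "fst (Y t) \<in> snd c ` fst c" by (intro image_eqI[of _ _ "\<eta> t"]) simp_all
    qed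
    then show ?thesis
    proof (rule continuous_on_eq)
      fix t assume "t \<in> J"
      from \<eta>J[OF this] show "chart_inv c (fst (Y t)) = \<eta> t" using chart_inv_chart[OF c(1), of "\<eta> t"] by simp
    qed
  qed
  ultimately have "continuous_on (I \<union> J) \<eta>" by (rule continuous_on_open_Un[OF I(1) oJ])
  moreover have "\<eta> ` (I \<union> J) \<subseteq> S"
  proof (rule image_subsetI)
    fix t assume "t \<in> I \<union> J"
    then show "\<eta> t \<in> S"
    proof
      assume t: "t \<in> I"
      then have "\<gamma> t \<in> S" using g unfolding geodesic_on_iff by blast
      then show ?thesis using \<eta>I[OF t] by simp
    next
      assume "t \<in> J" then show ?thesis using \<eta>J by blast
    qed
  qed
  ultimately have "geodesic_on A S G (I \<union> J) \<eta>" using geoI geoJ unfolding geodesic_on_iff by blast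
  moreover have "is_interval (I \<union> J)"
  proof -
    have "(a + b) / 2 \<in> I \<inter> J" using tI[of "(a + b) / 2"] a e by (auto simp: J_def)
    then have "connected (I \<union> J)" using I(2) by (intro connected_Un) (auto simp: is_interval_connected_1 J_def)
    then show ?thesis by (simp add: is_interval_connected_1)
  qed
  moreover have "b \<in> J" "b \<notin> I" using a e lt_b by (auto simp: J_def)
  then have "I \<subset> I \<union> J" by blast
  ultimately show ?thesis using I(1) oJ \<eta>I by (intro exI[of _ "I \<union> J"] exI[of _ \<eta>]) auto
qed

lemma christoffel_minus:
  assumes "c \<in> A" "p \<in> cdom c"
  shows "Chr c p (- v) (- v) = Chr c p v v"
  by (rule christoffel_char(2)[OF assms, symmetric, where u="- v" and v="- v", THEN sym, symmetric])
     (simp add: christoffel_char(1)[OF assms] blinfun.bilinear_simps)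

text \<open>The geodesic equation is quadratic in the velocity, hence invariant under time reversal.\<close>

lemma geodesic_reverse:
  assumes g: "geodesic_on A S G I \<gamma>" and I: "open I"
  shows "geodesic_on A S G (uminus ` I) (\<lambda>t. \<gamma> (- t))"
proof -
  have cont: "continuous_on I \<gamma>" and S: "\<gamma> ` I \<subseteq> S" and geo: "\<And>t. t \<in> I \<Longrightarrow> geo_at \<gamma> t"
    using g unfolding geodesic_on_iff by auto
  have "continuous_on (uminus ` I) (\<lambda>t. \<gamma> (- t))"
    by (rule continuous_on_compose2[OF cont]) (auto intro!: continuous_intros)
  moreover have "(\<lambda>t. \<gamma> (- t)) ` (uminus ` I) \<subseteq> S" using S by auto
  moreover have "geo_at (\<lambda>t. \<gamma> (- t)) t" if t: "t \<in> uminus ` I" for t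
  proof -
    have tI: "- t \<in> I" using t by auto
    obtain c where c: "c \<in> A" "\<gamma> (- t) \<in> fst c" using ex_chart by blast
    define T0 where "T0 = I \<inter> \<gamma> -` fst c"
    have T0: "open T0" unfolding T0_def by (rule continuous_open_preimage[OF cont I chart_open[OF c(1)]])
    define T where "T = uminus ` T0"
    have T: "open T" unfolding T_def using T0 by (rule open_negations)
    have tT: "t \<in> T" using tI c by (auto simp: T_def T0_def image_iff intro!: bexI[of _ "- t"])
    have mT: "- s \<in> I" "\<gamma> (- s) \<in> fst c" if "s \<in> T" for s using that by (auto simp: T_def T0_def)
    define V where "V s = chart_velocity c \<gamma> s" for s
    have neg: "(uminus has_vector_derivative -1) (at s)" for s :: real
      by (auto intro!: derivative_eq_intros simp: has_vector_derivative_def)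
    show ?thesis
    proof (rule geo_at_if_geodesic_in_chart[OF c(1) T tT])
      show "\<gamma> (- s) \<in> fst c \<and> \<gamma> (- s) \<in> S" if "s \<in> T" for s using mT[OF that] S by blast
      show "((snd c \<circ> (\<lambda>t. \<gamma> (- t))) has_vector_derivative - V (- s)) (at s)" if s: "s \<in> T" for s
      proof -
        have "((snd c \<circ> \<gamma>) has_vector_derivative V (- s)) (at (- s))"
          using geo[OF mT(1)[OF s]] mT(2)[OF s] c(1) unfolding geo_at_def V_def by blast
        from vector_diff_chain_at[OF neg this] show ?thesis by (simp add: comp_def)
      qed
      have "(V has_vector_derivative - Chr c (snd c (\<gamma> (- t))) (V (- t)) (V (- t))) (at (- t))"
        using geo[OF tI] c unfolding geo_at_def V_def[abs_def] by blast
      from has_vector_derivative_minus[OF vector_diff_chain_at[OF neg this]]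
      have "((\<lambda>s. - V (- s)) has_vector_derivative - Chr c (snd c (\<gamma> (- t))) (V (- t)) (V (- t))) (at t)"
        by (simp add: comp_def)
      moreover have "snd c (\<gamma> (- t)) \<in> cdom c" using c S tI by blast
      ultimately show "((\<lambda>s. - V (- s)) has_vector_derivative - Chr c (snd c (\<gamma> (- t))) (- V (- t)) (- V (- t))) (at t)"
        by (simp add: christoffel_minus[OF c(1)])
    qed
  qed
  ultimately show ?thesis unfolding geodesic_on_iff by blast
qed

lemma geodesic_extends_left:
  assumes mc: "metrically_complete A S G" and g: "geodesic_on A S G I \<gamma>"
    and I: "open I" "is_interval I" "I \<noteq> {}" "bdd_below I"
  shows "\<exists>J \<eta>. open J \<and> is_interval J \<and> I \<subset> J \<and> geodesic_on A S G J \<eta> \<and> (\<forall>t\<in>I. \<eta> t = \<gamma> t)"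
proof -
  have neg_interval: "is_interval (uminus ` K)" if "is_interval K" for K :: "real set"
    using that unfolding is_interval_connected_1 by (intro connected_continuous_image continuous_intros)
  have nn: "uminus ` uminus ` K = K" for K :: "real set" by (simp add: image_image)
  have ne: "uminus ` I \<noteq> {}" and bd: "bdd_above (uminus ` I)" using I(3,4) by auto
  obtain J \<eta> where J: "open J" "is_interval J" "uminus ` I \<subset> J" "geodesic_on A S G J \<eta>"
    and eq: "\<forall>t\<in>uminus ` I. \<eta> t = \<gamma> (- t)"
    using geodesic_extends_right[OF mc geodesic_reverse[OF g I(1)] open_negations[OF I(1)] neg_interval[OF I(2)] ne bd]
    by (elim exE conjE) (rule that)
  have "I \<subset> uminus ` J"
  proof -
    have "I \<subseteq> uminus ` J" using image_mono[of "uminus ` I" J uminus] J(3) nn[of I] by auto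
    moreover have "I \<noteq> uminus ` J" using J(3) nn[of J] by auto
    ultimately show ?thesis by blast
  qed
  then show ?thesis using open_negations[OF J(1)] neg_interval[OF J(2)] geodesic_reverse[OF J(4,1)] eq
    by (intro exI[of _ "uminus ` J"] exI[of _ "\<lambda>t. \<eta> (- t)"]) auto
qed

text \<open>
  Zorn's lemma, applied to the graphs of extensions ordered by inclusion: a maximal extension has an unbounded domain
  on both sides.
\<close>

theorem geodesically_complete_if_metrically_complete:
  assumes mc: "metrically_complete A S G"
  shows "geodesically_complete A S G" unfolding geodesically_complete_def
proof (intro allI impI)
  fix I \<gamma> assume "open I \<and> is_interval I \<and> I \<noteq> {} \<and> geodesic_on A S G I \<gamma>"
  then have I: "open I" "is_interval I" "I \<noteq> {}" and g: "geodesic_on A S G I \<gamma>" by auto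
  obtain t0 where t0: "t0 \<in> I" using I by blast
  define ext where "ext J \<eta> \<longleftrightarrow> open J \<and> is_interval J \<and> I \<subseteq> J \<and> geodesic_on A S G J \<eta> \<and> (\<forall>t\<in>I. \<eta> t = \<gamma> t)" for J \<eta>
  \<comment> \<open>Graphs make extension of partially defined geodesics an inclusion of sets.\<close>
  define gr where "gr J \<eta> = (\<lambda>t. (t, \<eta> t)) ` J" for J :: "real set" and \<eta> :: "real \<Rightarrow> 'm"
  define \<A> where "\<A> = {gr J \<eta> | J \<eta>. ext J \<eta>}"
  have grD: "(t, y) \<in> gr J \<eta> \<longleftrightarrow> t \<in> J \<and> y = \<eta> t" for t y J \<eta> by (auto simp: gr_def)
  have "\<exists>M\<in>\<A>. \<forall>X\<in>\<A>. M \<subseteq> X \<longrightarrow> X = M"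
  proof (rule subset_Zorn_nonempty)
    show "\<A> \<noteq> {}" using I g unfolding \<A>_def ext_def by blast
    fix \<C> assume ne: "\<C> \<noteq> {}" and ch: "subset.chain \<A> \<C>"
    have mem: "\<exists>J \<eta>. F = gr J \<eta> \<and> ext J \<eta>" if "F \<in> \<C>" for F
      using ch that unfolding subset.chain_def \<A>_def by blast
    define J where "J = fst ` \<Union>\<C>"
    define \<eta> where "\<eta> t = (SOME y. (t, y) \<in> \<Union>\<C>)" for t
    have JD: "\<exists>F\<in>\<C>. \<exists>y. (t, y) \<in> F" if "t \<in> J" for t
    proof -
      obtain z where z: "t = fst z" "z \<in> \<Union>\<C>" using \<open>t \<in> J\<close> unfolding J_def by (rule imageE)
      obtain F where "F \<in> \<C>" "z \<in> F" using z(2) by (rule UnionE)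
      then show ?thesis using z(1) by (intro bexI[of _ F] exI[of _ "snd z"]) simp_all
    qed
    have uniq: "y = z" if y: "(t, y) \<in> \<Union>\<C>" "(t, z) \<in> \<Union>\<C>" for t y z
    proof -
      obtain F1 F2 where F: "F1 \<in> \<C>" "F2 \<in> \<C>" "(t, y) \<in> F1" "(t, z) \<in> F2" using y by blast
      then have "F1 \<subseteq> F2 \<or> F2 \<subseteq> F1" using ch unfolding subset.chain_def by blast
      then obtain F where "F \<in> \<C>" "(t, y) \<in> F" "(t, z) \<in> F" using F by blast
      obtain J' \<eta>' where "F = gr J' \<eta>'" using mem[OF \<open>F \<in> \<C>\<close>] by blast
      then show ?thesis using \<open>(t, y) \<in> F\<close> \<open>(t, z) \<in> F\<close> by (simp add: grD)
    qed
    have \<eta>: "\<eta> t = y" if "(t, y) \<in> \<Union>\<C>" for t y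
      unfolding \<eta>_def using uniq[OF _ that] that by (metis (mono_tags) someI)
    have sub: "J' \<subseteq> J" "\<And>t. t \<in> J' \<Longrightarrow> \<eta> t = \<eta>' t" if "gr J' \<eta>' \<in> \<C>" for J' \<eta>'
    proof -
      have in_C: "(t, \<eta>' t) \<in> \<Union>\<C>" if "t \<in> J'" for t by (rule UnionI[OF \<open>gr J' \<eta>' \<in> \<C>\<close>]) (simp add: grD that)
      show "J' \<subseteq> J"
      proof
        fix t assume "t \<in> J'"
        then have "fst (t, \<eta>' t) \<in> J" unfolding J_def by (intro imageI in_C)
        then show "t \<in> J" by simp
      qed
      show "\<eta> t = \<eta>' t" if "t \<in> J'" for t using in_C[OF that] by (rule \<eta>)
    qed
    have cov: "\<exists>J' \<eta>'. gr J' \<eta>' \<in> \<C> \<and> ext J' \<eta>' \<and> t \<in> J'" if "t \<in> J" for t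
    proof -
      obtain F y where F: "F \<in> \<C>" "(t, y) \<in> F" using JD[OF \<open>t \<in> J\<close>] by (elim bexE exE) (rule that)
      obtain J' \<eta>' where J': "F = gr J' \<eta>'" "ext J' \<eta>'" using mem[OF F(1)] by blast
      have "t \<in> J'" using F(2) unfolding J'(1) grD by simp
      then show ?thesis using F(1) J' by (intro exI[of _ J'] exI[of _ \<eta>']) simp
    qed
    define \<J> where "\<J> = {J'. \<exists>\<eta>'. gr J' \<eta>' \<in> \<C> \<and> ext J' \<eta>'}"
    have JU: "J = \<Union>\<J>"
    proof (intro equalityI subsetI)
      show "t \<in> \<Union>\<J>" if "t \<in> J" for t using cov[OF that] unfolding \<J>_def by (elim exE conjE) (rule UnionI, auto)
      show "t \<in> J" if "t \<in> \<Union>\<J>" for t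
        using that unfolding \<J>_def by (elim UnionE CollectE exE conjE) (rule subsetD[OF sub(1)])
    qed
    have oJ: "open J" unfolding JU by (rule open_Union) (auto simp: \<J>_def ext_def)
    have iJ: "is_interval J"
    proof -
      have "connected (\<Union>\<J>)"
        by (rule connected_Union) (use t0 in \<open>auto simp: \<J>_def ext_def is_interval_connected_1\<close>)
      then show ?thesis unfolding JU by (simp add: is_interval_connected_1)
    qed
    obtain F0 where "F0 \<in> \<C>" using ne by blast
    then obtain J0 \<eta>0 where J0: "gr J0 \<eta>0 \<in> \<C>" "ext J0 \<eta>0" using mem by metis
    have IJ: "I \<subseteq> J" using J0 sub(1)[OF J0(1)] unfolding ext_def by blast
    have \<eta>\<gamma>: "\<forall>t\<in>I. \<eta> t = \<gamma> t" using J0 sub(2)[OF J0(1)] unfolding ext_def by (metis subsetD)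
    have loc: "isCont \<eta> t \<and> \<eta> t \<in> S \<and> geo_at \<eta> t" if "t \<in> J" for t
    proof -
      obtain J' \<eta>' where J': "gr J' \<eta>' \<in> \<C>" "ext J' \<eta>'" "t \<in> J'" using cov[OF \<open>t \<in> J\<close>] by blast
      have o: "open J'" and gg: "geodesic_on A S G J' \<eta>'" using J'(2) unfolding ext_def by auto
      have eq: "\<eta>' s = \<eta> s" if "s \<in> J'" for s using sub(2)[OF J'(1) that] by simp
      have "geo_at \<eta>' t" using gg J'(3) unfolding geodesic_on_iff by blast
      then have "geo_at \<eta> t" by (rule geo_at_cong[OF o J'(3) eq, rotated])
      moreover have "continuous_on J' \<eta>'" using gg unfolding geodesic_on_iff by blast
      then have "continuous_on J' \<eta>" by (rule continuous_on_eq) (rule eq)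
      then have "isCont \<eta> t" using o J'(3) by (simp add: continuous_on_eq_continuous_at)
      moreover have "\<eta>' t \<in> S" using gg J'(3) unfolding geodesic_on_iff by blast
      then have "\<eta> t \<in> S" using eq[OF J'(3)] by simp
      ultimately show ?thesis by blast
    qed
    have "geodesic_on A S G J \<eta>"
      unfolding geodesic_on_iff using loc by (auto intro: continuous_at_imp_continuous_on)
    then have "ext J \<eta>" unfolding ext_def using oJ iJ IJ \<eta>\<gamma> by blast
    moreover have "\<Union>\<C> = gr J \<eta>"
    proof (intro set_eqI iffI)
      fix z assume z: "z \<in> \<Union>\<C>"
      then have "fst z \<in> J" unfolding J_def by (rule imageI)
      moreover have "\<eta> (fst z) = snd z" using z by (intro \<eta>) simp
      ultimately have "(fst z, snd z) \<in> gr J \<eta>" unfolding grD by simp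
      then show "z \<in> gr J \<eta>" by (simp only: prod.collapse)
    next
      fix z assume "z \<in> gr J \<eta>"
      then obtain t where t: "t \<in> J" "z = (t, \<eta> t)" by (auto simp: gr_def)
      obtain F y where "F \<in> \<C>" "(t, y) \<in> F" using JD[OF t(1)] by (elim bexE exE) (rule that)
      then have y: "(t, y) \<in> \<Union>\<C>" by (rule UnionI)
      then show "z \<in> \<Union>\<C>" using \<eta>[OF y] t(2) by simp
    qed
    ultimately show "\<Union>\<C> \<in> \<A>" unfolding \<A>_def by (intro CollectI exI[of _ J] exI[of _ \<eta>]) simp
  qed
  then obtain M where M: "M \<in> \<A>" "\<forall>X\<in>\<A>. M \<subseteq> X \<longrightarrow> X = M" by (elim bexE) (rule that)
  obtain J \<eta> where MJ: "M = gr J \<eta>" and J: "ext J \<eta>" using M(1) unfolding \<A>_def by (elim CollectE exE conjE) (rule that)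
  have max: "X = gr J \<eta>" if "X \<in> \<A>" "gr J \<eta> \<subseteq> X" for X using M(2) that unfolding MJ by simp
  have noext: False if "open K" "is_interval K" "J \<subset> K" "geodesic_on A S G K \<zeta>" "\<forall>t\<in>J. \<zeta> t = \<eta> t" for K \<zeta>
  proof -
    have "I \<subseteq> J" "\<forall>t\<in>I. \<eta> t = \<gamma> t" using J unfolding ext_def by simp_all
    then have "I \<subseteq> K" "\<forall>t\<in>I. \<zeta> t = \<gamma> t" using that(3,5) by (auto simp: subset_iff)
    then have "ext K \<zeta>" unfolding ext_def using that by simp
    then have "gr K \<zeta> \<in> \<A>" unfolding \<A>_def by (intro CollectI exI[of _ K] exI[of _ \<zeta>]) simp
    moreover have "gr J \<eta> \<subseteq> gr K \<zeta>"
    proof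
      fix z assume "z \<in> gr J \<eta>"
      then have "(fst z, snd z) \<in> gr J \<eta>" by simp
      then have "(fst z, snd z) \<in> gr K \<zeta>" unfolding grD using that(3,5) by auto
      then show "z \<in> gr K \<zeta>" by simp
    qed
    ultimately have "gr K \<zeta> = gr J \<eta>" by (rule max)
    then have "fst ` gr K \<zeta> = fst ` gr J \<eta>" by simp
    then have "K = J" by (simp add: gr_def image_image)
    then show False using that(3) by simp
  qed
  have Jp: "open J" "is_interval J" "J \<noteq> {}" "geodesic_on A S G J \<eta>" using J t0 unfolding ext_def by auto
  have nb: "\<not> bdd_above J" "\<not> bdd_below J"
  proof -
    show "\<not> bdd_above J"
    proof
      assume "bdd_above J"
      from geodesic_extends_right[OF mc Jp(4,1-3) this] show False by (elim exE conjE) (rule noext)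
    qed
    show "\<not> bdd_below J"
    proof
      assume "bdd_below J"
      from geodesic_extends_left[OF mc Jp(4,1-3) this] show False by (elim exE conjE) (rule noext)
    qed
  qed
  have "J = UNIV"
  proof (rule UNIV_eq_I[symmetric])
    fix t
    obtain s1 where s1: "s1 \<in> J" "t < s1" using nb(1) unfolding bdd_above_def by (meson not_le)
    obtain s2 where s2: "s2 \<in> J" "s2 < t" using nb(2) unfolding bdd_below_def by (meson not_le)
    show "t \<in> J" using Jp(2) s1 s2 unfolding is_interval_1 by (meson less_imp_le)
  qed
  then show "\<exists>\<eta>. geodesic_on A S G UNIV \<eta> \<and> (\<forall>t\<in>I. \<eta> t = \<gamma> t)"
    using J unfolding ext_def by (intro exI[of _ \<eta>]) simp
qed

end

section \<open>Strongly measurable and square-integrable paths\<close>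

abbreviation I01 :: "real measure" where "I01 \<equiv> lebesgue_on {0..1}"

lemma emeasure_I01: "emeasure I01 (space I01) = 1"
proof -
  have "emeasure I01 {0..1} = emeasure lebesgue {0..1::real}" by (rule emeasure_restrict_space) auto
  also have "\<dots> = emeasure lborel {0..1::real}" by simp
  finally show ?thesis by simp
qed

lemma finite_measure_I01: "finite_measure I01" by (rule finite_measureI) (simp only: emeasure_I01, simp)

lemma AE_I01_finite: "finite P \<Longrightarrow> AE t in I01. t \<notin> P"
proof -
  assume "finite P"
  then have "AE t in lebesgue. t \<notin> P"
    by (intro AE_not_in) (simp add: null_sets_completionI finite_imp_null_set_lborel)
  then show ?thesis by (subst AE_restrict_space_iff) (auto elim: eventually_mono)
qed

lemma AE_I01_space: "AE t in I01. t \<in> {0..1::real}" by (metis AE_space space_lebesgue_on)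

lemma borel_measurable_I01_AE:
  fixes f :: "real \<Rightarrow> real"
  assumes f: "f \<in> borel_measurable I01" and ae: "AE t in I01. f t = h t"
  shows "h \<in> borel_measurable I01"
proof -
  have iff: "k \<in> borel_measurable I01 \<longleftrightarrow> (\<lambda>t. indicator {0..1} t *\<^sub>R k t) \<in> borel_measurable lebesgue" for k :: "real \<Rightarrow> real"
    by (rule borel_measurable_restrict_space_iff) simp
  have "AE t in lebesgue. t \<in> {0..1} \<longrightarrow> f t = h t" using ae by (subst (asm) AE_restrict_space_iff) auto
  then have "AE t in lebesgue. indicator {0..1} t *\<^sub>R f t = indicator {0..1} t *\<^sub>R h t"
    by (rule eventually_mono) (auto simp: indicator_def)
  then show ?thesis using f unfolding iff by (rule borel_measurable_AE[rotated])
qed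

lemma borel_measurable_I01_continuous:
  fixes f :: "real \<Rightarrow> real"
  shows "continuous_on {0..1} f \<Longrightarrow> f \<in> borel_measurable I01"
  by (rule continuous_imp_measurable_on_sets_lebesgue) auto

lemma simple_function_caratheodory:
  fixes F :: "real \<Rightarrow> 'b \<Rightarrow> real"
  assumes s: "simple_function I01 s" and F: "\<And>y. (\<lambda>t. F t y) \<in> borel_measurable I01"
  shows "(\<lambda>t. F t (s t)) \<in> borel_measurable I01"
proof -
  have fin: "finite (s ` space I01)" and sets: "\<And>y. s -` {y} \<inter> space I01 \<in> sets I01"
    using s simple_functionD(2)[OF s, of "{_}"] by (simp_all only: simple_function_def)
  have "(\<lambda>t. \<Sum>y\<in>s ` space I01. indicator (s -` {y} \<inter> space I01) t * F t y) \<in> borel_measurable I01"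
    using sets F by (intro borel_measurable_sum borel_measurable_times borel_measurable_indicator) auto
  moreover have "(\<Sum>y\<in>s ` space I01. indicator (s -` {y} \<inter> space I01) t * F t y) = F t (s t)" if "t \<in> space I01" for t
  proof -
    have "(\<Sum>y\<in>s ` space I01. indicator (s -` {y} \<inter> space I01) t * F t y) = (\<Sum>y\<in>s ` space I01. if y = s t then F t y else 0)"
      using that by (intro sum.cong) (auto simp: indicator_def)
    also have "\<dots> = F t (s t)" using fin that by (simp add: sum.delta)
    finally show ?thesis .
  qed
  ultimately show ?thesis by (subst measurable_cong[symmetric]) auto
qed

text \<open>
  The source of all measurability below: inner products, norms, and the speed of a path with respect to a variable
  metric.
\<close>

lemma strongly_measurable_caratheodory:
  fixes F :: "real \<Rightarrow> 'h::real_normed_vector \<Rightarrow> real"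
  assumes u: "strongly_measurable u" and F: "\<And>y. (\<lambda>t. F t y) \<in> borel_measurable I01"
    and c: "\<And>t y. t \<in> {0..1} \<Longrightarrow> isCont (F t) y"
  shows "(\<lambda>t. F t (u t)) \<in> borel_measurable I01"
proof -
  obtain s :: "nat \<Rightarrow> real \<Rightarrow> 'h" where s: "\<And>n. simple_function I01 (s n)" "AE t in I01. (\<lambda>n. s n t) \<longlonglongrightarrow> u t"
    using u unfolding strongly_measurable_def by blast
  have "(\<lambda>t. lim (\<lambda>n. F t (s n t))) \<in> borel_measurable I01"
    by (rule borel_measurable_lim_metric) (rule simple_function_caratheodory[OF s(1) F])
  then show ?thesis
  proof (rule borel_measurable_I01_AE)
    show "AE t in I01. lim (\<lambda>n. F t (s n t)) = F t (u t)" using s(2) AE_I01_space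
    proof eventually_elim
      case (elim t)
      then show ?case using isCont_tendsto_compose[OF c] by (intro limI) blast
    qed
  qed
qed

lemma strongly_measurable_inner_const:
  fixes u :: "real \<Rightarrow> 'h::real_inner"
  shows "strongly_measurable u \<Longrightarrow> (\<lambda>t. u t \<bullet> w) \<in> borel_measurable I01"
  by (rule strongly_measurable_caratheodory[where F="\<lambda>t y. y \<bullet> w"]) (auto intro!: continuous_intros)

lemma strongly_measurable_inner:
  fixes u v :: "real \<Rightarrow> 'h::real_inner"
  assumes "strongly_measurable u" "strongly_measurable v"
  shows "(\<lambda>t. u t \<bullet> v t) \<in> borel_measurable I01"
  by (rule strongly_measurable_caratheodory[OF assms(2), where F="\<lambda>t y. u t \<bullet> y"])
     (auto intro!: continuous_intros strongly_measurable_inner_const assms)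

lemma strongly_measurable_norm:
  fixes u :: "real \<Rightarrow> 'h::real_inner"
  shows "strongly_measurable u \<Longrightarrow> (\<lambda>t. norm (u t)) \<in> borel_measurable I01"
  by (rule strongly_measurable_caratheodory[where F="\<lambda>t y. norm y"]) (auto intro!: continuous_intros)

text \<open>
  Vector-valued, hence not covered by \<open>strongly_measurable_caratheodory\<close>: subtract the approximating
  simple functions.
\<close>

lemma strongly_measurable_diff:
  fixes u v :: "real \<Rightarrow> 'h::real_normed_vector"
  assumes u: "strongly_measurable u" and v: "strongly_measurable v"
  shows "strongly_measurable (\<lambda>t. u t - v t)"
proof -
  obtain s s' :: "nat \<Rightarrow> real \<Rightarrow> 'h" where s: "\<And>n. simple_function I01 (s n)" "AE t in I01. (\<lambda>n. s n t) \<longlonglongrightarrow> u t"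
    and s': "\<And>n. simple_function I01 (s' n)" "AE t in I01. (\<lambda>n. s' n t) \<longlonglongrightarrow> v t"
    using u v unfolding strongly_measurable_def by blast
  have "AE t in I01. (\<lambda>n. s n t - s' n t) \<longlonglongrightarrow> u t - v t" using s(2) s'(2) by eventually_elim (rule tendsto_diff)
  moreover have "simple_function I01 (\<lambda>t. s n t - s' n t)" for n
    by (rule simple_function_compose2[OF s(1) s'(1)])
  ultimately show ?thesis unfolding strongly_measurable_def by (intro exI[of _ "\<lambda>n t. s n t - s' n t"]) simp
qed

lemma simple_function_strongly_measurable: "simple_function I01 s \<Longrightarrow> strongly_measurable s"
  unfolding strongly_measurable_def by (intro exI[of _ "\<lambda>_. s"]) simp

lemma L2_path_integrable:
  fixes u :: "real \<Rightarrow> 'h::real_inner"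
  assumes "L2_path u"
  shows "integrable I01 (\<lambda>t. (norm (u t))^2)" using assms strongly_measurable_norm[of u] unfolding L2_path_def
  by (intro integrableI_nonneg) auto

lemma L2_pathI:
  fixes u :: "real \<Rightarrow> 'h::real_inner"
  assumes "strongly_measurable u" "integrable I01 (\<lambda>t. (norm (u t))^2)"
  shows "L2_path u" using assms unfolding L2_path_def by (simp add: nn_integral_eq_integral)

lemma L2_inner_integrable:
  fixes u v :: "real \<Rightarrow> 'h::real_inner"
  assumes u: "L2_path u" and v: "L2_path v"
  shows "integrable I01 (\<lambda>t. u t \<bullet> v t)"
proof (rule Bochner_Integration.integrable_bound)
  show "integrable I01 (\<lambda>t. (norm (u t))^2 + (norm (v t))^2)"
    by (intro Bochner_Integration.integrable_add L2_path_integrable u v)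
  show "(\<lambda>t. u t \<bullet> v t) \<in> borel_measurable I01"
    using u v by (auto simp: L2_path_def intro: strongly_measurable_inner)
  show "AE t in I01. norm (u t \<bullet> v t) \<le> norm ((norm (u t))^2 + (norm (v t))^2)"
  proof (intro always_eventually allI)
    fix t
    have "2 * (norm (u t) * norm (v t)) \<le> (norm (u t))^2 + (norm (v t))^2"
      using sum_squares_bound[of "norm (u t)" "norm (v t)"] by simp
    moreover have "0 \<le> norm (u t) * norm (v t)" by simp
    ultimately show "norm (u t \<bullet> v t) \<le> norm ((norm (u t))^2 + (norm (v t))^2)"
      using Cauchy_Schwarz_ineq2[of "u t" "v t"] by (simp only: real_norm_def)
  qed
qed

lemma L2_path_diff:
  fixes u v :: "real \<Rightarrow> 'h::real_inner"
  assumes u: "L2_path u" and v: "L2_path v"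
  shows "L2_path (\<lambda>t. u t - v t)"
proof (rule L2_pathI)
  show "strongly_measurable (\<lambda>t. u t - v t)" using u v by (auto simp: L2_path_def intro: strongly_measurable_diff)
  have "integrable I01 (\<lambda>t. (norm (u t))^2 + (norm (v t))^2 - 2 * (u t \<bullet> v t))"
    by (rule Bochner_Integration.integrable_diff[OF Bochner_Integration.integrable_add[OF L2_path_integrable[OF u] L2_path_integrable[OF v]]
          integrable_mult_right[OF L2_inner_integrable[OF u v]]])
  then show "integrable I01 (\<lambda>t. (norm (u t - v t))^2)"
    by (simp add: power2_norm_eq_inner inner_diff inner_commute algebra_simps)
qed

lemma integrable_I01_const: "integrable I01 (\<lambda>_. c :: real)"
  using finite_measure_I01 by (simp add: finite_measure.integrable_const)

lemma bounded_strongly_measurable_L2: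
  fixes u :: "real \<Rightarrow> 'h::real_inner"
  assumes u: "strongly_measurable u" and b: "\<And>t. t \<in> {0..1} \<Longrightarrow> norm (u t) \<le> B"
  shows "L2_path u"
proof (rule L2_pathI[OF u], rule Bochner_Integration.integrable_bound)
  show "integrable I01 (\<lambda>_. B^2)" by (rule integrable_I01_const)
  show "(\<lambda>t. (norm (u t))^2) \<in> borel_measurable I01" using strongly_measurable_norm[OF u] by simp
  show "AE t in I01. norm ((norm (u t))^2) \<le> norm (B^2)"
    using AE_I01_space by eventually_elim (use b in \<open>simp add: power_mono\<close>)
qed

lemma simple_function_L2:
  fixes s :: "real \<Rightarrow> 'h::real_inner"
  assumes s: "simple_function I01 s"
  shows "L2_path s"
proof -
  have "finite (norm ` s ` space I01)" using s by (simp add: simple_function_def)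
  then have "bdd_above (norm ` s ` space I01)" by (rule bdd_above_finite)
  then obtain B where B: "\<And>x. x \<in> norm ` s ` space I01 \<Longrightarrow> x \<le> B" by (auto simp: bdd_above_def)
  show ?thesis
  proof (rule bounded_strongly_measurable_L2[OF simple_function_strongly_measurable[OF s]])
    show "norm (s t) \<le> B" if "t \<in> {0..1}" for t using that by (intro B) simp
  qed
qed

lemma L2_path_const: "L2_path (\<lambda>_. w :: 'h::real_inner)" by (rule simple_function_L2) simp

lemma simple_function_floor:
  assumes c: "c > 0"
  shows "simple_function I01 (\<lambda>t. \<lfloor>c * t\<rfloor>)" unfolding simple_function_def
proof (intro conjI ballI)
  have "(\<lambda>t. \<lfloor>c * t\<rfloor>) ` space I01 \<subseteq> {0..\<lfloor>c * 1\<rfloor>}"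
  proof (rule image_subsetI)
    fix t assume "t \<in> space I01"
    then have t: "0 \<le> t" "t \<le> 1" by auto
    have "c * t \<le> c * 1" using t c by (intro mult_left_mono) auto
    then have "\<lfloor>c * t\<rfloor> \<le> \<lfloor>c * 1\<rfloor>" by (rule floor_mono)
    then show "\<lfloor>c * t\<rfloor> \<in> {0..\<lfloor>c * 1\<rfloor>}" using t c by simp
  qed
  then show "finite ((\<lambda>t. \<lfloor>c * t\<rfloor>) ` space I01)" by (rule finite_subset) simp
  fix y
  have "(\<lambda>t. \<lfloor>c * t\<rfloor>) -` {y} = {t. real_of_int y \<le> c * t \<and> c * t < real_of_int y + 1}"
    by (auto simp: floor_eq_iff)
  also have "\<dots> \<in> sets borel" by simp
  finally have "(\<lambda>t. \<lfloor>c * t\<rfloor>) -` {y} \<in> sets lebesgue" by (metis sets_completionI_sets sets_lborel)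
  then show "(\<lambda>t. \<lfloor>c * t\<rfloor>) -` {y} \<inter> space I01 \<in> sets I01" by (simp add: sets_restrict_space_iff sets.Int)
qed

text \<open>Approximation by step functions on a partition into \<open>n\<close> cells.\<close>

lemma continuous_strongly_measurable:
  fixes f :: "real \<Rightarrow> 'h::real_normed_vector"
  assumes f: "continuous_on {0..1} f"
  shows "strongly_measurable f"
proof -
  define s where "s n t = f (real_of_int \<lfloor>real (Suc n) * t\<rfloor> / real (Suc n))" for n :: nat and t
  have s: "simple_function I01 (s n)" for n
  proof -
    have "simple_function I01 (\<lambda>t. \<lfloor>real (Suc n) * t\<rfloor>)" by (rule simple_function_floor) simp
    then show ?thesis
      unfolding s_def by (rule simple_function_compose1[where g="\<lambda>i::int. f (real_of_int i / real (Suc n))"])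
  qed
  have conv: "(\<lambda>n. s n t) \<longlonglongrightarrow> f t" if t: "t \<in> {0..1}" for t
  proof -
    have bd: "\<bar>real_of_int \<lfloor>real (Suc n) * t\<rfloor> / real (Suc n) - t\<bar> \<le> 1 / real (Suc n)" for n
    proof -
      have "\<bar>real_of_int \<lfloor>real (Suc n) * t\<rfloor> - real (Suc n) * t\<bar> \<le> 1" by linarith
      then have "\<bar>real_of_int \<lfloor>real (Suc n) * t\<rfloor> - real (Suc n) * t\<bar> / real (Suc n) \<le> 1 / real (Suc n)"
        by (intro divide_right_mono) auto
      moreover have "\<bar>real_of_int \<lfloor>real (Suc n) * t\<rfloor> - real (Suc n) * t\<bar> / real (Suc n) = \<bar>real_of_int \<lfloor>real (Suc n) * t\<rfloor> / real (Suc n) - t\<bar>"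
        by (subst abs_of_pos[of "real (Suc n)", symmetric]) (simp_all only: abs_divide[symmetric] diff_divide_distrib, simp_all)
      ultimately show ?thesis by simp
    qed
    have "(\<lambda>n. real_of_int \<lfloor>real (Suc n) * t\<rfloor> / real (Suc n) - t) \<longlonglongrightarrow> 0"
      by (rule Lim_null_comparison[OF _ LIMSEQ_Suc[OF lim_1_over_n]]) (use bd in simp)
    then have l: "(\<lambda>n. real_of_int \<lfloor>real (Suc n) * t\<rfloor> / real (Suc n)) \<longlonglongrightarrow> t" by (simp add: LIM_zero_iff)
    have inI: "real_of_int \<lfloor>real (Suc n) * t\<rfloor> / real (Suc n) \<in> {0..1}" for n
    proof -
      have "real (Suc n) * t \<le> real (Suc n) * 1" using t by (intro mult_left_mono) auto
      then have "real_of_int \<lfloor>real (Suc n) * t\<rfloor> \<le> real (Suc n)"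
        using of_int_floor_le[of "real (Suc n) * t"] by (simp only: mult_1_right)
      moreover have "0 \<le> real_of_int \<lfloor>real (Suc n) * t\<rfloor>" using t by simp
      ultimately show ?thesis by simp
    qed
    show ?thesis unfolding s_def by (rule continuous_on_tendsto_compose[OF f l t]) (use inI in simp)
  qed
  have "AE t in I01. (\<lambda>n. s n t) \<longlonglongrightarrow> f t" using AE_I01_space by eventually_elim (rule conv)
  then show ?thesis unfolding strongly_measurable_def using s by blast
qed

lemma continuous_L2_path:
  fixes f :: "real \<Rightarrow> 'h::real_inner"
  assumes f: "continuous_on {0..1} f"
  shows "L2_path f"
proof -
  have "compact (f ` {0..1})" using f by (intro compact_continuous_image) auto
  then have "bounded (f ` {0..1})" by (rule compact_imp_bounded)
  then obtain B where B: "\<forall>x\<in>f ` {0..1}. norm x \<le> B" unfolding bounded_iff by (elim exE) (rule that)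
  show ?thesis
  proof (rule bounded_strongly_measurable_L2[OF continuous_strongly_measurable[OF f]])
    show "norm (f t) \<le> B" if "t \<in> {0..1}" for t using that B by simp
  qed
qed

text \<open>The discriminant condition.\<close>

lemma quadratic_nonneg_imp:
  fixes a b p :: real
  assumes *: "\<And>c. 0 \<le> a + 2 * c * p + c^2 * b" and b: "b \<ge> 0"
  shows "p^2 \<le> a * b"
proof (cases "b = 0")
  case True
  have "p = 0"
  proof (rule ccontr)
    assume "p \<noteq> 0"
    then show False using *[of "- (a + 1) / (2 * p)"] True by (simp add: field_simps)
  qed
  then show ?thesis using True by simp
next
  case False
  then have bp: "b > 0" using b by simp
  have "0 \<le> b * (a + 2 * (- p / b) * p + (- p / b)^2 * b)"
    using *[of "- p / b"] bp by (intro mult_nonneg_nonneg) auto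
  also have "\<dots> = a * b - p^2" using bp by (simp add: field_simps power2_eq_square)
  finally show ?thesis by simp
qed

lemma L2_Cauchy_Schwarz:
  fixes u v :: "real \<Rightarrow> 'h::real_inner"
  assumes u: "L2_path u" and v: "L2_path v"
  shows "(\<integral>t. u t \<bullet> v t \<partial>I01)^2 \<le> (\<integral>t. (norm (u t))^2 \<partial>I01) * (\<integral>t. (norm (v t))^2 \<partial>I01)"
proof (rule quadratic_nonneg_imp)
  fix c :: real
  have "0 \<le> (\<integral>t. (norm (u t + c *\<^sub>R v t))^2 \<partial>I01)" by simp
  also have "\<dots> = (\<integral>t. (norm (u t))^2 + 2 * c * (u t \<bullet> v t) + c^2 * (norm (v t))^2 \<partial>I01)"
  proof -
    have "(norm (u t + c *\<^sub>R v t))^2 = (norm (u t))^2 + 2 * c * (u t \<bullet> v t) + c^2 * (norm (v t))^2" for t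
      unfolding power2_norm_eq_inner by (simp add: inner_add_left inner_add_right inner_commute power2_eq_square)
    then show ?thesis by (simp only:)
  qed
  also have "\<dots> = (\<integral>t. (norm (u t))^2 \<partial>I01) + 2 * c * (\<integral>t. u t \<bullet> v t \<partial>I01) + c^2 * (\<integral>t. (norm (v t))^2 \<partial>I01)"
    by (simp add: L2_path_integrable[OF u] L2_path_integrable[OF v] L2_inner_integrable[OF u v])
  finally show "0 \<le> (\<integral>t. (norm (u t))^2 \<partial>I01) + 2 * c * (\<integral>t. u t \<bullet> v t \<partial>I01) + c^2 * (\<integral>t. (norm (v t))^2 \<partial>I01)" .
qed simp

lemma interval_integrals_zero_imp_AE_zero:
  fixes f :: "real \<Rightarrow> real"
  assumes f: "integrable I01 f" and z: "\<And>s. s \<in> {0..1} \<Longrightarrow> integral {s..1} f = 0"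
  shows "AE t in I01. f t = 0"
proof -
  define h where "h t = indicator {0..1} t * f t" for t
  have hi: "integrable lebesgue h" using f unfolding h_def by (subst (asm) integrable_restrict_space) auto
  obtain h' where h': "h' \<in> borel_measurable borel" "AE t in lborel. h t = h' t"
    using completion_ex_borel_measurable_real[of h lborel] borel_measurable_integrable[OF hi] by auto
  have ae: "AE t in lebesgue. h t = h' t" using h'(2) by (rule AE_completion)
  have h'm: "h' \<in> borel_measurable lborel" using h'(1) by simp
  have h'i: "integrable lborel h'"
  proof -
    have "integrable lebesgue h'"
      using integrable_cong_AE[THEN iffD1, OF _ _ ae hi] borel_measurable_integrable[OF hi] h'm by (simp add: measurable_completion)
    then show ?thesis using integrable_completion[OF h'm] by simp
  qed
  have tail: "(\<integral>t. indicator {x<..} t * h' t \<partial>lborel) = 0" for x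
  proof -
    have m: "(\<lambda>t. indicator {x<..} t * h' t) \<in> borel_measurable lborel" using h'm by measurable
    have "(\<integral>t. indicator {x<..} t * h' t \<partial>lborel) = (\<integral>t. indicator {x<..} t * h' t \<partial>lebesgue)"
      by (rule integral_completion[OF m, symmetric])
    also have "\<dots> = (\<integral>t. indicator {max x 0..1} t * f t \<partial>lebesgue)"
    proof (rule integral_cong_AE)
      show "(\<lambda>t. indicator {x<..} t * h' t) \<in> borel_measurable lebesgue" using m by (rule measurable_completion)
      have "(\<lambda>t. indicator {max x 0..1} t * h t) \<in> borel_measurable lebesgue"
        by (intro borel_measurable_times borel_measurable_indicator borel_measurable_integrable[OF hi]) auto
      moreover have "(\<lambda>t. indicator {max x 0..1} t * h t) = (\<lambda>t. indicator {max x 0..1} t * f t)"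
        by (auto simp: h_def fun_eq_iff indicator_def)
      ultimately show "(\<lambda>t. indicator {max x 0..1} t * f t) \<in> borel_measurable lebesgue" by simp
      have "AE t in lebesgue. t \<noteq> x" by (rule AE_completion) (rule AE_lborel_singleton)
      then show "AE t in lebesgue. indicator {x<..} t * h' t = indicator {max x 0..1} t * f t"
        using ae by eventually_elim (auto simp: h_def indicator_def)
    qed
    also have "\<dots> = (\<integral>t. f t \<partial>lebesgue_on {max x 0..1})" by (subst integral_restrict_space) auto
    also have "\<dots> = integral {max x 0..1} f"
      by (rule lebesgue_integral_eq_integral[OF integrable_subinterval[OF f]]) auto
    also have "\<dots> = 0" using z[of "max x 0"] by (cases "x \<le> 1") auto
    finally show ?thesis .
  qed
  define p where "p t = max 0 (h' t)" for t
  define q where "q t = max 0 (- h' t)" for t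
  have pm: "p \<in> borel_measurable lborel" "q \<in> borel_measurable lborel" unfolding p_def q_def using h'm by measurable
  have pi: "integrable lborel p" "integrable lborel q"
    unfolding p_def q_def by (rule Bochner_Integration.integrable_bound[OF h'i]; use h'm in \<open>auto simp: max_def\<close>)+
  have em: "emeasure (density lborel (\<lambda>t. ennreal (k t))) {x<..} = ennreal (\<integral>t. indicator {x<..} t * k t \<partial>lborel)"
    if k: "k \<in> borel_measurable lborel" "integrable lborel k" "\<And>t. 0 \<le> k t" for k :: "real \<Rightarrow> real" and x
  proof -
    have "emeasure (density lborel (\<lambda>t. ennreal (k t))) {x<..} = (\<integral>\<^sup>+t. ennreal (k t) * indicator {x<..} t \<partial>lborel)"
      using k(1) by (subst emeasure_density) auto
    also have "\<dots> = (\<integral>\<^sup>+t. ennreal (indicator {x<..} t * k t) \<partial>lborel)"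
      by (intro nn_integral_cong) (auto simp: indicator_def)
    also have "\<dots> = ennreal (\<integral>t. indicator {x<..} t * k t \<partial>lborel)"
    proof (rule nn_integral_eq_integral)
      have "integrable lborel (\<lambda>t. k t * indicator {x<..} t)" by (rule integrable_real_mult_indicator[OF _ k(2)]) simp
      then show "integrable lborel (\<lambda>t. indicator {x<..} t * k t)" by (simp add: mult.commute)
    qed (use k(3) in \<open>simp add: indicator_def\<close>)
    finally show ?thesis .
  qed
  have "density lborel (\<lambda>t. ennreal (p t)) = density lborel (\<lambda>t. ennreal (q t))"
  proof (rule measure_eqI_lessThan)
    fix x :: real
    have e1: "emeasure (density lborel (\<lambda>t. ennreal (p t))) {x<..} = ennreal (\<integral>t. indicator {x<..} t * p t \<partial>lborel)"
      by (rule em[OF pm(1) pi(1)]) (simp add: p_def)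
    have e2: "emeasure (density lborel (\<lambda>t. ennreal (q t))) {x<..} = ennreal (\<integral>t. indicator {x<..} t * q t \<partial>lborel)"
      by (rule em[OF pm(2) pi(2)]) (simp add: q_def)
    show "emeasure (density lborel (\<lambda>t. ennreal (p t))) {x<..} < \<infinity>" using e1 by simp
    have ii: "integrable lborel (\<lambda>t. indicator {x<..} t * p t)" "integrable lborel (\<lambda>t. indicator {x<..} t * q t)"
      using integrable_real_mult_indicator[OF _ pi(1), of "{x<..}"] integrable_real_mult_indicator[OF _ pi(2), of "{x<..}"]
      by (auto simp: mult.commute)
    have "(\<integral>t. indicator {x<..} t * p t \<partial>lborel) - (\<integral>t. indicator {x<..} t * q t \<partial>lborel)
       = (\<integral>t. indicator {x<..} t * p t - indicator {x<..} t * q t \<partial>lborel)" using ii by simp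
    also have "\<dots> = (\<integral>t. indicator {x<..} t * h' t \<partial>lborel)"
      by (intro Bochner_Integration.integral_cong) (auto simp: p_def q_def indicator_def)
    finally show "emeasure (density lborel (\<lambda>t. ennreal (p t))) {x<..} = emeasure (density lborel (\<lambda>t. ennreal (q t))) {x<..}"
      using tail[of x] e1 e2 by simp
  qed auto
  then have "AE t in lborel. ennreal (p t) = ennreal (q t)"
    using sigma_finite_measure.density_unique_iff[OF sigma_finite_lborel, of "\<lambda>t. ennreal (p t)" "\<lambda>t. ennreal (q t)"] pm by simp
  then have "AE t in lborel. h t = 0" using h'(2)
  proof eventually_elim
    case (elim t)
    then have "p t = q t" by (simp add: p_def q_def)
    then show ?case using elim by (auto simp: p_def q_def max_def split: if_splits)
  qed
  then have "AE t in lebesgue. h t = 0" by (rule AE_completion)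
  then show ?thesis by (subst AE_restrict_space_iff) (auto elim!: eventually_mono simp: h_def)
qed

text \<open>
  Testing with one \<open>w\<close> at a time leaves a null set for each \<open>w\<close>; strong measurability
  reduces the test vectors to the countably many values of the approximating simple functions.
\<close>

lemma strongly_measurable_AE_zero:
  fixes u :: "real \<Rightarrow> 'h::real_inner"
  assumes u: "strongly_measurable u" and z: "\<And>w. AE t in I01. u t \<bullet> w = 0"
  shows "AE t in I01. u t = 0"
proof -
  obtain s :: "nat \<Rightarrow> real \<Rightarrow> 'h" where s: "\<And>n. simple_function I01 (s n)" "AE t in I01. (\<lambda>n. s n t) \<longlonglongrightarrow> u t"
    using u unfolding strongly_measurable_def by blast
  define Z where "Z = (\<Union>n. s n ` space I01)"
  have "countable (s n ` space I01)" for n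
    using s(1)[of n] unfolding simple_function_def by (elim conjE) (rule countable_finite)
  then have Z: "countable Z" unfolding Z_def by (intro countable_UN) auto
  have "AE t in I01. \<forall>w\<in>Z. u t \<bullet> w = 0" using Z z by (simp add: AE_ball_countable)
  with s(2) AE_I01_space show ?thesis
  proof eventually_elim
    case (elim t)
    have "(\<lambda>n. u t \<bullet> s n t) \<longlonglongrightarrow> u t \<bullet> u t" by (intro tendsto_intros elim)
    moreover have "u t \<bullet> s n t = 0" for n using elim by (auto simp: Z_def)
    ultimately have "u t \<bullet> u t = 0" by (simp add: LIMSEQ_const_iff)
    then show ?case by simp
  qed
qed

section \<open>Weak derivatives\<close>

lemma integral_I01:
  fixes f :: "real \<Rightarrow> real"
  assumes "integrable I01 f"
  shows "(\<integral>t. f t \<partial>I01) = integral {0..1} f" "f integrable_on {0..1}"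
  using lebesgue_integral_eq_integral[OF assms] integrable_on_lebesgue_on[OF assms] by auto

lemma integral_I01_indicator:
  fixes f :: "real \<Rightarrow> real"
  assumes f: "integrable I01 f" and st: "0 \<le> s" "t \<le> 1"
  shows "(\<integral>x. indicator {s..t} x * f x \<partial>I01) = integral {s..t} f"
proof -
  have "(\<integral>x. indicator {s..t} x * f x \<partial>I01) = (\<integral>x. indicator {0..1} x *\<^sub>R (indicator {s..t} x * f x) \<partial>lebesgue)"
    by (rule integral_restrict_space) simp
  also have "\<dots> = (\<integral>x. indicator {s..t} x *\<^sub>R f x \<partial>lebesgue)"
    by (intro Bochner_Integration.integral_cong) (use st in \<open>auto simp: indicator_def\<close>)
  also have "\<dots> = (\<integral>x. f x \<partial>lebesgue_on {s..t})" by (rule integral_restrict_space[symmetric]) simp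
  also have "\<dots> = integral {s..t} f"
    by (rule lebesgue_integral_eq_integral[OF integrable_subinterval[OF f]]) (use st in auto)
  finally show ?thesis .
qed

lemma continuous_integrable_I01:
  fixes f :: "real \<Rightarrow> real"
  assumes "continuous_on {0..1} f"
  shows "integrable I01 f" using assms by (rule continuous_imp_integrable_real)

lemma test_functionD:
  assumes "test_function \<phi>"
  shows "(\<phi> has_real_derivative deriv \<phi> t) (at t)" "continuous_on UNIV (deriv \<phi>)" "\<phi> 0 = 0" "\<phi> 1 = 0" "continuous_on T \<phi>"
proof -
  obtain D where D: "\<And>x. (\<phi> has_vector_derivative D x) (at x)" "continuous_on UNIV D"
    using assms unfolding test_function_def C1_differentiable_on_def by auto
  have d: "(\<phi> has_real_derivative D x) (at x)" for x using D(1) by (simp add: has_real_derivative_iff_has_vector_derivative)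
  then have eq: "deriv \<phi> = D" by (auto intro: DERIV_imp_deriv)
  show "(\<phi> has_real_derivative deriv \<phi> t) (at t)" unfolding eq by (rule d)
  show "continuous_on UNIV (deriv \<phi>)" unfolding eq by (rule D(2))
  show "\<phi> 0 = 0" "\<phi> 1 = 0" using assms unfolding test_function_def by force+
  show "continuous_on T \<phi>" using d by (intro continuous_at_imp_continuous_on ballI DERIV_isCont)
qed

lemma bounded_mult_integrable:
  fixes f k :: "real \<Rightarrow> real"
  assumes f: "integrable I01 f" and k: "continuous_on {0..1} k"
  shows "integrable I01 (\<lambda>t. k t * f t)"
proof -
  have "bounded (k ` {0..1})" using k by (intro compact_imp_bounded compact_continuous_image) auto
  then obtain B where B: "\<forall>x\<in>k ` {0..1}. norm x \<le> B" unfolding bounded_iff by (elim exE) (rule that)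
  show ?thesis
  proof (rule Bochner_Integration.integrable_bound)
    show "integrable I01 (\<lambda>t. B * f t)" by (intro integrable_mult_right f)
    show "(\<lambda>t. k t * f t) \<in> borel_measurable I01"
      by (intro borel_measurable_times borel_measurable_I01_continuous k borel_measurable_integrable[OF f])
    show "AE t in I01. norm (k t * f t) \<le> norm (B * f t)" using AE_I01_space
    proof eventually_elim
      case (elim t)
      then have "\<bar>k t\<bar> \<le> B" using B by auto
      then have "\<bar>k t\<bar> * \<bar>f t\<bar> \<le> \<bar>B\<bar> * \<bar>f t\<bar>" by (intro mult_right_mono) auto
      then show ?case by (simp add: abs_mult)
    qed
  qed
qed

lemma L2_inner_const_integrable:
  fixes v :: "real \<Rightarrow> 'h::real_inner"
  shows "L2_path v \<Longrightarrow> integrable I01 (\<lambda>t. v t \<bullet> w)" using L2_inner_integrable[OF _ L2_path_const] .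

text \<open>Integration by parts, for each test vector, with finitely many exceptional points.\<close>

lemma polygonal_weak_derivative:
  fixes f :: "real \<Rightarrow> 'h::real_inner"
  assumes f: "continuous_on {0..1} f" and P: "finite P"
    and d: "\<And>t. t \<in> {0<..<1} - P \<Longrightarrow> (f has_vector_derivative v t) (at t)" and v: "simple_function I01 v"
  shows "has_weak_derivative f v" unfolding has_weak_derivative_def
proof (intro allI impI)
  fix \<phi> :: "real \<Rightarrow> real" and w :: 'h assume \<phi>: "test_function \<phi>"
  note \<phi>' = test_functionD[OF \<phi>]
  have i1: "integrable I01 (\<lambda>t. deriv \<phi> t * (f t \<bullet> w))"
    by (intro continuous_integrable_I01 continuous_intros f continuous_on_subset[OF \<phi>'(2)]) auto
  have i2: "integrable I01 (\<lambda>t. \<phi> t * (v t \<bullet> w))"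
    by (intro bounded_mult_integrable L2_inner_const_integrable simple_function_L2 v \<phi>'(5))
  have "((\<lambda>t. deriv \<phi> t * (f t \<bullet> w) + \<phi> t * (v t \<bullet> w)) has_integral (\<phi> 1 * (f 1 \<bullet> w) - \<phi> 0 * (f 0 \<bullet> w))) {0..1}"
  proof (rule fundamental_theorem_of_calculus_interior_strong[OF P])
    fix t assume t: "t \<in> {0<..<1} - P"
    have 1: "(\<phi> has_vector_derivative deriv \<phi> t) (at t)" using \<phi>'(1) by (simp add: has_real_derivative_iff_has_vector_derivative)
    have 2: "((\<lambda>t. f t \<bullet> w) has_vector_derivative v t \<bullet> w) (at t)"
      by (rule bounded_linear.has_vector_derivative[OF bounded_linear_inner_left d[OF t]])
    show "((\<lambda>t. \<phi> t * (f t \<bullet> w)) has_vector_derivative deriv \<phi> t * (f t \<bullet> w) + \<phi> t * (v t \<bullet> w)) (at t)"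
      using has_vector_derivative_mult[OF 1 2] by (simp add: add.commute)
  qed (auto intro!: continuous_intros f \<phi>'(5))
  then have "integral {0..1} (\<lambda>t. deriv \<phi> t * (f t \<bullet> w) + \<phi> t * (v t \<bullet> w)) = 0"
    using \<phi>'(3,4) by (simp add: integral_unique)
  then have "(\<integral>t. deriv \<phi> t * (f t \<bullet> w) + \<phi> t * (v t \<bullet> w) \<partial>I01) = 0"
    using integral_I01(1)[OF Bochner_Integration.integrable_add[OF i1 i2]] by simp
  then show "(\<integral>t. deriv \<phi> t * (f t \<bullet> w) \<partial>I01) = - (\<integral>t. \<phi> t * (v t \<bullet> w) \<partial>I01)"
    by (simp add: Bochner_Integration.integral_add[OF i1 i2])
qed

lemma H1I: "continuous_on {0..1} f \<Longrightarrow> L2_path v \<Longrightarrow> has_weak_derivative f v \<Longrightarrow> f \<in> H1"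
  unfolding H1_def using continuous_L2_path by blast

lemma weak_deriv:
  assumes "f \<in> H1"
  shows "L2_path (weak_deriv f)" "has_weak_derivative f (weak_deriv f)"
  using assms someI_ex[of "\<lambda>v. L2_path v \<and> has_weak_derivative f v"] unfolding H1_def weak_deriv_def by auto

lemma H1_continuous: "f \<in> H1 \<Longrightarrow> continuous_on {0..1} f" by (simp add: H1_def)

text \<open>
  \<open>cutoff\<close> is a \<open>C\<^sup>1\<close> step from 0 to 1 on \<open>[0,2]\<close>; its derivative
  \<open>hat\<close> has total mass 1. Test functions need only be \<open>C\<^sup>1\<close>, so piecewise quadratic
  ones suffice.
\<close>

definition ramp_sq :: "real \<Rightarrow> real" where "ramp_sq y = (max 0 y)^2 / 2"
definition cutoff :: "real \<Rightarrow> real" where "cutoff y = ramp_sq y - 2 * ramp_sq (y - 1) + ramp_sq (y - 2)"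
definition hat :: "real \<Rightarrow> real" where "hat y = max 0 y - 2 * max 0 (y - 1) + max 0 (y - 2)"

lemma ramp_sq_derivative: "(ramp_sq has_real_derivative max 0 y) (at y)"
proof (cases y "0::real" rule: linorder_cases)
  case less
  have "((\<lambda>_. 0) has_real_derivative 0) (at y)" by (rule DERIV_const)
  then have "(ramp_sq has_real_derivative 0) (at y)"
    by (rule has_field_derivative_transform_within_open[of _ _ _ "{..<0}"]) (use less in \<open>auto simp: ramp_sq_def\<close>)
  then show ?thesis using less by simp
next
  case greater
  have "((\<lambda>y. y^2 / 2) has_real_derivative y) (at y)" by (auto intro!: derivative_eq_intros)
  then have "(ramp_sq has_real_derivative y) (at y)"
    by (rule has_field_derivative_transform_within_open[of _ _ _ "{0<..}"]) (use greater in \<open>auto simp: ramp_sq_def\<close>)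
  then show ?thesis using greater by simp
next
  case equal
  have "(\<lambda>h. (ramp_sq (0 + h) - ramp_sq 0) / h) \<midarrow>0\<rightarrow> 0"
  proof (rule Lim_null_comparison)
    show "((\<lambda>h::real. \<bar>h\<bar>) \<longlongrightarrow> 0) (at 0)" using tendsto_rabs_zero[OF tendsto_ident_at[of 0 UNIV]] .
    show "\<forall>\<^sub>F h in at 0. norm ((ramp_sq (0 + h) - ramp_sq 0) / h) \<le> \<bar>h\<bar>"
    proof (intro always_eventually allI)
      fix h :: real
      have "norm ((ramp_sq (0 + h) - ramp_sq 0) / h) \<le> \<bar>h\<bar> / 2"
        by (cases "h > 0") (auto simp: ramp_sq_def power2_eq_square)
      also have "\<dots> \<le> \<bar>h\<bar>" by simp
      finally show "norm ((ramp_sq (0 + h) - ramp_sq 0) / h) \<le> \<bar>h\<bar>" .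
    qed
  qed
  then show ?thesis using equal by (simp add: DERIV_def)
qed

lemma cutoff_derivative: "(cutoff has_real_derivative hat y) (at y)"
proof -
  have s: "((\<lambda>y. ramp_sq (y - a)) has_real_derivative max 0 (y - a)) (at y)" for a
  proof -
    have 1: "((\<lambda>y. y - a) has_real_derivative 1) (at y)" by (auto intro!: derivative_eq_intros)
    show ?thesis using DERIV_chain'[OF 1 ramp_sq_derivative] by simp
  qed
  have "((\<lambda>y. ramp_sq y - 2 * ramp_sq (y - 1) + ramp_sq (y - 2)) has_real_derivative hat y) (at y)"
    unfolding hat_def by (intro DERIV_add DERIV_diff DERIV_cmult s ramp_sq_derivative)
  then show ?thesis by (simp add: cutoff_def[abs_def])
qed

lemma hat_continuous: "continuous_on T hat" unfolding hat_def by (intro continuous_intros)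
lemma hat_nonneg: "0 \<le> hat y" by (auto simp: hat_def max_def)
lemma cutoff_0: "y \<le> 0 \<Longrightarrow> cutoff y = 0" by (simp add: cutoff_def ramp_sq_def)
lemma cutoff_1: "2 \<le> y \<Longrightarrow> cutoff y = 1" by (simp add: cutoff_def ramp_sq_def power2_eq_square field_simps)
lemma hat_0: "y \<le> 0 \<or> 2 \<le> y \<Longrightarrow> hat y = 0" by (auto simp: hat_def)

lemma cutoff_bound: "\<bar>cutoff y\<bar> \<le> 3"
proof -
  consider "y \<le> 0" | "0 < y" "y < 2" | "2 \<le> y" by linarith
  then show ?thesis
  proof cases
    case 2
    have "(max 0 y)^2 \<le> 2^2" "(max 0 (y - 1))^2 \<le> 1^2" using 2 by (intro power_mono; auto)+
    then have "0 \<le> ramp_sq y" "ramp_sq y \<le> 2" "0 \<le> ramp_sq (y - 1)" "ramp_sq (y - 1) \<le> 1/2"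
      by (auto simp: ramp_sq_def)
    moreover have "ramp_sq (y - 2) = 0" using 2 by (simp add: ramp_sq_def)
    ultimately show ?thesis unfolding cutoff_def by linarith
  qed (auto simp: cutoff_0 cutoff_1)
qed

definition bump :: "real \<Rightarrow> real \<Rightarrow> real \<Rightarrow> real" where
  "bump n s x = n * hat (n * (x - s))"

lemma cutoff_scaled_derivative: "((\<lambda>x. cutoff (n * (x - s))) has_real_derivative bump n s x) (at x)"
proof -
  have 1: "((\<lambda>x. n * (x - s)) has_real_derivative n) (at x)" by (auto intro!: derivative_eq_intros)
  show ?thesis using DERIV_chain'[OF 1 cutoff_derivative] by (simp add: bump_def mult.commute)
qed

lemma bump_continuous: "continuous_on T (bump n s)"
  unfolding bump_def by (intro continuous_intros continuous_on_compose2[OF hat_continuous[of UNIV]]) auto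

lemma bump_approximates_delta:
  assumes U: "continuous_on {0..1} U" and s: "0 \<le> s" "s < 1"
  shows "(\<lambda>k. \<integral>x. bump (real (Suc k)) s x * U x \<partial>I01) \<longlonglongrightarrow> U s"
proof (rule metric_LIMSEQ_I)
  fix e :: real assume e: "e > 0"
  obtain d where d: "d > 0" "\<And>x. x \<in> {0..1} \<Longrightarrow> dist x s < d \<Longrightarrow> dist (U x) (U s) < e / 2"
    using U e s unfolding continuous_on_iff by (metis atLeastAtMost_iff half_gt_zero less_imp_le)
  obtain N where N: "inverse (real (Suc N)) < min d (1 - s) / 2" using reals_Archimedean[of "min d (1 - s) / 2"] d s by auto
  show "\<exists>N. \<forall>k\<ge>N. dist (\<integral>x. bump (real (Suc k)) s x * U x \<partial>I01) (U s) < e"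
  proof (intro exI allI impI)
    fix k assume k: "k \<ge> N"
    define n where "n = real (Suc k)"
    have n: "n > 0" by (simp add: n_def)
    have "inverse n \<le> inverse (real (Suc N))" using k by (simp add: n_def)
    then have "inverse n < min d (1 - s) / 2" using N by (rule order.strict_trans1)
    then have "2 * inverse n < min d (1 - s)" by simp
    then have n2: "2 / n < d" "2 / n < 1 - s" unfolding divide_inverse[of 2 n] by simp_all
    have c: "continuous_on {0..1} (\<lambda>x. bump n s x * U x)" by (intro continuous_intros bump_continuous U)
    have c2: "continuous_on {0..1} (\<lambda>x. bump n s x * (U x - U s))" by (intro continuous_intros bump_continuous U)
    have "(bump n s has_integral (cutoff (n * (1 - s)) - cutoff (n * (0 - s)))) {0..1}"
    proof (rule fundamental_theorem_of_calculus)
      show "((\<lambda>x. cutoff (n * (x - s))) has_vector_derivative bump n s x) (at x within {0..1})" for x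
        using cutoff_scaled_derivative[of n s x]
        by (simp add: has_real_derivative_iff_has_vector_derivative has_vector_derivative_at_within)
    qed simp
    moreover have "2 \<le> n * (1 - s)" using n2(2) n by (simp add: pos_divide_less_eq mult.commute)
    then have "cutoff (n * (1 - s)) = 1" by (rule cutoff_1)
    moreover have "cutoff (n * (0 - s)) = 0" using n s by (intro cutoff_0) (simp add: mult_nonneg_nonneg)
    ultimately have one: "(bump n s has_integral 1) {0..1}" by simp
    have bs: "((\<lambda>x. bump n s x * U s) has_integral U s) {0..1}"
      using has_integral_mult_left[OF one, of "U s"] by simp
    have "norm (integral {0..1} (\<lambda>x. bump n s x * (U x - U s))) \<le> integral {0..1} (\<lambda>x. bump n s x * (e / 2))"
    proof (rule integral_norm_bound_integral)
      show "(\<lambda>x. bump n s x * (U x - U s)) integrable_on {0..1}" by (rule integrable_continuous_real[OF c2])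
      show "(\<lambda>x. bump n s x * (e / 2)) integrable_on {0..1}"
        by (intro integrable_continuous_real continuous_intros bump_continuous)
      fix x :: real assume x: "x \<in> {0..1}"
      have b0: "0 \<le> bump n s x" using n by (simp add: bump_def hat_nonneg)
      show "norm (bump n s x * (U x - U s)) \<le> bump n s x * (e / 2)"
      proof (cases "bump n s x = 0")
        case False
        then have "hat (n * (x - s)) \<noteq> 0" by (simp add: bump_def)
        then have "\<not> (n * (x - s) \<le> 0 \<or> 2 \<le> n * (x - s))" using hat_0 by blast
        then have h: "0 < n * (x - s)" "n * (x - s) < 2" by auto
        then have "0 < x - s" using n by (simp add: zero_less_mult_iff)
        moreover have "x - s < 2 / n" using h(2) n by (simp add: pos_less_divide_eq mult.commute)
        ultimately have "dist x s < d" using n2 by (simp add: dist_real_def)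
        then have "norm (U x - U s) \<le> e / 2" using d(2)[OF x] by (simp add: dist_norm)
        from mult_left_mono[OF this b0] show ?thesis using b0 by (simp add: abs_mult)
      qed simp
    qed
    also have "\<dots> = e / 2" using integral_unique[OF has_integral_mult_left[OF one, of "e / 2"]] by simp
    also have "integral {0..1} (\<lambda>x. bump n s x * (U x - U s)) = integral {0..1} (\<lambda>x. bump n s x * U x) - U s"
    proof -
      have "integral {0..1} (\<lambda>x. bump n s x * (U x - U s)) = integral {0..1} (\<lambda>x. bump n s x * U x - bump n s x * U s)"
        by (simp add: right_diff_distrib)
      also have "\<dots> = integral {0..1} (\<lambda>x. bump n s x * U x) - U s"
        using has_integral_integrable[OF bs] integrable_continuous_real[OF c] integral_unique[OF one] by (subst integral_diff) (auto simp: integral_unique[OF bs] has_integral_integrable)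
      finally show ?thesis .
    qed
    finally show "dist (\<integral>x. bump (real (Suc k)) s x * U x \<partial>I01) (U s) < e"
      using e unfolding n_def[symmetric] integral_I01(1)[OF continuous_integrable_I01[OF c]] by (simp add: dist_real_def)
  qed
qed

text \<open>
  The fundamental theorem for weak derivatives. Test with smoothed indicators of \<open>[s,t]\<close>: their
  derivatives approximate Dirac masses at \<open>s\<close> and \<open>t\<close>.
\<close>

lemma weak_derivative_increment:
  fixes u v :: "real \<Rightarrow> 'h::real_inner"
  assumes u: "continuous_on {0..1} u" and v: "L2_path v" and weak: "has_weak_derivative u v"
    and st: "0 \<le> s" "s \<le> t" "t \<le> 1"
  shows "(u t - u s) \<bullet> w = integral {s..t} (\<lambda>\<tau>. v \<tau> \<bullet> w)"
proof -
  define U where "U x = u x \<bullet> w" for x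
  define W where "W x = v x \<bullet> w" for x
  have U: "continuous_on {0..1} U" unfolding U_def by (intro continuous_intros u)
  have W: "integrable I01 W" unfolding W_def by (rule L2_inner_const_integrable[OF v])
  have inner_case: "U t - U s = integral {s..t} W" if st: "0 < s" "s < t" "t < 1" for s t
  proof -
    \<comment> \<open>A smoothed indicator of \<open>[s,t]\<close>, rising and falling within \<open>2 / (k + 1)\<close> after \<open>s\<close> and \<open>t\<close>.\<close>
    define \<phi> where "\<phi> k x = cutoff (real (Suc k) * (x - s)) - cutoff (real (Suc k) * (x - t))" for k :: nat and x
    have d\<phi>: "(\<phi> k has_real_derivative bump (real (Suc k)) s x - bump (real (Suc k)) t x) (at x)" for k x
      unfolding \<phi>_def by (intro DERIV_diff cutoff_scaled_derivative)
    have deriv\<phi>: "deriv (\<phi> k) x = bump (real (Suc k)) s x - bump (real (Suc k)) t x" for k x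
      by (rule DERIV_imp_deriv[OF d\<phi>])
    have c\<phi>: "continuous_on T (\<phi> k)" for k T using d\<phi> by (intro continuous_at_imp_continuous_on ballI DERIV_isCont)
    obtain N where N: "inverse (real (Suc N)) < (1 - t) / 2" using reals_Archimedean[of "(1 - t) / 2"] st by auto
    have test: "test_function (\<phi> k)" if k: "k \<ge> N" for k unfolding test_function_def
    proof (intro conjI exI allI impI)
      show "\<phi> k C1_differentiable_on UNIV" unfolding C1_differentiable_on_def
      proof (intro exI conjI ballI)
        show "(\<phi> k has_vector_derivative bump (real (Suc k)) s x - bump (real (Suc k)) t x) (at x)" for x
          using d\<phi> by (simp add: has_real_derivative_iff_has_vector_derivative)
      qed (intro continuous_intros bump_continuous)
      have "inverse (real (Suc k)) \<le> inverse (real (Suc N))" using k by simp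
      then have "inverse (real (Suc k)) < (1 - t) / 2" using N by (rule order.strict_trans1)
      then have "2 * inverse (real (Suc k)) < 1 - t" by (simp only: less_divide_eq_numeral1 mult.commute)
      then show "t + 2 / real (Suc k) < 1" unfolding divide_inverse[of 2 "real (Suc k)"] by (simp only: less_diff_eq add.commute)
      show "0 < s" by fact
      fix x assume x: "x \<notin> {s..t + 2 / real (Suc k)}"
      show "\<phi> k x = 0"
      proof (cases "x < s")
        case True
        then have "real (Suc k) * (x - s) \<le> 0" "real (Suc k) * (x - t) \<le> 0" using st by (auto intro: mult_nonneg_nonpos)
        then show ?thesis by (simp add: \<phi>_def cutoff_0)
      next
        case False
        then have "2 / real (Suc k) \<le> x - t" using x by auto
        then have 1: "2 \<le> real (Suc k) * (x - t)" by (simp only: pos_divide_le_eq of_nat_0_less_iff zero_less_Suc mult.commute)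
        have "real (Suc k) * (x - t) \<le> real (Suc k) * (x - s)" using st by (intro mult_left_mono) auto
        then have "2 \<le> real (Suc k) * (x - s)" using 1 by (rule order_trans[rotated])
        then show ?thesis using 1 by (simp only: \<phi>_def cutoff_1)
      qed
    qed
    have "(\<lambda>k. (\<integral>x. bump (real (Suc k)) s x * U x \<partial>I01) - (\<integral>x. bump (real (Suc k)) t x * U x \<partial>I01)) \<longlonglongrightarrow> U s - U t"
      using st by (intro tendsto_diff bump_approximates_delta U) auto
    moreover have "(\<integral>x. bump (real (Suc k)) s x * U x \<partial>I01) - (\<integral>x. bump (real (Suc k)) t x * U x \<partial>I01)
       = (\<integral>x. deriv (\<phi> k) x * U x \<partial>I01)" for k unfolding deriv\<phi> left_diff_distrib
      by (rule Bochner_Integration.integral_diff[symmetric]) (intro continuous_integrable_I01 continuous_intros bump_continuous U)+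
    ultimately have lim1: "(\<lambda>k. \<integral>x. deriv (\<phi> k) x * U x \<partial>I01) \<longlonglongrightarrow> U s - U t" by simp
    have eq: "\<forall>\<^sub>F k in sequentially. (\<integral>x. deriv (\<phi> k) x * U x \<partial>I01) = - (\<integral>x. \<phi> k x * W x \<partial>I01)"
      unfolding eventually_sequentially
    proof (intro exI allI impI)
      fix k assume "N \<le> k"
      from weak[unfolded has_weak_derivative_def, rule_format, OF test[OF this], of w]
      show "(\<integral>x. deriv (\<phi> k) x * U x \<partial>I01) = - (\<integral>x. \<phi> k x * W x \<partial>I01)" unfolding U_def W_def .
    qed
    have "(\<lambda>k. \<integral>x. \<phi> k x * W x \<partial>I01) \<longlonglongrightarrow> (\<integral>x. indicator {s..t} x * W x \<partial>I01)"
    proof (rule integral_dominated_convergence[where w="\<lambda>x. 6 * \<bar>W x\<bar>"])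
      have "{s..t} \<subseteq> {0..1}" using st by auto
      then have "{s..t} \<in> sets I01" by (subst sets_restrict_space_iff) auto
      then show "(\<lambda>x. indicator {s..t} x * W x) \<in> borel_measurable I01"
        by (intro borel_measurable_times borel_measurable_indicator borel_measurable_integrable[OF W])
      show "(\<lambda>x. \<phi> k x * W x) \<in> borel_measurable I01" for k
        by (intro borel_measurable_times borel_measurable_I01_continuous c\<phi> borel_measurable_integrable[OF W])
      show "integrable I01 (\<lambda>x. 6 * \<bar>W x\<bar>)" by (intro integrable_mult_right integrable_abs W)
      show "AE x in I01. norm (\<phi> k x * W x) \<le> 6 * \<bar>W x\<bar>" for k
      proof (intro always_eventually allI)
        fix x
        have "\<bar>\<phi> k x\<bar> \<le> 6"
          using cutoff_bound[of "real (Suc k) * (x - s)"] cutoff_bound[of "real (Suc k) * (x - t)"] unfolding \<phi>_def by linarith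
        then show "norm (\<phi> k x * W x) \<le> 6 * \<bar>W x\<bar>" by (simp add: abs_mult mult_right_mono)
      qed
      have conv: "(\<lambda>k. cutoff (real (Suc k) * (x - a))) \<longlonglongrightarrow> (if x < a then 0 else 1)" if "x \<noteq> a" for x a
      proof (cases "x < a")
        case True
        then have "cutoff (real (Suc k) * (x - a)) = 0" for k by (intro cutoff_0) (auto intro: mult_nonneg_nonpos)
        then show ?thesis using True by simp
      next
        case False
        then have p: "x - a > 0" using that by simp
        obtain M where M: "inverse (real (Suc M)) < (x - a) / 2" using reals_Archimedean[of "(x - a) / 2"] p by auto
        have "cutoff (real (Suc k) * (x - a)) = 1" if "k \<ge> M" for k
        proof (rule cutoff_1)
          have "inverse (real (Suc k)) \<le> inverse (real (Suc M))" using that by simp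
          then have "inverse (real (Suc k)) < (x - a) / 2" using M by (rule order.strict_trans1)
          then have "real (Suc k) * inverse (real (Suc k)) < real (Suc k) * ((x - a) / 2)" by (intro mult_strict_left_mono) auto
          then show "2 \<le> real (Suc k) * (x - a)" by simp
        qed
        then have "\<forall>\<^sub>F k in sequentially. cutoff (real (Suc k) * (x - a)) = 1" unfolding eventually_sequentially by blast
        then show ?thesis using False tendsto_eventually by auto
      qed
      have "AE x in I01. x \<notin> {s, t}" by (rule AE_I01_finite) simp
      then show "AE x in I01. (\<lambda>k. \<phi> k x * W x) \<longlonglongrightarrow> indicator {s..t} x * W x"
      proof eventually_elim
        case (elim x)
        then have "(\<lambda>k. \<phi> k x) \<longlonglongrightarrow> (if x < s then 0 else 1) - (if x < t then 0 else 1)"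
          unfolding \<phi>_def by (intro tendsto_diff conv) auto
        moreover have "(if x < s then 0 else 1) - (if x < t then 0 else 1) = (indicator {s..t} x :: real)"
          using elim st by (auto simp: indicator_def)
        ultimately show ?case by (intro tendsto_mult_right) simp
      qed
    qed
    then have "(\<lambda>k. - (\<integral>x. \<phi> k x * W x \<partial>I01)) \<longlonglongrightarrow> - integral {s..t} W"
      using integral_I01_indicator[OF W, of s t] st by (intro tendsto_minus) simp
    then have "(\<lambda>k. \<integral>x. deriv (\<phi> k) x * U x \<partial>I01) \<longlonglongrightarrow> - integral {s..t} W"
      by (rule Lim_transform_eventually) (use eq in \<open>auto elim: eventually_mono\<close>)
    from LIMSEQ_unique[OF lim1 this] show ?thesis by simp
  qed
  have Wi: "W integrable_on {0..1}" by (rule integral_I01(2)[OF W])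
  define K where "K x = U x - integral {0..x} W" for x
  have K: "continuous_on {0..1} K" unfolding K_def by (intro continuous_intros U indefinite_integral_continuous_1 Wi)
  have comb: "integral {0..b} W = integral {0..a} W + integral {a..b} W" if "0 \<le> a" "a \<le> b" "b \<le> 1" for a b
    using Henstock_Kurzweil_Integration.integral_combine[of 0 a b W] integrable_on_subinterval[OF Wi, of 0 b] that by simp
  have Kc: "K x = K (1/2)" if "x \<in> {0<..<1}" for x
  proof (cases x "1/2::real" rule: linorder_cases)
    case less
    then show ?thesis using inner_case[of x "1/2"] comb[of x "1/2"] that by (simp add: K_def)
  next
    case greater
    then show ?thesis using inner_case[of "1/2" x] comb[of "1/2" x] that by (simp add: K_def)
  next
    case equal
    then show ?thesis by (simp only:)
  qed
  have cl: "closure {0<..<1::real} = {0..1}" by simp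
  have Kall: "K x = K (1/2)" if "x \<in> {0..1}" for x
    by (rule continuous_constant_on_closure[of "{0<..<1}" K "K (1/2)" x, unfolded cl, OF K Kc that])
  have "U t - U s = integral {s..t} W" using Kall[of s] Kall[of t] comb[of s t] st by (simp add: K_def)
  then show ?thesis by (simp add: U_def[abs_def] W_def[abs_def] inner_diff_left)
qed

text \<open>Increments determine all integrals over intervals.\<close>

lemma weak_derivative_unique:
  fixes u v v' :: "real \<Rightarrow> 'h::real_inner"
  assumes u: "continuous_on {0..1} u" and v: "L2_path v" "has_weak_derivative u v" and v': "L2_path v'" "has_weak_derivative u v'"
  shows "AE t in I01. v t = v' t"
proof -
  have d: "L2_path (\<lambda>t. v t - v' t)" by (rule L2_path_diff[OF v(1) v'(1)])
  have "AE t in I01. (v t - v' t) \<bullet> w = 0" for w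
  proof (rule interval_integrals_zero_imp_AE_zero[OF L2_inner_const_integrable[OF d]])
    fix s :: real assume s: "s \<in> {0..1}"
    then have sub: "{s..1} \<subseteq> {0..1}" by auto
    note i = integrable_on_subinterval[OF integral_I01(2)[OF L2_inner_const_integrable[OF v(1), of w]] sub]
        integrable_on_subinterval[OF integral_I01(2)[OF L2_inner_const_integrable[OF v'(1), of w]] sub]
    have "integral {s..1} (\<lambda>t. (v t - v' t) \<bullet> w) = integral {s..1} (\<lambda>t. v t \<bullet> w) - integral {s..1} (\<lambda>t. v' t \<bullet> w)"
      unfolding inner_diff_left by (rule Henstock_Kurzweil_Integration.integral_diff[OF i])
    then show "integral {s..1} (\<lambda>t. (v t - v' t) \<bullet> w) = 0"
      using weak_derivative_increment[OF u v, where s=s and t=1 and w=w]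
        weak_derivative_increment[OF u v', where s=s and t=1 and w=w] s by simp
  qed
  then have "AE t in I01. v t - v' t = 0"
    using d unfolding L2_path_def by (elim conjE) (rule strongly_measurable_AE_zero)
  then show ?thesis by simp
qed

section \<open>Dyadic difference quotients\<close>

definition node :: "nat \<Rightarrow> nat \<Rightarrow> real" where "node j i = real i / 2 ^ j"

definition incr :: "nat \<Rightarrow> (real \<Rightarrow> 'h::real_vector) \<Rightarrow> nat \<Rightarrow> 'h" where
  "incr j f i = f (node j (Suc i)) - f (node j i)"

definition cell :: "nat \<Rightarrow> real \<Rightarrow> nat" where "cell j t = nat \<lfloor>2 ^ j * t\<rfloor>"

text \<open>
  The difference quotient of \<open>f\<close> on dyadic cells of level \<open>j\<close>: the derivative of the
  interpolation \<open>interp j f\<close>, and the \<open>L\<^sup>2\<close>-projection of \<open>f'\<close> onto the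
  functions that are constant on cells.
\<close>

definition dquot :: "nat \<Rightarrow> (real \<Rightarrow> 'h::real_vector) \<Rightarrow> real \<Rightarrow> 'h" where
  "dquot j f t = 2 ^ j *\<^sub>R incr j f (cell j t)"

definition interp :: "nat \<Rightarrow> (real \<Rightarrow> 'h::real_vector) \<Rightarrow> real \<Rightarrow> 'h" where
  "interp j f t = f (node j (cell j t)) + (2 ^ j * t - real (cell j t)) *\<^sub>R incr j f (cell j t)"

definition dform :: "nat \<Rightarrow> (real \<Rightarrow> 'h::real_inner) \<Rightarrow> (real \<Rightarrow> 'h) \<Rightarrow> real" where
  "dform j f g = (\<Sum>i<2 ^ j. 2 ^ j * (incr j f i \<bullet> incr j g i))"

lemma node_bounds: "i \<le> 2 ^ j \<Longrightarrow> node j i \<in> {0..1}"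
proof -
  assume "i \<le> 2 ^ j"
  then have "real i \<le> real (2 ^ j)" by (rule of_nat_mono)
  then show ?thesis by (simp add: node_def)
qed

lemma node_mono: "node j i < node j (Suc i)" "node j (Suc i) - node j i = 1 / 2 ^ j"
  by (simp_all add: node_def divide_strict_right_mono add_divide_distrib)

lemma cell_eq: "t \<in> {node j i..<node j (Suc i)} \<Longrightarrow> cell j t = i"
proof -
  assume t: "t \<in> {node j i..<node j (Suc i)}"
  have "real i \<le> 2 ^ j * t" "2 ^ j * t < real i + 1"
    using t by (auto simp: node_def pos_divide_le_eq pos_less_divide_eq mult.commute)
  then have "\<lfloor>2 ^ j * t\<rfloor> = int i" by (intro floor_unique) auto
  then show ?thesis by (simp add: cell_def)
qed

lemma cell_node: "cell j (node j i) = i" by (rule cell_eq) (simp add: node_mono)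

lemma cell_bounds:
  assumes t: "0 \<le> t"
  shows "node j (cell j t) \<le> t" "t < node j (Suc (cell j t))"
proof -
  have "0 \<le> \<lfloor>2 ^ j * t\<rfloor>" using t by simp
  then have r: "real (cell j t) = real_of_int \<lfloor>2 ^ j * t\<rfloor>" by (simp add: cell_def)
  have "real (cell j t) \<le> 2 ^ j * t" "2 ^ j * t < real (cell j t) + 1" unfolding r by linarith+
  then show "node j (cell j t) \<le> t" "t < node j (Suc (cell j t))"
    by (simp_all add: node_def pos_divide_le_eq pos_less_divide_eq mult.commute add.commute)
qed

lemma cell_less:
  assumes t: "0 \<le> t" "t < 1"
  shows "cell j t < 2 ^ j"
proof -
  have "node j (cell j t) < 1" using cell_bounds(1)[OF t(1), of j] t(2) by simp
  then have "real (cell j t) < 2 ^ j" by (simp add: node_def pos_divide_less_eq)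
  then have "real (cell j t) < real (2 ^ j)" by simp
  then show ?thesis by (simp only: of_nat_less_iff)
qed

lemma node_refine: "j \<le> m \<Longrightarrow> node j i = node m (2 ^ (m - j) * i)"
proof -
  assume "j \<le> m"
  then have "(2::real) ^ m = 2 ^ (m - j) * 2 ^ j" by (simp flip: power_add)
  then show ?thesis by (simp add: node_def)
qed

lemma interp_node: "interp j f (node j i) = f (node j i)"
  by (simp add: interp_def cell_node) (simp add: node_def)

lemma interp_on_cell:
  assumes t: "t \<in> {node j i..node j (Suc i)}"
  shows "interp j f t = f (node j i) + (2 ^ j * t - real i) *\<^sub>R incr j f i"
proof (cases "t = node j (Suc i)")
  case True
  have "2 ^ j * t - real i = 1" unfolding True by (simp add: node_def)
  then show ?thesis unfolding True by (simp add: interp_node incr_def)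
next
  case False
  then have "cell j t = i" using t by (intro cell_eq) auto
  then show ?thesis by (simp add: interp_def)
qed

lemma simple_function_dquot: "simple_function I01 (dquot j f)"
proof -
  have "simple_function I01 (\<lambda>t. \<lfloor>2 ^ j * t\<rfloor>)" by (rule simple_function_floor) simp
  then show ?thesis unfolding dquot_def[abs_def] cell_def
    by (rule simple_function_compose1[where g="\<lambda>z. 2 ^ j *\<^sub>R incr j f (nat z)"])
qed

lemma dquot_L2: "L2_path (dquot j (f :: real \<Rightarrow> 'h::real_inner))"
  by (rule simple_function_L2[OF simple_function_dquot])

lemma unit_interval_cells: "{0..1} = (\<Union>i\<in>{..<2 ^ j}. {node j i..node j (Suc i)})"
proof (intro equalityI subsetI)
  fix t :: real assume t: "t \<in> {0..1}"
  show "t \<in> (\<Union>i\<in>{..<2 ^ j}. {node j i..node j (Suc i)})"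
  proof (cases "t = 1")
    case True
    have s: "Suc (2 ^ j - 1) = 2 ^ j" by simp
    have "t = node j (Suc (2 ^ j - 1))" unfolding s True by (simp add: node_def)
    then show ?thesis using node_mono(1)[of j "2 ^ j - 1"] by (intro UN_I[of "2 ^ j - 1"]) auto
  next
    case False
    then have "cell j t < 2 ^ j" using t by (intro cell_less) auto
    then show ?thesis using cell_bounds[of t j] t by (intro UN_I[of "cell j t"]) auto
  qed
next
  fix t assume "t \<in> (\<Union>i\<in>{..<2 ^ j}. {node j i..node j (Suc i)})"
  then obtain i where i: "i < 2 ^ j" "t \<in> {node j i..node j (Suc i)}" by blast
  have "node j i \<in> {0..1}" "node j (Suc i) \<in> {0..1}" using i(1) by (intro node_bounds; simp)+
  then show "t \<in> {0..1}" using i(2) by auto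
qed

lemma interp_continuous: "continuous_on {0..1} (interp j (f :: real \<Rightarrow> 'h::real_normed_vector))"
  unfolding unit_interval_cells[of j]
proof (rule continuous_on_closed_Union)
  fix i
  have "continuous_on {node j i..node j (Suc i)} (\<lambda>t. f (node j i) + (2 ^ j * t - real i) *\<^sub>R incr j f i)"
    by (intro continuous_intros)
  then show "continuous_on {node j i..node j (Suc i)} (interp j f)"
    by (rule continuous_on_eq) (simp add: interp_on_cell)
qed auto

lemma interp_derivative:
  fixes f :: "real \<Rightarrow> 'h::real_normed_vector"
  assumes t: "t \<in> {0<..<1} - node j ` {..2 ^ j}"
  shows "(interp j f has_vector_derivative dquot j f t) (at t)"
proof -
  define i where "i = cell j t"
  have t01: "0 \<le> t" "t < 1" using t by auto
  have i: "i < 2 ^ j" unfolding i_def by (rule cell_less[OF t01])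
  have ne: "t \<noteq> node j i" using t i by auto
  have tin: "t \<in> {node j i<..<node j (Suc i)}" using cell_bounds[OF t01(1), of j] ne by (simp add: i_def)
  have "((\<lambda>t. f (node j i) + (2 ^ j * t - real i) *\<^sub>R incr j f i) has_vector_derivative 2 ^ j *\<^sub>R incr j f i) (at t)"
    by (auto intro!: derivative_eq_intros)
  then have "(interp j f has_vector_derivative 2 ^ j *\<^sub>R incr j f i) (at t)"
    by (rule has_vector_derivative_transform_within_open[OF _ open_greaterThanLessThan tin])
       (subst interp_on_cell, auto)
  then show ?thesis by (simp add: dquot_def i_def)
qed

lemma interp_weak_derivative:
  fixes f :: "real \<Rightarrow> 'h::real_inner"
  shows "has_weak_derivative (interp j f) (dquot j f)"
  by (rule polygonal_weak_derivative[OF interp_continuous _ interp_derivative simple_function_dquot]) auto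

lemma integral_by_cells:
  fixes k :: "nat \<Rightarrow> real \<Rightarrow> real"
  assumes "\<And>i. i < m \<Longrightarrow> ((\<lambda>t. k i t) has_integral c i) {node j i..node j (Suc i)}"
  shows "((\<lambda>t. k (cell j t) t) has_integral (\<Sum>i<m. c i)) {0..node j m}" using assms
proof (induction m)
  case 0
  then show ?case by (simp add: node_def has_integral_refl)
next
  case (Suc m)
  have "((\<lambda>t. k (cell j t) t) has_integral c m) {node j m..node j (Suc m)}"
  proof (rule has_integral_spike_finite[of "{node j (Suc m)}"])
    fix t assume "t \<in> {node j m..node j (Suc m)} - {node j (Suc m)}"
    then have "cell j t = m" by (intro cell_eq) auto
    then show "k (cell j t) t = k m t" by simp
  qed (use Suc.prems in auto)
  moreover have "((\<lambda>t. k (cell j t) t) has_integral (\<Sum>i<m. c i)) {0..node j m}"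
    using Suc.prems by (intro Suc.IH) simp
  ultimately show ?case
    using has_integral_combine[of 0 "node j m" "node j (Suc m)"] node_mono(1)[of j m] by (simp add: node_def)
qed

text \<open>The projection property, cell by cell from the fundamental theorem.\<close>

lemma integral_inner_dquot:
  fixes f g :: "real \<Rightarrow> 'h::real_inner"
  assumes f: "continuous_on {0..1} f" and v: "L2_path v" "has_weak_derivative f v"
  shows "(\<integral>t. v t \<bullet> dquot j g t \<partial>I01) = dform j f g"
proof -
  have hi: "((\<lambda>t. v t \<bullet> (2 ^ j *\<^sub>R incr j g (cell j t))) has_integral (\<Sum>i<2 ^ j. 2 ^ j * (incr j f i \<bullet> incr j g i))) {0..node j (2 ^ j)}"
  proof (rule integral_by_cells)
    fix i :: nat assume i: "i < 2 ^ j"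
    define w where "w = 2 ^ j *\<^sub>R incr j g i"
    have n: "0 \<le> node j i" "node j (Suc i) \<le> 1" using node_bounds[of i j] node_bounds[of "Suc i" j] i by auto
    have "{node j i..node j (Suc i)} \<subseteq> {0..1}" using n by auto
    from integrable_on_subinterval[OF integral_I01(2)[OF L2_inner_const_integrable[OF v(1)]] this]
    have "((\<lambda>t. v t \<bullet> w) has_integral integral {node j i..node j (Suc i)} (\<lambda>t. v t \<bullet> w)) {node j i..node j (Suc i)}"
      by (rule integrable_integral)
    moreover have "integral {node j i..node j (Suc i)} (\<lambda>t. v t \<bullet> w) = incr j f i \<bullet> w"
      unfolding incr_def using node_mono(1)[of j i] n
      by (intro weak_derivative_increment[OF f v, symmetric]) auto
    ultimately show "((\<lambda>t. v t \<bullet> (2 ^ j *\<^sub>R incr j g i)) has_integral 2 ^ j * (incr j f i \<bullet> incr j g i)) {node j i..node j (Suc i)}"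
      by (simp add: w_def)
  qed
  have node1: "node j (2 ^ j) = 1" by (simp add: node_def)
  have "integral {0..1} (\<lambda>t. v t \<bullet> dquot j g t) = dform j f g"
    using integral_unique[OF hi] unfolding node1 dquot_def dform_def .
  then show ?thesis using integral_I01(1)[OF L2_inner_integrable[OF v(1) dquot_L2]] by simp
qed

lemma incr_interp: "j \<le> m \<Longrightarrow> incr j (interp m f) i = incr j f i"
  by (simp add: incr_def node_refine[of j m] interp_node)

text \<open>Apply the projection property to the interpolation on the finer level.\<close>

lemma integral_dquot_dquot:
  fixes f g :: "real \<Rightarrow> 'h::real_inner"
  assumes "j \<le> m"
  shows "(\<integral>t. dquot m f t \<bullet> dquot j g t \<partial>I01) = dform j f g"
proof -
  have "(\<integral>t. dquot m f t \<bullet> dquot j g t \<partial>I01) = dform j (interp m f) g"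
    by (rule integral_inner_dquot[OF interp_continuous dquot_L2 interp_weak_derivative])
  then show ?thesis by (simp add: dform_def incr_interp[OF assms])
qed

lemma L2_norm_diff:
  fixes u v :: "real \<Rightarrow> 'h::real_inner"
  assumes u: "L2_path u" and v: "L2_path v"
  shows "(\<integral>t. (norm (u t - v t))^2 \<partial>I01) =
    (\<integral>t. (norm (u t))^2 \<partial>I01) - 2 * (\<integral>t. u t \<bullet> v t \<partial>I01) + (\<integral>t. (norm (v t))^2 \<partial>I01)"
proof -
  have "(norm (u t - v t))^2 = ((norm (u t))^2 - 2 * (u t \<bullet> v t)) + (norm (v t))^2" for t
    unfolding power2_norm_eq_inner by (simp add: inner_diff_left inner_diff_right inner_commute)
  then show ?thesis by (simp add: L2_path_integrable[OF u] L2_path_integrable[OF v] L2_inner_integrable[OF u v])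
qed

lemma dquot_norm: "(\<integral>t. (norm (dquot j f t))^2 \<partial>I01) = dform j f f"
  using integral_dquot_dquot[of j j f f] by (simp add: power2_norm_eq_inner)

text \<open>
  Pythagoras for nested orthogonal projections, a martingale identity. It shows that the \<open>dform j f f\<close>
  increase and that boundedness implies that the \<open>dquot j f\<close> are \<open>L\<^sup>2\<close>-Cauchy.
\<close>

lemma dquot_diff_norm: "j \<le> m \<Longrightarrow> (\<integral>t. (norm (dquot m f t - dquot j f t))^2 \<partial>I01) = dform m f f - dform j f f"
  by (simp add: L2_norm_diff[OF dquot_L2 dquot_L2] dquot_norm integral_dquot_dquot)

lemma dform_mono: "j \<le> m \<Longrightarrow> dform j f f \<le> dform m f f"
proof -
  assume "j \<le> m"
  have "0 \<le> (\<integral>t. (norm (dquot m f t - dquot j f t))^2 \<partial>I01)" by simp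
  then show ?thesis using dquot_diff_norm[OF \<open>j \<le> m\<close>, of f] by simp
qed

lemma dform_nonneg: "0 \<le> dform j f f" by (simp add: dform_def sum_nonneg)

text \<open>A projection does not increase the norm.\<close>

lemma dform_le_norm:
  fixes f :: "real \<Rightarrow> 'h::real_inner"
  assumes f: "continuous_on {0..1} f" and v: "L2_path v" "has_weak_derivative f v"
  shows "dform j f f \<le> (\<integral>t. (norm (v t))^2 \<partial>I01)"
proof -
  have "0 \<le> (\<integral>t. (norm (v t - dquot j f t))^2 \<partial>I01)" by simp
  then show ?thesis by (simp add: L2_norm_diff[OF v(1) dquot_L2] dquot_norm integral_inner_dquot[OF assms])
qed

lemma interp_tendsto:
  fixes f :: "real \<Rightarrow> 'h::real_inner"
  assumes f: "continuous_on {0..1} f" and t: "t \<in> {0..<1}"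
  shows "(\<lambda>j. interp j f t) \<longlonglongrightarrow> f t"
proof (rule metric_LIMSEQ_I)
  fix e :: real assume e: "e > 0"
  obtain d where d: "d > 0" "\<And>s. s \<in> {0..1} \<Longrightarrow> dist s t < d \<Longrightarrow> dist (f s) (f t) < e / 3"
    using f e t unfolding continuous_on_iff by (metis atLeastAtMost_iff atLeastLessThan_iff divide_pos_pos less_imp_le zero_less_numeral)
  obtain N where N: "(1/2::real) ^ N < d" using real_arch_pow_inv[OF d(1), of "1/2"] by auto
  show "\<exists>N. \<forall>j\<ge>N. dist (interp j f t) (f t) < e"
  proof (intro exI allI impI)
    fix j assume j: "j \<ge> N"
    define i where "i = cell j t"
    have "(1/2::real) ^ j \<le> (1/2) ^ N" using j by (intro power_decreasing) auto
    then have small: "1 / 2 ^ j < d" using N by (simp add: power_one_over)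
    have b: "node j i \<le> t" "t < node j (Suc i)" using cell_bounds[of t j] t by (auto simp: i_def)
    have i: "i < 2 ^ j" unfolding i_def using t by (intro cell_less) auto
    have n: "node j i \<in> {0..1}" "node j (Suc i) \<in> {0..1}" using i by (intro node_bounds; simp)+
    have "dist (node j i) t < d" "dist (node j (Suc i)) t < d"
      using b node_mono(2)[of j i] small by (auto simp: dist_real_def)
    then have 1: "norm (f (node j i) - f t) < e / 3" "norm (f (node j (Suc i)) - f t) < e / 3"
      using d(2)[OF n(1)] d(2)[OF n(2)] by (auto simp: dist_norm)
    have "norm (incr j f i) \<le> norm (f (node j (Suc i)) - f t) + norm (f (node j i) - f t)"
      unfolding incr_def using norm_triangle_ineq4[of "f (node j (Suc i)) - f t" "f (node j i) - f t"] by simp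
    then have 2: "norm (incr j f i) < 2 * e / 3" using 1 by simp
    have x: "\<bar>2 ^ j * t - real i\<bar> \<le> 1"
      using b by (auto simp: node_def pos_divide_le_eq pos_less_divide_eq mult.commute abs_le_iff)
    have eq: "interp j f t - f t = (f (node j i) - f t) + (2 ^ j * t - real i) *\<^sub>R incr j f i"
      by (simp add: interp_def i_def)
    have "norm (interp j f t - f t) \<le> norm (f (node j i) - f t) + \<bar>2 ^ j * t - real i\<bar> * norm (incr j f i)"
      unfolding eq using norm_triangle_ineq[of "f (node j i) - f t" "(2 ^ j * t - real i) *\<^sub>R incr j f i"]
      by (simp only: norm_scaleR)
    also have "\<dots> \<le> norm (f (node j i) - f t) + 1 * norm (incr j f i)"
      using x by (intro add_left_mono mult_right_mono) auto
    also have "\<dots> < e" using 1 2 by simp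
    finally show "dist (interp j f t) (f t) < e" by (simp add: dist_norm)
  qed
qed

lemma interp_bounded:
  fixes f :: "real \<Rightarrow> 'h::real_inner"
  assumes B: "\<And>s. s \<in> {0..1} \<Longrightarrow> norm (f s) \<le> B" and t: "t \<in> {0..<1}"
  shows "norm (interp j f t) \<le> 3 * B"
proof -
  define i where "i = cell j t"
  have b: "node j i \<le> t" "t < node j (Suc i)" using cell_bounds[of t j] t by (auto simp: i_def)
  have i: "i < 2 ^ j" unfolding i_def using t by (intro cell_less) auto
  have n: "node j i \<in> {0..1}" "node j (Suc i) \<in> {0..1}" using i by (intro node_bounds; simp)+
  have x: "\<bar>2 ^ j * t - real i\<bar> \<le> 1"
    using b by (auto simp: node_def pos_divide_le_eq pos_less_divide_eq mult.commute abs_le_iff)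
  have "norm (incr j f i) \<le> 2 * B"
    unfolding incr_def using norm_triangle_ineq4[of "f (node j (Suc i))" "f (node j i)"] B[OF n(1)] B[OF n(2)] by simp
  moreover have "norm (interp j f t) \<le> norm (f (node j i)) + \<bar>2 ^ j * t - real i\<bar> * norm (incr j f i)"
    using norm_triangle_ineq[of "f (node j i)" "(2 ^ j * t - real i) *\<^sub>R incr j f i"] by (simp add: interp_def i_def)
  moreover have "\<bar>2 ^ j * t - real i\<bar> * norm (incr j f i) \<le> 1 * norm (incr j f i)"
    using x by (intro mult_right_mono) auto
  ultimately show ?thesis using B[OF n(1)] by simp
qed

lemma AE_I01_half_open: "AE t in I01. t \<in> {0..<1::real}"
proof -
  have "AE t in I01. t \<notin> {1::real}" by (rule AE_I01_finite) simp
  with AE_I01_space show ?thesis by eventually_elim auto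
qed

lemma bounded_on_I01:
  fixes f :: "real \<Rightarrow> 'h::real_normed_vector"
  assumes "continuous_on {0..1} f"
  obtains B where "\<And>t. t \<in> {0..1} \<Longrightarrow> norm (f t) \<le> B"
proof -
  have "bounded (f ` {0..1})" using assms by (intro compact_imp_bounded compact_continuous_image) auto
  then obtain B where "\<forall>x\<in>f ` {0..1}. norm x \<le> B" unfolding bounded_iff by (elim exE) (rule that)
  then show ?thesis using that by blast
qed

text \<open>
  Pass to the limit in the weak formulation for the interpolations, which converge pointwise and boundedly to
  \<open>f\<close>.
\<close>

lemma weak_derivative_of_L2_limit:
  fixes f v :: "real \<Rightarrow> 'h::real_inner"
  assumes f: "continuous_on {0..1} f" and v: "L2_path v" and r: "strict_mono r"
    and lim: "(\<lambda>k. \<integral>t. (norm (v t - dquot (r k) f t))^2 \<partial>I01) \<longlonglongrightarrow> 0"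
  shows "has_weak_derivative f v" unfolding has_weak_derivative_def
proof (intro allI impI)
  fix \<phi> :: "real \<Rightarrow> real" and w :: 'h assume \<phi>: "test_function \<phi>"
  note \<phi>' = test_functionD[OF \<phi>]
  have c\<phi>': "continuous_on {0..1} (deriv \<phi>)" by (rule continuous_on_subset[OF \<phi>'(2)]) simp
  obtain B where B: "\<And>t. t \<in> {0..1} \<Longrightarrow> norm (f t) \<le> B" using bounded_on_I01[OF f] by blast
  have L: "(\<lambda>k. \<integral>t. deriv \<phi> t * (interp (r k) f t \<bullet> w) \<partial>I01) \<longlonglongrightarrow> (\<integral>t. deriv \<phi> t * (f t \<bullet> w) \<partial>I01)"
  proof (rule integral_dominated_convergence[where w="\<lambda>t. \<bar>deriv \<phi> t\<bar> * (3 * B * norm w)"])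
    show "(\<lambda>t. deriv \<phi> t * (f t \<bullet> w)) \<in> borel_measurable I01"
      by (intro borel_measurable_I01_continuous continuous_intros c\<phi>' f)
    show "(\<lambda>t. deriv \<phi> t * (interp (r k) f t \<bullet> w)) \<in> borel_measurable I01" for k
      by (intro borel_measurable_I01_continuous continuous_intros c\<phi>' interp_continuous)
    show "integrable I01 (\<lambda>t. \<bar>deriv \<phi> t\<bar> * (3 * B * norm w))"
      by (intro continuous_integrable_I01 continuous_intros c\<phi>')
    show "AE t in I01. norm (deriv \<phi> t * (interp (r k) f t \<bullet> w)) \<le> \<bar>deriv \<phi> t\<bar> * (3 * B * norm w)" for k
      using AE_I01_half_open
    proof eventually_elim
      case (elim t)
      have "\<bar>interp (r k) f t \<bullet> w\<bar> \<le> norm (interp (r k) f t) * norm w" by (rule Cauchy_Schwarz_ineq2)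
      also have "\<dots> \<le> 3 * B * norm w" by (intro mult_right_mono interp_bounded B elim) auto
      finally show ?case by (simp add: abs_mult mult_left_mono)
    qed
    show "AE t in I01. (\<lambda>k. deriv \<phi> t * (interp (r k) f t \<bullet> w)) \<longlonglongrightarrow> deriv \<phi> t * (f t \<bullet> w)" using AE_I01_half_open
    proof eventually_elim
      case (elim t)
      have "(\<lambda>k. interp (r k) f t) \<longlonglongrightarrow> f t"
        using LIMSEQ_subseq_LIMSEQ[OF interp_tendsto[OF f elim] r] by (simp add: comp_def)
      then show ?case by (intro tendsto_intros)
    qed
  qed
  have \<phi>w: "L2_path (\<lambda>t. \<phi> t *\<^sub>R w)" by (intro continuous_L2_path continuous_intros \<phi>'(5))
  define C where "C = (\<integral>t. (norm (\<phi> t *\<^sub>R w))^2 \<partial>I01)"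
  have R: "(\<lambda>k. \<integral>t. \<phi> t * (dquot (r k) f t \<bullet> w) \<partial>I01) \<longlonglongrightarrow> (\<integral>t. \<phi> t * (v t \<bullet> w) \<partial>I01)"
  proof -
    have bound: "((\<integral>t. \<phi> t * (v t \<bullet> w) \<partial>I01) - (\<integral>t. \<phi> t * (dquot (r k) f t \<bullet> w) \<partial>I01))\<^sup>2
        \<le> C * (\<integral>t. (norm (v t - dquot (r k) f t))^2 \<partial>I01)" for k
    proof -
      have i: "integrable I01 (\<lambda>t. (\<phi> t *\<^sub>R w) \<bullet> v t)" "integrable I01 (\<lambda>t. (\<phi> t *\<^sub>R w) \<bullet> dquot (r k) f t)"
        by (rule L2_inner_integrable[OF \<phi>w v] L2_inner_integrable[OF \<phi>w dquot_L2])+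
      have "(\<integral>t. (\<phi> t *\<^sub>R w) \<bullet> (v t - dquot (r k) f t) \<partial>I01)
         = (\<integral>t. (\<phi> t *\<^sub>R w) \<bullet> v t \<partial>I01) - (\<integral>t. (\<phi> t *\<^sub>R w) \<bullet> dquot (r k) f t \<partial>I01)"
        unfolding inner_diff_right by (rule Bochner_Integration.integral_diff[OF i])
      also have "\<dots> = (\<integral>t. \<phi> t * (v t \<bullet> w) \<partial>I01) - (\<integral>t. \<phi> t * (dquot (r k) f t \<bullet> w) \<partial>I01)"
        by (simp add: inner_commute)
      finally show ?thesis
        using L2_Cauchy_Schwarz[OF \<phi>w L2_path_diff[OF v dquot_L2], of "r k" f] by (simp add: C_def)
    qed
    have "(\<lambda>k. C * (\<integral>t. (norm (v t - dquot (r k) f t))^2 \<partial>I01)) \<longlonglongrightarrow> C * 0" by (intro tendsto_intros lim)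
    then have lim0: "(\<lambda>k. C * (\<integral>t. (norm (v t - dquot (r k) f t))^2 \<partial>I01)) \<longlonglongrightarrow> 0" by simp
    have "(\<lambda>k. ((\<integral>t. \<phi> t * (v t \<bullet> w) \<partial>I01) - (\<integral>t. \<phi> t * (dquot (r k) f t \<bullet> w) \<partial>I01))^2) \<longlonglongrightarrow> 0"
      by (rule Lim_null_comparison[OF _ lim0]) (use bound in simp)
    then have "(\<lambda>k. (\<integral>t. \<phi> t * (v t \<bullet> w) \<partial>I01) - (\<integral>t. \<phi> t * (dquot (r k) f t \<bullet> w) \<partial>I01)) \<longlonglongrightarrow> 0"
      by (simp add: tendsto_power_zero tendsto_null_power)
    from tendsto_diff[OF tendsto_const[of "\<integral>t. \<phi> t * (v t \<bullet> w) \<partial>I01"] this] show ?thesis by simp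
  qed
  have eq: "(\<integral>t. deriv \<phi> t * (interp (r k) f t \<bullet> w) \<partial>I01) = - (\<integral>t. \<phi> t * (dquot (r k) f t \<bullet> w) \<partial>I01)" for k
    using interp_weak_derivative[of "r k" f, unfolded has_weak_derivative_def, rule_format, OF \<phi>, of w] .
  have "(\<lambda>k. \<integral>t. deriv \<phi> t * (interp (r k) f t \<bullet> w) \<partial>I01) \<longlonglongrightarrow> - (\<integral>t. \<phi> t * (v t \<bullet> w) \<partial>I01)"
    unfolding eq by (intro tendsto_minus R)
  from LIMSEQ_unique[OF L this]
  show "(\<integral>t. deriv \<phi> t * (f t \<bullet> w) \<partial>I01) = - (\<integral>t. \<phi> t * (v t \<bullet> w) \<partial>I01)" .
qed

lemma ennreal_power2_le_imp_le:
  assumes le: "a^2 \<le> (ennreal b)^2" and b: "0 \<le> b"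
  shows "a \<le> ennreal b"
proof (cases a)
  case (real x)
  have "ennreal (x^2) \<le> ennreal (b^2)" using le real b by (simp add: ennreal_power)
  then have "x^2 \<le> b^2" by (simp add: ennreal_le_iff)
  then show ?thesis unfolding real using b by (intro ennreal_leI) (rule power2_le_imp_le)
next
  case top
  have "(ennreal b)^2 \<noteq> top" using b by (simp add: ennreal_power)
  moreover have "a^2 = top" unfolding top power2_eq_square by simp
  ultimately show ?thesis using le by (simp add: top_unique)
qed

text \<open>
  The Riesz-Fischer argument: the norms of the differences have summable integrals, so the sequence converges almost
  everywhere.
\<close>

lemma L2_norm_sum_AE_Cauchy:
  fixes y :: "nat \<Rightarrow> real \<Rightarrow> 'h::{real_inner, complete_space}"
  assumes L2: "\<And>k. L2_path (y k)" and b: "\<And>k. (\<integral>t. (norm (y (Suc k) t - y k t))^2 \<partial>I01) \<le> (1/4) ^ k"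
  shows "AE t in I01. convergent (\<lambda>k. y k t)"
proof -
  define d where "d k t = norm (y (Suc k) t - y k t)" for k t
  have dm: "d k \<in> borel_measurable I01" for k
    unfolding d_def[abs_def] using L2_path_diff[OF L2 L2] by (auto simp: L2_path_def intro: strongly_measurable_norm)
  have d2: "integrable I01 (\<lambda>t. (d k t)^2)" for k unfolding d_def by (rule L2_path_integrable[OF L2_path_diff[OF L2 L2]])
  have nn: "(\<integral>\<^sup>+t. ennreal (d k t) \<partial>I01) \<le> ennreal ((1/2) ^ k)" for k
  proof -
    have "(\<integral>\<^sup>+t. ennreal (d k t) * 1 \<partial>I01)^2 \<le> (\<integral>\<^sup>+t. (ennreal (d k t))^2 \<partial>I01) * (\<integral>\<^sup>+t. 1^2 \<partial>I01)"
      by (rule Cauchy_Schwarz_nn_integral) (use dm in measurable)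
    also have "(\<integral>\<^sup>+t. 1^2 \<partial>I01) = (1::ennreal)" by (simp add: emeasure_I01[simplified])
    also have "(\<integral>\<^sup>+t. (ennreal (d k t))^2 \<partial>I01) = (\<integral>\<^sup>+t. ennreal ((d k t)^2) \<partial>I01)"
      by (intro nn_integral_cong) (simp add: ennreal_power d_def)
    also have "\<dots> = ennreal (\<integral>t. (d k t)^2 \<partial>I01)" by (rule nn_integral_eq_integral[OF d2]) simp
    also have "\<dots> * 1 \<le> ennreal (((1/2) ^ k)^2)"
    proof -
      have "((1/2::real) ^ k)^2 = (1/4) ^ k" by (simp add: power_mult_distrib power2_eq_square flip: power_mult_distrib)
      then show ?thesis using b[of k] by (simp add: d_def ennreal_leI)
    qed
    also have "\<dots> = (ennreal ((1/2) ^ k))^2" by (simp add: ennreal_power)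
    finally have "(\<integral>\<^sup>+t. ennreal (d k t) \<partial>I01)^2 \<le> (ennreal ((1/2) ^ k))^2" by simp
    then show ?thesis by (rule ennreal_power2_le_imp_le) simp
  qed
  have "(\<integral>\<^sup>+t. (\<Sum>k. ennreal (d k t)) \<partial>I01) = (\<Sum>k. \<integral>\<^sup>+t. ennreal (d k t) \<partial>I01)"
    by (rule nn_integral_suminf) (use dm in measurable)
  also have "\<dots> \<le> (\<Sum>k. ennreal ((1/2) ^ k))" by (intro suminf_le nn) auto
  also have "\<dots> = ennreal (\<Sum>k. (1/2) ^ k)" by (rule suminf_ennreal2) (auto intro: summable_geometric)
  finally have "(\<integral>\<^sup>+t. (\<Sum>k. ennreal (d k t)) \<partial>I01) \<noteq> \<infinity>" by (auto simp: top_unique)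
  then have "AE t in I01. (\<Sum>k. ennreal (d k t)) \<noteq> \<infinity>"
    by (rule nn_integral_PInf_AE[rotated]) (use dm in measurable)
  then show ?thesis
  proof eventually_elim
    case (elim t)
    have sm: "summable (\<lambda>k. d k t)" using elim by (intro summable_suminf_not_top) (auto simp: d_def)
    have "Cauchy (\<lambda>k. y k t)"
    proof (rule metric_CauchyI)
      fix e :: real assume e: "e > 0"
      obtain N where N: "\<And>m n. m \<ge> N \<Longrightarrow> norm (\<Sum>k\<in>{m..<n}. d k t) < e"
        using sm[unfolded summable_Cauchy] e by blast
      have *: "dist (y n t) (y m t) < e" if "m \<ge> N" "m \<le> n" for m n
      proof -
        have "y n t - y m t = (\<Sum>k\<in>{m..<n}. y (Suc k) t - y k t)" using sum_Suc_diff'[OF that(2), of "\<lambda>k. y k t"] by simp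
        then have "norm (y n t - y m t) \<le> (\<Sum>k\<in>{m..<n}. d k t)" unfolding d_def by (simp add: norm_sum)
        then show ?thesis using N[OF that(1), of n] by (simp add: dist_norm)
      qed
      show "\<exists>M. \<forall>m\<ge>M. \<forall>n\<ge>M. dist (y m t) (y n t) < e"
      proof (intro exI allI impI)
        fix m n assume "m \<ge> N" "n \<ge> N"
        then show "dist (y m t) (y n t) < e" using *[of m n] *[of n m] by (cases "m \<le> n") (auto simp: dist_commute)
      qed
    qed
    then show ?case by (simp add: Cauchy_convergent_iff)
  qed
qed

text \<open>
  Completeness of \<open>L\<^sup>2\<close>, used only for difference quotients: they are simple, so their almost
  everywhere limit is strongly measurable, and Fatou's lemma turns it into an \<open>L\<^sup>2\<close>-limit.
\<close>

lemma dquot_subsequence_converges: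
  fixes f :: "real \<Rightarrow> 'h::{real_inner, complete_space}"
  assumes K: "\<And>j. dform j f f \<le> K"
  shows "\<exists>v r. L2_path v \<and> strict_mono r \<and> (\<lambda>k. \<integral>t. (norm (v t - dquot (r k) f t))^2 \<partial>I01) \<longlonglongrightarrow> 0"
proof -
  have "convergent (\<lambda>j. dform j f f)"
  proof (rule Bseq_monoseq_convergent)
    show "Bseq (\<lambda>j. dform j f f)"
    proof (rule BseqI')
      show "norm (dform j f f) \<le> K" for j using K[of j] dform_nonneg[of j f] by simp
    qed
    show "monoseq (\<lambda>j. dform j f f)" by (intro monoI1) (use dform_mono in blast)
  qed
  then have C: "Cauchy (\<lambda>j. dform j f f)" by (rule convergent_Cauchy)
  have "\<exists>M. \<forall>m\<ge>M. \<forall>n\<ge>M. dist (dform m f f) (dform n f f) < (1/4) ^ k" for k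
    using metric_CauchyD[OF C, of "(1/4) ^ k"] by simp
  then obtain M where M: "\<And>k m n. m \<ge> M k \<Longrightarrow> n \<ge> M k \<Longrightarrow> dist (dform m f f) (dform n f f) < (1/4) ^ k" by metis
  \<comment> \<open>Any strictly increasing sequence above \<open>M\<close>.\<close>
  define r where "r k = (\<Sum>i\<le>k. M i) + k" for k
  have r: "strict_mono r" unfolding strict_mono_Suc_iff by (simp add: r_def)
  have rM: "M k \<le> r k" for k unfolding r_def by (rule trans_le_add1) (simp add: member_le_sum)
  have close: "(\<integral>t. (norm (dquot (r m) f t - dquot (r k) f t))^2 \<partial>I01) \<le> (1/4) ^ k" if "k \<le> m" for k m
  proof -
    have "r k \<le> r m" using r that by (simp add: strict_mono_less_eq)
    then have "(\<integral>t. (norm (dquot (r m) f t - dquot (r k) f t))^2 \<partial>I01) = dform (r m) f f - dform (r k) f f"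
      by (rule dquot_diff_norm)
    also have "\<dots> \<le> (1/4) ^ k" using M[of k "r m" "r k"] rM[of k] \<open>r k \<le> r m\<close> by (simp add: dist_real_def)
    finally show ?thesis .
  qed
  define y where "y k = dquot (r k) f" for k
  have yL2: "L2_path (y k)" for k unfolding y_def by (rule dquot_L2)
  have "AE t in I01. convergent (\<lambda>k. y k t)"
    by (rule L2_norm_sum_AE_Cauchy[OF yL2]) (use close in \<open>simp add: y_def\<close>)
  define v where "v t = lim (\<lambda>k. y k t)" for t
  have ae: "AE t in I01. (\<lambda>k. y k t) \<longlonglongrightarrow> v t"
    using \<open>AE t in I01. convergent (\<lambda>k. y k t)\<close> by eventually_elim (simp add: v_def convergent_LIMSEQ_iff)
  have vm: "strongly_measurable v"
    unfolding strongly_measurable_def using ae simple_function_dquot[of _ f] by (intro exI[of _ y]) (simp add: y_def)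
  have fatou: "(\<integral>\<^sup>+t. ennreal ((norm (v t - y k t))^2) \<partial>I01) \<le> ennreal ((1/4) ^ k)" for k
  proof -
    have "(\<integral>\<^sup>+t. ennreal ((norm (v t - y k t))^2) \<partial>I01) = (\<integral>\<^sup>+t. liminf (\<lambda>m. ennreal ((norm (y m t - y k t))^2)) \<partial>I01)"
    proof (rule nn_integral_cong_AE)
      show "AE t in I01. ennreal ((norm (v t - y k t))^2) = liminf (\<lambda>m. ennreal ((norm (y m t - y k t))^2))"
        using ae
      proof eventually_elim
        case (elim t)
        have "(\<lambda>m. ennreal ((norm (y m t - y k t))^2)) \<longlonglongrightarrow> ennreal ((norm (v t - y k t))^2)"
          by (intro tendsto_intros tendsto_ennrealI elim)
        then show ?case by (intro lim_imp_Liminf[symmetric]) simp_all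
      qed
    qed
    also have "\<dots> \<le> liminf (\<lambda>m. \<integral>\<^sup>+t. ennreal ((norm (y m t - y k t))^2) \<partial>I01)"
    proof (rule nn_integral_liminf)
      fix m
      have "(\<lambda>t. norm (y m t - y k t)) \<in> borel_measurable I01"
        by (rule strongly_measurable_norm[OF L2_path_diff[OF yL2 yL2, unfolded L2_path_def, THEN conjunct1]])
      then show "(\<lambda>t. ennreal ((norm (y m t - y k t))^2)) \<in> borel_measurable I01" by measurable
    qed
    also have "\<dots> \<le> ennreal ((1/4) ^ k)"
    proof (rule Liminf_le)
      show "\<forall>\<^sub>F m in sequentially. (\<integral>\<^sup>+t. ennreal ((norm (y m t - y k t))^2) \<partial>I01) \<le> ennreal ((1/4) ^ k)"
        using eventually_ge_at_top[of k]
      proof eventually_elim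
        case (elim m)
        have "(\<integral>\<^sup>+t. ennreal ((norm (y m t - y k t))^2) \<partial>I01) = ennreal (\<integral>t. (norm (y m t - y k t))^2 \<partial>I01)"
          by (intro nn_integral_eq_integral L2_path_integrable[OF L2_path_diff[OF yL2 yL2]]) simp
        then show ?case using close[OF elim] by (simp only: y_def ennreal_leI)
      qed
    qed simp
    finally show ?thesis .
  qed
  have dL2: "L2_path (\<lambda>t. v t - y k t)" for k unfolding L2_path_def
  proof (intro conjI strongly_measurable_diff vm)
    show "strongly_measurable (y k)" using yL2[of k] by (simp add: L2_path_def)
    show "(\<integral>\<^sup>+t. ennreal ((norm (v t - y k t))^2) \<partial>I01) < \<infinity>" using fatou[of k] by (simp add: le_less_trans)
  qed
  have neg: "L2_path (\<lambda>t. 0 - y 0 t)" by (rule L2_path_diff[OF L2_path_const yL2])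
  have "L2_path (\<lambda>t. (v t - y 0 t) - (0 - y 0 t))" by (rule L2_path_diff[OF dL2 neg])
  then have vL2: "L2_path v" by simp
  have le: "(\<integral>t. (norm (v t - y k t))^2 \<partial>I01) \<le> (1/4) ^ k" for k
  proof -
    have "ennreal (\<integral>t. (norm (v t - y k t))^2 \<partial>I01) = (\<integral>\<^sup>+t. ennreal ((norm (v t - y k t))^2) \<partial>I01)"
      by (intro nn_integral_eq_integral[symmetric] L2_path_integrable[OF dL2]) simp
    then have "ennreal (\<integral>t. (norm (v t - y k t))^2 \<partial>I01) \<le> ennreal ((1/4) ^ k)" using fatou[of k] by simp
    then show ?thesis by (subst (asm) ennreal_le_iff) simp_all
  qed
  have "(\<lambda>k. (1/4::real) ^ k) \<longlonglongrightarrow> 0" by (intro LIMSEQ_power_zero) simp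
  then have "(\<lambda>k. \<integral>t. (norm (v t - y k t))^2 \<partial>I01) \<longlonglongrightarrow> 0" by (rule Lim_null_comparison[rotated]) (use le in simp)
  then show ?thesis using vL2 r by (intro exI[of _ v] exI[of _ r]) (simp add: y_def)
qed

text \<open>
  Difference quotients converge in \<open>L\<^sup>2\<close> to a weak derivative, which is the given one by
  uniqueness.
\<close>

lemma H1_dquot_approx:
  fixes f :: "real \<Rightarrow> 'h::{real_inner, complete_space}"
  assumes f: "f \<in> H1" and e: "e > 0"
  shows "\<exists>j. (\<integral>t. (norm (weak_deriv f t - dquot j f t))^2 \<partial>I01) < e"
proof -
  note c = H1_continuous[OF f] and w = weak_deriv[OF f]
  obtain v r where v: "L2_path v" and r: "strict_mono r"
    and lim: "(\<lambda>k. \<integral>t. (norm (v t - dquot (r k) f t))^2 \<partial>I01) \<longlonglongrightarrow> 0"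
    using dquot_subsequence_converges[OF dform_le_norm[OF c w]] by blast
  have "has_weak_derivative f v" by (rule weak_derivative_of_L2_limit[OF c v r lim])
  then have ae: "AE t in I01. v t = weak_deriv f t" by (rule weak_derivative_unique[OF c v _ w])
  obtain k where k: "(\<integral>t. (norm (v t - dquot (r k) f t))^2 \<partial>I01) < e"
    using order_tendstoD(2)[OF lim e] by (meson eventually_happens' sequentially_bot)
  have "(\<integral>t. (norm (weak_deriv f t - dquot (r k) f t))^2 \<partial>I01) = (\<integral>t. (norm (v t - dquot (r k) f t))^2 \<partial>I01)"
  proof (rule integral_cong_AE)
    show "AE t in I01. (norm (weak_deriv f t - dquot (r k) f t))^2 = (norm (v t - dquot (r k) f t))^2"
      using ae by eventually_elim simp
  qed (intro borel_measurable_integrable L2_path_integrable L2_path_diff dquot_L2 w v)+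
  then show ?thesis using k by (intro exI[of _ "r k"]) simp
qed

text \<open>Cauchy-Schwarz gives Hoelder continuity with exponent 1/2.\<close>

lemma H1_increment_bound:
  fixes f :: "real \<Rightarrow> 'h::real_inner"
  assumes f: "f \<in> H1" and K: "(\<integral>t. (norm (weak_deriv f t))^2 \<partial>I01) \<le> K" and st: "0 \<le> s" "s \<le> t" "t \<le> 1"
  shows "(norm (f t - f s))^2 \<le> K * (t - s)"
proof (cases "f t = f s")
  case True
  have "0 \<le> K" using K by (rule order_trans[rotated]) simp
  then show ?thesis using True st by simp
next
  case False
  define w where "w = f t - f s"
  have w: "norm w > 0" using False by (simp add: w_def)
  define u where "u x = indicator {s..t} x *\<^sub>R w" for x :: real
  have st_sets: "{s..t} \<in> sets I01" by (subst sets_restrict_space_iff) (use st in auto)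
  have u: "L2_path u" unfolding u_def using st_sets
    by (intro simple_function_L2 simple_function_compose1[where g="\<lambda>x. x *\<^sub>R w"] simple_function_indicator)
  have "w \<bullet> w = integral {s..t} (\<lambda>\<tau>. weak_deriv f \<tau> \<bullet> w)"
    using weak_derivative_increment[OF H1_continuous[OF f] weak_deriv[OF f] st, of w] by (simp add: w_def)
  also have "\<dots> = (\<integral>x. indicator {s..t} x * (weak_deriv f x \<bullet> w) \<partial>I01)"
    using integral_I01_indicator[OF L2_inner_const_integrable[OF weak_deriv(1)[OF f]], of s t w] st by simp
  also have "\<dots> = (\<integral>x. weak_deriv f x \<bullet> u x \<partial>I01)" by (simp add: u_def)
  finally have eq: "(norm w)^2 = (\<integral>x. weak_deriv f x \<bullet> u x \<partial>I01)" by (simp add: power2_norm_eq_inner)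
  have "(\<integral>x. (norm (u x))^2 \<partial>I01) = (\<integral>x. indicator {s..t} x * (norm w)^2 \<partial>I01)"
    by (intro Bochner_Integration.integral_cong) (auto simp: u_def indicator_def)
  also have "\<dots> = (t - s) * (norm w)^2"
    using integral_I01_indicator[OF integrable_I01_const[of "(norm w)^2"], of s t] st by simp
  finally have nu: "(\<integral>x. (norm (u x))^2 \<partial>I01) = (t - s) * (norm w)^2" .
  have "((norm w)^2)^2 \<le> (\<integral>t. (norm (weak_deriv f t))^2 \<partial>I01) * ((t - s) * (norm w)^2)"
    unfolding eq using L2_Cauchy_Schwarz[OF weak_deriv(1)[OF f] u] by (simp only: nu eq)
  also have "\<dots> \<le> K * ((t - s) * (norm w)^2)" using K st by (intro mult_right_mono) auto
  finally have "(norm w)^2 * (norm w)^2 \<le> (K * (t - s)) * (norm w)^2" by (simp add: power2_eq_square mult_ac)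
  moreover have "0 < (norm w)^2" using w by simp
  ultimately have "(norm w)^2 \<le> K * (t - s)" by (rule mult_right_le_imp_le)
  then show ?thesis by (simp only: w_def)
qed

section \<open>Weak compactness of bounded sets of paths\<close>

lemma bounded_inner_convergence_closed:
  fixes X :: "nat \<Rightarrow> 'h::real_inner"
  assumes B: "\<And>n. norm (X n) \<le> R" and w: "w \<in> closure {w. convergent (\<lambda>n. X n \<bullet> w)}"
  shows "convergent (\<lambda>n. X n \<bullet> w)"
proof -
  have R: "0 \<le> R" using B[of 0] norm_ge_zero order_trans by blast
  have "Cauchy (\<lambda>n. X n \<bullet> w)"
  proof (rule metric_CauchyI)
    fix e :: real assume e: "e > 0"
    have "e / (3 * (R + 1)) > 0" using e R by simp
    then obtain w' where w': "convergent (\<lambda>n. X n \<bullet> w')" "dist w' w < e / (3 * (R + 1))"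
      using w unfolding closure_approachable by blast
    have "dist w' w * (3 * (R + 1)) < e" using w'(2) R by (simp add: pos_less_divide_eq)
    then have "3 * ((R + 1) * norm (w' - w)) < e" by (simp add: dist_norm algebra_simps)
    then have d: "(R + 1) * norm (w' - w) < e / 3" by simp
    have small: "\<bar>X n \<bullet> w' - X n \<bullet> w\<bar> < e / 3" for n
    proof -
      have "\<bar>X n \<bullet> (w' - w)\<bar> \<le> norm (X n) * norm (w' - w)" by (rule Cauchy_Schwarz_ineq2)
      also have "\<dots> \<le> (R + 1) * norm (w' - w)" using B[of n] by (intro mult_right_mono) auto
      also have "\<dots> < e / 3" by (rule d)
      finally show ?thesis by (simp add: inner_diff_right)
    qed
    obtain N where N: "\<And>m n. m \<ge> N \<Longrightarrow> n \<ge> N \<Longrightarrow> dist (X m \<bullet> w') (X n \<bullet> w') < e / 3"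
      using metric_CauchyD[OF convergent_Cauchy[OF w'(1)], of "e / 3"] e by auto
    show "\<exists>M. \<forall>m\<ge>M. \<forall>n\<ge>M. dist (X m \<bullet> w) (X n \<bullet> w) < e"
    proof (intro exI allI impI)
      fix m n assume mn: "m \<ge> N" "n \<ge> N"
      show "dist (X m \<bullet> w) (X n \<bullet> w) < e"
        using small[of m] small[of n] N[OF mn] unfolding dist_real_def by linarith
    qed
  qed
  then show ?thesis by (rule Cauchy_convergent)
qed

lemma subspace_closure_inner:
  fixes V :: "'h::real_normed_vector set"
  assumes V: "subspace V"
  shows "subspace (closure V)"
proof (rule subspaceI)
  show "0 \<in> closure V" using subspace_0[OF V] closure_subset by blast
  fix x y assume "x \<in> closure V" "y \<in> closure V"
  then obtain a b where ab: "\<And>n. a n \<in> V" "a \<longlonglongrightarrow> x" "\<And>n. b n \<in> V" "b \<longlonglongrightarrow> y" unfolding closure_sequential by blast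
  have "(\<lambda>n. a n + b n) \<longlonglongrightarrow> x + y" by (intro tendsto_intros ab)
  moreover have "a n + b n \<in> V" for n using subspace_add[OF V ab(1,3)] .
  ultimately show "x + y \<in> closure V" unfolding closure_sequential by (intro exI[of _ "\<lambda>n. a n + b n"]) simp
next
  fix c :: real and x assume "x \<in> closure V"
  then obtain a where ab: "\<And>n. a n \<in> V" "a \<longlonglongrightarrow> x" unfolding closure_sequential by blast
  have "(\<lambda>n. c *\<^sub>R a n) \<longlonglongrightarrow> c *\<^sub>R x" by (intro tendsto_intros ab)
  moreover have "c *\<^sub>R a n \<in> V" for n using subspace_scale[OF V ab(1)] .
  ultimately show "c *\<^sub>R x \<in> closure V" unfolding closure_sequential by (intro exI[of _ "\<lambda>n. c *\<^sub>R a n"]) simp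
qed

text \<open>
  Only test vectors in the closed span of the sequence matter, by orthogonal projection. This replaces separability.
\<close>

lemma weak_convergence_from_generators:
  fixes X :: "nat \<Rightarrow> 'h::{real_inner, complete_space}"
  assumes B: "\<And>n. norm (X n) \<le> R" and Z: "\<And>z. z \<in> Z \<Longrightarrow> convergent (\<lambda>n. X n \<bullet> z)"
    and X: "\<And>n. X n \<in> closure (span Z)"
  shows "convergent (\<lambda>n. X n \<bullet> w)"
proof -
  define C where "C = {w. convergent (\<lambda>n. X n \<bullet> w)}"
  have "subspace C"
  proof (rule subspaceI)
    show "0 \<in> C" by (simp add: C_def convergent_const)
    show "x + y \<in> C" if "x \<in> C" "y \<in> C" for x y
      using that convergent_add unfolding C_def by (simp add: inner_add_right)
    show "c *\<^sub>R x \<in> C" if x: "x \<in> C" for c x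
    proof -
      obtain L where "(\<lambda>n. X n \<bullet> x) \<longlonglongrightarrow> L" using x by (auto simp: C_def convergent_def)
      then have "(\<lambda>n. c * (X n \<bullet> x)) \<longlonglongrightarrow> c * L" by (intro tendsto_intros)
      then show ?thesis by (auto simp: C_def convergent_def)
    qed
  qed
  then have "span Z \<subseteq> C" using Z by (intro span_minimal) (auto simp: C_def)
  then have "closure (span Z) \<subseteq> closure C" by (rule closure_mono)
  then have VC: "convergent (\<lambda>n. X n \<bullet> v)" if "v \<in> closure (span Z)" for v
    using that unfolding C_def by (intro bounded_inner_convergence_closed[of X R, OF B]) blast
  have "\<exists>z\<in>closure (span Z). \<forall>x\<in>closure (span Z). z \<bullet> x = w \<bullet> x"
  proof (rule riesz_subspace)
    show "\<bar>w \<bullet> x\<bar> \<le> norm w * norm x" for x by (rule Cauchy_Schwarz_ineq2)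
  qed (auto intro: subspace_closure_inner subspace_span simp: inner_add_right)
  then obtain z where z: "z \<in> closure (span Z)" "\<And>x. x \<in> closure (span Z) \<Longrightarrow> z \<bullet> x = w \<bullet> x" by blast
  have "X n \<bullet> w = X n \<bullet> z" for n using z(2)[OF X[of n]] by (simp add: inner_commute)
  then show ?thesis using VC[OF z(1)] by simp
qed

lemma weak_limit_exists:
  fixes X :: "nat \<Rightarrow> 'h::{real_inner, complete_space}"
  assumes B: "\<And>n. norm (X n) \<le> R" and c: "\<And>w. convergent (\<lambda>n. X n \<bullet> w)"
  shows "\<exists>x. \<forall>w. (\<lambda>n. X n \<bullet> w) \<longlonglongrightarrow> x \<bullet> w"
proof -
  define l where "l w = lim (\<lambda>n. X n \<bullet> w)" for w
  have l: "(\<lambda>n. X n \<bullet> w) \<longlonglongrightarrow> l w" for w using c[of w] by (simp add: l_def convergent_LIMSEQ_iff)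
  have "bounded_linear l"
  proof (rule bounded_linear_intro[where K=R])
    show "l (x + y) = l x + l y" for x y
      using LIMSEQ_unique[OF l[of "x + y"]] tendsto_add[OF l[of x] l[of y]] by (simp add: inner_add_right)
    show "l (a *\<^sub>R x) = a *\<^sub>R l x" for a x
      using LIMSEQ_unique[OF l[of "a *\<^sub>R x"]] tendsto_mult_left[OF l[of x], of a] by simp
    show "norm (l x) \<le> norm x * R" for x
    proof (rule LIMSEQ_le_const2[OF tendsto_norm[OF l[of x]]])
      have "norm (X n \<bullet> x) \<le> norm x * R" for n
      proof -
        have "\<bar>X n \<bullet> x\<bar> \<le> norm (X n) * norm x" by (rule Cauchy_Schwarz_ineq2)
        also have "\<dots> \<le> R * norm x" using B[of n] by (intro mult_right_mono) auto
        finally show ?thesis by (simp add: mult.commute)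
      qed
      then show "\<exists>N. \<forall>n\<ge>N. norm (X n \<bullet> x) \<le> norm x * R" by blast
    qed
  qed
  then obtain x where "\<And>w. l w = x \<bullet> w" using riesz by blast
  then show ?thesis using l by auto
qed

lemma rational_in_unit_interval:
  assumes t: "t \<in> {0..1::real}" and d: "d > 0"
  shows "\<exists>q\<in>\<rat> \<inter> {0..1}. \<bar>t - q\<bar> < d"
proof -
  have "max 0 (t - d) < min 1 (t + d)" using t d by auto
  then obtain q where "q \<in> \<rat>" "max 0 (t - d) < q" "q < min 1 (t + d)" using Rats_dense_in_real by blast
  then show ?thesis by (intro bexI[of _ q]) auto
qed

text \<open>
  A diagonal argument over rational times \<open>q\<close> and the countably many generators \<open>F m q'\<close>
  gives weak convergence at rational times, and equicontinuity at all times. The limit \<open>f\<close> satisfies the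
  bound \<open>dform j f f \<le> K\<close>, so it lies in \<open>H\<^sup>1\<close>. Finally, the pairing of
  derivatives with \<open>U'\<close> is tested against \<open>dquot j U\<close>, where it is a finite sum of
  pairings at dyadic times, up to an error that is uniform in \<open>n\<close>.
\<close>

lemma H1_weak_compactness:
  fixes F :: "nat \<Rightarrow> real \<Rightarrow> 'h::{real_inner, complete_space}"
  assumes H1: "\<And>n. F n \<in> H1" and F0: "\<And>n. F n 0 = a" and F1: "\<And>n. F n 1 = b"
    and K: "\<And>n. (\<integral>t. (norm (weak_deriv (F n) t))^2 \<partial>I01) \<le> K"
  shows "\<exists>f r. strict_mono r \<and> f \<in> H1 \<and> f 0 = a \<and> f 1 = b \<and> H1_weakly_converges (\<lambda>n. F (r n)) f"
proof -
  have K0: "K \<ge> 0" using K[of 0] by (rule order_trans[rotated]) simp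
  have inc: "norm (F n t - F n s) \<le> sqrt (K * \<bar>t - s\<bar>)" if "s \<in> {0..1}" "t \<in> {0..1}" for n s t
  proof -
    have "(norm (F n t - F n s))^2 \<le> K * \<bar>t - s\<bar>"
    proof (cases "s \<le> t")
      case True
      then show ?thesis using H1_increment_bound[OF H1 K, of s t n] that by simp
    next
      case False
      then show ?thesis using H1_increment_bound[OF H1 K, of t s n] that by (simp add: norm_minus_commute)
    qed
    then show ?thesis by (rule real_le_rsqrt)
  qed
  define R where "R = norm a + sqrt K"
  have R: "norm (F n t) \<le> R" if t: "t \<in> {0..1}" for n t
  proof -
    have "norm (F n t - F n 0) \<le> sqrt (K * \<bar>t - 0\<bar>)" by (rule inc) (use t in auto)
    also have "\<dots> \<le> sqrt K" using t K0 mult_left_mono[of t 1 K] by simp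
    finally show ?thesis using norm_triangle_sub[of "F n t" "F n 0"] by (simp add: F0 R_def)
  qed
  define Q where "Q = \<rat> \<inter> {0..1::real}"
  have Q: "countable Q" unfolding Q_def by (rule countable_subset[OF _ countable_rat]) simp
  have Q01: "q \<in> {0..1}" if "q \<in> Q" for q using that by (simp add: Q_def)
  define I where "I = Q \<times> (UNIV :: nat set) \<times> Q"
  have cI: "countable I" unfolding I_def using Q by (intro countable_SIGMA) auto
  define T where "T n i = F n (fst i) \<bullet> F (fst (snd i)) (snd (snd i))" for n and i :: "real \<times> nat \<times> real"
  have Tb: "norm (T n i) \<le> R * R" if "i \<in> I" for n i
  proof -
    have "fst i \<in> Q" "snd (snd i) \<in> Q" using that by (auto simp: I_def)
    then have q: "fst i \<in> {0..1}" "snd (snd i) \<in> {0..1}" using Q01 by blast+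
    have "\<bar>T n i\<bar> \<le> norm (F n (fst i)) * norm (F (fst (snd i)) (snd (snd i)))"
      unfolding T_def by (rule Cauchy_Schwarz_ineq2)
    also have "\<dots> \<le> R * R" using R[OF q(1), of n] by (intro mult_mono R q) (auto intro: order_trans[OF norm_ge_zero])
    finally show ?thesis by simp
  qed
  obtain r :: "nat \<Rightarrow> nat" where r: "strict_mono r" and rl: "\<And>i. i \<in> I \<Longrightarrow> \<exists>l. (\<lambda>n. T (r n) i) \<longlonglongrightarrow> l"
    by (rule function_convergent_subsequence[OF cI, of T "R * R", OF Tb]) (assumption, rule that, assumption, simp)
  define Z where "Z = {F m q | m q. q \<in> Q}"
  have convQ: "convergent (\<lambda>n. F (r n) q \<bullet> w)" if q: "q \<in> Q" for q w
  proof (rule weak_convergence_from_generators)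
    show "norm (F (r n) q) \<le> R" for n by (rule R[OF Q01[OF q]])
    show "F (r n) q \<in> closure (span Z)" for n
    proof -
      have "F (r n) q \<in> Z" using q by (auto simp: Z_def)
      then show ?thesis by (intro subsetD[OF closure_subset] span_base)
    qed
    fix z assume "z \<in> Z"
    then obtain m q' where z: "z = F m q'" "q' \<in> Q" by (auto simp: Z_def)
    have "(q, m, q') \<in> I" using q z by (simp add: I_def)
    from rl[OF this] show "convergent (\<lambda>n. F (r n) q \<bullet> z)" by (simp add: convergent_def T_def z)
  qed
  have conv: "convergent (\<lambda>n. F (r n) t \<bullet> w)" if t: "t \<in> {0..1}" for t w
  proof -
    have "Cauchy (\<lambda>n. F (r n) t \<bullet> w)"
    proof (rule metric_CauchyI)
      fix e :: real assume e: "e > 0"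
      define d where "d = (e / (3 * (norm w + 1)))^2 / (K + 1)"
      have nw: "3 * (norm w + 1) > 0" by (simp add: add_nonneg_pos)
      have dp: "d > 0" unfolding d_def using e K0 nw by (intro divide_pos_pos zero_less_power) auto
      obtain q where q: "q \<in> Q" "\<bar>t - q\<bar> < d" using rational_in_unit_interval[OF t dp] by (auto simp: Q_def)
      have sm: "\<bar>F n t \<bullet> w - F n q \<bullet> w\<bar> \<le> e / 3" for n
      proof -
        have "K * \<bar>t - q\<bar> \<le> (K + 1) * d" using K0 q(2) by (intro mult_mono) auto
        also have "\<dots> = (e / (3 * (norm w + 1)))^2" using K0 by (simp add: d_def)
        finally have "sqrt (K * \<bar>t - q\<bar>) \<le> e / (3 * (norm w + 1))"
          using e nw by (intro real_le_lsqrt) (auto intro: divide_nonneg_pos)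
        then have "norm (F n t - F n q) \<le> e / (3 * (norm w + 1))" using inc[OF Q01[OF q(1)] t, of n] by simp
        then have "norm (F n t - F n q) * norm w \<le> e / (3 * (norm w + 1)) * (norm w + 1)"
          using e nw by (intro mult_mono) (auto intro: divide_nonneg_pos)
        also have "\<dots> = e / 3" using nw by (simp add: field_simps)
        finally show ?thesis using Cauchy_Schwarz_ineq2[of "F n t - F n q" w] by (simp add: inner_diff_left)
      qed
      obtain N where N: "\<And>m n. m \<ge> N \<Longrightarrow> n \<ge> N \<Longrightarrow> dist (F (r m) q \<bullet> w) (F (r n) q \<bullet> w) < e / 3"
        using metric_CauchyD[OF convergent_Cauchy[OF convQ[OF q(1), of w]], of "e / 3"] e by auto
      show "\<exists>M. \<forall>m\<ge>M. \<forall>n\<ge>M. dist (F (r m) t \<bullet> w) (F (r n) t \<bullet> w) < e"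
      proof (intro exI allI impI)
        fix m n assume mn: "m \<ge> N" "n \<ge> N"
        show "dist (F (r m) t \<bullet> w) (F (r n) t \<bullet> w) < e"
          using sm[of "r m"] sm[of "r n"] N[OF mn] unfolding dist_real_def by linarith
      qed
    qed
    then show ?thesis by (rule Cauchy_convergent)
  qed
  define f where "f t = (SOME x. \<forall>w. (\<lambda>n. F (r n) t \<bullet> w) \<longlonglongrightarrow> x \<bullet> w)" for t
  have f: "(\<lambda>n. F (r n) t \<bullet> w) \<longlonglongrightarrow> f t \<bullet> w" if t: "t \<in> {0..1}" for t w
    using someI_ex[OF weak_limit_exists[where X="\<lambda>n. F (r n) t", OF R[OF t] conv[OF t]]] unfolding f_def by blast
  have const: "f t = c" if "t \<in> {0..1}" "\<And>n. F n t = c" for t c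
  proof -
    have "f t \<bullet> w = c \<bullet> w" for w using LIMSEQ_unique[OF f[OF that(1), of w]] that(2) by simp
    then have "(f t - c) \<bullet> (f t - c) = 0" by (simp add: inner_diff_left)
    then show ?thesis by simp
  qed
  have finc: "norm (f t - f s) \<le> sqrt (K * \<bar>t - s\<bar>)" if st: "s \<in> {0..1}" "t \<in> {0..1}" for s t
  proof (cases "f t = f s")
    case False
    define w where "w = f t - f s"
    have w: "norm w > 0" using False by (simp add: w_def)
    have "(\<lambda>n. (F (r n) t - F (r n) s) \<bullet> w) \<longlonglongrightarrow> (f t - f s) \<bullet> w"
      unfolding inner_diff_left by (intro tendsto_diff f st)
    moreover have "(F (r n) t - F (r n) s) \<bullet> w \<le> sqrt (K * \<bar>t - s\<bar>) * norm w" for n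
    proof -
      have "(F (r n) t - F (r n) s) \<bullet> w \<le> norm (F (r n) t - F (r n) s) * norm w" by (rule norm_cauchy_schwarz)
      also have "\<dots> \<le> sqrt (K * \<bar>t - s\<bar>) * norm w" by (intro mult_right_mono inc st) simp
      finally show ?thesis .
    qed
    ultimately have "(f t - f s) \<bullet> w \<le> sqrt (K * \<bar>t - s\<bar>) * norm w" by (intro LIMSEQ_le_const2) auto
    then have "norm w * norm w \<le> sqrt (K * \<bar>t - s\<bar>) * norm w"
      by (simp add: w_def power2_norm_eq_inner[symmetric] power2_eq_square)
    then have "norm w \<le> sqrt (K * \<bar>t - s\<bar>)" using w by (rule mult_right_le_imp_le)
    then show ?thesis by (simp only: w_def)
  qed (use K0 in simp)
  have fc: "continuous_on {0..1} f" unfolding continuous_on_iff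
  proof (intro ballI allI impI)
    fix t e :: real assume t: "t \<in> {0..1}" and e: "e > 0"
    show "\<exists>d>0. \<forall>x'\<in>{0..1}. dist x' t < d \<longrightarrow> dist (f x') (f t) < e"
    proof (intro exI[of _ "e^2 / (K + 1)"] conjI ballI impI)
      show "0 < e^2 / (K + 1)" using e K0 by simp
      fix s assume s: "s \<in> {0..1}" "dist s t < e^2 / (K + 1)"
      have "\<bar>s - t\<bar> * (K + 1) < e^2" using s(2) K0 by (simp add: dist_real_def pos_less_divide_eq)
      moreover have "K * \<bar>s - t\<bar> \<le> \<bar>s - t\<bar> * (K + 1)" by (simp add: algebra_simps)
      ultimately have "sqrt (K * \<bar>s - t\<bar>) < e" using e by (intro real_less_lsqrt) auto
      then show "dist (f s) (f t) < e" using finc[OF t s(1)] by (simp add: dist_norm)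
    qed
  qed
  have dform_lim: "(\<lambda>n. dform j (F (r n)) g) \<longlonglongrightarrow> dform j f g" for j g unfolding dform_def incr_def inner_diff_left
    by (intro tendsto_sum tendsto_mult_left tendsto_diff f node_bounds) auto
  have wd: "L2_path (weak_deriv (F n))" "has_weak_derivative (F n) (weak_deriv (F n))" for n
    by (rule weak_deriv[OF H1])+
  have dK: "dform j f f \<le> K" for j
  proof -
    have "(dform j (F (r n)) f)^2 \<le> K * dform j f f" for n
    proof -
      have "(\<integral>t. weak_deriv (F (r n)) t \<bullet> dquot j f t \<partial>I01)\<^sup>2
         \<le> (\<integral>t. (norm (weak_deriv (F (r n)) t))^2 \<partial>I01) * (\<integral>t. (norm (dquot j f t))^2 \<partial>I01)"
        by (rule L2_Cauchy_Schwarz[OF wd(1) dquot_L2])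
      then have "(dform j (F (r n)) f)^2 \<le> (\<integral>t. (norm (weak_deriv (F (r n)) t))^2 \<partial>I01) * dform j f f"
        by (simp only: dquot_norm integral_inner_dquot[OF H1_continuous[OF H1] wd])
      also have "\<dots> \<le> K * dform j f f" by (intro mult_right_mono K dform_nonneg)
      finally show ?thesis .
    qed
    then have "(dform j f f)^2 \<le> K * dform j f f"
      using tendsto_power[OF dform_lim[of j f], of 2] by (intro LIMSEQ_le_const2) auto
    then have le: "dform j f f * dform j f f \<le> K * dform j f f" by (simp add: power2_eq_square)
    show ?thesis
    proof (cases "dform j f f > 0")
      case True
      then show ?thesis using le by (rule mult_right_le_imp_le[rotated])
    next
      case False
      then show ?thesis using K0 by simp
    qed
  qed
  obtain v r' where v: "L2_path v" "strict_mono r'" "(\<lambda>k. \<integral>t. (norm (v t - dquot (r' k) f t))^2 \<partial>I01) \<longlonglongrightarrow> 0"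
    using dquot_subsequence_converges[OF dK] by blast
  have fH: "f \<in> H1" by (rule H1I[OF fc v(1) weak_derivative_of_L2_limit[OF fc v]])
  note fw = weak_deriv[OF fH]
  define M where "M = K + (\<integral>t. (norm (weak_deriv f t))^2 \<partial>I01) + 1"
  have M: "M > 0" "K \<le> M" "(\<integral>t. (norm (weak_deriv f t))^2 \<partial>I01) \<le> M"
  proof -
    have "0 \<le> (\<integral>t. (norm (weak_deriv f t))^2 \<partial>I01)" by simp
    then show "M > 0" "K \<le> M" "(\<integral>t. (norm (weak_deriv f t))^2 \<partial>I01) \<le> M" using K0 unfolding M_def by linarith+
  qed
  have "H1_weakly_converges (\<lambda>n. F (r n)) f" unfolding H1_weakly_converges_def H1_inner_def
  proof (intro ballI tendsto_add)
    fix U :: "real \<Rightarrow> 'h" assume U: "U \<in> H1"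
    note Uc = H1_continuous[OF U] and Uw = weak_deriv[OF U]
    obtain B where B: "\<And>t. t \<in> {0..1} \<Longrightarrow> norm (U t) \<le> B" using bounded_on_I01[OF Uc] by blast
    show "(\<lambda>n. \<integral>t. F (r n) t \<bullet> U t \<partial>I01) \<longlonglongrightarrow> (\<integral>t. f t \<bullet> U t \<partial>I01)"
    proof (rule integral_dominated_convergence[where w="\<lambda>_. R * B"])
      show "(\<lambda>t. f t \<bullet> U t) \<in> borel_measurable I01"
        by (intro borel_measurable_I01_continuous continuous_intros fc Uc)
      show "(\<lambda>t. F (r n) t \<bullet> U t) \<in> borel_measurable I01" for n
        by (intro borel_measurable_I01_continuous continuous_intros H1_continuous[OF H1] Uc)
      show "integrable I01 (\<lambda>_. R * B)" by (rule integrable_I01_const)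
      show "AE t in I01. (\<lambda>n. F (r n) t \<bullet> U t) \<longlonglongrightarrow> f t \<bullet> U t" using AE_I01_space by eventually_elim (rule f)
      show "AE t in I01. norm (F (r n) t \<bullet> U t) \<le> R * B" for n using AE_I01_space
      proof eventually_elim
        case (elim t)
        have "\<bar>F (r n) t \<bullet> U t\<bar> \<le> norm (F (r n) t) * norm (U t)" by (rule Cauchy_Schwarz_ineq2)
        also have "\<dots> \<le> R * B" using R[OF elim, of "r n"] by (intro mult_mono R B elim) (auto intro: order_trans[OF norm_ge_zero])
        finally show ?case by simp
      qed
    qed
    show "(\<lambda>n. \<integral>t. weak_deriv (F (r n)) t \<bullet> weak_deriv U t \<partial>I01) \<longlonglongrightarrow> (\<integral>t. weak_deriv f t \<bullet> weak_deriv U t \<partial>I01)"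
    proof (rule metric_LIMSEQ_I)
      fix e :: real assume e: "e > 0"
      \<comment> \<open>By Cauchy-Schwarz the error is below \<open>sqrt (M * (e\<^sup>2 / (9 * M))) = e / 3\<close>.\<close>
      have "e^2 / (9 * M) > 0" using e M by simp
      then obtain j where j: "(\<integral>t. (norm (weak_deriv U t - dquot j U t))^2 \<partial>I01) < e^2 / (9 * M)"
        using H1_dquot_approx[OF U] by blast
      have approx: "\<bar>(\<integral>t. p t \<bullet> weak_deriv U t \<partial>I01) - (\<integral>t. p t \<bullet> dquot j U t \<partial>I01)\<bar> < e / 3"
        if p: "L2_path p" "(\<integral>t. (norm (p t))^2 \<partial>I01) \<le> M" for p
      proof -
        have "((\<integral>t. p t \<bullet> weak_deriv U t \<partial>I01) - (\<integral>t. p t \<bullet> dquot j U t \<partial>I01))^2 = (\<integral>t. p t \<bullet> (weak_deriv U t - dquot j U t) \<partial>I01)^2"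
          unfolding inner_diff_right
          by (subst Bochner_Integration.integral_diff[OF L2_inner_integrable[OF p(1) Uw(1)] L2_inner_integrable[OF p(1) dquot_L2]]) (rule refl)
        also have "\<dots> \<le> (\<integral>t. (norm (p t))^2 \<partial>I01) * (\<integral>t. (norm (weak_deriv U t - dquot j U t))^2 \<partial>I01)"
          by (rule L2_Cauchy_Schwarz[OF p(1) L2_path_diff[OF Uw(1) dquot_L2]])
        also have "\<dots> \<le> M * (\<integral>t. (norm (weak_deriv U t - dquot j U t))^2 \<partial>I01)" by (intro mult_right_mono p) simp
        also have "\<dots> < M * (e^2 / (9 * M))" using j M by (intro mult_strict_left_mono) auto
        also have "\<dots> = (e / 3)^2" using M by (simp add: power2_eq_square)
        finally have "\<bar>(\<integral>t. p t \<bullet> weak_deriv U t \<partial>I01) - (\<integral>t. p t \<bullet> dquot j U t \<partial>I01)\<bar>\<^sup>2 < (e / 3)^2" by simp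
        then show ?thesis by (rule power2_less_imp_less) (use e in simp)
      qed
      have eq: "(\<integral>t. weak_deriv g t \<bullet> dquot j U t \<partial>I01) = dform j g U" if "g \<in> H1" for g
        by (rule integral_inner_dquot[OF H1_continuous[OF that] weak_deriv[OF that]])
      have "e / 3 > 0" using e by simp
      then obtain N where N: "\<And>n. n \<ge> N \<Longrightarrow> dist (dform j (F (r n)) U) (dform j f U) < e / 3"
        using dform_lim[of j U] unfolding lim_sequentially by blast
      show "\<exists>N. \<forall>n\<ge>N. dist (\<integral>t. weak_deriv (F (r n)) t \<bullet> weak_deriv U t \<partial>I01) (\<integral>t. weak_deriv f t \<bullet> weak_deriv U t \<partial>I01) < e"
      proof (intro exI allI impI)
        fix n assume n: "n \<ge> N"
        have 1: "\<bar>(\<integral>t. weak_deriv (F (r n)) t \<bullet> weak_deriv U t \<partial>I01) - dform j (F (r n)) U\<bar> < e / 3"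
          using approx[OF wd(1) order_trans[OF K M(2)], of "r n"] by (simp only: eq[OF H1])
        have 2: "\<bar>(\<integral>t. weak_deriv f t \<bullet> weak_deriv U t \<partial>I01) - dform j f U\<bar> < e / 3"
          using approx[OF fw(1) M(3)] by (simp only: eq[OF fH])
        show "dist (\<integral>t. weak_deriv (F (r n)) t \<bullet> weak_deriv U t \<partial>I01) (\<integral>t. weak_deriv f t \<bullet> weak_deriv U t \<partial>I01) < e"
          using 1 2 N[OF n] unfolding dist_real_def by linarith
      qed
    qed
  qed
  moreover have "f 0 = a" "f 1 = b" by (rule const; simp add: F0 F1)+
  ultimately show ?thesis using r fH by blast
qed

section \<open>Metrics on open subsets of a Hilbert space\<close>

locale hilbert_riem = strong_riem hilbert_atlas M G
  for M :: "'h::{real_inner, complete_space} set" and G :: "('h, 'h) metric"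
begin

text \<open>The norm of the tangent vector \<open>v\<close> at \<open>x\<close>, in the identity chart.\<close>

definition nrm :: "'h \<Rightarrow> 'h \<Rightarrow> real" where
  "nrm x v = sqrt (blinfun_apply (blinfun_apply (g id_chart x) v) v)"

lemma id_chart_in: "id_chart \<in> hilbert_atlas" by (simp add: hilbert_atlas_def)

lemma form_sym: "x \<in> M \<Longrightarrow> g id_chart x v w = g id_chart x w v" using g_sym[OF id_chart_in, of x v w] by simp

lemma form_nonneg: "x \<in> M \<Longrightarrow> 0 \<le> g id_chart x v v" using g_nonneg[OF id_chart_in, of x v] by simp

lemma form_nrm: "x \<in> M \<Longrightarrow> (nrm x v)\<^sup>2 = g id_chart x v v" using form_nonneg[of x v] by (simp add: nrm_def)

lemma metric_nrm: "x \<in> M \<Longrightarrow> G x (hilbert_tangent x v) (hilbert_tangent x v) = (nrm x v)^2"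
  using G_eq_g[OF id_chart_in, of x v v] by (simp add: form_nrm)

lemma nrm_nonneg: "x \<in> M \<Longrightarrow> 0 \<le> nrm x v" using form_nonneg[of x v] by (simp add: nrm_def)

lemma nrm_scale: "nrm x (a *\<^sub>R v) = \<bar>a\<bar> * nrm x v"
  by (simp add: nrm_def blinfun.scaleR_left blinfun.scaleR_right real_sqrt_mult flip: mult.assoc)

lemma nrm_isCont: "isCont (nrm x) y"
  unfolding nrm_def isCont_def by (intro tendsto_real_sqrt blinfun.tendsto tendsto_const tendsto_ident_at)

text \<open>
  The metric at nearby points is almost the same, in ratio. With
  \<open>\<eta> = \<delta> / (1 + \<delta>)\<close> and norm continuity, coercivity turns an absolute error into
  the relative error \<open>\<eta>\<close>.
\<close>

lemma nrm_comparison: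
  assumes p: "p \<in> M" and \<delta>: "\<delta> > 0"
  shows "\<exists>r>0. ball p r \<subseteq> M \<and> (\<forall>x\<in>ball p r. \<forall>v. nrm x v \<le> (1 + \<delta>) * nrm p v \<and> nrm p v \<le> (1 + \<delta>) * nrm x v)"
proof -
  obtain k where k: "k > 0" "\<And>v. k * norm v \<le> nrm p v"
    using g_coercive[OF id_chart_in, of p] p by (auto simp: nrm_def)
  define \<eta> where "\<eta> = \<delta> / (1 + \<delta>)"
  have \<eta>: "\<eta> > 0" "\<eta> \<le> \<delta>" "(1 + \<delta>) * (1 - \<eta>) = 1" using \<delta> by (auto simp: \<eta>_def divide_le_eq field_simps)
  have e: "\<eta> * k^2 > 0" using k \<eta> by simp
  have "continuous_on M (g id_chart)" using g_continuous[OF id_chart_in] by simp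
  then obtain d where d: "d > 0" "\<And>x. x \<in> M \<Longrightarrow> dist x p < d \<Longrightarrow> dist (g id_chart x) (g id_chart p) < \<eta> * k^2"
    using p e unfolding continuous_on_iff by meson
  obtain r0 where r0: "r0 > 0" "ball p r0 \<subseteq> M" using openE[OF openS p] .
  show ?thesis
  proof (intro exI[of _ "min d r0"] conjI ballI allI)
    show "0 < min d r0" using d r0 by simp
    show "ball p (min d r0) \<subseteq> M" using r0 by auto
    fix x v assume x: "x \<in> ball p (min d r0)"
    then have xM: "x \<in> M" using r0 by auto
    define D where "D = g id_chart x - g id_chart p"
    have "norm D < \<eta> * k^2" using d(2)[OF xM] x by (simp add: D_def dist_norm dist_commute[of p x] norm_minus_commute)
    have "\<bar>D v v\<bar> \<le> norm (D v) * norm v" using norm_blinfun[of "D v" v] by simp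
    also have "\<dots> \<le> (norm D * norm v) * norm v" by (intro mult_right_mono norm_blinfun) simp
    also have "\<dots> \<le> (\<eta> * k^2 * norm v) * norm v" using \<open>norm D < _\<close> by (intro mult_right_mono) auto
    also have "\<dots> = \<eta> * (k * norm v)^2" by (simp add: power2_eq_square)
    also have "\<dots> \<le> \<eta> * (nrm p v)^2" using \<eta> k by (intro mult_left_mono power_mono) auto
    finally have dv: "\<bar>(nrm x v)\<^sup>2 - (nrm p v)\<^sup>2\<bar> \<le> \<eta> * (nrm p v)^2"
      by (simp add: D_def form_nrm[OF xM] form_nrm[OF p] blinfun.diff_left)
    have sq: "1 + \<delta> \<le> (1 + \<delta>)^2" using \<delta> by (simp add: power2_eq_square field_simps)
    have "(nrm x v)^2 \<le> (1 + \<eta>) * (nrm p v)^2" using dv by (simp add: algebra_simps)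
    also have "\<dots> \<le> (1 + \<delta>)^2 * (nrm p v)^2" using \<eta> sq by (intro mult_right_mono) auto
    finally have "(nrm x v)^2 \<le> ((1 + \<delta>) * nrm p v)^2" by (simp add: power_mult_distrib)
    then show "nrm x v \<le> (1 + \<delta>) * nrm p v" by (rule power2_le_imp_le) (use \<delta> nrm_nonneg[OF p, of v] in simp)
    have "(nrm p v)^2 = (1 + \<delta>) * ((1 - \<eta>) * (nrm p v)^2)" by (simp add: \<eta>(3) flip: mult.assoc)
    also have "\<dots> \<le> (1 + \<delta>) * (nrm x v)^2" using dv \<delta> by (intro mult_left_mono) (auto simp: algebra_simps)
    also have "\<dots> \<le> (1 + \<delta>)^2 * (nrm x v)^2" using sq by (intro mult_right_mono) auto
    finally have "(nrm p v)^2 \<le> ((1 + \<delta>) * nrm x v)^2" by (simp add: power_mult_distrib)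
    then show "nrm p v \<le> (1 + \<delta>) * nrm x v" by (rule power2_le_imp_le) (use \<delta> nrm_nonneg[OF xM, of v] in simp)
  qed
qed

lemma dist_le_nrm:
  assumes r: "ball p r \<subseteq> M" and K: "\<And>x v. x \<in> ball p r \<Longrightarrow> nrm x v \<le> K * nrm p v"
    and x: "x \<in> ball p r" and y: "y \<in> ball p r"
  shows "dist\<^sub>G x y \<le> ennreal (K * nrm p (y - x))"
proof -
  have seg: "closed_segment x y \<subseteq> ball p r" using x y by (intro closed_segment_subset) auto
  show ?thesis
  proof (rule dist_le_segment[OF id_chart_in])
    show "closed_segment (snd id_chart x) (snd id_chart y) \<subseteq> cdom id_chart" using seg r by simp
    fix q assume "q \<in> closed_segment (snd id_chart x) (snd id_chart y)"
    then have "q \<in> ball p r" using seg by auto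
    from K[OF this, of "y - x"]
    show "sqrt (g id_chart q (snd id_chart y - snd id_chart x) (snd id_chart y - snd id_chart x)) \<le> K * nrm p (y - x)"
      by (simp add: nrm_def)
  qed simp_all
qed

lemma nrm_integrable:
  assumes p: "p \<in> M" and v: "L2_path v"
  shows "integrable I01 (\<lambda>t. nrm p (v t))"
proof -
  have sm: "strongly_measurable v" using v by (simp add: L2_path_def)
  define K where "K = norm (g id_chart p) + 1"
  have K: "K \<ge> 1" by (simp add: K_def)
  show ?thesis
  proof (rule Bochner_Integration.integrable_bound[where f="\<lambda>t. K * (1 + (norm (v t))^2)"])
    show "integrable I01 (\<lambda>t. K * (1 + (norm (v t))^2))"
      by (intro integrable_mult_right Bochner_Integration.integrable_add integrable_I01_const L2_path_integrable v)
    show "(\<lambda>t. nrm p (v t)) \<in> borel_measurable I01"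
      by (rule strongly_measurable_caratheodory[OF sm]) (simp_all add: nrm_isCont)
    show "AE t in I01. norm (nrm p (v t)) \<le> norm (K * (1 + (norm (v t))^2))"
    proof (rule AE_I2)
      fix t
      have "(nrm p (v t))^2 \<le> norm (g id_chart p (v t)) * norm (v t)"
        using norm_blinfun[of "g id_chart p (v t)" "v t"] by (simp add: form_nrm[OF p])
      also have "\<dots> \<le> (norm (g id_chart p) * norm (v t)) * norm (v t)" by (intro mult_right_mono norm_blinfun) simp
      also have "\<dots> \<le> K * (norm (v t))^2" by (simp add: K_def power2_eq_square algebra_simps)
      finally have a: "(nrm p (v t))^2 \<le> K * (norm (v t))^2" .
      have "nrm p (v t) \<le> 1 + (nrm p (v t))^2"
        using zero_le_power2[of "nrm p (v t) - 1"] zero_le_power2[of "nrm p (v t)"]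
        nrm_nonneg[OF p, of "v t"] unfolding power2_diff by simp
      also have "\<dots> \<le> K * (1 + (norm (v t))^2)" using a K by (simp add: algebra_simps)
      finally show "norm (nrm p (v t)) \<le> norm (K * (1 + (norm (v t))^2))"
        using nrm_nonneg[OF p, of "v t"] by simp
    qed
  qed
qed

text \<open>
  As for differentiable curves, the increment is paired with itself, now through the Riesz representative of
  \<open>g z\<close>.
\<close>

lemma nrm_increment:
  assumes f: "continuous_on {0..1} f" and v: "L2_path v" and w: "has_weak_derivative f v" and p: "p \<in> M"
    and st: "0 \<le> s" "s \<le> t" "t \<le> 1"
  shows "ennreal (nrm p (f t - f s)) \<le> (\<integral>\<^sup>+\<tau>. indicator {s..t} \<tau> * ennreal (nrm p (v \<tau>)) \<partial>I01)"
proof -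
  note int = nrm_integrable[OF p v]
  define z where "z = f t - f s"
  obtain \<zeta> where \<zeta>: "\<And>y. g id_chart p z y = \<zeta> \<bullet> y"
    using riesz[OF blinfun.bounded_linear_right[of "g id_chart p z"]] by blast
  have h: "(\<lambda>\<tau>. nrm p (v \<tau>)) integrable_on {s..t}"
    by (rule integrable_on_subinterval[OF integral_I01(2)[OF int]]) (use st in auto)
  have "(nrm p z)^2 = z \<bullet> \<zeta>" using \<zeta>[of z] by (simp add: form_nrm[OF p] inner_commute)
  also have "\<dots> = integral {s..t} (\<lambda>\<tau>. v \<tau> \<bullet> \<zeta>)" unfolding z_def by (rule weak_derivative_increment[OF f v w st])
  also have "\<dots> \<le> integral {s..t} (\<lambda>\<tau>. nrm p z * nrm p (v \<tau>))"
  proof (rule integral_le)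
    show "(\<lambda>\<tau>. v \<tau> \<bullet> \<zeta>) integrable_on {s..t}"
      by (rule integrable_on_subinterval[OF integral_I01(2)[OF L2_inner_const_integrable[OF v]]]) (use st in auto)
    show "(\<lambda>\<tau>. nrm p z * nrm p (v \<tau>)) integrable_on {s..t}" by (rule integrable_on_mult_right[OF h])
    fix \<tau>
    have "\<bar>g id_chart p z (v \<tau>)\<bar> \<le> nrm p z * nrm p (v \<tau>)"
      unfolding nrm_def by (rule form_Cauchy_Schwarz) (use p in \<open>auto intro: form_sym form_nonneg\<close>)
    then show "v \<tau> \<bullet> \<zeta> \<le> nrm p z * nrm p (v \<tau>)" by (simp add: \<zeta> inner_commute)
  qed
  also have "\<dots> = nrm p z * integral {s..t} (\<lambda>\<tau>. nrm p (v \<tau>))" by simp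
  finally have "nrm p z * nrm p z \<le> nrm p z * integral {s..t} (\<lambda>\<tau>. nrm p (v \<tau>))" by (simp add: power2_eq_square)
  then have "nrm p z \<le> integral {s..t} (\<lambda>\<tau>. nrm p (v \<tau>))"
    using nrm_nonneg[OF p, of z] integral_nonneg[OF h nrm_nonneg[OF p]]
    by (cases "nrm p z = 0") (auto simp: mult_le_cancel_left)
  also have "\<dots> = (\<integral>\<tau>. indicator {s..t} \<tau> * nrm p (v \<tau>) \<partial>I01)"
    by (rule integral_I01_indicator[symmetric, OF int]) (use st in auto)
  finally have "ennreal (nrm p z) \<le> ennreal (\<integral>\<tau>. indicator {s..t} \<tau> * nrm p (v \<tau>) \<partial>I01)" by (rule ennreal_leI)
  also have "\<dots> = (\<integral>\<^sup>+\<tau>. ennreal (indicator {s..t} \<tau> * nrm p (v \<tau>)) \<partial>I01)"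
  proof (rule nn_integral_eq_integral[symmetric])
    have "{s..t} \<subseteq> {0..1}" using st by auto
    then have "{s..t} \<in> sets I01" by (simp add: sets_restrict_space_iff)
    then show "integrable I01 (\<lambda>\<tau>. indicator {s..t} \<tau> * nrm p (v \<tau>))"
      using integrable_mult_indicator[OF _ int, of "{s..t}"] by simp
    show "AE \<tau> in I01. 0 \<le> indicator {s..t} \<tau> * nrm p (v \<tau>)" using nrm_nonneg[OF p] by simp
  qed
  also have "\<dots> = (\<integral>\<^sup>+\<tau>. indicator {s..t} \<tau> * ennreal (nrm p (v \<tau>)) \<partial>I01)"
    by (intro nn_integral_cong) (simp add: indicator_def)
  finally show ?thesis by (simp only: z_def)
qed

text \<open>
  Cutting off outside \<open>[s,t]\<close> makes the integrand meaningful although \<open>f\<close> may leave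
  \<open>M\<close> at other times.
\<close>

lemma speed_measurable:
  assumes f: "continuous_on {0..1} f" and v: "strongly_measurable v" and st: "0 \<le> s" "t \<le> 1" and im: "f ` {s..t} \<subseteq> M"
  shows "(\<lambda>\<tau>. if \<tau> \<in> {s..t} then nrm (f \<tau>) (v \<tau>) else 0) \<in> borel_measurable I01"
proof (rule strongly_measurable_caratheodory[OF v])
  fix y
  have gM: "continuous_on M (g id_chart)" using g_continuous[OF id_chart_in] by simp
  have "continuous_on {s..t} f" by (rule continuous_on_subset[OF f]) (use st in auto)
  then have "continuous_on {s..t} (\<lambda>\<tau>. nrm (f \<tau>) y)" unfolding nrm_def
    by (intro continuous_on_real_sqrt blinfun.continuous_on continuous_on_const continuous_on_compose2[OF gM _ im])
  then have "(\<lambda>\<tau>. if \<tau> \<in> {s..t} then nrm (f \<tau>) y else 0) \<in> borel_measurable borel"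
    by (intro borel_measurable_continuous_on_if) auto
  then have "(\<lambda>\<tau>. if \<tau> \<in> {s..t} then nrm (f \<tau>) y else 0) \<in> borel_measurable lebesgue"
    using measurable_completion[of _ lborel] by simp
  then show "(\<lambda>\<tau>. if \<tau> \<in> {s..t} then nrm (f \<tau>) y else 0) \<in> borel_measurable I01"
    by (rule measurable_restrict_space1)
next
  fix \<tau> y
  show "isCont (\<lambda>y. if \<tau> \<in> {s..t} then nrm (f \<tau>) y else 0) y"
    using nrm_isCont[where x="f \<tau>" and y=y] by (cases "\<tau> \<in> {s..t}") (simp_all only: if_True if_False continuous_const)
qed

end

section \<open>Distance, energy and polygons\<close>

context hilbert_riem begin

lemma interval_split_AE: "AE \<tau> in I01. indicator {s..u} \<tau> = (indicator {s..t} \<tau> + indicator {t..u} \<tau> :: ennreal)"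
  if "s \<le> t" "t \<le> u" using AE_I01_finite[of "{t}"] that by (auto elim!: eventually_mono simp: indicator_def)

text \<open>
  The distance is defined through piecewise \<open>C\<^sup>1\<close> paths, but \<open>H\<^sup>1\<close>-paths are not
  shorter. On a small parameter interval the segment joining the end points beats the path up to a factor
  \<open>(1 + \<delta>)\<^sup>2\<close>; bisection makes this global, and \<open>\<delta>\<close> is arbitrary.
\<close>

lemma dist_le_length_H1:
  assumes f: "continuous_on {0..1} f" and v: "L2_path v" and w: "has_weak_derivative f v"
    and st: "0 \<le> s0" "s0 \<le> t0" "t0 \<le> 1" and im: "f ` {s0..t0} \<subseteq> M"
  shows "dist\<^sub>G (f s0) (f t0) \<le> (\<integral>\<^sup>+\<tau>. indicator {s0..t0} \<tau> * ennreal (nrm (f \<tau>) (v \<tau>)) \<partial>I01)"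
proof -
  define l where "l \<tau> = (if \<tau> \<in> {s0..t0} then nrm (f \<tau>) (v \<tau>) else 0)" for \<tau>
  have lm: "l \<in> borel_measurable I01"
    unfolding l_def by (rule speed_measurable[OF f _ st(1,3) im]) (use v in \<open>simp add: L2_path_def\<close>)
  define L where "L s t = (\<integral>\<^sup>+\<tau>. indicator {s..t} \<tau> * ennreal (l \<tau>) \<partial>I01)" for s t
  have ind[measurable]: "(indicator {s..t} :: real \<Rightarrow> ennreal) \<in> borel_measurable I01" for s t :: real
    by (intro measurable_restrict_space1 borel_measurable_indicator) simp
  have L_add: "L s u = L s t + L t u" if "s \<le> t" "t \<le> u" for s t u
  proof -
    have "L s u = (\<integral>\<^sup>+\<tau>. indicator {s..t} \<tau> * ennreal (l \<tau>) + indicator {t..u} \<tau> * ennreal (l \<tau>) \<partial>I01)"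
      unfolding L_def by (rule nn_integral_cong_AE, use interval_split_AE[OF that] in eventually_elim) (simp add: distrib_right)
    also have "\<dots> = L s t + L t u"
      unfolding L_def using lm by (intro nn_integral_add borel_measurable_times_ennreal ind) simp_all
    finally show ?thesis .
  qed
  have close: "dist\<^sub>G (f s0) (f t0) \<le> ennreal ((1 + \<delta>)^2) * L s0 t0" if \<delta>: "\<delta> > 0" for \<delta>
  proof -
    have "s0 \<le> s0 \<and> t0 \<le> t0 \<longrightarrow> dist\<^sub>G (f s0) (f t0) \<le> ennreal ((1 + \<delta>)^2) * L s0 t0" using st(2)
    proof (induction rule: Bolzano[where P="\<lambda>s t. s0 \<le> s \<and> t \<le> t0 \<longrightarrow> dist\<^sub>G (f s) (f t) \<le> ennreal ((1 + \<delta>)^2) * L s t"])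
      case (trans a b c)
      show ?case
      proof
        assume "s0 \<le> a \<and> c \<le> t0"
        then have 1: "dist\<^sub>G (f a) (f b) \<le> ennreal ((1 + \<delta>)^2) * L a b" "dist\<^sub>G (f b) (f c) \<le> ennreal ((1 + \<delta>)^2) * L b c"
          using trans by auto
        have "dist\<^sub>G (f a) (f c) \<le> dist\<^sub>G (f a) (f b) + dist\<^sub>G (f b) (f c)" by (rule dist_triangle)
        also have "\<dots> \<le> ennreal ((1 + \<delta>)^2) * L a c"
          unfolding L_add[OF trans(3,4)] distrib_left by (rule add_mono[OF 1])
        finally show "dist\<^sub>G (f a) (f c) \<le> ennreal ((1 + \<delta>)^2) * L a c" .
      qed
    next
      case (local x)
      have p: "f x \<in> M" using im local by auto
      obtain r where r: "r > 0" "ball (f x) r \<subseteq> M"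
        "\<And>y v. y \<in> ball (f x) r \<Longrightarrow> nrm y v \<le> (1 + \<delta>) * nrm (f x) v"
        "\<And>y v. y \<in> ball (f x) r \<Longrightarrow> nrm (f x) v \<le> (1 + \<delta>) * nrm y v" using nrm_comparison[OF p \<delta>] by blast
      have x01: "x \<in> {0..1}" using local st by auto
      obtain d where d: "d > 0" "\<And>y. y \<in> {0..1} \<Longrightarrow> dist y x < d \<Longrightarrow> dist (f y) (f x) < r"
        using f x01 r(1) unfolding continuous_on_iff by meson
      have "dist\<^sub>G (f a) (f b) \<le> ennreal ((1 + \<delta>)^2) * L a b" if ab: "a \<le> x" "x \<le> b" "b - a < d" "s0 \<le> a" "b \<le> t0" for a b
      proof -
        have near: "f \<tau> \<in> ball (f x) r" if "\<tau> \<in> {a..b}" for \<tau>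
        proof -
          have "dist \<tau> x < d" using that ab by (auto simp: dist_real_def abs_if)
          moreover have "\<tau> \<in> {0..1}" using that ab st by auto
          ultimately have "dist (f \<tau>) (f x) < r" by (intro d(2))
          then show ?thesis by (simp add: dist_norm norm_minus_commute)
        qed
        have "dist\<^sub>G (f a) (f b) \<le> ennreal ((1 + \<delta>) * nrm (f x) (f b - f a))"
          by (rule dist_le_nrm[OF r(2,3)]) (use near ab in auto)
        also have "\<dots> = ennreal (1 + \<delta>) * ennreal (nrm (f x) (f b - f a))" using \<delta> nrm_nonneg[OF p] by (simp add: ennreal_mult)
        also have "\<dots> \<le> ennreal (1 + \<delta>) * (\<integral>\<^sup>+\<tau>. indicator {a..b} \<tau> * ennreal (nrm (f x) (v \<tau>)) \<partial>I01)"
          by (intro mult_left_mono nrm_increment[OF f v w p]) (use ab st in auto)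
        also have "(\<integral>\<^sup>+\<tau>. indicator {a..b} \<tau> * ennreal (nrm (f x) (v \<tau>)) \<partial>I01)
            \<le> (\<integral>\<^sup>+\<tau>. ennreal (1 + \<delta>) * (indicator {a..b} \<tau> * ennreal (l \<tau>)) \<partial>I01)"
        proof (rule nn_integral_mono)
          fix \<tau>
          show "indicator {a..b} \<tau> * ennreal (nrm (f x) (v \<tau>)) \<le> ennreal (1 + \<delta>) * (indicator {a..b} \<tau> * ennreal (l \<tau>))"
          proof (cases "\<tau> \<in> {a..b}")
            case True
            then have "l \<tau> = nrm (f \<tau>) (v \<tau>)" using ab by (simp add: l_def)
            moreover have "0 \<le> nrm (f \<tau>) (v \<tau>)" using near[OF True] r(2) by (auto intro: nrm_nonneg)
            moreover have "ennreal (nrm (f x) (v \<tau>)) \<le> ennreal ((1 + \<delta>) * nrm (f \<tau>) (v \<tau>))"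
              by (intro ennreal_leI r near True)
            ultimately show ?thesis using True \<delta> by (simp add: ennreal_mult)
          qed simp
        qed
        also have "\<dots> = ennreal (1 + \<delta>) * L a b"
          unfolding L_def using lm by (intro nn_integral_cmult borel_measurable_times_ennreal ind) simp
        finally show ?thesis using \<delta> by (simp add: ennreal_mult power2_eq_square mult.assoc mult_left_mono)
      qed
      then show ?case using d(1) by (intro exI[of _ d]) blast
    qed
    then show ?thesis by simp
  qed
  have "dist\<^sub>G (f s0) (f t0) \<le> L s0 t0"
  proof (rule tendsto_lowerbound)
    have "((\<lambda>\<delta>. (1 + \<delta>)^2) \<longlongrightarrow> (1 + 0)\<^sup>2) (at_right (0::real))" by (intro tendsto_intros)
    then have "((\<lambda>\<delta>. ennreal ((1 + \<delta>)^2)) \<longlongrightarrow> 1) (at_right 0)" using tendsto_ennrealI by force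
    then show "((\<lambda>\<delta>. ennreal ((1 + \<delta>)^2) * L s0 t0) \<longlongrightarrow> L s0 t0) (at_right 0)"
      using tendsto_mult_ennreal[of _ 1 _ "\<lambda>_. L s0 t0" "L s0 t0"] by simp
    show "\<forall>\<^sub>F \<delta> in at_right 0. dist\<^sub>G (f s0) (f t0) \<le> ennreal ((1 + \<delta>)^2) * L s0 t0"
      using close by (auto simp: eventually_at_right_field intro: exI[of _ 1])
  qed simp
  also have "L s0 t0 = (\<integral>\<^sup>+\<tau>. indicator {s0..t0} \<tau> * ennreal (nrm (f \<tau>) (v \<tau>)) \<partial>I01)"
    unfolding L_def by (intro nn_integral_cong) (simp add: l_def indicator_def)
  finally show ?thesis .
qed

text \<open>
  Cauchy-Schwarz on an interval of length at most 1. The path may leave \<open>M\<close> outside \<open>[s,t]\<close>;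
  this is needed for the first-exit argument.
\<close>

lemma dist_le_energy:
  assumes f: "f \<in> H1" and st: "0 \<le> s" "s \<le> t" "t \<le> 1" and im: "f ` {s..t} \<subseteq> M"
  shows "(dist\<^sub>G (f s) (f t))^2 \<le> path_energy M G f"
proof -
  note v = weak_deriv[OF f] and c = H1_continuous[OF f]
  define l where "l \<tau> = (if \<tau> \<in> {s..t} then nrm (f \<tau>) (weak_deriv f \<tau>) else 0)" for \<tau>
  have lm: "l \<in> borel_measurable I01"
    unfolding l_def by (rule speed_measurable[OF c _ st(1,3) im]) (use v in \<open>simp add: L2_path_def\<close>)
  have l0: "0 \<le> l \<tau>" for \<tau> using im by (auto simp: l_def intro!: nrm_nonneg)
  have "dist\<^sub>G (f s) (f t) \<le> (\<integral>\<^sup>+\<tau>. indicator {s..t} \<tau> * ennreal (nrm (f \<tau>) (weak_deriv f \<tau>)) \<partial>I01)"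
    by (rule dist_le_length_H1[OF c v st im])
  also have "\<dots> = (\<integral>\<^sup>+\<tau>. ennreal (l \<tau>) * 1 \<partial>I01)" by (intro nn_integral_cong) (simp add: l_def indicator_def)
  finally have "(dist\<^sub>G (f s) (f t))^2 \<le> (\<integral>\<^sup>+\<tau>. ennreal (l \<tau>) * 1 \<partial>I01)^2" by (rule power_mono) simp
  also have "\<dots> \<le> (\<integral>\<^sup>+\<tau>. (ennreal (l \<tau>))^2 \<partial>I01) * (\<integral>\<^sup>+\<tau>. 1^2 \<partial>I01)"
    using lm by (intro Cauchy_Schwarz_nn_integral) simp_all
  also have "\<dots> = (\<integral>\<^sup>+\<tau>. (ennreal (l \<tau>))^2 \<partial>I01)" using emeasure_I01 by simp
  also have "\<dots> \<le> path_energy M G f" unfolding path_energy_def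
  proof (rule nn_integral_mono)
    fix \<tau>
    show "(ennreal (l \<tau>))^2 \<le> (if f \<tau> \<in> M then ennreal (G (f \<tau>) (hilbert_tangent (f \<tau>) (weak_deriv f \<tau>)) (hilbert_tangent (f \<tau>) (weak_deriv f \<tau>))) else \<infinity>)"
      using l0[of \<tau>] by (simp add: metric_nrm ennreal_power l_def)
  qed
  finally show ?thesis .
qed

text \<open>
  \<open>x\<close> and \<open>y\<close> are joined by a polygon in \<open>M\<close> whose speed is at most 1 during a
  time \<open>m\<close>. Speed is bounded at all regular times, so that rescaling to \<open>[0,1]\<close> gives a
  bound for the energy, not just the length.
\<close>

definition polygon :: "'h \<Rightarrow> 'h \<Rightarrow> real \<Rightarrow> bool" where
  "polygon x y m \<longleftrightarrow> 0 \<le> m \<and> (\<exists>f v P. continuous_on {0..m} f \<and> f ` {0..m} \<subseteq> M \<and> f 0 = x \<and> f m = y \<and> finite P \<and>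
     simple_function borel v \<and>
     (\<forall>t\<in>{0<..<m} - P. (f has_vector_derivative v t) (at t) \<and> nrm (f t) (v t) \<le> 1))"

lemma polygonI:
  assumes "0 \<le> m" "continuous_on {0..m} f" "f ` {0..m} \<subseteq> M" "f 0 = x" "f m = y" "finite P" "simple_function borel v"
    and "\<And>t. t \<in> {0<..<m} - P \<Longrightarrow> (f has_vector_derivative v t) (at t)"
    and "\<And>t. t \<in> {0<..<m} - P \<Longrightarrow> nrm (f t) (v t) \<le> 1"
  shows "polygon x y m" unfolding polygon_def
  by (rule conjI, rule assms(1), rule exI[of _ f], rule exI[of _ v], rule exI[of _ P], intro conjI ballI assms)

lemma polygon_segment:
  assumes seg: "closed_segment x y \<subseteq> M" and n: "\<And>q. q \<in> closed_segment x y \<Longrightarrow> nrm q (y - x) \<le> m" and m: "m > 0"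
  shows "polygon x y m"
proof -
  define v where "v = (1 / m) *\<^sub>R (y - x)"
  have q: "x + t *\<^sub>R v \<in> closed_segment x y" if "t \<in> {0..m}" for t
  proof -
    have "x + t *\<^sub>R v = (1 - t / m) *\<^sub>R x + (t / m) *\<^sub>R y" by (simp add: v_def algebra_simps)
    moreover have "0 \<le> t / m" "t / m \<le> 1" using that m by auto
    ultimately show ?thesis unfolding closed_segment_def by blast
  qed
  have nv: "nrm (x + t *\<^sub>R v) v \<le> 1" if "t \<in> {0..m}" for t
    using n[OF q[OF that]] m by (subst (2) v_def) (simp add: nrm_scale divide_le_eq)
  show ?thesis
  proof (rule polygonI[of m "\<lambda>t. x + t *\<^sub>R v" x y "{}" "\<lambda>_. v"])
    show "(\<lambda>t. x + t *\<^sub>R v) ` {0..m} \<subseteq> M" using q seg by auto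
    show "x + m *\<^sub>R v = y" using m by (simp add: v_def)
    fix t assume "t \<in> {0<..<m} - {}"
    then show "nrm (x + t *\<^sub>R v) v \<le> 1" by (intro nv) auto
    show "((\<lambda>t. x + t *\<^sub>R v) has_vector_derivative v) (at t)" by (auto intro!: derivative_eq_intros)
  qed (use m in \<open>auto intro!: continuous_intros\<close>)
qed

lemma polygon_refl: "x \<in> M \<Longrightarrow> polygon x x 0" by (rule polygonI[of 0 "\<lambda>_. x" x x "{}" "\<lambda>_. 0"]) auto

text \<open>Concatenation, with the second polygon shifted in time.\<close>

lemma polygon_trans:
  assumes "polygon x y k" "polygon y z m"
  shows "polygon x z (k + m)"
proof -
  obtain f v P where k: "0 \<le> k" and f: "continuous_on {0..k} f" "f ` {0..k} \<subseteq> M" "f 0 = x" "f k = y" "finite P"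
    "simple_function borel v" "\<And>t. t \<in> {0<..<k} - P \<Longrightarrow> (f has_vector_derivative v t) (at t) \<and> nrm (f t) (v t) \<le> 1"
    using assms(1) unfolding polygon_def by (elim exE conjE) (rule that, assumption+, blast)
  obtain f' v' P' where l: "0 \<le> m" and f': "continuous_on {0..m} f'" "f' ` {0..m} \<subseteq> M" "f' 0 = y" "f' m = z" "finite P'"
    "simple_function borel v'" "\<And>t. t \<in> {0<..<m} - P' \<Longrightarrow> (f' has_vector_derivative v' t) (at t) \<and> nrm (f' t) (v' t) \<le> 1"
    using assms(2) unfolding polygon_def by (elim exE conjE) (rule that, assumption+, blast)
  define h where "h t = (if t \<le> k then f t else f' (t - k))" for t
  define w where "w t = (if t \<le> k then v t else v' (t - k))" for t
  define R where "R = insert k (P \<union> (\<lambda>t. t + k) ` P')"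
  have hk: "h t = f' (t - k)" if "k \<le> t" for t using that f(4) f'(3) by (cases "t = k") (auto simp: h_def)
  have "continuous_on ({0..k} \<union> {k..k + m}) h"
  proof (rule continuous_on_closed_Un)
    show "continuous_on {0..k} h" by (rule continuous_on_eq[OF f(1)]) (simp add: h_def)
    have "continuous_on {k..k + m} (\<lambda>t. f' (t - k))" by (rule continuous_on_compose2[OF f'(1)]) (auto intro!: continuous_intros)
    then show "continuous_on {k..k + m} h" by (rule continuous_on_eq) (simp add: hk)
  qed auto
  moreover have "{0..k} \<union> {k..k + m} = {0..k + m}" using k l by auto
  ultimately have hc: "continuous_on {0..k + m} h" by simp
  have hM: "h t \<in> M" if "t \<in> {0..k + m}" for t using that f(2) f'(2) by (auto simp: h_def image_subset_iff)
  have ws: "simple_function borel w" unfolding w_def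
  proof (rule simple_function_If[OF f(6)])
    show "simple_function borel (\<lambda>t. v' (t - k))"
      using simple_function_comp[of "\<lambda>t. t - k" borel borel v'] f'(6) by (simp add: comp_def)
    show "{t \<in> space borel. t \<le> k} \<in> sets borel" by simp
  qed
  have dw: "(h has_vector_derivative w t) (at t) \<and> nrm (h t) (w t) \<le> 1" if t: "t \<in> {0<..<k + m} - R" for t
  proof (cases "t < k")
    case True
    then have d: "(f has_vector_derivative v t) (at t) \<and> nrm (f t) (v t) \<le> 1" using t by (intro f(7)) (auto simp: R_def)
    have "(h has_vector_derivative v t) (at t)"
      by (rule has_vector_derivative_transform_within_open[OF conjunct1[OF d], of "{..<k}"]) (use True in \<open>auto simp: h_def\<close>)
    then show ?thesis using True d by (simp add: h_def w_def)
  next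
    case False
    then have tk: "t > k" using t by (auto simp: R_def)
    have "t - k \<notin> P'"
    proof
      assume "t - k \<in> P'"
      then have "t - k + k \<in> (\<lambda>t. t + k) ` P'" by (rule imageI)
      then show False using t by (simp add: R_def)
    qed
    then have d: "(f' has_vector_derivative v' (t - k)) (at (t - k)) \<and> nrm (f' (t - k)) (v' (t - k)) \<le> 1"
      using t tk by (intro f'(7)) auto
    have "((f' \<circ> (\<lambda>t. t - k)) has_vector_derivative 1 *\<^sub>R v' (t - k)) (at t)"
      by (rule vector_diff_chain_at) (use d in \<open>auto intro!: derivative_eq_intros\<close>)
    then have d': "((\<lambda>t. f' (t - k)) has_vector_derivative v' (t - k)) (at t)" by (simp add: comp_def)
    have "(h has_vector_derivative v' (t - k)) (at t)"
      by (rule has_vector_derivative_transform_within_open[OF d', of "{k<..}"]) (use tk in \<open>auto simp: h_def\<close>)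
    then show ?thesis using tk d by (simp add: h_def w_def)
  qed
  show ?thesis
  proof (rule polygonI[of "k + m" h x z R w])
    show "h ` {0..k + m} \<subseteq> M" using hM by auto
    show "h 0 = x" using k f(3) by (simp add: h_def)
    show "h (k + m) = z" using hk[of "k + m"] l f'(4) by simp
    show "finite R" using f(5) f'(5) by (simp add: R_def)
  qed (use k l hc ws dw in \<open>simp_all\<close>)
qed

end

context hilbert_riem begin

text \<open>
  Inscribe a polygon in an almost minimal path. The extra \<open>\<delta> (t - s)\<close> makes the duration of
  each segment positive, even where the path stands still.
\<close>

lemma polygon_le_length:
  assumes r: "dist\<^sub>G x y < ennreal r"
  shows "\<exists>m>0. m < r \<and> polygon x y m"
proof -
  obtain \<gamma> where \<gamma>: "pwC1 hilbert_atlas 0 1 \<gamma>" "\<gamma> ` {0..1} \<subseteq> M" "\<gamma> 0 = x" "\<gamma> 1 = y" "integral {0..1} (speed hilbert_atlas G \<gamma>) < r"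
    using dist_lessE[OF r] .
  define len where "len s t = integral {s..t} (speed hilbert_atlas G \<gamma>)" for s t
  have len0: "0 \<le> len s t" if "0 \<le> s" "s \<le> t" "t \<le> 1" for s t
    unfolding len_def by (rule speed_integral_nonneg[OF pwC1_subset[OF \<gamma>(1)]]) (use that \<gamma>(2) in \<open>auto simp: image_subset_iff\<close>)
  have si: "speed hilbert_atlas G \<gamma> integrable_on {s..t}" if "0 \<le> s" "t \<le> 1" for s t
    by (rule integrable_on_subinterval[OF speed_integrable[OF \<gamma>(1,2)]]) (use that in auto)
  have len_add: "len s u = len s t + len t u" if "0 \<le> s" "s \<le> t" "t \<le> u" "u \<le> 1" for s t u
    unfolding len_def by (rule Henstock_Kurzweil_Integration.integral_combine[symmetric]) (use that si in auto)
  have "((\<lambda>\<delta>. (1 + \<delta>)^2 * len 0 1 + \<delta>) \<longlongrightarrow> (1 + 0)\<^sup>2 * len 0 1 + 0) (at_right (0::real))" by (intro tendsto_intros)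
  then have "\<forall>\<^sub>F \<delta> in at_right 0. (1 + \<delta>)^2 * len 0 1 + \<delta> < r"
    by (rule order_tendstoD(2)) (use \<gamma>(5) in \<open>simp add: len_def\<close>)
  then obtain \<delta> where \<delta>: "\<delta> > 0" "(1 + \<delta>)^2 * len 0 1 + \<delta> < r"
    using eventually_happens[OF eventually_conj[OF _ eventually_at_right_less[of 0]]] by force
  have "polygon (\<gamma> 0) (\<gamma> 1) ((1 + \<delta>)^2 * len 0 1 + \<delta> * (1 - 0))"
  proof (rule pwC1_Bolzano[OF \<gamma>(1), where Q="\<lambda>s t. polygon (\<gamma> s) (\<gamma> t) ((1 + \<delta>)^2 * len s t + \<delta> * (t - s))"])
    fix s t u :: real
    assume st: "0 \<le> s" "s \<le> t" "t \<le> u" "u \<le> 1"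
      and "polygon (\<gamma> s) (\<gamma> t) ((1 + \<delta>)^2 * len s t + \<delta> * (t - s))" "polygon (\<gamma> t) (\<gamma> u) ((1 + \<delta>)^2 * len t u + \<delta> * (u - t))"
    from polygon_trans[OF this(5,6)] show "polygon (\<gamma> s) (\<gamma> u) ((1 + \<delta>)^2 * len s u + \<delta> * (u - s))"
      by (simp add: len_add[OF st] algebra_simps)
  next
    fix x :: real assume x: "x \<in> {0..1}"
    then have p: "\<gamma> x \<in> M" using \<gamma>(2) by auto
    obtain r where r: "r > 0" "ball (\<gamma> x) r \<subseteq> M"
      "\<And>y v. y \<in> ball (\<gamma> x) r \<Longrightarrow> nrm y v \<le> (1 + \<delta>) * nrm (\<gamma> x) v"
      "\<And>y v. y \<in> ball (\<gamma> x) r \<Longrightarrow> nrm (\<gamma> x) v \<le> (1 + \<delta>) * nrm y v" using nrm_comparison[OF p \<delta>(1)] by blast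
    show "\<exists>U. open U \<and> \<gamma> x \<in> U \<and> (\<forall>s t. 0 \<le> s \<and> s \<le> t \<and> t \<le> 1 \<and> \<gamma> ` {s..t} \<subseteq> U \<and> (s < t \<longrightarrow> C1_path_on hilbert_atlas s t \<gamma>)
        \<longrightarrow> polygon (\<gamma> s) (\<gamma> t) ((1 + \<delta>)^2 * len s t + \<delta> * (t - s)))"
    proof (intro exI[of _ "ball (\<gamma> x) r"] conjI allI impI; (elim conjE)?)
      show "\<gamma> x \<in> ball (\<gamma> x) r" using r by simp
      fix s t assume st: "0 \<le> s" "s \<le> t" "t \<le> 1" and im: "\<gamma> ` {s..t} \<subseteq> ball (\<gamma> x) r"
        and C: "s < t \<longrightarrow> C1_path_on hilbert_atlas s t \<gamma>"
      have near: "\<gamma> \<tau> \<in> ball (\<gamma> x) r" if "\<tau> \<in> {s..t}" for \<tau> using that im by blast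
      show "polygon (\<gamma> s) (\<gamma> t) ((1 + \<delta>)^2 * len s t + \<delta> * (t - s))"
      proof (cases "s = t")
        case True
        have "\<gamma> t \<in> M" using near[of t] r(2) st by auto
        then show ?thesis using True polygon_refl by (simp add: len_def)
      next
        case False
        then have lt: "s < t" using st by simp
        obtain x' where x': "continuous_on {s..t} (snd id_chart \<circ> \<gamma>)"
          "\<And>\<tau>. \<tau> \<in> {s<..<t} \<Longrightarrow> ((snd id_chart \<circ> \<gamma>) has_vector_derivative x' \<tau>) (at \<tau>)"
          "\<And>\<tau>. \<tau> \<in> {s<..<t} \<Longrightarrow> \<gamma> \<tau> \<in> M \<Longrightarrow> speed hilbert_atlas G \<gamma> \<tau> = sqrt (g id_chart (snd id_chart (\<gamma> \<tau>)) (x' \<tau>) (x' \<tau>))"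
          using chart_piece[OF C[rule_format, OF lt] lt id_chart_in, unfolded fst_conv, OF subset_UNIV] by blast
        have "nrm (\<gamma> x) (\<gamma> t - \<gamma> s) \<le> integral {s..t} (\<lambda>\<tau>. (1 + \<delta>) * speed hilbert_atlas G \<gamma> \<tau>)"
          unfolding nrm_def
        proof (rule sqrt_form_increment_le_integral[where P="{}" and x'=x'])
          show "continuous_on {s..t} \<gamma>" using x'(1) by (simp add: comp_def)
          fix \<tau> assume \<tau>: "\<tau> \<in> {s<..<t} - {}"
          then show "(\<gamma> has_vector_derivative x' \<tau>) (at \<tau>)" using x'(2)[of \<tau>] by (simp add: comp_def)
          have n: "\<gamma> \<tau> \<in> ball (\<gamma> x) r" using \<tau> by (intro near) auto
          have "nrm (\<gamma> x) (x' \<tau>) \<le> (1 + \<delta>) * nrm (\<gamma> \<tau>) (x' \<tau>)" by (rule r(4)[OF n])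
          moreover have "speed hilbert_atlas G \<gamma> \<tau> = nrm (\<gamma> \<tau>) (x' \<tau>)"
            using x'(3)[of \<tau>] \<tau> n r(2) unfolding nrm_def by (auto simp: subset_iff)
          ultimately show "sqrt (g id_chart (\<gamma> x) (x' \<tau>) (x' \<tau>)) \<le> (1 + \<delta>) * speed hilbert_atlas G \<gamma> \<tau>" by (simp add: nrm_def)
        qed (use p st in \<open>auto intro: form_sym form_nonneg integrable_on_mult_right si\<close>)
        also have "\<dots> = (1 + \<delta>) * len s t" by (simp add: len_def)
        finally have le: "nrm (\<gamma> x) (\<gamma> t - \<gamma> s) \<le> (1 + \<delta>) * len s t" .
        have seg: "closed_segment (\<gamma> s) (\<gamma> t) \<subseteq> ball (\<gamma> x) r"
          by (rule closed_segment_subset) (use near[of s] near[of t] st in auto)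
        show ?thesis
        proof (rule polygon_segment)
          show "closed_segment (\<gamma> s) (\<gamma> t) \<subseteq> M" using seg r(2) by blast
          show "0 < (1 + \<delta>)^2 * len s t + \<delta> * (t - s)"
            using len0[OF st] \<delta>(1) lt by (intro add_nonneg_pos mult_nonneg_nonneg mult_pos_pos) auto
          fix q assume "q \<in> closed_segment (\<gamma> s) (\<gamma> t)"
          then have "nrm q (\<gamma> t - \<gamma> s) \<le> (1 + \<delta>) * nrm (\<gamma> x) (\<gamma> t - \<gamma> s)" using seg by (intro r(3)) blast
          also have "\<dots> \<le> (1 + \<delta>) * ((1 + \<delta>) * len s t)" using le \<delta>(1) by (intro mult_left_mono) auto
          also have "\<dots> = (1 + \<delta>)^2 * len s t" by (simp add: power2_eq_square)
          also have "\<dots> \<le> (1 + \<delta>)^2 * len s t + \<delta> * (t - s)" using \<delta>(1) lt by simp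
          finally show "nrm q (\<gamma> t - \<gamma> s) \<le> (1 + \<delta>)^2 * len s t + \<delta> * (t - s)" .
        qed
      qed
    qed simp
  qed simp
  moreover have "0 < (1 + \<delta>)^2 * len 0 1 + \<delta>" using len0[of 0 1] \<delta>(1) by (intro add_nonneg_pos) auto
  ultimately show ?thesis using \<delta>(2) \<gamma>(3,4) by (intro exI[of _ "(1 + \<delta>)^2 * len 0 1 + \<delta>"]) simp
qed

text \<open>
  Rescale time by \<open>m\<close>; the velocity takes finitely many values, so the polygon is in
  \<open>H\<^sup>1\<close>.
\<close>

lemma H1_path_of_polygon:
  assumes P: "polygon x y m" and m: "m > 0"
  shows "\<exists>f\<in>H1_paths_between M x y. path_energy M G f \<le> ennreal (m^2)"
proof -
  obtain f v P where f: "continuous_on {0..m} f" "f ` {0..m} \<subseteq> M" "f 0 = x" "f m = y" "finite P"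
    "simple_function borel v" "\<And>t. t \<in> {0<..<m} - P \<Longrightarrow> (f has_vector_derivative v t) (at t) \<and> nrm (f t) (v t) \<le> 1"
    using P unfolding polygon_def by (elim exE conjE) (rule that, assumption+, blast)
  define h where "h t = f (m * t)" for t
  define w where "w t = m *\<^sub>R v (m * t)" for t
  define Q where "Q = (\<lambda>t. m * t) -` P"
  have Q: "finite Q" unfolding Q_def using f(5) m by (intro finite_vimageI injI) auto
  have mt: "m * t \<in> {0..m}" if "t \<in> {0..1}" for t using that m by (auto simp: mult_le_cancel_left1)
  have hc: "continuous_on {0..1} h"
    unfolding h_def by (rule continuous_on_compose2[OF f(1)]) (use mt in \<open>auto intro!: continuous_intros\<close>)
  have hM: "h ` {0..1} \<subseteq> M" using mt f(2) by (auto simp: h_def image_subset_iff)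
  have ws: "simple_function I01 w"
  proof -
    have "simple_function borel (\<lambda>t. v (m * t))"
      using simple_function_comp[of "\<lambda>t. m * t" borel borel v] f(6) by (simp add: comp_def)
    then have "simple_function borel w" unfolding w_def by (rule simple_function_compose1)
    then have fin: "finite (range w)" and mb: "w \<in> measurable borel (count_space UNIV)" by (simp_all add: simple_function_eq_measurable)
    have m: "w \<in> measurable lebesgue (count_space UNIV)"
      by (rule measurable_completion) (simp only: measurable_lborel2 mb)
    have "finite (w ` space I01)" by (rule finite_subset[OF image_mono[OF subset_UNIV] fin])
    moreover have "w \<in> measurable I01 (count_space UNIV)" by (rule measurable_restrict_space1[OF m])
    ultimately show ?thesis unfolding simple_function_eq_measurable by (rule conjI)
  qed
  have dw: "(h has_vector_derivative w t) (at t)" and nw: "nrm (h t) (w t) \<le> m" if t: "t \<in> {0<..<1} - Q" for t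
  proof -
    have "m * t \<in> {0<..<m} - P" using t m by (auto simp: Q_def)
    from f(7)[OF this] have d: "(f has_vector_derivative v (m * t)) (at (m * t))" and n: "nrm (h t) (v (m * t)) \<le> 1"
      by (simp_all add: h_def)
    have "((f \<circ> (\<lambda>t. m * t)) has_vector_derivative m *\<^sub>R v (m * t)) (at t)"
      by (rule vector_diff_chain_at) (use d in \<open>auto intro!: derivative_eq_intros\<close>)
    then show "(h has_vector_derivative w t) (at t)" by (simp add: comp_def h_def[abs_def] w_def)
    show "nrm (h t) (w t) \<le> m" using n m by (simp add: w_def nrm_scale mult_le_cancel_left1)
  qed
  have wL2: "L2_path w" by (rule simple_function_L2[OF ws])
  have wd: "has_weak_derivative h w" by (rule polygonal_weak_derivative[OF hc Q dw ws])
  have hH: "h \<in> H1" by (rule H1I[OF hc wL2 wd])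
  have "AE t in I01. t \<notin> insert 0 (insert 1 Q)" by (rule AE_I01_finite) (use Q in simp)
  then have "AE t in I01. (if h t \<in> M then ennreal (G (h t) (hilbert_tangent (h t) (weak_deriv h t)) (hilbert_tangent (h t) (weak_deriv h t))) else \<infinity>) \<le> ennreal (m^2)"
    using AE_I01_space weak_derivative_unique[OF hc wL2 wd weak_deriv[OF hH]]
  proof eventually_elim
    case (elim t)
    have hM': "h t \<in> M" using hM elim by blast
    have "nrm (h t) (w t) \<le> m" using elim by (intro nw) auto
    then have "(nrm (h t) (w t))^2 \<le> m^2" using nrm_nonneg[OF hM'] by (intro power_mono) auto
    then show ?case using hM' elim(3)[symmetric] by (simp add: metric_nrm ennreal_leI)
  qed
  then have "path_energy M G h \<le> (\<integral>\<^sup>+t. ennreal (m^2) \<partial>I01)" unfolding path_energy_def by (rule nn_integral_mono_AE)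
  also have "\<dots> = ennreal (m^2)" using emeasure_I01 by simp
  finally have e: "path_energy M G h \<le> ennreal (m^2)" .
  show ?thesis using e hH hM f(3,4) by (intro bexI[of _ h]) (simp_all add: H1_paths_between_def h_def)
qed

text \<open>Having finite distance is an equivalence relation with open classes.\<close>

lemma finite_dist_iff_connected:
  assumes x: "x \<in> M" and y: "y \<in> M"
  shows "dist\<^sub>G x y < \<infinity> \<longleftrightarrow> connected_component M x y"
proof
  assume "dist\<^sub>G x y < \<infinity>"
  then obtain q where q: "dist\<^sub>G x y = ennreal q" "0 \<le> q" by (cases "dist\<^sub>G x y") auto
  have "dist\<^sub>G x y < ennreal (q + 1)" unfolding q(1) using q(2) by (intro ennreal_lessI) auto
  then obtain \<gamma> where \<gamma>: "pwC1 hilbert_atlas 0 1 \<gamma>" "\<gamma> ` {0..1} \<subseteq> M" "\<gamma> 0 = x" "\<gamma> 1 = y" by (rule dist_lessE)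
  have "connected (\<gamma> ` {0..1})" by (rule connected_continuous_image) (use \<gamma>(1) in \<open>simp_all add: pwC1_def\<close>)
  moreover have "x \<in> \<gamma> ` {0..1}" "y \<in> \<gamma> ` {0..1}" using \<gamma>(3,4) by force+
  ultimately show "connected_component M x y" unfolding connected_component_def using \<gamma>(2) by blast
next
  assume "connected_component M x y"
  then obtain T where T: "connected T" "T \<subseteq> M" "x \<in> T" "y \<in> T" unfolding connected_component_def by blast
  show "dist\<^sub>G x y < \<infinity>"
  proof (rule connected_equivalence_relation[OF T(1,3,4), where R="\<lambda>x y. dist\<^sub>G x y < \<infinity>"])
    show "dist\<^sub>G v u < \<infinity>" if "dist\<^sub>G u v < \<infinity>" for u v using that dist_commute[of u v] by simp
    show "dist\<^sub>G u w < \<infinity>" if "dist\<^sub>G u v < \<infinity>" "dist\<^sub>G v w < \<infinity>" for u v w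
      using that dist_triangle[of u w v] by (simp add: ennreal_add_less_top order_le_less_trans)
    fix a assume a: "a \<in> T"
    then have aM: "a \<in> M" using T(2) by blast
    obtain d where d: "d > 0" "\<And>z. norm (z - a) < d \<Longrightarrow> dist\<^sub>G a z < ennreal 1"
      using chart_controls_dist[OF id_chart_in, of a 1] aM by auto
    show "\<exists>U. openin (top_of_set T) U \<and> a \<in> U \<and> (\<forall>z\<in>U. dist\<^sub>G a z < \<infinity>)"
    proof (intro exI[of _ "T \<inter> ball a d"] conjI ballI)
      show "openin (top_of_set T) (T \<inter> ball a d)" by (intro openin_open_Int open_ball)
      show "a \<in> T \<inter> ball a d" using a d by simp
      fix z assume "z \<in> T \<inter> ball a d"
      then have "dist\<^sub>G a z < ennreal 1" by (intro d) (simp add: dist_norm norm_minus_commute)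
      also have "ennreal 1 < \<infinity>" by simp
      finally show "dist\<^sub>G a z < \<infinity>" .
    qed
  qed
qed

end

section \<open>Energy minimizers\<close>

text \<open>The transition map of the single chart is the identity.\<close>

lemma hilbert_coord_tangent:
  assumes "smooth_atlas (hilbert_atlas :: ('h::{real_inner, complete_space}, 'h) chart set)"
  shows "hilbert_coord (hilbert_tangent x v) = (v :: 'h)"
proof -
  interpret atlas "hilbert_atlas :: ('h, 'h) chart set" by unfold_locales (rule assms)
  have "dtrans id_chart id_chart x = (\<lambda>v :: 'h. v)"
    by (rule transition_derivative_self) (simp_all add: hilbert_atlas_def)
  then have "hilbert_tangent x v = {(id_chart, v)}" by (auto simp: tangent_def hilbert_atlas_def)
  then show ?thesis by (simp add: hilbert_coord_def)
qed

lemma hilbert_metric_tangent: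
  assumes "smooth_atlas (hilbert_atlas :: ('h::{real_inner, complete_space}, 'h) chart set)"
  shows "hilbert_metric x (hilbert_tangent x v) (hilbert_tangent x w) = (v :: 'h) \<bullet> w"
  by (simp add: hilbert_metric_def hilbert_coord_tangent[OF assms])

lemma hilbert_dist_le_norm:
  assumes a: "smooth_atlas (hilbert_atlas :: ('h::{real_inner, complete_space}, 'h) chart set)"
    and s: "strong_riemannian_metric hilbert_atlas UNIV (hilbert_metric :: ('h, 'h) metric)"
  shows "geodesic_dist hilbert_atlas UNIV hilbert_metric x y \<le> ennreal (norm (y - x :: 'h))"
proof -
  interpret bar: hilbert_riem "UNIV :: 'h set" hilbert_metric by unfold_locales (use a s in simp_all)
  have n: "bar.nrm q v = norm v" for q v
  proof -
    have "(bar.nrm q v)^2 = (norm v)^2"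
      using bar.metric_nrm[of q v] by (simp add: hilbert_metric_tangent[OF a] power2_norm_eq_inner)
    then show ?thesis by (rule power2_eq_imp_eq) (simp_all add: bar.nrm_nonneg)
  qed
  show ?thesis
    using bar.dist_le_nrm[of x "norm (y - x) + 1" 1 x y] add_nonneg_pos[OF norm_ge_zero[of "y - x"] zero_less_one]
    by (simp add: n dist_norm norm_minus_commute)
qed

lemma ennreal_le_square_imp_less:
  assumes "a^2 \<le> ennreal (r^2)" "0 \<le> r" "r < s"
  shows "a < ennreal s"
proof -
  have "a \<le> ennreal r" using assms by (intro ennreal_power2_le_imp_le) (simp_all add: ennreal_power)
  also have "\<dots> < ennreal s" using assms by (intro ennreal_lessI) auto
  finally show ?thesis .
qed

text \<open>The direct method, with the first-exit argument for the weak limit.\<close>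

theorem minimizing_geodesic_exists:
  assumes H: "completeness_hypotheses hilbert_atlas hilbert_metric M G"
    and lsc: "energy_weakly_lsc (M :: 'h::{real_inner, complete_space} set) G"
    and f0: "f0 \<in> M" and f1: "f1 \<in> M" and fin: "geodesic_dist hilbert_atlas M G f0 f1 < \<infinity>"
  shows "\<exists>f. minimizing_geodesic M G f0 f1 f"
proof -
  note hyps = H[unfolded completeness_hypotheses_def]
  have atl: "smooth_atlas (hilbert_atlas :: ('h, 'h) chart set)" using hyps by blast
  interpret hilbert_riem M G by unfold_locales (use hyps in blast)+
  obtain D where D: "dist\<^sub>G f0 f1 = ennreal D" "0 \<le> D" using fin by (cases "dist\<^sub>G f0 f1") auto
  have "\<exists>F\<in>H1_paths_between M f0 f1. path_energy M G F \<le> ennreal ((D + 1 / Suc n)^2)" for n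
  proof -
    have "dist\<^sub>G f0 f1 < ennreal (D + 1 / Suc n)" unfolding D(1) using D(2) by (intro ennreal_lessI) (auto simp: add_nonneg_pos)
    from polygon_le_length[OF this] obtain m where m: "m > 0" "m < D + 1 / Suc n" "polygon f0 f1 m" by blast
    obtain F where F: "F \<in> H1_paths_between M f0 f1" "path_energy M G F \<le> ennreal (m^2)"
      using H1_path_of_polygon[OF m(3,1)] by blast
    have "ennreal (m^2) \<le> ennreal ((D + 1 / Suc n)^2)" using m by (intro ennreal_leI power_mono) auto
    with F(2) have "path_energy M G F \<le> ennreal ((D + 1 / Suc n)^2)" by (rule order_trans)
    then show ?thesis using F(1) by (rule bexI)
  qed
  then obtain F where F: "\<And>n. F n \<in> H1_paths_between M f0 f1" and FE: "\<And>n. path_energy M G (F n) \<le> ennreal ((D + 1 / Suc n)^2)"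
    by metis
  have FH: "F n \<in> H1" and FM: "F n ` {0..1} \<subseteq> M" and F0: "F n 0 = f0" and F1: "F n 1 = f1" for n
    using F[of n] by (simp_all add: H1_paths_between_def)
  \<comment> \<open>Contains all paths of energy at most \<open>(D + 1)\<^sup>2\<close> that start at \<open>f0\<close>.\<close>
  define B where "B = {y\<in>M. dist\<^sub>G f0 y < ennreal (D + 2)}"
  have B: "B \<in> metric_balls hilbert_atlas M G"
    unfolding metric_balls_def B_def using f0 D(2) by (intro CollectI exI[of _ f0] exI[of _ "D + 2"]) simp
  obtain C where C: "C > 0" "\<And>x h. x \<in> B \<Longrightarrow> h \<in> tangent_space hilbert_atlas x \<Longrightarrow> hilbert_metric x h h \<le> C * G x h h"
    using hyps B unfolding dominates_on_balls_def by meson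
  have Cn: "(norm v)^2 \<le> C * (nrm x v)^2" if "x \<in> B" for x v
  proof -
    have "hilbert_tangent x v \<in> tangent_space hilbert_atlas x" unfolding tangent_space_def using id_chart_in by fastforce
    from C(2)[OF that this] show ?thesis
      using that by (simp add: hilbert_metric_tangent[OF atl] metric_nrm B_def power2_norm_eq_inner)
  qed
  have FE1: "path_energy M G (F n) \<le> ennreal ((D + 1)^2)" for n
  proof -
    have "ennreal ((D + 1 / Suc n)^2) \<le> ennreal ((D + 1)^2)" using D(2) by (intro ennreal_leI power_mono) auto
    then show ?thesis using FE[of n] by (rule order_trans[rotated])
  qed
  have FB: "F n t \<in> B" if t: "t \<in> {0..1}" for n t
  proof -
    have "(dist\<^sub>G (F n 0) (F n t))^2 \<le> path_energy M G (F n)"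
      by (rule dist_le_energy[OF FH]) (use t FM[of n] in \<open>auto simp: image_subset_iff\<close>)
    then have "(dist\<^sub>G f0 (F n t))^2 \<le> ennreal ((D + 1)^2)" unfolding F0 using FE1[of n] by (rule order_trans)
    then have "dist\<^sub>G f0 (F n t) < ennreal (D + 2)" by (rule ennreal_le_square_imp_less) (use D in simp_all)
    then show ?thesis using t FM[of n] by (auto simp: B_def)
  qed
  have bound: "(\<integral>t. (norm (weak_deriv (F n) t))^2 \<partial>I01) \<le> C * (D + 1)^2" for n
  proof -
    have "ennreal (\<integral>t. (norm (weak_deriv (F n) t))^2 \<partial>I01) = (\<integral>\<^sup>+t. ennreal ((norm (weak_deriv (F n) t))^2) \<partial>I01)"
      by (rule nn_integral_eq_integral[symmetric, OF L2_path_integrable[OF weak_deriv(1)[OF FH]]]) simp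
    also have "\<dots> = (\<integral>\<^sup>+t. ennreal C * ennreal ((norm (weak_deriv (F n) t))^2 / C) \<partial>I01)"
      using C(1) by (intro nn_integral_cong) (simp flip: ennreal_mult)
    also have "\<dots> = ennreal C * (\<integral>\<^sup>+t. ennreal ((norm (weak_deriv (F n) t))^2 / C) \<partial>I01)"
      using L2_path_integrable[OF weak_deriv(1)[OF FH, of n]] by (intro nn_integral_cmult) simp
    also have "\<dots> \<le> ennreal C * path_energy M G (F n)" unfolding path_energy_def
    proof (intro mult_left_mono nn_integral_mono)
      fix t assume "t \<in> space I01"
      then have t: "t \<in> {0..1}" by simp
      have "F n t \<in> M" using FB[OF t] by (simp add: B_def)
      then show "ennreal ((norm (weak_deriv (F n) t))^2 / C) \<le> (if F n t \<in> M then ennreal (G (F n t) (hilbert_tangent (F n t) (weak_deriv (F n) t)) (hilbert_tangent (F n t) (weak_deriv (F n) t))) else \<infinity>)"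
        using Cn[OF FB[OF t], of "weak_deriv (F n) t"] C(1)
        by (simp add: metric_nrm ennreal_leI pos_divide_le_eq mult.commute)
    qed simp
    also have "ennreal C * path_energy M G (F n) \<le> ennreal C * ennreal ((D + 1)^2)" by (rule mult_left_mono[OF FE1]) simp
    also have "\<dots> = ennreal (C * (D + 1)^2)" using C(1) by (simp add: ennreal_mult)
    finally show ?thesis using C(1) by (subst (asm) ennreal_le_iff) auto
  qed
  obtain f r where r: "strict_mono r" and f: "f \<in> H1" "f 0 = f0" "f 1 = f1" and wk: "H1_weakly_converges (\<lambda>n. F (r n)) f"
    using H1_weak_compactness[of F, OF FH F0 F1 bound] by (elim exE conjE) (rule that)
  have "path_energy M G f \<le> liminf (\<lambda>n. path_energy M G (F (r n)))"
    using lsc f0 f1 FH F0 F1 f(1) wk unfolding energy_weakly_lsc_def by (elim allE[of _ "\<lambda>n. F (r n)"] allE[of _ f] allE[of _ f0] allE[of _ f1]) simp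
  also have "\<dots> \<le> liminf (\<lambda>n. ennreal ((D + 1 / Suc n)^2))"
  proof (intro Liminf_mono always_eventually allI)
    fix n
    have "n \<le> r n" by (rule strict_mono_imp_increasing[OF r])
    then have "ennreal ((D + 1 / Suc (r n))^2) \<le> ennreal ((D + 1 / Suc n)^2)"
      using D(2) by (intro ennreal_leI power_mono add_left_mono divide_left_mono) auto
    then show "path_energy M G (F (r n)) \<le> ennreal ((D + 1 / Suc n)^2)" using FE[of "r n"] by (rule order_trans[rotated])
  qed
  also have "\<dots> = ennreal (D^2)"
  proof (rule lim_imp_Liminf)
    have "(\<lambda>n. (D + 1 / Suc n)^2) \<longlonglongrightarrow> (D + 0)\<^sup>2" by (intro tendsto_intros LIMSEQ_Suc[OF lim_inverse_n'])
    then show "(\<lambda>n. ennreal ((D + 1 / Suc n)^2)) \<longlonglongrightarrow> ennreal (D^2)" by (intro tendsto_ennrealI) simp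
  qed simp
  finally have E: "path_energy M G f \<le> ennreal (D^2)" .
  have fc: "continuous_on {0..1} f" by (rule H1_continuous[OF f(1)])
  have inB: "f t \<in> B" if t: "0 \<le> t" "t \<le> 1" and im: "f ` {0..t} \<subseteq> M" for t
  proof -
    have "(dist\<^sub>G (f 0) (f t))^2 \<le> path_energy M G f" by (rule dist_le_energy[OF f(1) _ t im]) simp
    then have "(dist\<^sub>G f0 (f t))^2 \<le> ennreal (D^2)" unfolding f(2) using E by (rule order_trans)
    then have "dist\<^sub>G f0 (f t) < ennreal (D + 2)" by (rule ennreal_le_square_imp_less) (use D in simp_all)
    then show ?thesis using im t by (auto simp: B_def)
  qed
  have fM: "f ` {0..1} \<subseteq> M"
  proof (rule ccontr)
    assume notM: "\<not> f ` {0..1} \<subseteq> M"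
    define T where "T = {t\<in>{0..1}. f t \<in> - M}"
    have T: "T \<noteq> {}" using notM by (auto simp: T_def)
    have "closed T" unfolding T_def
      by (rule continuous_closed_preimage[OF fc, unfolded vimage_def Int_def mem_Collect_eq]) (use openS in auto)
    moreover have bb: "bdd_below T" by (rule bdd_belowI[of _ 0]) (simp add: T_def)
    ultimately have \<tau>: "Inf T \<in> T" using T by (intro closed_contains_Inf)
    define \<tau> where "\<tau> = Inf T"
    have \<tau>01: "\<tau> \<in> {0..1}" "f \<tau> \<notin> M" using \<tau> by (simp_all add: T_def \<tau>_def)
    have before: "f t \<in> M" if "0 \<le> t" "t < \<tau>" for t
    proof (rule ccontr)
      assume "f t \<notin> M"
      then have "t \<in> T" using that \<tau>01 by (simp add: T_def)
      then have "\<tau> \<le> t" unfolding \<tau>_def by (rule cInf_lower[OF _ bb])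
      then show False using that by simp
    qed
    have "\<tau> \<noteq> 0" using \<tau>01(2) f(2) f0 by auto
    then have \<tau>0: "\<tau> > 0" using \<tau>01 by simp
    have "f \<tau> \<in> metric_closure hilbert_atlas UNIV hilbert_metric B" unfolding metric_closure_def
    proof (intro CollectI conjI UNIV_I allI impI)
      fix e :: real assume e: "e > 0"
      obtain d where d: "d > 0" "\<And>t. t \<in> {0..1} \<Longrightarrow> dist t \<tau> < d \<Longrightarrow> dist (f t) (f \<tau>) < e"
        using fc \<tau>01(1) e unfolding continuous_on_iff by meson
      define t where "t = max 0 (\<tau> - d / 2)"
      have t: "0 \<le> t" "t < \<tau>" "dist t \<tau> < d" using d(1) \<tau>0 by (auto simp: t_def dist_real_def max_def)
      have "f t \<in> B" by (rule inB) (use t \<tau>01 before in auto)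
      moreover have "geodesic_dist hilbert_atlas UNIV hilbert_metric (f t) (f \<tau>) < ennreal e"
      proof -
        have "geodesic_dist hilbert_atlas UNIV hilbert_metric (f t) (f \<tau>) \<le> ennreal (norm (f \<tau> - f t))"
          by (rule hilbert_dist_le_norm[OF atl]) (use hyps in blast)
        also have "\<dots> < ennreal e" using d(2)[of t] t \<tau>01 e by (intro ennreal_lessI) (auto simp: dist_norm norm_minus_commute)
        finally show ?thesis .
      qed
      ultimately show "\<exists>x\<in>B. geodesic_dist hilbert_atlas UNIV hilbert_metric x (f \<tau>) < ennreal e" by blast
    qed
    moreover have "metric_closure hilbert_atlas UNIV hilbert_metric B \<subseteq> M"
      using hyps B unfolding ball_closures_inside_def by blast
    ultimately show False using \<tau>01(2) by blast
  qed
  have lower: "(dist\<^sub>G f0 f1)^2 \<le> path_energy M G h" if h: "h \<in> H1_paths_between M f0 f1" for h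
    using dist_le_energy[of h 0 1] h by (simp add: H1_paths_between_def)
  have fP: "f \<in> H1_paths_between M f0 f1" using f fM by (simp add: H1_paths_between_def)
  have eq: "path_energy M G f = (dist\<^sub>G f0 f1)^2"
    using E lower[OF fP] D by (intro antisym) (simp_all add: ennreal_power)
  show ?thesis unfolding minimizing_geodesic_def using fP eq lower by (intro exI[of _ f]) simp
qed

theorem theorem2p1:
  shows
    "(\<forall>(A :: ('m::t2_space, 'e::{real_inner, complete_space}) chart set) Gbar M G.
        completeness_hypotheses A Gbar M G \<longrightarrow>
        metrically_complete A M G \<and> geodesically_complete A M G) \<and>
     (\<forall>(M :: 'h::{real_inner, complete_space} set) G.
        completeness_hypotheses hilbert_atlas hilbert_metric M G \<and> energy_weakly_lsc M G \<longrightarrow>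
        (\<forall>f0\<in>M. \<forall>f1\<in>M.
           (geodesic_dist hilbert_atlas M G f0 f1 < \<infinity> \<longrightarrow> (\<exists>f. minimizing_geodesic M G f0 f1 f)) \<and>
           (geodesic_dist hilbert_atlas M G f0 f1 < \<infinity> \<longleftrightarrow> connected_component M f0 f1)))"
proof (intro conjI allI impI ballI; (elim conjE)?)
  fix A :: "('m, 'e) chart set" and Gbar M G
  assume H: "completeness_hypotheses A Gbar M G"
  then interpret strong_riem A M G by unfold_locales (simp_all add: completeness_hypotheses_def)
  show "metrically_complete A M G" by (rule metric_completeness[OF H])
  then show "geodesically_complete A M G" by (rule geodesically_complete_if_metrically_complete)
next
  fix M :: "'h set" and G f0 f1
  assume H: "completeness_hypotheses hilbert_atlas hilbert_metric M G" and lsc: "energy_weakly_lsc M G"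
    and f: "f0 \<in> M" "f1 \<in> M"
  interpret hilbert_riem M G by unfold_locales (use H in \<open>simp_all add: completeness_hypotheses_def\<close>)
  show "\<exists>f. minimizing_geodesic M G f0 f1 f" if "dist\<^sub>G f0 f1 < \<infinity>"
    by (rule minimizing_geodesic_exists[OF H lsc f that])
  show "dist\<^sub>G f0 f1 < \<infinity> \<longleftrightarrow> connected_component M f0 f1" by (rule finite_dist_iff_connected[OF f])
qed

end
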